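(* Let $k$ be a field, $\mathcal{O}$ a commutative ring and $V\in\mathbf{CAG}_{\mathcal{O}}(k)$. Suppose $\mathcal{I},\mathcal{J}_1,\ldots,\mathcal{J}_t\in\mathbf{FMod}_{\mathcal{O}}(k)$, and $\mathcal{I}\otimes_{\mathbb{Z}}\mathbb{Q}\cong\bigoplus_{i=1}^t(\mathcal{J}_i\otimes_{\mathbb{Z}}\mathbb{Q})$ as $\mathcal{O}[G_k]$-modules. Then $\mathcal{I}\otimes_{\mathcal{O}}V$ is $k$-isogenous to $\bigoplus_{i=1}^t(\mathcal{J}_i\otimes_{\mathcal{O}}V)$.
   Context: Let $k^s$ be a separable closure of $k$ and $G_k=\mathrm{Gal}(k^s/k)$. Rings have identity. "Commutative algebraic group" means commutative algebraic group variety, not necessarily connected. $\mathbf{FMod}_{\mathcal{O}}(k)$: objects are finitely generated free $\mathcal{O}$-modules with a continuous (i.e. factoring through the Galois group of a finite extension of $k$) $\mathcal{O}$-linear right action of $G_k$; morphisms are $G_k$-equivariant $\mathcal{O}$-module homomorphisms. $\mathbf{CAG}_{\mathcal{O}}(k)$: objects are commutative algebraic groups $V$ over $k$ with a ring homomorphism $\mathcal{O}\to\mathrm{End}_k(V)$; morphisms are $\mathcal{O}$-equivariant homomorphisms defined over $k$. Definition of $\mathcal{I}\otimes_{\mathcal{O}}V$: let $d=\mathrm{rank}_{\mathcal{O}}(\mathcal{I})$ and fix an $\mathcal{O}$-module isomorphism $j:\mathcal{O}^d\to\mathcal{I}$. For $\gamma\in G_k$ let $j^\gamma(x)=j(x)\gamma^{-1}$.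 Let $c_{\mathcal{I}}$ be the image of the cocycle $\gamma\mapsto j^{-1}\circ j^\gamma\in\mathrm{GL}_d(\mathcal{O})$ in $\mathrm{Aut}_{k^s}(V^d)$ (via the action of $\mathrm{GL}_d(\mathcal{O})$ on $V^d$). Then $(\mathcal{I}\otimes_{\mathcal{O}}V,\phi)$ is the pair, unique up to isomorphism, with $\mathcal{I}\otimes_{\mathcal{O}}V\in\mathbf{CAG}_{\mathcal{O}}(k)$ and $\phi:V^d\to\mathcal{I}\otimes_{\mathcal{O}}V$ an isomorphism over $k^s$ such that $c_{\mathcal{I}}(\gamma)=\phi^{-1}\circ\phi^\gamma$ for all $\gamma\in G_k$. It is independent of $j$. A $k$-isogeny in $\mathbf{CAG}_{\mathcal{O}}(k)$ is a morphism in this category whose kernel and cokernel are annihilated by some positive integer; two objects are $k$-isogenous if there is a $k$-isogeny between them. *)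

theory Defs
  imports
    "HOL-Analysis.Abstract_Topology"
    "HOL-Algebra.Algebraic_Closure_Type"
    "HOL-Algebra.Free_Abelian_Groups"
    "HOL-Algebra.Product_Groups"
    "HOL-Algebra.Module"
begin

text \<open>This notation would reserve \<open>X\<close>, which is used as a variable name below.\<close>

no_notation Polynomials.var (\<open>X\<index>\<close>)

section \<open>The separable closure and the absolute Galois group\<close>

text \<open>The field \<open>k\<close> is the type \<open>'k\<close>, and \<open>K\<close> denotes its algebraic closure \<open>'k alg_closure\<close>.
  The separable closure \<open>k\<^sup>s\<close> is taken inside \<open>K\<close>.\<close>

definition ksep :: "('k::field) alg_closure set" where
  "ksep = {x. \<exists>p::'k poly. irreducible p \<and> poly (map_poly to_ac p) x = 0
                \<and> rsquarefree (map_poly to_ac p)}"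

text \<open>Elements of \<open>Gal(k\<^sup>s/k)\<close> are represented by functions on \<open>K\<close> that are \<open>undefined\<close>
  outside \<open>k\<^sup>s\<close>; the product \<open>\<gamma>\<delta>\<close> is \<open>\<gamma> \<circ> \<delta>\<close>.\<close>

definition Gal :: "(('k::field) alg_closure \<Rightarrow> 'k alg_closure) monoid" where
  "Gal = \<lparr>carrier = {\<gamma> \<in> extensional ksep. bij_betw \<gamma> ksep ksep
              \<and> (\<forall>x\<in>ksep. \<forall>y\<in>ksep. \<gamma> (x + y) = \<gamma> x + \<gamma> y \<and> \<gamma> (x * y) = \<gamma> x * \<gamma> y)
              \<and> (\<forall>c. \<gamma> (to_ac c) = to_ac c)},
          monoid.mult = compose ksep, one = (\<lambda>x\<in>ksep. x)\<rparr>"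

definition Aut_ac :: "(('k::field) alg_closure \<Rightarrow> 'k alg_closure) set" where
  "Aut_ac = {\<tau>. bij \<tau> \<and> (\<forall>x y. \<tau> (x + y) = \<tau> x + \<tau> y \<and> \<tau> (x * y) = \<tau> x * \<tau> y)
              \<and> (\<forall>c. \<tau> (to_ac c) = to_ac c)}"

text \<open>\<open>K\<close> is purely inseparable over \<open>k\<^sup>s\<close>, so an automorphism of \<open>k\<^sup>s\<close> over \<open>k\<close> extends to
  \<open>K\<close> in exactly one way.\<close>

definition gal_ext ::
  "(('k::field) alg_closure \<Rightarrow> 'k alg_closure) \<Rightarrow> 'k alg_closure \<Rightarrow> 'k alg_closure" where
  "gal_ext \<gamma> = (THE \<tau>. \<tau> \<in> Aut_ac \<and> (\<forall>x\<in>ksep. \<tau> x = \<gamma> x))"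

definition finite_galois_subext :: "('k::field) alg_closure set \<Rightarrow> bool" where
  "finite_galois_subext F \<longleftrightarrow>
     range to_ac \<subseteq> F \<and> F \<subseteq> ksep
     \<and> (\<forall>x\<in>F. \<forall>y\<in>F. x + y \<in> F \<and> x * y \<in> F \<and> - x \<in> F \<and> inverse x \<in> F)
     \<and> (\<exists>B. finite B \<and> F \<subseteq> Modules.module.span (\<lambda>c x. to_ac c * x) B)
     \<and> (\<forall>\<gamma>\<in>carrier Gal. \<gamma> ` F = F)"


section \<open>Varieties\<close>

text \<open>A variety over \<open>k\<close> (a geometrically reduced, separated scheme of finite type over \<open>k\<close>, not
  necessarily irreducible) is encoded as a space with functions, in the manner of Serre: the points
  are its \<open>K\<close>-valued points, the topology is the Zariski topology defined over \<open>k\<close>, and \<open>regf X U\<close>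
  is the set of \<open>K\<close>-valued functions on \<open>U\<close> that come from sections over \<open>k\<close> of the structure
  sheaf. Points conjugate over \<open>k\<close> are not separated by this topology. Functions are total on
  the type of points, but only their values on \<open>U\<close> are significant.\<close>

record (overloaded) ('k::field, 'p) kspace =
  ztop :: "'p topology"
  regf :: "'p set \<Rightarrow> ('p \<Rightarrow> 'k alg_closure) set"

abbreviation points :: "('k::field, 'p) kspace \<Rightarrow> 'p set" where
  "points X \<equiv> topspace (ztop X)"

text \<open>The space with functions in which, for all \<open>(U, f)\<close> in the given set, \<open>f\<close> is regular on \<open>U\<close>
  and its nonvanishing locus is open, and in which regular functions are locally quotients of these.
  All instances below are closed under products, \<open>(U, f) (V, g) = (U \<inter> V, f g)\<close>, so the
  nonvanishing loci are a basis of the topology.\<close>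

definition gen_space :: "('p set \<times> ('p \<Rightarrow> ('k::field) alg_closure)) set \<Rightarrow> ('k, 'p) kspace" where
  "gen_space P =
     (let T = topology_generated_by {{x \<in> U. f x \<noteq> 0} | U f. (U, f) \<in> P} in
      \<lparr>ztop = T,
       regf = (\<lambda>W. {h. openin T W \<and>
          (\<forall>x\<in>W. \<exists>U f g. (U, f) \<in> P \<and> (U, g) \<in> P \<and> x \<in> U \<and> g x \<noteq> 0
              \<and> (\<forall>y\<in>W. y \<in> U \<and> g y \<noteq> 0 \<longrightarrow> h y = f y / g y))})\<rparr>)"

definition kmorphism :: "('k::field, 'p) kspace \<Rightarrow> ('k, 'q) kspace \<Rightarrow> ('p \<Rightarrow> 'q) \<Rightarrow> bool" where
  "kmorphism X Y \<phi> \<longleftrightarrow> continuous_map (ztop X) (ztop Y) \<phi>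
     \<and> (\<forall>U. \<forall>f\<in>regf Y U. f \<circ> \<phi> \<in> regf X {x \<in> points X. \<phi> x \<in> U})"

definition kisomorphism :: "('k::field, 'p) kspace \<Rightarrow> ('k, 'q) kspace \<Rightarrow> ('p \<Rightarrow> 'q) \<Rightarrow> bool" where
  "kisomorphism X Y \<phi> \<longleftrightarrow> bij_betw \<phi> (points X) (points Y)
     \<and> kmorphism X Y \<phi> \<and> kmorphism Y X (inv_into (points X) \<phi>)"

definition open_sub :: "('k::field, 'p) kspace \<Rightarrow> 'p set \<Rightarrow> ('k, 'p) kspace" where
  "open_sub X U = \<lparr>ztop = subtopology (ztop X) U,
                   regf = (\<lambda>W. if W \<subseteq> U then regf X W else {})\<rparr>"

text \<open>Functions \<open>K\<^sup>n \<rightarrow> K\<close> given by polynomials with coefficients in \<open>k\<close>. The coordinates are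
  those with index less than \<open>n\<close>.\<close>

inductive_set polyfun :: "nat \<Rightarrow> ((nat \<Rightarrow> ('k::field) alg_closure) \<Rightarrow> 'k alg_closure) set"
  for n :: nat where
  const: "(\<lambda>x. to_ac c) \<in> polyfun n"
| coord: "i < n \<Longrightarrow> (\<lambda>x. x i) \<in> polyfun n"
| add: "f \<in> polyfun n \<Longrightarrow> g \<in> polyfun n \<Longrightarrow> (\<lambda>x. f x + g x) \<in> polyfun n"
| mult: "f \<in> polyfun n \<Longrightarrow> g \<in> polyfun n \<Longrightarrow> (\<lambda>x. f x * g x) \<in> polyfun n"

definition zero_set ::
  "nat \<Rightarrow> ((nat \<Rightarrow> ('k::field) alg_closure) \<Rightarrow> 'k alg_closure) set
    \<Rightarrow> (nat \<Rightarrow> 'k alg_closure) set" where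
  "zero_set n S = {x \<in> {..<n} \<rightarrow>\<^sub>E UNIV. \<forall>p\<in>S. p x = 0}"

definition affine_model ::
  "nat \<Rightarrow> ((nat \<Rightarrow> ('k::field) alg_closure) \<Rightarrow> 'k alg_closure) set
    \<Rightarrow> ('k, nat \<Rightarrow> 'k alg_closure) kspace" where
  "affine_model n S = gen_space {(zero_set n S, f) | f. f \<in> polyfun n}"

definition is_affine :: "('k::field, 'p) kspace \<Rightarrow> bool" where
  "is_affine X \<longleftrightarrow> (\<exists>n S \<phi>. S \<subseteq> polyfun n \<and> kisomorphism X (affine_model n S) \<phi>)"

text \<open>The product over \<open>k\<close> of a finite family. The explicit constants \<open>c l\<close> matter only for the
  empty family, whose product is \<open>Spec k\<close>.\<close>

definition prod_space :: "'i set \<Rightarrow> ('i \<Rightarrow> ('k::field, 'p) kspace) \<Rightarrow> ('k, 'i \<Rightarrow> 'p) kspace" where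
  "prod_space A X = gen_space
     {(\<Pi>\<^sub>E i\<in>A. U i, \<lambda>x. \<Sum>l<n. to_ac (c l) * (\<Prod>i\<in>A. f l i (x i))) | U (n::nat) c f.
        \<forall>i\<in>A. openin (ztop (X i)) (U i) \<and> (\<forall>l<n. f l i \<in> regf (X i) (U i))}"

text \<open>The sheaf axioms for \<open>regf\<close>; restriction, gluing, and independence of the values of a
  function outside \<open>U\<close> are combined in one equivalence.\<close>

definition is_sheaf :: "('k::field, 'p) kspace \<Rightarrow> bool" where
  "is_sheaf X \<longleftrightarrow> (\<forall>U f. f \<in> regf X U \<longleftrightarrow> openin (ztop X) U
     \<and> (\<forall>x\<in>U. \<exists>V g. x \<in> V \<and> openin (ztop X) V \<and> g \<in> regf X V \<and> (\<forall>y\<in>U \<inter> V. f y = g y)))"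

text \<open>Sections that are linearly independent over \<open>k\<close> remain so over \<open>K\<close> as functions, i.e.
  \<open>O(U) \<otimes>\<^sub>k K\<close> embeds into the functions on \<open>U\<close>. This is geometric reducedness.\<close>

definition geom_reduced :: "('k::field, 'p) kspace \<Rightarrow> bool" where
  "geom_reduced X \<longleftrightarrow> (\<forall>U (n::nat) f c.
     (\<forall>i<n. f i \<in> regf X U) \<and> (\<exists>i<n. c i \<noteq> 0) \<and> (\<forall>x\<in>U. (\<Sum>i<n. c i * f i x) = 0)
     \<longrightarrow> (\<exists>a. (\<exists>i<n. a i \<noteq> 0) \<and> (\<forall>x\<in>U. (\<Sum>i<n. to_ac (a i) * f i x) = 0)))"

definition variety :: "('k::field, 'p) kspace \<Rightarrow> bool" where
  "variety X \<longleftrightarrow> is_sheaf X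
     \<and> (\<exists>\<U>. finite \<U> \<and> \<Union>\<U> = points X
           \<and> (\<forall>U\<in>\<U>. openin (ztop X) U \<and> is_affine (open_sub X U)))
     \<and> geom_reduced X
     \<and> closedin (ztop (prod_space {..<2::nat} (\<lambda>_. X)))
         {x \<in> {..<2} \<rightarrow>\<^sub>E points X. x 0 = x 1}"

text \<open>The extension of scalars of \<open>X\<close> to an intermediate field \<open>L\<close> of \<open>K\<close> and \<open>k\<close>: the points are
  unchanged, and \<open>L\<close>-linear combinations of regular functions over \<open>k\<close> become regular.\<close>

definition base_change :: "('k::field) alg_closure set \<Rightarrow> ('k, 'p) kspace \<Rightarrow> ('k, 'p) kspace" where
  "base_change L X = gen_space
     {(U, \<lambda>x. \<Sum>i<n. c i * f i x) | U (n::nat) c f.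
        openin (ztop X) U \<and> (\<forall>i<n. c i \<in> L \<and> f i \<in> regf X U)}"

text \<open>The action of an automorphism of \<open>K\<close> over \<open>k\<close> on the \<open>K\<close>-valued points: in affine
  coordinates over \<open>k\<close> it is applied to each coordinate.\<close>

definition pt_act ::
  "('k::field, 'p) kspace \<Rightarrow> ('k alg_closure \<Rightarrow> 'k alg_closure) \<Rightarrow> 'p \<Rightarrow> 'p" where
  "pt_act X \<tau> x = (THE y. y \<in> points X \<and>
     (\<forall>U. openin (ztop X) U \<longrightarrow> (y \<in> U \<longleftrightarrow> x \<in> U) \<and> (x \<in> U \<longrightarrow> (\<forall>f\<in>regf X U. f y = \<tau> (f x)))))"

text \<open>\<open>\<phi>\<^sup>\<gamma> = \<gamma> \<circ> \<phi> \<circ> \<gamma>\<^sup>-\<^sup>1\<close> for a map \<open>\<phi>\<close> on points, in particular for a morphism over \<open>k\<^sup>s\<close>.\<close>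

definition conj_map ::
  "('k::field, 'p) kspace \<Rightarrow> ('k, 'q) kspace \<Rightarrow> ('k alg_closure \<Rightarrow> 'k alg_closure)
    \<Rightarrow> ('p \<Rightarrow> 'q) \<Rightarrow> 'p \<Rightarrow> 'q" where
  "conj_map X Y \<gamma> \<phi> =
     (\<lambda>x. pt_act Y (gal_ext \<gamma>) (\<phi> (pt_act X (gal_ext (inv\<^bsub>Gal\<^esub> \<gamma>)) x)))"


section \<open>Commutative algebraic groups with an action of a ring\<close>

text \<open>The group of \<open>K\<close>-valued points (written multiplicatively), the underlying variety over \<open>k\<close>,
  and the action of the ring \<open>R\<close>.\<close>

record (overloaded) ('k::field, 'r, 'p) cag =
  grp :: "'p monoid"
  vrt :: "('k, 'p) kspace"
  ract :: "'r \<Rightarrow> 'p \<Rightarrow> 'p"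

definition comm_alg_group :: "'p monoid \<Rightarrow> ('k::field, 'p) kspace \<Rightarrow> bool" where
  "comm_alg_group G X \<longleftrightarrow> comm_group G \<and> variety X \<and> carrier G = points X
     \<and> kmorphism (prod_space {..<2::nat} (\<lambda>_. X)) X (\<lambda>x. x 0 \<otimes>\<^bsub>G\<^esub> x 1)
     \<and> kmorphism X X (\<lambda>x. inv\<^bsub>G\<^esub> x)
     \<and> kmorphism (prod_space ({}::nat set) (\<lambda>_. X)) X (\<lambda>_. \<one>\<^bsub>G\<^esub>)"

definition End_ring :: "'p monoid \<Rightarrow> ('k::field, 'p) kspace \<Rightarrow> ('p \<Rightarrow> 'p) ring" where
  "End_ring G X = \<lparr>carrier = {f \<in> hom G G. f \<in> extensional (carrier G) \<and> kmorphism X X f},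
     monoid.mult = compose (carrier G), one = (\<lambda>x\<in>carrier G. x),
     ring.zero = (\<lambda>x\<in>carrier G. \<one>\<^bsub>G\<^esub>), ring.add = (\<lambda>f g. \<lambda>x\<in>carrier G. f x \<otimes>\<^bsub>G\<^esub> g x)\<rparr>"

definition CAG :: "'r ring \<Rightarrow> ('k::field, 'r, 'p) cag \<Rightarrow> bool" where
  "CAG R V \<longleftrightarrow> comm_alg_group (grp V) (vrt V) \<and> ract V \<in> ring_hom R (End_ring (grp V) (vrt V))"

definition equivariant ::
  "'r ring \<Rightarrow> ('k::field, 'r, 'p) cag \<Rightarrow> ('k, 'r, 'q) cag \<Rightarrow> ('p \<Rightarrow> 'q) \<Rightarrow> bool" where
  "equivariant R V W f \<longleftrightarrow>
     (\<forall>a\<in>carrier R. \<forall>x\<in>carrier (grp V). f (ract V a x) = ract W a (f x))"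

definition CAG_hom ::
  "'r ring \<Rightarrow> ('k::field, 'r, 'p) cag \<Rightarrow> ('k, 'r, 'q) cag \<Rightarrow> ('p \<Rightarrow> 'q) \<Rightarrow> bool" where
  "CAG_hom R V W f \<longleftrightarrow>
     f \<in> hom (grp V) (grp W) \<and> kmorphism (vrt V) (vrt W) f \<and> equivariant R V W f"

definition CAG_iso_ksep ::
  "'r ring \<Rightarrow> ('k::field, 'r, 'p) cag \<Rightarrow> ('k, 'r, 'q) cag \<Rightarrow> ('p \<Rightarrow> 'q) \<Rightarrow> bool" where
  "CAG_iso_ksep R V W f \<longleftrightarrow>
     f \<in> iso (grp V) (grp W)
     \<and> kisomorphism (base_change ksep (vrt V)) (base_change ksep (vrt W)) f
     \<and> equivariant R V W f"

text \<open>The direct sum of a finite family, and in particular the power \<open>V\<^sup>d\<close>.\<close>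

definition CAG_sum :: "'i set \<Rightarrow> ('i \<Rightarrow> ('k::field, 'r, 'p) cag) \<Rightarrow> ('k, 'r, 'i \<Rightarrow> 'p) cag" where
  "CAG_sum A V = \<lparr>grp = product_group A (\<lambda>i. grp (V i)),
     vrt = prod_space A (\<lambda>i. vrt (V i)),
     ract = (\<lambda>a. \<lambda>x\<in>(\<Pi>\<^sub>E i\<in>A. carrier (grp (V i))). \<lambda>i\<in>A. ract (V i) a (x i))\<rparr>"

abbreviation CAG_power :: "('k::field, 'r, 'p) cag \<Rightarrow> nat \<Rightarrow> ('k, 'r, nat \<Rightarrow> 'p) cag" where
  "CAG_power V d \<equiv> CAG_sum {..<d} (\<lambda>_. V)"

text \<open>Kernel and cokernel are taken on \<open>K\<close>-valued points. A commutative group scheme of finite type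
  is annihilated by some positive integer iff its group of \<open>K\<close>-valued points is, since the
  infinitesimal finite group schemes over \<open>k\<close> are annihilated by their order.\<close>

definition k_isogeny ::
  "'r ring \<Rightarrow> ('k::field, 'r, 'p) cag \<Rightarrow> ('k, 'r, 'q) cag \<Rightarrow> ('p \<Rightarrow> 'q) \<Rightarrow> bool" where
  "k_isogeny R V W f \<longleftrightarrow> CAG_hom R V W f \<and>
     (\<exists>n::nat. n > 0
        \<and> (\<forall>x\<in>kernel (grp V) (grp W) f. x [^]\<^bsub>grp V\<^esub> n = \<one>\<^bsub>grp V\<^esub>)
        \<and> (let C = grp W Mod (f ` carrier (grp V)) in \<forall>y\<in>carrier C. y [^]\<^bsub>C\<^esub> n = \<one>\<^bsub>C\<^esub>))"

definition k_isogenous ::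
  "'r ring \<Rightarrow> ('k::field, 'r, 'p) cag \<Rightarrow> ('k, 'r, 'q) cag \<Rightarrow> bool" where
  "k_isogenous R V W \<longleftrightarrow> (\<exists>f. k_isogeny R V W f)"


section \<open>Galois modules\<close>

text \<open>\<open>gact M x \<gamma>\<close> is the right action \<open>x \<gamma>\<close>.\<close>

record (overloaded) ('k::field, 'r, 'm) galmod =
  mdl :: "('r, 'm) module"
  gact :: "'m \<Rightarrow> ('k alg_closure \<Rightarrow> 'k alg_closure) \<Rightarrow> 'm"

definition linear_map ::
  "('r, 'a) ring_scheme \<Rightarrow> ('r, 'm) module \<Rightarrow> ('r, 'n) module \<Rightarrow> ('m \<Rightarrow> 'n) \<Rightarrow> bool" where
  "linear_map R M N f \<longleftrightarrow> f \<in> carrier M \<rightarrow> carrier N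
     \<and> (\<forall>x\<in>carrier M. \<forall>y\<in>carrier M. f (x \<oplus>\<^bsub>M\<^esub> y) = f x \<oplus>\<^bsub>N\<^esub> f y)
     \<and> (\<forall>a\<in>carrier R. \<forall>x\<in>carrier M. f (a \<odot>\<^bsub>M\<^esub> x) = a \<odot>\<^bsub>N\<^esub> f x)"

definition free_mod :: "('r, 'a) ring_scheme \<Rightarrow> nat \<Rightarrow> ('r, nat \<Rightarrow> 'r) module" where
  "free_mod R d = \<lparr>carrier = {..<d} \<rightarrow>\<^sub>E carrier R,
     monoid.mult = (\<lambda>x y. \<lambda>i\<in>{..<d}. x i \<otimes>\<^bsub>R\<^esub> y i), one = (\<lambda>i\<in>{..<d}. \<one>\<^bsub>R\<^esub>),
     ring.zero = (\<lambda>i\<in>{..<d}. \<zero>\<^bsub>R\<^esub>), ring.add = (\<lambda>x y. \<lambda>i\<in>{..<d}. x i \<oplus>\<^bsub>R\<^esub> y i),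
     module.smult = (\<lambda>a x. \<lambda>i\<in>{..<d}. a \<otimes>\<^bsub>R\<^esub> x i)\<rparr>"

definition basis_iso ::
  "('r, 'a) ring_scheme \<Rightarrow> ('r, 'm) module \<Rightarrow> nat \<Rightarrow> ((nat \<Rightarrow> 'r) \<Rightarrow> 'm) \<Rightarrow> bool" where
  "basis_iso R M d j \<longleftrightarrow>
     linear_map R (free_mod R d) M j \<and> bij_betw j (carrier (free_mod R d)) (carrier M)"

definition FMod :: "'r ring \<Rightarrow> ('k::field, 'r, 'm) galmod \<Rightarrow> bool" where
  "FMod R M \<longleftrightarrow> module R (mdl M) \<and> (\<exists>d j. basis_iso R (mdl M) d j)
     \<and> (\<forall>\<gamma>\<in>carrier Gal. linear_map R (mdl M) (mdl M) (\<lambda>x. gact M x \<gamma>))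
     \<and> (\<forall>x\<in>carrier (mdl M). gact M x \<one>\<^bsub>Gal\<^esub> = x)
     \<and> (\<forall>x\<in>carrier (mdl M). \<forall>\<gamma>\<in>carrier Gal. \<forall>\<delta>\<in>carrier Gal.
          gact M x (\<gamma> \<otimes>\<^bsub>Gal\<^esub> \<delta>) = gact M (gact M x \<gamma>) \<delta>)
     \<and> (\<exists>F. finite_galois_subext F
          \<and> (\<forall>\<gamma>\<in>carrier Gal. \<forall>\<delta>\<in>carrier Gal. (\<forall>x\<in>F. \<gamma> x = \<delta> x)
                \<longrightarrow> (\<forall>x\<in>carrier (mdl M). gact M x \<gamma> = gact M x \<delta>)))"


section \<open>The twist of an algebraic group by a Galois module\<close>

text \<open>The \<open>R\<close>-linear endomorphism \<open>A\<close> of \<open>R\<^sup>d\<close> acts on \<open>V\<^sup>d\<close> through its matrix, whose entry in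
  row \<open>a\<close> and column \<open>b\<close> is \<open>A e\<^sub>b\<close> evaluated at \<open>a\<close>.\<close>

definition unit_vec :: "('r, 'a) ring_scheme \<Rightarrow> nat \<Rightarrow> nat \<Rightarrow> nat \<Rightarrow> 'r" where
  "unit_vec R d b = (\<lambda>i\<in>{..<d}. if i = b then \<one>\<^bsub>R\<^esub> else \<zero>\<^bsub>R\<^esub>)"

definition matrix_act ::
  "('r, 'a) ring_scheme \<Rightarrow> ('k::field, 'r, 'p) cag \<Rightarrow> nat \<Rightarrow> ((nat \<Rightarrow> 'r) \<Rightarrow> (nat \<Rightarrow> 'r))
    \<Rightarrow> (nat \<Rightarrow> 'p) \<Rightarrow> nat \<Rightarrow> 'p" where
  "matrix_act R V d A v =
     (\<lambda>a\<in>{..<d}. finprod (grp V) (\<lambda>b. ract V (A (unit_vec R d b) a) (v b)) {..<d})"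

definition twist_cocycle ::
  "('r, 'a) ring_scheme \<Rightarrow> ('k::field, 'r, 'm) galmod \<Rightarrow> nat \<Rightarrow> ((nat \<Rightarrow> 'r) \<Rightarrow> 'm)
    \<Rightarrow> ('k alg_closure \<Rightarrow> 'k alg_closure) \<Rightarrow> (nat \<Rightarrow> 'r) \<Rightarrow> (nat \<Rightarrow> 'r)" where
  "twist_cocycle R M d j \<gamma> =
     (\<lambda>x. inv_into (carrier (free_mod R d)) j (gact M (j x) (inv\<^bsub>Gal\<^esub> \<gamma>)))"

text \<open>\<open>is_twist_via R M V d j W \<phi>\<close>: the pair \<open>(W, \<phi>)\<close> is \<open>M \<otimes>\<^sub>R V\<close> formed with \<open>j\<close>, i.e.
  \<open>c\<^sub>M(\<gamma>) = \<phi>\<^sup>-\<^sup>1 \<circ> \<phi>\<^sup>\<gamma>\<close> on \<open>V\<^sup>d\<close> for all \<open>\<gamma>\<close>.\<close>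

definition is_twist_via ::
  "'r ring \<Rightarrow> ('k::field, 'r, 'm) galmod \<Rightarrow> ('k, 'r, 'p) cag \<Rightarrow> nat \<Rightarrow> ((nat \<Rightarrow> 'r) \<Rightarrow> 'm)
    \<Rightarrow> ('k, 'r, 'q) cag \<Rightarrow> ((nat \<Rightarrow> 'p) \<Rightarrow> 'q) \<Rightarrow> bool" where
  "is_twist_via R M V d j W \<phi> \<longleftrightarrow> basis_iso R (mdl M) d j \<and> CAG R W
     \<and> CAG_iso_ksep R (CAG_power V d) W \<phi>
     \<and> (\<forall>\<gamma>\<in>carrier Gal. \<forall>v\<in>carrier (grp (CAG_power V d)).
          matrix_act R V d (twist_cocycle R M d j \<gamma>) v
            = inv_into (carrier (grp (CAG_power V d))) \<phi>
                (conj_map (vrt (CAG_power V d)) (vrt W) \<gamma> \<phi> v))"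

text \<open>\<open>M \<otimes>\<^sub>R V\<close> is determined only up to isomorphism, hence a predicate on \<open>W\<close>.\<close>

definition is_twist ::
  "'r ring \<Rightarrow> ('k::field, 'r, 'm) galmod \<Rightarrow> ('k, 'r, 'p) cag \<Rightarrow> ('k, 'r, 'q) cag \<Rightarrow> bool" where
  "is_twist R M V W \<longleftrightarrow> (\<exists>d j \<phi>. is_twist_via R M V d j W \<phi>)"


section \<open>Tensor products with the rationals\<close>

text \<open>\<open>M \<otimes>\<^sub>\<int> \<rat>\<close> as the free abelian group on pairs modulo the biadditivity relations.\<close>

definition tensorQ_free :: "('r, 'm) module \<Rightarrow> ('m \<times> rat \<Rightarrow>\<^sub>0 int) monoid" where
  "tensorQ_free M = free_Abelian_group (carrier M \<times> UNIV)"

definition tensorQ_rel :: "('r, 'm) module \<Rightarrow> ('m \<times> rat \<Rightarrow>\<^sub>0 int) set" where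
  "tensorQ_rel M = generate (tensorQ_free M)
     ({frag_of (x \<oplus>\<^bsub>M\<^esub> y, q) - frag_of (x, q) - frag_of (y, q) | x y q.
         x \<in> carrier M \<and> y \<in> carrier M}
      \<union> {frag_of (x, p + q) - frag_of (x, p) - frag_of (x, q) | x p q. x \<in> carrier M})"

definition tensorQ :: "('r, 'm) module \<Rightarrow> ('m \<times> rat \<Rightarrow>\<^sub>0 int) set monoid" where
  "tensorQ M = tensorQ_free M Mod tensorQ_rel M"

text \<open>The endomorphism \<open>f \<otimes> id\<close> of \<open>M \<otimes>\<^sub>\<int> \<rat>\<close> for an additive endomorphism \<open>f\<close> of \<open>M\<close>.\<close>

definition tensorQ_map ::
  "('r, 'm) module \<Rightarrow> ('m \<Rightarrow> 'm) \<Rightarrow> ('m \<times> rat \<Rightarrow>\<^sub>0 int) set \<Rightarrow> ('m \<times> rat \<Rightarrow>\<^sub>0 int) set" where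
  "tensorQ_map M f X =
     tensorQ_rel M <#>\<^bsub>tensorQ_free M\<^esub> (frag_extend (\<lambda>(x, q). frag_of (f x, q)) ` X)"

text \<open>An isomorphism of \<open>R[G\<^sub>k]\<close>-modules from \<open>M \<otimes>\<^sub>\<int> \<rat>\<close> onto the direct sum of the
  \<open>N i \<otimes>\<^sub>\<int> \<rat>\<close>. The index set \<open>A\<close> is finite, so the direct sum is the product.\<close>

definition tensorQ_iso_sum ::
  "'r ring \<Rightarrow> ('k::field, 'r, 'm) galmod \<Rightarrow> 'i set \<Rightarrow> ('i \<Rightarrow> ('k, 'r, 'n) galmod) \<Rightarrow> bool" where
  "tensorQ_iso_sum R M A N \<longleftrightarrow>
     (\<exists>\<theta> \<in> iso (tensorQ (mdl M)) (product_group A (\<lambda>i. tensorQ (mdl (N i)))).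
        (\<forall>a\<in>carrier R. \<forall>X\<in>carrier (tensorQ (mdl M)).
           \<theta> (tensorQ_map (mdl M) (\<lambda>x. a \<odot>\<^bsub>mdl M\<^esub> x) X)
             = (\<lambda>i\<in>A. tensorQ_map (mdl (N i)) (\<lambda>x. a \<odot>\<^bsub>mdl (N i)\<^esub> x) (\<theta> X i)))
        \<and> (\<forall>\<gamma>\<in>carrier Gal. \<forall>X\<in>carrier (tensorQ (mdl M)).
           \<theta> (tensorQ_map (mdl M) (\<lambda>x. gact M x \<gamma>) X)
             = (\<lambda>i\<in>A. tensorQ_map (mdl (N i)) (\<lambda>x. gact (N i) x \<gamma>) (\<theta> X i))))"

end

theory Submission
  imports Defs
begin

text \<open>The given isomorphism \<open>\<theta>\<close> maps \<open>I\<close> into the sum of the \<open>J i \<otimes> \<rat>\<close>. As \<open>I\<close> is finitely generated, one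
  common denominator turns the components of \<open>\<theta>\<close> into \<open>R\<close>-linear maps \<open>f i : I \<rightarrow> J i\<close>, and in the same
  way \<open>\<theta>\<^sup>-\<^sup>1\<close> yields linear maps \<open>g i : J i \<rightarrow> I\<close>. Every identity that holds after tensoring with \<open>\<rat>\<close>
  holds up to torsion, and one integer kills all the torsion that occurs, because the modules are
  finitely generated and \<open>G\<^sub>k\<close> acts on them through a finite group. After rescaling, the \<open>f i\<close> commute
  with \<open>G\<^sub>k\<close>, \<open>f i \<circ> g k\<close> is \<open>n\<close> or \<open>0\<close> according to whether \<open>i = k\<close>, and the sum of the \<open>g i \<circ> f i\<close> is
  \<open>n\<close>, for some positive integer \<open>n\<close>. This is \<open>integral_quasi_inverse\<close>.

  In bases, a linear map between free modules of ranks \<open>d\<close> and \<open>e\<close> is a matrix over \<open>R\<close>, and such a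
  matrix acts as a morphism \<open>V\<^sup>d \<rightarrow> V\<^sup>e\<close> over \<open>k\<close>, compatibly with composition (\<open>mod_act_comp\<close>,
  \<open>mod_act_kmorphism\<close>). With the twisting isomorphisms \<open>\<phi> : V\<^sup>d \<rightarrow> I \<otimes> V\<close> and
  \<open>\<psi> i : V\<^sup>e \<rightarrow> J i \<otimes> V\<close>, the maps \<open>F i = \<psi> i \<circ> f i \<circ> \<phi>\<^sup>-\<^sup>1\<close> are homomorphisms over \<open>k\<^sup>s\<close>. The cocycle
  condition says that an automorphism \<open>\<tau>\<close> of the algebraic closure which restricts to \<open>\<gamma>\<close> on \<open>k\<^sup>s\<close> acts
  on the points of a twist by its action on \<open>V\<^sup>d\<close> followed by the matrix of \<open>x \<mapsto> x\<gamma>\<^sup>-\<^sup>1\<close>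
  (\<open>twist_conj_related\<close>); hence \<open>F i\<close> commutes with the Galois action on points
  as soon as \<open>f i\<close> is equivariant, and so it is defined over \<open>k\<close> (\<open>galois_descent\<close>). The
  homomorphism \<open>F = (F i)\<^sub>i\<close> is the required isogeny: if \<open>F x = 0\<close> then \<open>n x\<close> is the sum of the
  \<open>g i (f i x)\<close>, which vanish, and \<open>n z\<close> is the image under \<open>F\<close> of the sum of the \<open>g k (z k)\<close>.

  The descent step rests on two ingredients. One is Galois theory inside an algebraic closure \<open>K\<close>:
  a homomorphism between subalgebras of \<open>K\<close> extends to an automorphism of \<open>K\<close>
  (\<open>partial_hom_extend_Aut\<close>), an element of \<open>k\<^sup>s\<close> fixed by all automorphisms lies in \<open>k\<close>
  (\<open>ksep_fixed\<close>), and an automorphism is determined by its restriction to \<open>k\<^sup>s\<close>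
  (\<open>Aut_ac_fixes_ksep_imp_id\<close>). The other is that a Galois-stable space of vectors over \<open>k\<^sup>s\<close> has
  enough vectors over \<open>k\<close> (\<open>rational_vector\<close>); applied to the coefficients of a local fraction,
  it rewrites an equivariant function over \<open>k\<^sup>s\<close> as a function over \<open>k\<close>.\<close>

section \<open>Extending embeddings into the algebraic closure\<close>

text \<open>The graph of a \<open>k\<close>-algebra homomorphism from a subalgebra of \<open>K\<close> to \<open>K\<close>. As graphs, extensions
  are supersets and chains have their unions as upper bounds, which suits Zorn's lemma. As the
  relation is closed under differences, the last clause makes it single-valued.\<close>
definition partial_hom :: "(('k::field) alg_closure \<times> 'k alg_closure) set \<Rightarrow> bool" where
  "partial_hom r \<longleftrightarrow> (\<forall>c. (to_ac c, to_ac c) \<in> r)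
     \<and> (\<forall>a b c d. (a, b) \<in> r \<longrightarrow> (c, d) \<in> r \<longrightarrow> (a + c, b + d) \<in> r \<and> (a * c, b * d) \<in> r)
     \<and> (\<forall>y. (0, y) \<in> r \<longrightarrow> y = 0)"

definition poly_rel :: "('a::zero \<times> 'a) set \<Rightarrow> 'a poly \<Rightarrow> 'a poly \<Rightarrow> bool" where
  "poly_rel r p q \<longleftrightarrow> (\<forall>i. (Polynomial.coeff p i, Polynomial.coeff q i) \<in> r)"

lemma partial_homD:
  assumes "partial_hom r"
  shows "(to_ac c, to_ac c) \<in> r"
    and "(a, b) \<in> r \<Longrightarrow> (a', b') \<in> r \<Longrightarrow> (a + a', b + b') \<in> r"
    and "(a, b) \<in> r \<Longrightarrow> (a', b') \<in> r \<Longrightarrow> (a * a', b * b') \<in> r"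
    and "(0, y) \<in> r \<Longrightarrow> y = 0"
  using assms by (auto simp: partial_hom_def)

lemma partial_hom_0: "partial_hom r \<Longrightarrow> (0, 0) \<in> r"
  using partial_homD(1)[of r 0] by simp

lemma partial_hom_1: "partial_hom r \<Longrightarrow> (1, 1) \<in> r"
  using partial_homD(1)[of r 1] by simp

lemma partial_hom_diff:
  assumes "partial_hom r" "(a, b) \<in> r" "(a', b') \<in> r"
  shows "(a - a', b - b') \<in> r"
  using partial_homD(2)[OF assms(1,2)] partial_homD(3)[OF assms(1) partial_homD(1)[OF assms(1), of "- 1"] assms(3)]
  by fastforce

lemma partial_hom_unique:
  assumes "partial_hom r" "(a, b) \<in> r" "(a, b') \<in> r"
  shows "b = b'"
  using partial_hom_diff[OF assms] partial_homD(4)[OF assms(1)] by fastforce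

lemma partial_hom_sum:
  assumes "partial_hom r" "\<And>i. i \<in> A \<Longrightarrow> (f i, g i) \<in> r"
  shows "(sum f A, sum g A) \<in> r"
  using assms(2)
  by (induction A rule: infinite_finite_induct)
     (auto intro: partial_hom_0[OF assms(1)] partial_homD(2)[OF assms(1)])

lemma poly_rel_0: "partial_hom r \<Longrightarrow> poly_rel r 0 0"
  by (simp add: poly_rel_def partial_hom_0)

lemma poly_rel_add:
  "partial_hom r \<Longrightarrow> poly_rel r p p' \<Longrightarrow> poly_rel r q q' \<Longrightarrow> poly_rel r (p + q) (p' + q')"
  by (simp add: poly_rel_def partial_homD(2))

lemma poly_rel_diff:
  "partial_hom r \<Longrightarrow> poly_rel r p p' \<Longrightarrow> poly_rel r q q' \<Longrightarrow> poly_rel r (p - q) (p' - q')"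
  by (simp add: poly_rel_def partial_hom_diff)

lemma poly_rel_mult:
  assumes "partial_hom r" "poly_rel r p p'" "poly_rel r q q'"
  shows "poly_rel r (p * q) (p' * q')"
  using assms(2,3) unfolding poly_rel_def Polynomial.coeff_mult
  by (auto intro!: partial_hom_sum[OF assms(1)] partial_homD(3)[OF assms(1)])

lemma poly_rel_monom:
  "partial_hom r \<Longrightarrow> (a, b) \<in> r \<Longrightarrow> poly_rel r (Polynomial.monom a n) (Polynomial.monom b n)"
  by (simp add: poly_rel_def partial_hom_0)

lemma poly_rel_to_ac: "partial_hom r \<Longrightarrow> poly_rel r (map_poly to_ac p) (map_poly to_ac p)"
  by (simp add: poly_rel_def partial_homD(1) coeff_map_poly)

lemma partial_hom_power:
  assumes "partial_hom r" "(x, y) \<in> r" shows "(x ^ n, y ^ n) \<in> r"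
  by (induction n) (auto simp: partial_hom_1[OF assms(1)] partial_homD(3)[OF assms(1)] assms)

lemma poly_rel_zero:
  assumes "partial_hom r" "poly_rel r 0 p" shows "p = 0"
  using assms by (auto simp: poly_rel_def intro!: poly_eqI dest: partial_homD(4))

lemma partial_hom_poly:
  fixes x y :: "('k::field) alg_closure"
  assumes r: "partial_hom r" and pq: "poly_rel r p q" and xy: "(x, y) \<in> r"
  shows "(poly p x, poly q y) \<in> r"
proof -
  define n where "n = max (Polynomial.degree p) (Polynomial.degree q)"
  have *: "poly u z = (\<Sum>i\<le>n. Polynomial.coeff u i * z ^ i)" if "Polynomial.degree u \<le> n"
    for u and z :: "'k alg_closure"
    unfolding poly_altdef using that by (intro sum.mono_neutral_left) (auto intro: coeff_eq_0)
  show ?thesis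
    using pq by (subst (1 2) *)
      (auto simp: n_def poly_rel_def intro!: partial_hom_sum[OF r] partial_homD(3)[OF r] partial_hom_power[OF r xy])
qed

text \<open>Every \<open>z \<noteq> 0\<close> is algebraic, so its inverse is a polynomial in \<open>z\<close>. Thus subalgebras of \<open>K\<close> are
  fields, and partial homomorphisms respect inverses.\<close>
lemma inverse_polynomial:
  fixes z :: "('k::field) alg_closure"
  assumes "z \<noteq> 0"
  obtains u :: "'k poly" where "z * poly (map_poly to_ac u) z = 1"
proof -
  obtain p :: "'k poly" where p: "p \<noteq> 0" "poly (map_poly to_ac p) z = 0"
    by (rule alg_closure_algebraic)
  then have "\<exists>u::'k poly. z * poly (map_poly to_ac u) z = 1"
  proof (induction p)
    case (pCons a p)
    show ?case
    proof (cases "a = 0")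
      case True
      with pCons assms show ?thesis by (simp add: map_poly_pCons)
    next
      case False
      have "z * poly (map_poly to_ac (Polynomial.smult (- inverse a) p)) z = - inverse (to_ac a) * (z * poly (map_poly to_ac p) z)"
        by (simp add: map_poly_smult del: smult_minus_left)
      also have "z * poly (map_poly to_ac p) z = - to_ac a"
        using pCons.prems by (simp add: map_poly_pCons eq_neg_iff_add_eq_0 add.commute)
      also have "- inverse (to_ac a) * (- to_ac a) = 1"
        using False by simp
      finally show ?thesis by blast
    qed
  qed simp
  with that show thesis by blast
qed

lemma partial_hom_inverse:
  assumes r: "partial_hom r" and ab: "(a, b) \<in> r"
  shows "(inverse a, inverse b) \<in> r"
proof (cases "a = 0")
  case True
  with ab have "b = 0" using partial_homD(4)[OF r] by blast
  with True show ?thesis by (simp add: partial_hom_0[OF r])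
next
  case False
  then obtain u :: "'a poly" where u: "a * poly (map_poly to_ac u) a = 1"
    by (rule inverse_polynomial)
  let ?u = "map_poly to_ac u"
  have *: "(poly ?u a, poly ?u b) \<in> r"
    by (intro partial_hom_poly[OF r] poly_rel_to_ac r ab)
  have "(a * poly ?u a, b * poly ?u b) \<in> r"
    by (intro partial_homD(3)[OF r] ab *)
  then have "b * poly ?u b = 1"
    using partial_hom_unique[OF r _ partial_hom_1[OF r]] u by metis
  with u have "poly ?u a = inverse a" "poly ?u b = inverse b"
    by (metis inverse_unique)+
  with * show ?thesis by simp
qed

text \<open>Division with remainder by a monic polynomial never leaves the ring of coefficients, so it can be
  carried out simultaneously on both sides of a partial homomorphism.\<close>
lemma poly_rel_division:
  assumes r: "partial_hom r" and m: "poly_rel r m m'" "Polynomial.lead_coeff m = 1"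
    and "poly_rel r p p'"
  shows "\<exists>u u' v v'. poly_rel r u u' \<and> poly_rel r v v' \<and> p = m * u + v \<and> p' = m' * u' + v'
           \<and> (v = 0 \<or> Polynomial.degree v < Polynomial.degree m)"
  using assms(4)
proof (induction "Polynomial.degree p" arbitrary: p p' rule: less_induct)
  case less
  show ?case
  proof (cases "p = 0 \<or> Polynomial.degree p < Polynomial.degree m")
    case True
    then show ?thesis using less.prems poly_rel_0[OF r]
      by (intro exI[of _ 0] exI[of _ p] exI[of _ p']) auto
  next
    case False
    define k where "k = Polynomial.degree p - Polynomial.degree m"
    define t where "t = Polynomial.monom (Polynomial.lead_coeff p) k"
    define t' where "t' = Polynomial.monom (Polynomial.coeff p' (Polynomial.degree p)) k"
    have t: "poly_rel r t t'"
      unfolding t_def t'_def using less.prems by (intro poly_rel_monom r) (auto simp: poly_rel_def)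
    have rel: "poly_rel r (p - m * t) (p' - m' * t')"
      by (intro poly_rel_diff poly_rel_mult r m less.prems t)
    have m0: "m \<noteq> 0" using m by auto
    have t0: "t \<noteq> 0" using False by (auto simp: t_def)
    have dt: "Polynomial.degree (m * t) = Polynomial.degree p"
      using False m0 t0 by (subst degree_mult_eq) (auto simp: t_def k_def degree_monom_eq)
    have "Polynomial.lead_coeff (m * t) = Polynomial.lead_coeff p"
      by (subst Polynomial.lead_coeff_mult) (use m False in \<open>auto simp: t_def degree_monom_eq\<close>)
    then have "Polynomial.coeff (p - m * t) (Polynomial.degree p) = 0" using dt by simp
    moreover have "Polynomial.degree (p - m * t) \<le> Polynomial.degree p"
      using dt by (intro degree_diff_le) auto
    ultimately have "p - m * t = 0 \<or> Polynomial.degree (p - m * t) < Polynomial.degree p"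
      using eq_zero_or_degree_less by blast
    then show ?thesis
    proof
      assume "p - m * t = 0"
      moreover from this have "p' - m' * t' = 0" using poly_rel_zero[OF r, of "p' - m' * t'"] rel by simp
      ultimately show ?thesis using t poly_rel_0[OF r]
        by (intro exI[of _ t] exI[of _ t'] exI[of _ 0]) auto
    next
      assume "Polynomial.degree (p - m * t) < Polynomial.degree p"
      from less.hyps[OF this rel] obtain u u' v v' where *: "poly_rel r u u'" "poly_rel r v v'"
          "p - m * t = m * u + v" "p' - m' * t' = m' * u' + v'"
          "v = 0 \<or> Polynomial.degree v < Polynomial.degree m" by blast
      have "p = m * (t + u) + v" "p' = m' * (t' + u') + v'"
        using *(3,4) by (simp_all add: algebra_simps)
      then show ?thesis using poly_rel_add[OF r t *(1)] *(2,5) by blast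
    qed
  qed
qed

text \<open>The minimal polynomial \<open>m\<close> of \<open>x\<close> over the domain of \<open>r\<close>, together with its image \<open>m'\<close> under \<open>r\<close>:
  a polynomial of least degree, made monic with \<open>partial_hom_inverse\<close>.\<close>
lemma partial_hom_minpoly:
  assumes r: "partial_hom r"
  obtains m m' where "poly_rel r m m'" "Polynomial.lead_coeff m = 1" "poly m x = 0"
    "\<And>p p'. poly_rel r p p' \<Longrightarrow> poly p x = 0 \<Longrightarrow> p = 0 \<or> Polynomial.degree m \<le> Polynomial.degree p"
proof -
  define P where "P = (\<lambda>(p, p'). poly_rel r p p' \<and> p \<noteq> 0 \<and> poly p x = 0)"
  obtain a :: "'a poly" where a: "a \<noteq> 0" "poly (map_poly to_ac a) x = 0"
    by (rule alg_closure_algebraic)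
  then have "P (map_poly to_ac a, map_poly to_ac a)"
    by (auto simp: P_def poly_rel_to_ac[OF r] map_poly_eq_0_iff)
  then obtain q where q: "P q" "\<And>y. P y \<Longrightarrow> Polynomial.degree (fst q) \<le> Polynomial.degree (fst y)"
    using ex_has_least_nat[of P _ "\<lambda>q. Polynomial.degree (fst q)"] by blast
  obtain p p' where qp: "q = (p, p')" by (cases q)
  have p: "poly_rel r p p'" "p \<noteq> 0" "poly p x = 0" using q qp by (auto simp: P_def)
  define m where "m = Polynomial.monom (inverse (Polynomial.lead_coeff p)) 0 * p"
  define m' where "m' = Polynomial.monom (inverse (Polynomial.coeff p' (Polynomial.degree p))) 0 * p'"
  show thesis
  proof
    show "poly_rel r m m'"
      using p(1) unfolding m_def m'_def
      by (intro poly_rel_mult r poly_rel_monom partial_hom_inverse) (auto simp: poly_rel_def)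
    show "Polynomial.lead_coeff m = 1"
      using p(2) by (simp add: m_def monom_0)
    show "poly m x = 0" using p(3) by (simp add: m_def)
    have dm: "Polynomial.degree m = Polynomial.degree p" using p(2) by (simp add: m_def monom_0)
    show "u = 0 \<or> Polynomial.degree m \<le> Polynomial.degree u" if "poly_rel r u u'" "poly u x = 0" for u u'
      using that q(2)[of "(u, u')"] by (auto simp: P_def qp dm)
  qed
qed

text \<open>The extension sends \<open>p(x)\<close> to \<open>p'(y)\<close>, where \<open>p'\<close> is the image of \<open>p\<close> under \<open>r\<close>. It is
  well defined because \<open>p(x) = 0\<close> makes \<open>p\<close> a multiple of \<open>m\<close>, so that \<open>p'\<close> is a multiple of \<open>m'\<close>.\<close>
lemma partial_hom_extend:
  assumes r: "partial_hom r" and m: "poly_rel r m m'" "Polynomial.lead_coeff m = 1" "poly m x = 0"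
    and min: "\<And>p p'. poly_rel r p p' \<Longrightarrow> poly p x = 0 \<Longrightarrow> p = 0 \<or> Polynomial.degree m \<le> Polynomial.degree p"
    and y: "poly m' y = 0"
  shows "\<exists>s. partial_hom s \<and> r \<subseteq> s \<and> (x, y) \<in> s"
proof (intro exI conjI)
  define s where "s = {(poly p x, poly p' y) | p p'. poly_rel r p p'}"
  have s: "(poly p x, poly p' y) \<in> s" if "poly_rel r p p'" for p p'
    using that by (auto simp: s_def)
  have const: "(a, b) \<in> s" if "(a, b) \<in> r" for a b
    using s[OF poly_rel_monom[OF r that, of 0]] by (simp add: poly_monom)
  have zero: "b = 0" if "(0, b) \<in> s" for b
  proof -
    from that obtain p p' where p: "poly_rel r p p'" "poly p x = 0" "b = poly p' y"
      by (auto simp: s_def)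
    obtain u u' v v' where *: "poly_rel r u u'" "poly_rel r v v'"
          "p = m * u + v" "p' = m' * u' + v'"
          "v = 0 \<or> Polynomial.degree v < Polynomial.degree m"
      using poly_rel_division[OF r m(1,2) p(1)] by blast
    have "poly v x = 0" using p(2) *(3) m(3) by simp
    then have "v = 0" using min[OF *(2)] *(5) by auto
    then have "v' = 0" using *(2) poly_rel_zero[OF r] by simp
    then show "b = 0" using p(3) *(4) y by simp
  qed
  show "partial_hom s"
    unfolding partial_hom_def
  proof (intro conjI allI impI zero)
    show "(to_ac c, to_ac c) \<in> s" for c by (intro const partial_homD(1)[OF r])
    fix a b c d assume "(a, b) \<in> s" "(c, d) \<in> s"
    then obtain p p' q q' where *: "poly_rel r p p'" "poly_rel r q q'" "a = poly p x" "b = poly p' y"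
      "c = poly q x" "d = poly q' y" by (auto simp: s_def)
    show "(a + c, b + d) \<in> s" using s[OF poly_rel_add[OF r *(1,2)]] * by simp
    show "(a * c, b * d) \<in> s" using s[OF poly_rel_mult[OF r *(1,2)]] * by simp
  qed
  show "r \<subseteq> s" using const by auto
  show "(x, y) \<in> s"
    using s[OF poly_rel_monom[OF r partial_hom_1[OF r], of 1]] by (simp add: poly_monom)
qed

lemma partial_hom_extend_root:
  assumes r: "partial_hom r"
  shows "\<exists>s y. partial_hom s \<and> r \<subseteq> s \<and> (x, y) \<in> s"
proof -
  obtain m m' where m: "poly_rel r m m'" "Polynomial.lead_coeff m = 1" "poly m x = 0"
    "\<And>p p'. poly_rel r p p' \<Longrightarrow> poly p x = 0 \<Longrightarrow> p = 0 \<or> Polynomial.degree m \<le> Polynomial.degree p"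
    by (rule partial_hom_minpoly[OF r]) blast
  have "Polynomial.degree m \<noteq> 0"
  proof
    assume "Polynomial.degree m = 0"
    then obtain c where "m = [:c:]" by (auto elim: degree_eq_zeroE)
    with m show False by simp
  qed
  moreover have "Polynomial.coeff m' (Polynomial.degree m) = 1"
    using m(1,2) partial_hom_unique[OF r _ partial_hom_1[OF r]] unfolding poly_rel_def by metis
  then have "Polynomial.degree m \<le> Polynomial.degree m'" by (intro le_degree) simp
  ultimately obtain y where "poly m' y = 0"
    using alg_closed_imp_poly_has_root[of m'] by fastforce
  from partial_hom_extend[OF r m(1-3) _ this] m(4) show ?thesis by blast
qed

lemma Aut_acD:
  assumes "\<tau> \<in> Aut_ac"
  shows "\<tau> (x + y) = \<tau> x + \<tau> y" "\<tau> (x * y) = \<tau> x * \<tau> y" "\<tau> (to_ac c) = to_ac c" "bij \<tau>"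
  using assms by (auto simp: Aut_ac_def)

text \<open>A maximal extension of \<open>r\<close> is defined on all of \<open>K\<close>, since otherwise one more element could be
  adjoined. It is onto because it permutes the finite set of roots in \<open>K\<close> of each polynomial over \<open>k\<close>.\<close>
lemma partial_hom_extend_Aut:
  assumes r: "partial_hom r"
  obtains \<tau> where "\<tau> \<in> Aut_ac" "\<And>a b. (a, b) \<in> r \<Longrightarrow> \<tau> a = b"
proof -
  have "\<exists>M\<in>{s. partial_hom s \<and> r \<subseteq> s}. \<forall>X\<in>{s. partial_hom s \<and> r \<subseteq> s}. M \<subseteq> X \<longrightarrow> X = M"
  proof (rule subset_Zorn_nonempty)
    show "{s. partial_hom s \<and> r \<subseteq> s} \<noteq> {}" using r by blast
    fix C assume C: "C \<noteq> {}" "subset.chain {s. partial_hom s \<and> r \<subseteq> s} C"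
    have CP: "partial_hom s" "r \<subseteq> s" if "s \<in> C" for s
      using C that by (auto simp: subset_chain_def)
    have join: "\<exists>s\<in>C. u \<in> s \<and> v \<in> s" if uv: "u \<in> \<Union>C" "v \<in> \<Union>C" for u v
    proof -
      from uv obtain s s' where "u \<in> s" "v \<in> s'" "s \<in> C" "s' \<in> C" by blast
      moreover from this C(2) have "s \<subseteq> s' \<or> s' \<subseteq> s"
        unfolding subset_chain_def by blast
      ultimately show ?thesis by (meson subsetD)
    qed
    have "partial_hom (\<Union>C)"
      unfolding partial_hom_def
    proof (intro conjI allI impI)
      show "(to_ac c, to_ac c) \<in> \<Union>C" for c using CP(1) C(1) partial_homD(1) by blast
      show "y = 0" if "(0, y) \<in> \<Union>C" for y using that CP(1) partial_homD(4) by blast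
      fix a b c d assume "(a, b) \<in> \<Union>C" "(c, d) \<in> \<Union>C"
      from join[OF this] obtain s where "s \<in> C" "(a, b) \<in> s" "(c, d) \<in> s" by blast
      then show "(a + c, b + d) \<in> \<Union>C" "(a * c, b * d) \<in> \<Union>C"
        using CP(1) partial_homD(2,3) by blast+
    qed
    with C CP show "\<Union>C \<in> {s. partial_hom s \<and> r \<subseteq> s}" by blast
  qed
  then obtain s where s': "s \<in> {s. partial_hom s \<and> r \<subseteq> s}"
    and max': "\<forall>X\<in>{s. partial_hom s \<and> r \<subseteq> s}. s \<subseteq> X \<longrightarrow> X = s" ..
  from s' have s: "partial_hom s" "r \<subseteq> s" by simp_all
  have max: "X = s" if "partial_hom X" "s \<subseteq> X" for X
    using max' that s(2) by simp
  have total: "\<exists>y. (x, y) \<in> s" for x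
    using partial_hom_extend_root[OF s(1), of x] max by metis
  define \<tau> where "\<tau> x = (SOME y. (x, y) \<in> s)" for x
  have \<tau>s: "(x, \<tau> x) \<in> s" for x
    unfolding \<tau>_def using total by (rule someI_ex)
  have \<tau>: "(x, y) \<in> s \<longleftrightarrow> \<tau> x = y" for x y
    using \<tau>s partial_hom_unique[OF s(1)] by blast
  have hom: "\<tau> (x + y) = \<tau> x + \<tau> y" "\<tau> (x * y) = \<tau> x * \<tau> y" "\<tau> (to_ac c) = to_ac c" for x y c
    using partial_homD(1-3)[OF s(1)] \<tau> by blast+
  have \<tau>_poly: "\<tau> (poly (map_poly to_ac p) x) = poly (map_poly to_ac p) (\<tau> x)" for p x
    using partial_hom_poly[OF s(1) poly_rel_to_ac[OF s(1)]] \<tau> by blast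
  have zero: "x = 0" if "\<tau> x = 0" for x
    using partial_hom_inverse[OF s(1) \<tau>s[of x]] partial_homD(3)[OF s(1) \<tau>s[of x]] that \<tau>
      hom(3)[of 1] by (metis hom(2) right_inverse mult_zero_left to_ac_1 zero_neq_one)
  have inj: "inj \<tau>"
  proof (rule injI)
    fix x y assume "\<tau> x = \<tau> y"
    then have "(x - y, 0) \<in> s" using partial_hom_diff[OF s(1) \<tau>s[of x] \<tau>s[of y]] by simp
    then show "x = y" using zero \<tau> by force
  qed
  have "surj \<tau>"
  unfolding surj_def
  proof
    fix y
    obtain p :: "'a poly" where p: "p \<noteq> 0" "poly (map_poly to_ac p) y = 0"
      by (rule alg_closure_algebraic)
    let ?R = "{z. poly (map_poly to_ac p) z = 0}"
    have "finite ?R" using p by (intro poly_roots_finite) (auto simp: map_poly_eq_0_iff)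
    moreover have "\<tau> ` ?R \<subseteq> ?R"
    proof clarify
      fix z assume "poly (map_poly to_ac p) z = 0"
      then show "poly (map_poly to_ac p) (\<tau> z) = 0"
        using \<tau>_poly[of p z] hom(3)[of 0] by simp
    qed
    ultimately have "\<tau> ` ?R = ?R"
      using inj by (intro endo_inj_surj) (auto simp: inj_on_def)
    then show "\<exists>x. y = \<tau> x" using p by blast
  qed
  with inj hom have "\<tau> \<in> Aut_ac" by (auto simp: Aut_ac_def bij_def)
  then show thesis using that \<tau> s(2) by blast
qed

section \<open>Automorphisms of the algebraic closure and separable elements\<close>

text \<open>An automorphism is itself a partial homomorphism, so the lemmas about polynomials related by a
  partial homomorphism apply to it.\<close>
lemma Aut_ac_graph: "\<tau> \<in> Aut_ac \<Longrightarrow> partial_hom {(x, \<tau> x) | x. True}"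
  unfolding partial_hom_def
proof (intro conjI allI impI)
  assume \<tau>: "\<tau> \<in> Aut_ac"
  have 0: "\<tau> 0 = 0" using Aut_acD(3)[OF \<tau>, of 0] by simp
  show "(to_ac c, to_ac c) \<in> {(x, \<tau> x) | x. True}" for c using Aut_acD(3)[OF \<tau>] by simp
  show "y = 0" if "(0, y) \<in> {(x, \<tau> x) | x. True}" for y using that 0 by simp
  fix a b c d assume "(a, b) \<in> {(x, \<tau> x) | x. True}" "(c, d) \<in> {(x, \<tau> x) | x. True}"
  then show "(a + c, b + d) \<in> {(x, \<tau> x) | x. True}" "(a * c, b * d) \<in> {(x, \<tau> x) | x. True}"
    using Aut_acD(1,2)[OF \<tau>] by simp_all
qed

lemma Aut_ac_0 [simp]: "\<tau> \<in> Aut_ac \<Longrightarrow> \<tau> 0 = 0"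
  using Aut_acD(3)[of \<tau> 0] by simp

lemma Aut_ac_1 [simp]: "\<tau> \<in> Aut_ac \<Longrightarrow> \<tau> 1 = 1"
  using Aut_acD(3)[of \<tau> 1] by simp

lemma Aut_ac_eq_iff [simp]: "\<tau> \<in> Aut_ac \<Longrightarrow> \<tau> x = \<tau> y \<longleftrightarrow> x = y"
  using Aut_acD(4) by (metis bij_pointE)

lemma Aut_ac_eq_0_iff [simp]: "\<tau> \<in> Aut_ac \<Longrightarrow> \<tau> x = 0 \<longleftrightarrow> x = 0"
  using Aut_ac_eq_iff[of \<tau> x 0] by simp

lemma Aut_ac_inverse: "\<tau> \<in> Aut_ac \<Longrightarrow> \<tau> (inverse x) = inverse (\<tau> x)"
  by (cases "x = 0") (auto intro!: inverse_unique[symmetric] simp flip: Aut_acD(2))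

lemma Aut_ac_divide: "\<tau> \<in> Aut_ac \<Longrightarrow> \<tau> (x / y) = \<tau> x / \<tau> y"
  by (simp add: field_class.field_divide_inverse Aut_acD(2) Aut_ac_inverse)

lemma Aut_ac_sum: "\<tau> \<in> Aut_ac \<Longrightarrow> \<tau> (sum f A) = (\<Sum>i\<in>A. \<tau> (f i))"
  by (induction A rule: infinite_finite_induct) (auto simp: Aut_acD(1))

lemma Aut_ac_prod: "\<tau> \<in> Aut_ac \<Longrightarrow> \<tau> (prod f A) = (\<Prod>i\<in>A. \<tau> (f i))"
  by (induction A rule: infinite_finite_induct) (auto simp: Aut_acD(2))

lemma Aut_ac_power: "\<tau> \<in> Aut_ac \<Longrightarrow> \<tau> (x ^ n) = \<tau> x ^ n"
  by (induction n) (auto simp: Aut_acD(2))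

lemma Aut_ac_poly:
  assumes "\<tau> \<in> Aut_ac"
  shows "\<tau> (poly (map_poly to_ac p) x) = poly (map_poly to_ac p) (\<tau> x)"
  using partial_hom_poly[OF Aut_ac_graph[OF assms] poly_rel_to_ac[OF Aut_ac_graph[OF assms]], of x "\<tau> x" p]
  by simp

lemma Aut_ac_id: "(\<lambda>x. x) \<in> Aut_ac"
  by (simp add: Aut_ac_def flip: id_def)

lemma Aut_ac_comp: "\<sigma> \<in> Aut_ac \<Longrightarrow> \<tau> \<in> Aut_ac \<Longrightarrow> (\<lambda>x. \<sigma> (\<tau> x)) \<in> Aut_ac"
  using bij_comp[of \<tau> \<sigma>] by (simp add: Aut_ac_def o_def)

lemma Aut_ac_inv_apply [simp]:
  assumes "\<tau> \<in> Aut_ac" shows "inv_into UNIV \<tau> (\<tau> x) = x" "\<tau> (inv_into UNIV \<tau> x) = x"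
  using Aut_acD(4)[OF assms] by (auto simp: bij_is_inj bij_is_surj surj_f_inv_f)

lemma Aut_ac_inv:
  assumes "\<tau> \<in> Aut_ac" shows "inv_into UNIV \<tau> \<in> Aut_ac"
  unfolding Aut_ac_def
proof (intro CollectI conjI allI)
  show "bij (inv_into UNIV \<tau>)" by (intro bij_imp_bij_inv Aut_acD(4) assms)
  show "inv_into UNIV \<tau> (to_ac c) = to_ac c" for c
    using Aut_ac_inv_apply(1)[OF assms, of "to_ac c"] Aut_acD(3)[OF assms] by simp
  show "inv_into UNIV \<tau> (x + y) = inv_into UNIV \<tau> x + inv_into UNIV \<tau> y" for x y
    using Aut_ac_inv_apply(1)[OF assms, of "inv_into UNIV \<tau> x + inv_into UNIV \<tau> y"] assms by (simp add: Aut_acD(1))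
  show "inv_into UNIV \<tau> (x * y) = inv_into UNIV \<tau> x * inv_into UNIV \<tau> y" for x y
    using Aut_ac_inv_apply(1)[OF assms, of "inv_into UNIV \<tau> x * inv_into UNIV \<tau> y"] assms by (simp add: Aut_acD(2))
qed

lemma map_poly_to_ac_mult: "map_poly to_ac (p * q) = map_poly to_ac p * map_poly to_ac q"
  by (rule poly_eqI) (simp add: coeff_map_poly Polynomial.coeff_mult to_ac_sum)

lemma map_poly_to_ac_add: "map_poly to_ac (p + q) = map_poly to_ac p + map_poly to_ac q"
  by (rule poly_eqI) (simp add: coeff_map_poly)

lemma map_poly_to_ac_pderiv: "map_poly to_ac (pderiv p) = pderiv (map_poly to_ac p)"
  by (rule poly_eqI) (simp add: coeff_map_poly coeff_pderiv)

lemma map_poly_to_ac_eq_0 [simp]: "map_poly to_ac p = 0 \<longleftrightarrow> p = 0"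
  by (simp add: map_poly_eq_0_iff)

lemma irreducible_annihilator:
  fixes z :: "('k::field) alg_closure"
  obtains q :: "'k poly" where "irreducible q" "poly (map_poly to_ac q) z = 0"
    "\<And>p. poly (map_poly to_ac p) z = 0 \<Longrightarrow> q dvd p"
proof -
  define P where "P p \<longleftrightarrow> p \<noteq> 0 \<and> poly (map_poly to_ac p) z = 0" for p :: "'k poly"
  obtain a :: "'k poly" where "a \<noteq> 0" "poly (map_poly to_ac a) z = 0"
    by (rule alg_closure_algebraic)
  then have "P a" by (simp add: P_def)
  then obtain q where q: "P q" "\<And>p. P p \<Longrightarrow> Polynomial.degree q \<le> Polynomial.degree p"
    using ex_has_least_nat[of P a Polynomial.degree] by blast
  have q0: "q \<noteq> 0" "poly (map_poly to_ac q) z = 0" using q(1) by (auto simp: P_def)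
  have dvd: "q dvd p" if "poly (map_poly to_ac p) z = 0" for p
  proof -
    have "poly (map_poly to_ac (q * (p div q) + p mod q)) z = 0" using that by simp
    then have "poly (map_poly to_ac (p mod q)) z = 0"
      unfolding map_poly_to_ac_add map_poly_to_ac_mult using q0(2) by simp
    moreover have "p mod q = 0 \<or> Polynomial.degree (p mod q) < Polynomial.degree q"
      by (rule degree_mod_less[OF q0(1)])
    ultimately have "p mod q = 0" using q(2)[of "p mod q"] unfolding P_def by linarith
    then show ?thesis by (simp add: dvd_eq_mod_eq_0)
  qed
  have nu: "\<not> is_unit q"
  proof
    assume "is_unit q"
    then obtain u where "1 = q * u" by (elim dvdE)
    then have "poly (map_poly to_ac (q * u)) z = 1" by simp
    then show False using q0(2) by (simp add: map_poly_to_ac_mult)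
  qed
  have unit: "is_unit b" if "q = a * b" "poly (map_poly to_ac a) z = 0" for a b
  proof -
    have "a \<noteq> 0" "b \<noteq> 0" using that q0 by auto
    then have "Polynomial.degree q = Polynomial.degree a + Polynomial.degree b"
      using that(1) by (simp add: degree_mult_eq)
    moreover have "Polynomial.degree q \<le> Polynomial.degree a"
      using q(2)[of a] \<open>a \<noteq> 0\<close> that(2) by (simp add: P_def)
    ultimately show ?thesis using is_unit_iff_degree[OF \<open>b \<noteq> 0\<close>] by simp
  qed
  have "irreducible q"
  proof (rule irreducibleI)
    show "q \<noteq> 0" "\<not> is_unit q" by fact+
    fix a b assume ab: "q = a * b"
    then have "poly (map_poly to_ac a) z = 0 \<or> poly (map_poly to_ac b) z = 0"
      using q0(2) by (simp add: map_poly_to_ac_mult)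
    then show "a dvd 1 \<or> b dvd 1"
      using unit[OF ab] unit[of b a] ab by (auto simp: mult.commute)
  qed
  with that q0 dvd show thesis by blast
qed

lemma rsquarefree_iff_no_square:
  fixes p :: "'a::field poly"
  shows "rsquarefree p \<longleftrightarrow> p \<noteq> 0 \<and> (\<forall>a. \<not> [:- a, 1:] ^ 2 dvd p)"
proof (cases "p = 0")
  case False
  have "[:- a, 1:] ^ 2 dvd p \<longleftrightarrow> Polynomial.order a p \<ge> 2" for a
    using False by (simp add: order_divides)
  then have "\<not> [:- a, 1:] ^ 2 dvd p \<longleftrightarrow> Polynomial.order a p = 0 \<or> Polynomial.order a p = 1" for a
    by (auto simp: not_le less_2_cases_iff)
  then show ?thesis using False unfolding rsquarefree_def by blast
qed (simp add: rsquarefree_def)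

lemma rsquarefree_dvd:
  fixes p q :: "'a::field poly"
  assumes "rsquarefree p" "q dvd p" shows "rsquarefree q"
  using assms unfolding rsquarefree_iff_no_square by (auto dest: dvd_trans)

text \<open>Over an algebraically closed field a squarefree polynomial splits into distinct linear factors.\<close>
lemma card_roots_rsquarefree:
  fixes p :: "'a::alg_closed_field poly"
  assumes "rsquarefree p"
  shows "card {x. poly p x = 0} = Polynomial.degree p"
  using assms
proof (induction "Polynomial.degree p" arbitrary: p)
  case 0
  then obtain c where "p = [:c:]" by (metis degree_eq_zeroE)
  moreover have "p \<noteq> 0" using 0 by (simp add: rsquarefree_def)
  ultimately show ?case by simp
next
  case (Suc n)
  then obtain x where "poly p x = 0" using alg_closed_imp_poly_has_root[of p] by auto
  then obtain q where q: "p = [:- x, 1:] * q" by (metis dvdE poly_eq_0_iff_dvd)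
  have "q dvd p" unfolding q by (rule dvd_triv_right)
  then have rq: "rsquarefree q" using rsquarefree_dvd[OF Suc.prems] by blast
  then have q0: "q \<noteq> 0" by (simp add: rsquarefree_def)
  have "Polynomial.degree p = Suc (Polynomial.degree q)"
    unfolding q by (subst degree_mult_eq) (use q0 in auto)
  then have card: "card {y. poly q y = 0} = n" "Polynomial.degree p = Suc n"
    using Suc.hyps(1)[OF _ rq] Suc.hyps(2) by simp_all
  have "poly q x \<noteq> 0"
  proof
    assume "poly q x = 0"
    then have "[:- x, 1:] dvd q" by (rule iffD1[OF poly_eq_0_iff_dvd])
    then have "[:- x, 1:] ^ 2 dvd p"
      unfolding q power2_eq_square by (rule mult_dvd_mono[OF dvd_refl])
    with Suc.prems show False by (simp add: rsquarefree_iff_no_square)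
  qed
  moreover have "{y. poly p y = 0} = insert x {y. poly q y = 0}" by (auto simp: q)
  ultimately show ?case using card poly_roots_finite[OF q0] by simp
qed

text \<open>The identity on \<open>E\<close> is a partial homomorphism exactly when \<open>E\<close> is a \<open>k\<close>-subalgebra; this makes the
  lemmas on partial homomorphisms available for polynomials with coefficients in \<open>E\<close>.\<close>
abbreviation subalg :: "(('k::field) alg_closure) set \<Rightarrow> bool" where
  "subalg E \<equiv> partial_hom (Id_on E)"

lemma subalg_iff: "subalg E \<longleftrightarrow> range to_ac \<subseteq> E \<and> (\<forall>x\<in>E. \<forall>y\<in>E. x + y \<in> E \<and> x * y \<in> E)"
  by (auto simp: partial_hom_def Id_on_iff)

lemma poly_rel_Id_on: "poly_rel (Id_on E) p q \<longleftrightarrow> p = q \<and> (\<forall>i. Polynomial.coeff p i \<in> E)"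
  by (auto simp: poly_rel_def Id_on_iff poly_eq_iff)

text \<open>The step of Galois theory for \<open>E(x)/E\<close> with \<open>x\<close> separable: an element of \<open>E(x)\<close> fixed by all
  automorphisms over \<open>E\<close> lies in \<open>E\<close>. Reduce \<open>p\<close> modulo the minimal polynomial \<open>m\<close> of \<open>x\<close>. For each root
  \<open>y\<close> of \<open>m\<close> some automorphism over \<open>E\<close> sends \<open>x\<close> to \<open>y\<close>, so the remainder takes the value \<open>z\<close> at all roots
  of \<open>m\<close>. These are as many as the degree of \<open>m\<close>, by separability, so the remainder is constant.\<close>
lemma subalg_fixed:
  assumes E: "subalg E" and x: "x \<in> ksep" and p: "\<And>i. Polynomial.coeff p i \<in> E" and z: "z = poly p x"
    and fixed: "\<And>\<tau>. \<tau> \<in> Aut_ac \<Longrightarrow> (\<And>e. e \<in> E \<Longrightarrow> \<tau> e = e) \<Longrightarrow> \<tau> z = z"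
  shows "z \<in> E"
proof -
  obtain m m' where m: "poly_rel (Id_on E) m m'" "Polynomial.lead_coeff m = 1" "poly m x = 0"
    and min: "\<And>p p'. poly_rel (Id_on E) p p' \<Longrightarrow> poly p x = 0 \<Longrightarrow>
          p = 0 \<or> Polynomial.degree m \<le> Polynomial.degree p"
    by (rule partial_hom_minpoly[OF E]) blast
  have m': "m' = m" using m(1) by (simp add: poly_rel_Id_on)
  have "Polynomial.degree m \<noteq> 0"
    using m(2,3) by (metis degree_eq_zeroE poly_const_conv zero_neq_one lead_coeff_pCons(2))
  obtain u v where v: "p = m * u + v" "\<And>i. Polynomial.coeff v i \<in> E"
    "v = 0 \<or> Polynomial.degree v < Polynomial.degree m"
    using poly_rel_division[OF E m(1,2), of p p] p by (auto simp: poly_rel_Id_on)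
  have zv: "z = poly v x" using z v(1) m(3) by simp
  obtain f :: "'a poly" where f: "poly (map_poly to_ac f) x = 0" "rsquarefree (map_poly to_ac f)"
    using x by (auto simp: ksep_def)
  obtain a b where ab: "map_poly to_ac f = m * a + b" "poly_rel (Id_on E) b b"
     "b = 0 \<or> Polynomial.degree b < Polynomial.degree m"
    using poly_rel_division[OF E m(1,2) poly_rel_to_ac[OF E, of f]] by (auto simp: poly_rel_Id_on)
  have "poly b x = 0" using f(1) m(3) ab(1) by simp
  with min[OF ab(2)] ab(3) have "b = 0" by auto
  then have "m dvd map_poly to_ac f" using ab(1) by simp
  then have "rsquarefree m" using f(2) rsquarefree_dvd by blast
  then have card: "card {y. poly m y = 0} = Polynomial.degree m" by (rule card_roots_rsquarefree)
  have val: "poly v y = z" if y: "poly m y = 0" for y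
  proof -
    have "poly m' y = 0" using y m' by simp
    from partial_hom_extend[OF E m _ this] min
    obtain s where s: "partial_hom s" "Id_on E \<subseteq> s" "(x, y) \<in> s" by blast
    obtain \<tau> where \<tau>: "\<tau> \<in> Aut_ac" "\<And>a b. (a, b) \<in> s \<Longrightarrow> \<tau> a = b"
      by (rule partial_hom_extend_Aut[OF s(1)]) blast
    have "poly_rel s v v" using v(2) s(2) by (auto simp: poly_rel_def)
    then have "(poly v x, poly v y) \<in> s" by (rule partial_hom_poly[OF s(1) _ s(3)])
    then have "\<tau> z = poly v y" using \<tau>(2) zv by blast
    moreover have "\<tau> e = e" if "e \<in> E" for e using s(2) \<tau>(2)[of e e] that by blast
    then have "\<tau> z = z" by (rule fixed[OF \<tau>(1)])
    ultimately show ?thesis by simp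
  qed
  \<comment> \<open>Both sides have degree below that of \<open>m\<close> and agree at its roots.\<close>
  have "v = [:z:]"
  proof (rule poly_eqI_degree)
    show "poly v y = poly [:z:] y" if "y \<in> {y. poly m y = 0}" for y using val that by simp
    show "card {y. poly m y = 0} > Polynomial.degree v" "card {y. poly m y = 0} > Polynomial.degree [:z:]"
      using v(3) \<open>Polynomial.degree m \<noteq> 0\<close> by (auto simp: card)
  qed
  then show ?thesis using v(2)[of 0] by simp
qed

inductive_set alg_gen :: "('k::field) alg_closure set \<Rightarrow> 'k alg_closure set" for C where
  base: "to_ac c \<in> alg_gen C"
| gen: "x \<in> C \<Longrightarrow> x \<in> alg_gen C"
| add: "x \<in> alg_gen C \<Longrightarrow> y \<in> alg_gen C \<Longrightarrow> x + y \<in> alg_gen C"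
| mult: "x \<in> alg_gen C \<Longrightarrow> y \<in> alg_gen C \<Longrightarrow> x * y \<in> alg_gen C"

lemma subalg_alg_gen: "subalg (alg_gen C)"
  by (auto simp: subalg_iff intro: alg_gen.intros)

lemma alg_gen_mono: "x \<in> alg_gen C \<Longrightarrow> C \<subseteq> D \<Longrightarrow> x \<in> alg_gen D"
  by (induction rule: alg_gen.induct) (auto intro: alg_gen.intros)

lemma alg_gen_insert:
  assumes "z \<in> alg_gen (insert x C)"
  shows "\<exists>p. (\<forall>i. Polynomial.coeff p i \<in> alg_gen C) \<and> z = poly p x"
proof -
  note E = subalg_alg_gen[of C]
  have "\<exists>p. poly_rel (Id_on (alg_gen C)) p p \<and> z = poly p x" using assms
  proof induction
    case (base c)
    show ?case
      by (rule exI[of _ "Polynomial.monom (to_ac c) 0"])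
         (auto simp: poly_monom intro!: poly_rel_monom[OF E] alg_gen.base)
  next
    case (gen y)
    then consider "y = x" | "y \<in> C" by blast
    then show ?case
    proof cases
      case 1
      then show ?thesis
        by (intro exI[of _ "Polynomial.monom 1 1"])
           (auto simp: poly_monom intro!: poly_rel_monom[OF E] partial_hom_1[OF E])
    next
      case 2
      then show ?thesis
        by (intro exI[of _ "Polynomial.monom y 0"])
           (auto simp: poly_monom intro!: poly_rel_monom[OF E] alg_gen.gen)
    qed
  next
    case (add y z)
    then show ?case using poly_rel_add[OF E] by (metis poly_add)
  next
    case (mult y z)
    then show ?case using poly_rel_mult[OF E] by (metis poly_mult)
  qed
  then show ?thesis by (auto simp: poly_rel_Id_on)
qed

text \<open>By induction on the number of generators, removing one separable generator at a time with
  \<open>subalg_fixed\<close>.\<close>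
lemma alg_gen_fixed:
  assumes "finite C" "C \<subseteq> ksep" "z \<in> alg_gen C" "\<And>\<tau>. \<tau> \<in> Aut_ac \<Longrightarrow> \<tau> z = z"
  shows "z \<in> range to_ac"
  using assms
proof (induction C)
  case empty
  from empty(2) show ?case
  proof induction
    case (add x y)
    then obtain a b where "x = to_ac a" "y = to_ac b" by blast
    then have "x + y = to_ac (a + b)" by simp
    then show ?case by blast
  next
    case (mult x y)
    then obtain a b where "x = to_ac a" "y = to_ac b" by blast
    then have "x * y = to_ac (a * b)" by simp
    then show ?case by blast
  qed auto
next
  case (insert x C)
  obtain p where p: "\<And>i. Polynomial.coeff p i \<in> alg_gen C" "z = poly p x"
    using alg_gen_insert[OF insert.prems(2)] by blast
  have *: "x \<in> ksep" "C \<subseteq> ksep" using insert.prems(1) by simp_all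
  have "z \<in> alg_gen C"
    by (rule subalg_fixed[OF subalg_alg_gen *(1) p]) (rule insert.prems(3))
  show ?case by (rule insert.IH[OF *(2)]) (fact, rule insert.prems(3))
qed

lemma alg_gen_finite:
  "z \<in> alg_gen D \<Longrightarrow> \<exists>C. finite C \<and> C \<subseteq> D \<and> z \<in> alg_gen C"
proof (induction rule: alg_gen.induct)
  case (base c) then show ?case by (intro exI[of _ "{}"]) (auto intro: alg_gen.base)
next
  case (gen x) then show ?case by (intro exI[of _ "{x}"]) (auto intro: alg_gen.gen)
next
  case (add x y)
  then obtain A B where "finite A" "A \<subseteq> D" "x \<in> alg_gen A" "finite B" "B \<subseteq> D" "y \<in> alg_gen B" by blast
  then show ?case
    by (intro exI[of _ "A \<union> B"]) (auto intro!: alg_gen.add intro: alg_gen_mono)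
next
  case (mult x y)
  then obtain A B where "finite A" "A \<subseteq> D" "x \<in> alg_gen A" "finite B" "B \<subseteq> D" "y \<in> alg_gen B" by blast
  then show ?case
    by (intro exI[of _ "A \<union> B"]) (auto intro!: alg_gen.mult intro: alg_gen_mono)
qed

lemma Aut_ac_ksep:
  assumes "\<tau> \<in> Aut_ac" "x \<in> ksep" shows "\<tau> x \<in> ksep"
proof -
  obtain p :: "'a poly" where "irreducible p" "poly (map_poly to_ac p) x = 0" "rsquarefree (map_poly to_ac p)"
    using assms(2) by (auto simp: ksep_def)
  moreover from this(2) have "poly (map_poly to_ac p) (\<tau> x) = 0"
    using Aut_ac_poly[OF assms(1), of p x] assms(1) by simp
  ultimately show ?thesis by (auto simp: ksep_def)
qed

lemma Aut_ac_alg_gen: "z \<in> alg_gen ksep \<Longrightarrow> \<tau> \<in> Aut_ac \<Longrightarrow> \<tau> z \<in> alg_gen ksep"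
  by (induction rule: alg_gen.induct) (auto simp: Aut_acD Aut_ac_ksep intro: alg_gen.intros)

lemma poly_rel_prod:
  assumes "partial_hom r" "\<And>i. i \<in> A \<Longrightarrow> poly_rel r (f i) (g i)"
  shows "poly_rel r (prod f A) (prod g A)"
  using assms(2)
proof (induction A rule: infinite_finite_induct)
  case (infinite A)
  then show ?case using poly_rel_monom[OF assms(1) partial_hom_1[OF assms(1)], of 0] by (simp add: monom_0 one_pCons)
next
  case empty
  then show ?case using poly_rel_monom[OF assms(1) partial_hom_1[OF assms(1)], of 0] by (simp add: monom_0 one_pCons)
qed (auto intro: poly_rel_mult[OF assms(1)])

lemma poly_rel_linear:
  assumes "partial_hom r" "(a, b) \<in> r"
  shows "poly_rel r [:- a, 1:] [:- b, 1:]"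
proof -
  have "poly_rel r (Polynomial.monom 1 1 - Polynomial.monom a 0) (Polynomial.monom 1 1 - Polynomial.monom b 0)"
    by (intro poly_rel_diff poly_rel_monom assms partial_hom_1)
  then show ?thesis by (simp add: monom_0 monom_Suc)
qed

text \<open>Separable elements form a field. For \<open>z\<close> in the algebra generated by \<open>k\<^sup>s\<close>, let \<open>P\<close> be the
  product of the factors \<open>X - y\<close> over the conjugates \<open>y\<close> of \<open>z\<close>. Its coefficients are generated by
  separable elements and invariant, so they lie in \<open>k\<close>; as \<open>P\<close> has simple roots, \<open>z\<close> is separable.\<close>
lemma alg_gen_ksep: "alg_gen ksep = (ksep :: ('k::field) alg_closure set)"
proof (intro subset_antisym subsetI)
  fix z :: "'k alg_closure" assume z: "z \<in> alg_gen ksep"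
  define Orb where "Orb = (\<lambda>\<tau>. \<tau> z) ` Aut_ac"
  obtain f :: "'k poly" where f: "irreducible f" "poly (map_poly to_ac f) z = 0"
    "\<And>p. poly (map_poly to_ac p) z = 0 \<Longrightarrow> f dvd p" by (rule irreducible_annihilator) blast
  have "Orb \<subseteq> {y. poly (map_poly to_ac f) y = 0}"
    using Aut_ac_poly[of _ f z] f(2) by (auto simp: Orb_def)
  moreover have "finite {y. poly (map_poly to_ac f) y = 0}"
    using f(1) by (intro poly_roots_finite) auto
  ultimately have fin: "finite Orb" by (rule finite_subset)
  have zO: "z \<in> Orb" using Aut_ac_id by (force simp: Orb_def)
  have OE: "Orb \<subseteq> alg_gen ksep" using Aut_ac_alg_gen[OF z] by (auto simp: Orb_def)
  define P where "P = (\<Prod>y\<in>Orb. [:- y, 1:])"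
  have deg: "Polynomial.degree P = card Orb"
    unfolding P_def by (subst degree_prod_eq_sum_degree) auto
  have root: "poly P y = 0 \<longleftrightarrow> y \<in> Orb" for y
    using fin by (auto simp: P_def poly_prod)
  have P0: "P \<noteq> 0" using fin by (auto simp: P_def)
  have "poly_rel (Id_on (alg_gen ksep)) P P"
    unfolding P_def using OE by (intro poly_rel_prod poly_rel_linear subalg_alg_gen) auto
  then have c1: "Polynomial.coeff P i \<in> alg_gen ksep" for i by (simp add: poly_rel_Id_on)
  have c2: "\<tau> (Polynomial.coeff P i) = Polynomial.coeff P i" if \<tau>: "\<tau> \<in> Aut_ac" for \<tau> i
  proof -
    have "\<tau> ` Orb \<subseteq> Orb" using Aut_ac_comp[OF \<tau>] by (auto simp: Orb_def)
    moreover have "inj_on \<tau> Orb" using \<tau> by (auto simp: inj_on_def)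
    ultimately have "\<tau> ` Orb = Orb" using fin by (intro endo_inj_surj)
    then have "P = (\<Prod>y\<in>\<tau> ` Orb. [:- y, 1:])" by (simp add: P_def)
    also have "\<dots> = (\<Prod>y\<in>Orb. [:- \<tau> y, 1:])"
      using \<open>inj_on \<tau> Orb\<close> by (simp add: prod.reindex)
    finally have "poly_rel {(x, \<tau> x) | x. True} P P"
      using poly_rel_prod[OF Aut_ac_graph[OF \<tau>], of Orb "\<lambda>y. [:- y, 1:]" "\<lambda>y. [:- \<tau> y, 1:]"]
        poly_rel_linear[OF Aut_ac_graph[OF \<tau>]] by (simp add: P_def)
    then show ?thesis by (auto simp: poly_rel_def)
  qed
  have "Polynomial.coeff P i \<in> range to_ac" for i
    using alg_gen_finite[OF c1[of i]] alg_gen_fixed c2 by metis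
  then have Pp: "P = map_poly to_ac (map_poly of_ac P)"
    by (intro poly_eqI) (simp add: coeff_map_poly to_ac_of_ac)
  define p where "p = map_poly of_ac P"
  have "rsquarefree P"
    unfolding rsquarefree_iff_no_square
  proof (intro conjI P0 allI notI)
    fix a assume "[:- a, 1:] ^ 2 dvd P"
    then obtain q where q: "P = [:- a, 1:] ^ 2 * q" by (elim dvdE)
    have q0: "q \<noteq> 0" using P0 q by auto
    have "Orb \<subseteq> insert a {y. poly q y = 0}" using root by (auto simp: q)
    then have "card Orb \<le> card (insert a {y. poly q y = 0})"
      using poly_roots_finite[OF q0] by (intro card_mono) auto
    also have "\<dots> \<le> Suc (Polynomial.degree q)"
      using card_poly_roots_bound[OF q0] card_insert_le_m1 by (metis card_insert_le_m1 diff_Suc_1 zero_less_Suc)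
    also have "\<dots> < Polynomial.degree P"
      unfolding q using q0 by (subst degree_mult_eq) (auto simp: degree_power_eq)
    finally show False using deg by simp
  qed
  moreover have "f dvd p" using f(3)[of p] root[of z] zO Pp by (simp add: p_def)
  then have "map_poly to_ac f dvd P"
    using Pp by (metis dvd_def map_poly_to_ac_mult p_def)
  ultimately have "rsquarefree (map_poly to_ac f)" by (rule rsquarefree_dvd)
  with f show "z \<in> ksep" by (auto simp: ksep_def)
qed (rule alg_gen.gen)

lemma subalg_ksep: "subalg ksep"
  using subalg_alg_gen[of ksep] by (simp add: alg_gen_ksep)

lemma ksep_closed:
  shows "to_ac c \<in> ksep" and "x \<in> ksep \<Longrightarrow> y \<in> ksep \<Longrightarrow> x + y \<in> ksep"
    and "x \<in> ksep \<Longrightarrow> y \<in> ksep \<Longrightarrow> x * y \<in> ksep"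
    and "x \<in> ksep \<Longrightarrow> y \<in> ksep \<Longrightarrow> x - y \<in> ksep"
    and "x \<in> ksep \<Longrightarrow> inverse x \<in> ksep"
    and "0 \<in> ksep" and "1 \<in> ksep"
  using subalg_ksep partial_hom_diff[OF subalg_ksep] partial_hom_inverse[OF subalg_ksep]
     partial_hom_0[OF subalg_ksep] partial_hom_1[OF subalg_ksep]
  by (auto simp: subalg_iff Id_on_iff)

lemma ksep_fixed:
  assumes "x \<in> ksep" "\<And>\<tau>. \<tau> \<in> Aut_ac \<Longrightarrow> \<tau> x = x"
  shows "x \<in> range to_ac"
  using alg_gen_fixed[of "{x}" x] assms by (auto intro: alg_gen.gen)

section \<open>Automorphisms of the closure as elements of the Galois group\<close>

lemma CHAR_power_inj:
  fixes x y :: "'a::field"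
  assumes "CHAR('a) > 0" "x ^ CHAR('a) = y ^ CHAR('a)"
  shows "x = y"
proof -
  have p: "prime CHAR('a)" by (rule prime_CHAR_semidom[OF assms(1)])
  have "(x - y + y) ^ CHAR('a) = (x - y) ^ CHAR('a) + y ^ CHAR('a)"
    by (rule freshmans_dream[OF p refl])
  then have "(x - y) ^ CHAR('a) = 0" using assms(2) by simp
  then show ?thesis by simp
qed

text \<open>A double root would be a root of the derivative as well. As \<open>q\<close> is up to a unit the minimal
  polynomial of each of its roots, it would divide its derivative, which has smaller degree.\<close>
lemma separable_of_pderiv:
  fixes q :: "('k::field) poly"
  assumes q: "irreducible q" "pderiv q \<noteq> 0"
  shows "rsquarefree (map_poly to_ac q)"
  unfolding rsquarefree_iff_no_square
proof (intro conjI allI notI)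
  show "map_poly to_ac q = 0 \<Longrightarrow> False" using q(1) by auto
  fix a assume "[:- a, 1:] ^ 2 dvd map_poly to_ac q"
  then obtain u where u: "map_poly to_ac q = [:- a, 1:] ^ 2 * u" by (elim dvdE)
  obtain f :: "'k poly" where f: "irreducible f" "poly (map_poly to_ac f) a = 0"
    "\<And>p. poly (map_poly to_ac p) a = 0 \<Longrightarrow> f dvd p" by (rule irreducible_annihilator) blast
  have "f dvd q" using u by (intro f(3)) simp
  then have "q dvd f" using q(1) f(1) by (metis irreducibleD' irreducible_def)
  moreover have "f dvd pderiv q"
  proof (rule f(3))
    define w where "w = [:- a, 1:]"
    have "map_poly to_ac q = w * (w * u)" "poly w a = 0"
      using u by (simp_all only: w_def power2_eq_square mult.assoc) simp
    then show "poly (map_poly to_ac (pderiv q)) a = 0"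
      by (simp add: map_poly_to_ac_pderiv pderiv_mult)
  qed
  ultimately have "q dvd pderiv q" by (rule dvd_trans)
  then have "Polynomial.degree q \<le> Polynomial.degree (pderiv q)" using q(2) by (rule dvd_imp_degree_le)
  moreover have "Polynomial.degree q \<noteq> 0"
    using q(2) by (metis degree_eq_zeroE pderiv_singleton)
  moreover have "Polynomial.degree (pderiv q) \<le> Polynomial.degree q - 1"
    by (rule degree_le) (auto simp: coeff_pderiv intro: coeff_eq_0)
  ultimately show False by simp
qed

text \<open>A polynomial with vanishing derivative is a polynomial in \<open>X\<^sup>p\<close>, where \<open>p\<close> is the characteristic.\<close>
lemma inseparable_descend:
  fixes q :: "('k::field) poly"
  assumes q: "q \<noteq> 0" "Polynomial.degree q > 0" "pderiv q = 0"
  obtains g :: "'k poly" where "CHAR('k) > 0" "g \<noteq> 0" "Polynomial.degree g < Polynomial.degree q"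
    "\<And>z. poly (map_poly to_ac g) (z ^ CHAR('k)) = poly (map_poly to_ac q) z"
proof -
  let ?c = "CHAR('k)" and ?N = "Polynomial.degree q"
  have dvd: "?c dvd i" if "Polynomial.coeff q i \<noteq> 0" for i
  proof (cases i)
    case (Suc j)
    have "Polynomial.coeff (pderiv q) j = 0" using q(3) by simp
    then have "of_nat (Suc j) = (0 :: 'k)" using that Suc by (simp only: coeff_pderiv mult_eq_0_iff) blast
    then show ?thesis using Suc by (simp only: of_nat_eq_0_iff_char_dvd)
  qed simp
  have N: "?c dvd ?N" using q(1) by (intro dvd) simp
  then have c: "?c > 0" using q(2) by (auto intro: Nat.gr0I)
  have c2: "?c \<ge> 2" using prime_ge_2_nat[OF prime_CHAR_semidom[OF c]] .
  define g where "g = (\<Sum>i\<le>?N. Polynomial.monom (Polynomial.coeff q (?c * i)) i)"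
  have cg: "Polynomial.coeff g i = Polynomial.coeff q (?c * i)" for i
  proof -
    have "Polynomial.coeff q (?c * i) = 0" if "\<not> i \<le> ?N"
      using that c by (intro coeff_eq_0) (metis not_le less_le_trans mult_le_mono1 nat_mult_1 Suc_leI One_nat_def)
    then show ?thesis by (auto simp: g_def Polynomial.coeff_sum)
  qed
  have "Polynomial.coeff g (?N div ?c) \<noteq> 0" using q(1) N by (simp add: cg)
  then have g0: "g \<noteq> 0" by auto
  have "Polynomial.degree g \<le> ?N div ?c"
  proof (rule degree_le, intro allI impI)
    fix i assume "?N div ?c < i"
    then have "?N < ?c * i" using c by (simp add: div_less_iff_less_mult mult.commute)
    then show "Polynomial.coeff g i = 0" by (simp add: cg coeff_eq_0)
  qed
  also have "\<dots> < ?N" using c2 q(2) by (intro div_less_dividend) auto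
  finally have dg: "Polynomial.degree g < ?N" .
  have val: "poly (map_poly to_ac g) (z ^ ?c) = poly (map_poly to_ac q) z" for z
  proof -
    let ?t = "\<lambda>j. to_ac (Polynomial.coeff q j) * z ^ j"
    have al: "poly (map_poly to_ac p) w = (\<Sum>i\<le>n. to_ac (Polynomial.coeff p i) * w ^ i)"
      if "Polynomial.degree p \<le> n" for p :: "'k poly" and n w
    proof -
      have "poly (map_poly to_ac p) w = (\<Sum>i\<le>Polynomial.degree p. to_ac (Polynomial.coeff p i) * w ^ i)"
        by (simp add: poly_altdef coeff_map_poly degree_map_poly)
      also have "\<dots> = (\<Sum>i\<le>n. to_ac (Polynomial.coeff p i) * w ^ i)"
        using that by (intro sum.mono_neutral_left) (auto intro: coeff_eq_0)
      finally show ?thesis .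
    qed
    have "poly (map_poly to_ac g) (z ^ ?c) = (\<Sum>i\<le>?N. ?t (?c * i))"
      using dg by (subst al[of _ ?N]) (auto simp: cg power_mult)
    also have "\<dots> = sum ?t ((\<lambda>i. ?c * i) ` {..?N})"
      using c by (subst sum.reindex) (auto simp: inj_on_def)
    also have "\<dots> = sum ?t {..?c * ?N}"
    proof (intro sum.mono_neutral_left ballI)
      fix j assume "j \<in> {..?c * ?N} - (\<lambda>i. ?c * i) ` {..?N}"
      then have "\<not> ?c dvd j" using c by (auto elim!: dvdE)
      then show "?t j = 0" using dvd by auto
    qed (use c in auto)
    also have "\<dots> = poly (map_poly to_ac q) z"
      using c by (intro al[symmetric]) simp
    finally show ?thesis .
  qed
  show thesis by (rule that[OF c g0 dg val])
qed

text \<open>\<open>K\<close> is purely inseparable over \<open>k\<^sup>s\<close>. If \<open>z\<close> is not separable, its minimal polynomial is a polynomial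
  in \<open>X\<^sup>p\<close>, so \<open>z\<^sup>p\<close> has smaller degree and is fixed by induction; the \<open>p\<close>-th power map is injective.\<close>
lemma Aut_ac_fixes_ksep_imp_id:
  fixes \<tau> :: "('k::field) alg_closure \<Rightarrow> 'k alg_closure"
  assumes \<tau>: "\<tau> \<in> Aut_ac" and fixed: "\<And>x. x \<in> ksep \<Longrightarrow> \<tau> x = x"
  shows "\<tau> z = z"
proof -
  obtain p :: "'k poly" where "p \<noteq> 0" "poly (map_poly to_ac p) z = 0"
    by (rule alg_closure_algebraic)
  then show ?thesis
  proof (induction "Polynomial.degree p" arbitrary: p z rule: less_induct)
    case less
    obtain q :: "'k poly" where q: "irreducible q" "poly (map_poly to_ac q) z = 0" and qp: "q dvd p"
      by (rule irreducible_annihilator[of z]) (use less.prems(2) in blast)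
    show ?case
    proof (cases "pderiv q = 0")
      case False
      then have "z \<in> ksep" using q separable_of_pderiv by (auto simp: ksep_def)
      then show ?thesis by (rule fixed)
    next
      case True
      have "q \<noteq> 0" using q(1) by auto
      moreover have "Polynomial.degree q > 0"
        using q \<open>q \<noteq> 0\<close> by (metis is_unit_iff_degree irreducible_def neq0_conv)
      ultimately obtain g :: "'k poly" where g: "CHAR('k) > 0" "g \<noteq> 0"
         "Polynomial.degree g < Polynomial.degree q"
         "\<And>z. poly (map_poly to_ac g) (z ^ CHAR('k)) = poly (map_poly to_ac q) z"
        using True by (rule inseparable_descend) blast
      have "Polynomial.degree g < Polynomial.degree p"
        using g(3) dvd_imp_degree_le[OF qp less.prems(1)] by simp
      then have "\<tau> (z ^ CHAR('k)) = z ^ CHAR('k)"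
        using g(2) by (rule less.hyps) (simp add: g(4) q(2))
      then show ?thesis
        using CHAR_power_inj[of "\<tau> z" z] g(1) by (simp add: Aut_ac_power[OF \<tau>])
    qed
  qed
qed

lemma Aut_ac_eqI:
  assumes "\<sigma> \<in> Aut_ac" "\<tau> \<in> Aut_ac" "\<And>x. x \<in> ksep \<Longrightarrow> \<sigma> x = \<tau> x"
  shows "\<sigma> = \<tau>"
proof
  fix z
  have "inv_into UNIV \<tau> (\<sigma> x) = x" if "x \<in> ksep" for x
    using assms(3)[OF that] Aut_ac_inv_apply(1)[OF assms(2)] by simp
  then have "inv_into UNIV \<tau> (\<sigma> z) = z"
    by (rule Aut_ac_fixes_ksep_imp_id[where \<tau> = "\<lambda>z. inv_into UNIV \<tau> (\<sigma> z)",
          OF Aut_ac_comp[OF Aut_ac_inv[OF assms(2)] assms(1)]])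
  then show "\<sigma> z = \<tau> z" using Aut_ac_inv_apply(2)[OF assms(2)] by metis
qed

lemma gal_extI:
  assumes "\<tau> \<in> Aut_ac" "\<And>x. x \<in> ksep \<Longrightarrow> \<tau> x = \<gamma> x"
  shows "gal_ext \<gamma> = \<tau>"
  unfolding gal_ext_def
proof (rule the_equality)
  show "\<tau> \<in> Aut_ac \<and> (\<forall>x\<in>ksep. \<tau> x = \<gamma> x)" using assms by blast
  fix \<sigma> assume \<sigma>: "\<sigma> \<in> Aut_ac \<and> (\<forall>x\<in>ksep. \<sigma> x = \<gamma> x)"
  have "\<sigma> x = \<tau> x" if "x \<in> ksep" for x using \<sigma> assms(2)[OF that] that by simp
  with \<sigma> assms(1) show "\<sigma> = \<tau>" by (blast intro: Aut_ac_eqI)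
qed

lemma gal_ext_Aut:
  assumes "\<gamma> \<in> carrier Gal"
  shows "gal_ext \<gamma> \<in> Aut_ac" and "\<And>x. x \<in> ksep \<Longrightarrow> gal_ext \<gamma> x = \<gamma> x"
proof -
  have \<gamma>: "\<And>x y. x \<in> ksep \<Longrightarrow> y \<in> ksep \<Longrightarrow> \<gamma> (x + y) = \<gamma> x + \<gamma> y \<and> \<gamma> (x * y) = \<gamma> x * \<gamma> y"
     "\<And>c. \<gamma> (to_ac c) = to_ac c"
    using assms by (auto simp: Gal_def)
  have "\<gamma> 0 = 0" using \<gamma>(2)[of 0] by simp
  then have "partial_hom {(x, \<gamma> x) | x. x \<in> ksep}"
    unfolding partial_hom_def using \<gamma> ksep_closed by auto
  then obtain \<tau> where "\<tau> \<in> Aut_ac" "\<And>a b. (a, b) \<in> {(x, \<gamma> x) | x. x \<in> ksep} \<Longrightarrow> \<tau> a = b"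
    by (rule partial_hom_extend_Aut) blast
  then have \<tau>: "\<tau> \<in> Aut_ac" "\<And>x. x \<in> ksep \<Longrightarrow> \<tau> x = \<gamma> x" by auto
  have "gal_ext \<gamma> = \<tau>" using \<tau> by (rule gal_extI)
  with \<tau> show "gal_ext \<gamma> \<in> Aut_ac" and "\<And>x. x \<in> ksep \<Longrightarrow> gal_ext \<gamma> x = \<gamma> x" by metis+
qed

text \<open>Together with \<open>gal_ext_Aut\<close> this identifies the automorphisms of \<open>K\<close> over \<open>k\<close> with the elements
  of the Galois group of \<open>k\<^sup>s\<close>.\<close>
lemma restrict_Aut_ac:
  assumes \<tau>: "\<tau> \<in> Aut_ac"
  shows "restrict \<tau> ksep \<in> carrier Gal" and "gal_ext (restrict \<tau> ksep) = \<tau>"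
proof -
  have "bij_betw (restrict \<tau> ksep) ksep ksep"
  proof (rule bij_betw_byWitness[where f' = "inv_into UNIV \<tau>"])
    show "restrict \<tau> ksep ` ksep \<subseteq> ksep" using Aut_ac_ksep[OF \<tau>] by auto
    show "inv_into UNIV \<tau> ` ksep \<subseteq> ksep" using Aut_ac_ksep[OF Aut_ac_inv[OF \<tau>]] by auto
    show "\<forall>a\<in>ksep. inv_into UNIV \<tau> (restrict \<tau> ksep a) = a" using \<tau> by simp
    show "\<forall>a\<in>ksep. restrict \<tau> ksep (inv_into UNIV \<tau> a) = a"
      using \<tau> Aut_ac_ksep[OF Aut_ac_inv[OF \<tau>]] by simp
  qed
  then show "restrict \<tau> ksep \<in> carrier Gal"
    using \<tau> by (auto simp: Gal_def ksep_closed Aut_acD)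
  show "gal_ext (restrict \<tau> ksep) = \<tau>" by (rule gal_extI[OF \<tau>]) simp
qed

lemma inv_Gal_restrict:
  assumes \<tau>: "\<tau> \<in> Aut_ac"
  shows "inv\<^bsub>Gal\<^esub> (restrict \<tau> ksep) = restrict (inv_into UNIV \<tau>) ksep"
proof -
  let ?\<gamma> = "restrict \<tau> ksep" and ?\<delta> = "restrict (inv_into UNIV \<tau>) ksep"
  note \<tau>' = Aut_ac_inv[OF \<tau>]
  have G: "?\<delta> \<in> carrier Gal" by (rule restrict_Aut_ac(1)[OF \<tau>'])
  have "compose ksep ?\<gamma> ?\<delta> = (\<lambda>x\<in>ksep. x)" "compose ksep ?\<delta> ?\<gamma> = (\<lambda>x\<in>ksep. x)"
    unfolding compose_def using Aut_ac_ksep[OF \<tau>] Aut_ac_ksep[OF \<tau>'] Aut_ac_inv_apply[OF \<tau>]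
    by (auto intro!: restrict_ext)
  then have 1: "?\<gamma> \<otimes>\<^bsub>Gal\<^esub> ?\<delta> = \<one>\<^bsub>Gal\<^esub>" "?\<delta> \<otimes>\<^bsub>Gal\<^esub> ?\<gamma> = \<one>\<^bsub>Gal\<^esub>"
    by (simp_all add: Gal_def)
  show ?thesis
    unfolding m_inv_def
  proof (rule the_equality)
    show "?\<delta> \<in> carrier Gal \<and> ?\<gamma> \<otimes>\<^bsub>Gal\<^esub> ?\<delta> = \<one>\<^bsub>Gal\<^esub> \<and> ?\<delta> \<otimes>\<^bsub>Gal\<^esub> ?\<gamma> = \<one>\<^bsub>Gal\<^esub>"
      using G 1 by blast
    fix y assume y: "y \<in> carrier Gal \<and> ?\<gamma> \<otimes>\<^bsub>Gal\<^esub> y = \<one>\<^bsub>Gal\<^esub> \<and> y \<otimes>\<^bsub>Gal\<^esub> ?\<gamma> = \<one>\<^bsub>Gal\<^esub>"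
    show "y = ?\<delta>"
    proof (rule extensionalityI[of _ ksep])
      show "y \<in> extensional ksep" "?\<delta> \<in> extensional ksep" using y by (auto simp: Gal_def)
      fix x :: "'a alg_closure" assume x: "x \<in> ksep"
      have yx: "y x \<in> ksep" using y x by (auto simp: Gal_def bij_betw_def)
      have "compose ksep ?\<gamma> y x = x" using y x by (simp add: Gal_def)
      then have "\<tau> (y x) = x" using x yx by (simp add: compose_def)
      then show "y x = ?\<delta> x" using x Aut_ac_inv_apply(1)[OF \<tau>] by (metis restrict_apply')
    qed
  qed
qed

lemma Gal_restrict_gal_ext:
  assumes "\<gamma> \<in> carrier Gal" shows "restrict (gal_ext \<gamma>) ksep = \<gamma>"
  using assms gal_ext_Aut(2)[OF assms]
  by (intro extensionalityI[of _ ksep]) (auto simp: Gal_def)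

lemma inv_Gal:
  assumes "\<gamma> \<in> carrier Gal"
  shows "inv\<^bsub>Gal\<^esub> \<gamma> \<in> carrier Gal" and "gal_ext (inv\<^bsub>Gal\<^esub> \<gamma>) = inv_into UNIV (gal_ext \<gamma>)"
  using inv_Gal_restrict[OF gal_ext_Aut(1)[OF assms]] restrict_Aut_ac[OF Aut_ac_inv[OF gal_ext_Aut(1)[OF assms]]]
  by (simp_all add: Gal_restrict_gal_ext[OF assms])

section \<open>Rational vectors in Galois-stable subspaces\<close>

text \<open>Galois descent for a space \<open>M\<close> of vectors over \<open>k\<^sup>s\<close> stable under the Galois group: if some linear
  form \<open>v \<mapsto> \<Sum> v i * a i\<close> does not vanish on \<open>M\<close>, it does not vanish on the vectors of \<open>M\<close> with entries
  in \<open>k\<close>. A nonzero vector of minimal support, scaled to have an entry \<open>1\<close>, is invariant and hence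
  rational; subtracting a multiple of it from \<open>v\<close> makes the support of \<open>v\<close> smaller.\<close>
lemma rational_vector:
  fixes M :: "('i \<Rightarrow> ('k::field) alg_closure) set" and a :: "'i \<Rightarrow> 'k alg_closure"
  assumes fin: "finite I"
    and sep: "\<And>v i. v \<in> M \<Longrightarrow> i \<in> I \<Longrightarrow> v i \<in> ksep"
    and lin: "\<And>v w c. v \<in> M \<Longrightarrow> w \<in> M \<Longrightarrow> c \<in> ksep \<Longrightarrow> (\<lambda>i. v i - c * w i) \<in> M"
    and scale: "\<And>v c. v \<in> M \<Longrightarrow> c \<in> ksep \<Longrightarrow> (\<lambda>i. c * v i) \<in> M"
    and gal: "\<And>v \<tau>. v \<in> M \<Longrightarrow> \<tau> \<in> Aut_ac \<Longrightarrow> (\<lambda>i. \<tau> (v i)) \<in> M"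
    and v: "v \<in> M" "(\<Sum>i\<in>I. v i * a i) \<noteq> 0"
  shows "\<exists>w\<in>M. (\<forall>i\<in>I. w i \<in> range to_ac) \<and> (\<Sum>i\<in>I. w i * a i) \<noteq> 0"
proof -
  define supp where "supp v = {i \<in> I. v i \<noteq> 0}" for v :: "'i \<Rightarrow> 'k alg_closure"
  have fs: "finite (supp v)" for v using fin by (simp add: supp_def)
  from v show ?thesis
  proof (induction "card (supp v)" arbitrary: v rule: less_induct)
    case less
    define Q where "Q u \<longleftrightarrow> u \<in> M \<and> supp u \<noteq> {} \<and> supp u \<subseteq> supp v" for u
    have "supp v \<noteq> {}"
    proof
      assume "supp v = {}"
      then have "\<forall>i\<in>I. v i = 0" by (auto simp: supp_def)
      then show False using less.prems(2) by simp
    qed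
    then have "Q v" using less.prems(1) by (simp add: Q_def)
    then obtain u where u: "Q u" and min: "\<And>w. Q w \<Longrightarrow> card (supp u) \<le> card (supp w)"
      using ex_has_least_nat[of Q v "\<lambda>w. card (supp w)"] by blast
    obtain j where j: "j \<in> supp u" using u by (auto simp: Q_def)
    then have jI: "j \<in> I" "u j \<noteq> 0" by (auto simp: supp_def)
    define w where "w = (\<lambda>i. inverse (u j) * u i)"
    have wM: "w \<in> M" unfolding w_def using u sep jI(1) by (intro scale ksep_closed) (auto simp: Q_def)
    have sw: "supp w = supp u" using jI(2) by (auto simp: supp_def w_def)
    have wj: "w j = 1" using jI(2) by (simp add: w_def)
    have rat: "w i \<in> range to_ac" if i: "i \<in> I" for i
    proof (rule ksep_fixed)
      show "w i \<in> ksep" using sep wM i by blast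
      fix \<tau> :: "'k alg_closure \<Rightarrow> 'k alg_closure" assume \<tau>: "\<tau> \<in> Aut_ac"
      \<comment> \<open>The support of \<open>d\<close> misses \<open>j\<close>, so \<open>d\<close> vanishes by minimality of \<open>u\<close>.\<close>
      define d where "d = (\<lambda>i. \<tau> (w i) - 1 * w i)"
      have dM: "d \<in> M" unfolding d_def by (rule lin[OF gal[OF wM \<tau>] wM ksep_closed(7)])
      have "d j = 0" using wj \<tau> by (simp add: d_def)
      moreover have "d i = 0" if "u i = 0" for i using that \<tau> by (simp add: d_def w_def)
      ultimately have "supp d \<subseteq> supp u - {j}" unfolding supp_def by blast
      then have "supp d \<subset> supp u" using j by blast
      then have "card (supp d) < card (supp u)" by (rule psubset_card_mono[OF fs])
      moreover have "supp d \<subseteq> supp v" using \<open>supp d \<subset> supp u\<close> u by (auto simp: Q_def)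
      ultimately have "supp d = {}" using min[of d] dM unfolding Q_def by linarith
      then have "d i = 0" using i by (auto simp: supp_def)
      then show "\<tau> (w i) = w i" by (simp add: d_def)
    qed
    show ?case
    proof (cases "(\<Sum>i\<in>I. w i * a i) = 0")
      case False
      then show ?thesis using wM rat by blast
    next
      case True
      \<comment> \<open>Here \<open>w\<close> is rational but orthogonal to \<open>a\<close>, so it may be used to reduce the support of \<open>v\<close>.\<close>
      define v' where "v' = (\<lambda>i. v i - v j * w i)"
      have "v' \<in> M" unfolding v'_def by (rule lin[OF less.prems(1) wM sep[OF less.prems(1) jI(1)]])
      moreover have "(\<Sum>i\<in>I. v' i * a i) = (\<Sum>i\<in>I. v i * a i) - v j * (\<Sum>i\<in>I. w i * a i)"
        by (simp add: v'_def sum_distrib_left sum_subtractf algebra_simps)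
      moreover have "supp v' \<subset> supp v"
      proof -
        have "v' j = 0" by (simp add: v'_def wj)
        moreover have "v' i = 0" if "i \<in> I" "v i = 0" for i
        proof -
          have "i \<notin> supp u" using u that by (auto simp: Q_def supp_def)
          then show ?thesis using that by (simp add: v'_def w_def supp_def)
        qed
        then have "supp v' \<subseteq> supp v" unfolding supp_def by blast
        moreover have "j \<in> supp v" using j u by (auto simp: Q_def)
        ultimately show ?thesis unfolding supp_def by blast
      qed
      then have "card (supp v') < card (supp v)" by (rule psubset_card_mono[OF fs])
      ultimately show ?thesis using True less.prems(2) less.hyps[of v'] by simp
    qed
  qed
qed

section \<open>Spaces with a ring of regular functions\<close>

abbreviation preimg :: "('k::field, 'p) kspace \<Rightarrow> ('p \<Rightarrow> 'q) \<Rightarrow> 'q set \<Rightarrow> 'p set" where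
  "preimg X \<phi> U \<equiv> {x \<in> points X. \<phi> x \<in> U}"

lemma sheaf_iff:
  assumes "is_sheaf X"
  shows "f \<in> regf X U \<longleftrightarrow> openin (ztop X) U \<and> (\<forall>x\<in>U. \<exists>V g. x \<in> V \<and> openin (ztop X) V
      \<and> g \<in> regf X V \<and> (\<forall>y\<in>U \<inter> V. f y = g y))"
  using assms unfolding is_sheaf_def by (elim allE)

lemma sheaf_local:
  assumes "is_sheaf X" "openin (ztop X) U"
    and "\<And>x. x \<in> U \<Longrightarrow>
      \<exists>V g. x \<in> V \<and> openin (ztop X) V \<and> g \<in> regf X V \<and> (\<forall>y\<in>U \<inter> V. f y = g y)"
  shows "f \<in> regf X U"
  by (rule iffD2[OF sheaf_iff[OF assms(1)]]) (intro conjI ballI assms(2,3))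

lemma sheaf_open: "is_sheaf X \<Longrightarrow> f \<in> regf X U \<Longrightarrow> openin (ztop X) U"
  using sheaf_iff by (rule iffD1[THEN conjunct1])

lemma sheaf_glue:
  assumes X: "is_sheaf X" and U: "openin (ztop X) U"
    and loc: "\<And>x. x \<in> U \<Longrightarrow> \<exists>V. x \<in> V \<and> f \<in> regf X V"
  shows "f \<in> regf X U"
proof (rule sheaf_local[OF X U])
  fix x assume x: "x \<in> U"
  from loc[OF x] obtain V where V: "x \<in> V" "f \<in> regf X V" by (elim exE conjE)
  moreover have "openin (ztop X) V" by (rule sheaf_open[OF X V(2)])
  moreover have "\<forall>y\<in>U \<inter> V. f y = f y" by simp
  ultimately show "\<exists>V g. x \<in> V \<and> openin (ztop X) V \<and> g \<in> regf X V \<and> (\<forall>y\<in>U \<inter> V. f y = g y)"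
    by (intro exI conjI)
qed

lemma sheaf_restrict:
  assumes X: "is_sheaf X" and f: "f \<in> regf X U" and V: "openin (ztop X) V" "V \<subseteq> U"
    and eq: "\<And>x. x \<in> V \<Longrightarrow> f x = g x"
  shows "g \<in> regf X V"
proof (rule sheaf_local[OF X V(1)])
  fix x assume x: "x \<in> V"
  then have "x \<in> U" using V(2) by blast
  moreover have "\<forall>y\<in>V \<inter> U. g y = f y" using eq by simp
  ultimately show "\<exists>W h. x \<in> W \<and> openin (ztop X) W \<and> h \<in> regf X W \<and> (\<forall>y\<in>V \<inter> W. g y = h y)"
    using f sheaf_open[OF X f] by blast
qed

lemma sheaf_cong:
  assumes "is_sheaf X" "f \<in> regf X U" "\<And>x. x \<in> U \<Longrightarrow> f x = g x"
  shows "g \<in> regf X U"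
  by (rule sheaf_restrict[OF assms(1,2) sheaf_open[OF assms(1,2)] subset_refl assms(3)])

text \<open>The properties of regular functions that the descent argument needs: they form sheaves of
  \<open>k\<close>-algebras, nonvanishing loci are open, and nonvanishing functions are invertible. Varieties,
  their products and their base changes all have them.\<close>
definition ring_space :: "('k::field, 'p) kspace \<Rightarrow> bool" where
  "ring_space X \<longleftrightarrow> is_sheaf X
     \<and> (\<forall>U c. openin (ztop X) U \<longrightarrow> (\<lambda>_. to_ac c) \<in> regf X U)
     \<and> (\<forall>U. \<forall>f\<in>regf X U. \<forall>g\<in>regf X U. (\<lambda>x. f x + g x) \<in> regf X U \<and> (\<lambda>x. f x * g x) \<in> regf X U)
     \<and> (\<forall>U. \<forall>f\<in>regf X U. openin (ztop X) {x \<in> U. f x \<noteq> 0})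
     \<and> (\<forall>U. \<forall>f\<in>regf X U. (\<forall>x\<in>U. f x \<noteq> 0) \<longrightarrow> (\<lambda>x. inverse (f x)) \<in> regf X U)"

lemma ring_spaceD:
  assumes "ring_space X"
  shows "is_sheaf X"
    and "openin (ztop X) U \<Longrightarrow> (\<lambda>_. to_ac c) \<in> regf X U"
    and "f \<in> regf X U \<Longrightarrow> g \<in> regf X U \<Longrightarrow> (\<lambda>x. f x + g x) \<in> regf X U"
    and "f \<in> regf X U \<Longrightarrow> g \<in> regf X U \<Longrightarrow> (\<lambda>x. f x * g x) \<in> regf X U"
    and "f \<in> regf X U \<Longrightarrow> openin (ztop X) {x \<in> U. f x \<noteq> 0}"
    and "f \<in> regf X U \<Longrightarrow> (\<And>x. x \<in> U \<Longrightarrow> f x \<noteq> 0) \<Longrightarrow> (\<lambda>x. inverse (f x)) \<in> regf X U"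
  using assms by (auto simp: ring_space_def)

lemma ring_space_one: "ring_space X \<Longrightarrow> openin (ztop X) U \<Longrightarrow> (\<lambda>_. 1) \<in> regf X U"
  using ring_spaceD(2)[of X U 1] by simp

lemma ring_space_divide:
  assumes "ring_space X" "f \<in> regf X U" "g \<in> regf X U" "\<And>x. x \<in> U \<Longrightarrow> g x \<noteq> 0"
  shows "(\<lambda>x. f x / g x) \<in> regf X U"
  using ring_spaceD(4)[OF assms(1,2) ring_spaceD(6)[OF assms(1,3,4)]]
  by (simp add: field_class.field_divide_inverse)

lemma ring_space_prod:
  assumes "ring_space X" "openin (ztop X) U" "\<And>i. i \<in> A \<Longrightarrow> f i \<in> regf X U"
  shows "(\<lambda>x. \<Prod>i\<in>A. f i x) \<in> regf X U"
  using assms(3) ring_spaceD(2)[OF assms(1,2), of 1]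
  by (induction A rule: infinite_finite_induct) (auto intro: ring_spaceD(4)[OF assms(1)])

section \<open>Spaces generated by functions\<close>

text \<open>The closure properties that make the space generated by a family of functions a \<^const>\<open>ring_space\<close>.
  Affine models, products and base changes are all generated by families of this kind.\<close>
definition gen_family :: "('p set \<times> ('p \<Rightarrow> ('k::field) alg_closure)) set \<Rightarrow> bool" where
  "gen_family P \<longleftrightarrow>
     (\<forall>U f V g. (U, f) \<in> P \<longrightarrow> (V, g) \<in> P \<longrightarrow>
        (U \<inter> V, \<lambda>x. f x + g x) \<in> P \<and> (U \<inter> V, \<lambda>x. f x * g x) \<in> P)
     \<and> (\<forall>U f c. (U, f) \<in> P \<longrightarrow> (U, \<lambda>_. to_ac c) \<in> P)"

lemma gen_familyD:
  assumes "gen_family P"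
  shows "(U, f) \<in> P \<Longrightarrow> (V, g) \<in> P \<Longrightarrow> (U \<inter> V, \<lambda>x. f x + g x) \<in> P"
    and "(U, f) \<in> P \<Longrightarrow> (V, g) \<in> P \<Longrightarrow> (U \<inter> V, \<lambda>x. f x * g x) \<in> P"
    and "(U, f) \<in> P \<Longrightarrow> (U, \<lambda>_. to_ac c) \<in> P"
    and "(U, f) \<in> P \<Longrightarrow> (U, g) \<in> P \<Longrightarrow> (U, \<lambda>x. f x * g x) \<in> P"
  using assms by (auto simp: gen_family_def) (metis Int_absorb)

lemma openin_gen_space:
  "openin (ztop (gen_space P)) W \<longleftrightarrow> generate_topology_on {{x \<in> U. f x \<noteq> 0} | U f. (U, f) \<in> P} W"
  by (simp add: gen_space_def openin_topology_generated_by_iff)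

lemma openin_gen_spaceI: "(U, f) \<in> P \<Longrightarrow> openin (ztop (gen_space P)) {x \<in> U. f x \<noteq> 0}"
  unfolding openin_gen_space by (rule generate_topology_on.Basis) blast

lemma regf_gen_space:
  "h \<in> regf (gen_space P) W \<longleftrightarrow> openin (ztop (gen_space P)) W \<and>
     (\<forall>x\<in>W. \<exists>U f g. (U, f) \<in> P \<and> (U, g) \<in> P \<and> x \<in> U \<and> g x \<noteq> 0
        \<and> (\<forall>y\<in>W. y \<in> U \<and> g y \<noteq> 0 \<longrightarrow> h y = f y / g y))"
  by (simp add: gen_space_def Let_def)

lemma regf_gen_space_open: "h \<in> regf (gen_space P) W \<Longrightarrow> openin (ztop (gen_space P)) W"
  unfolding regf_gen_space by (rule conjunct1)

lemma regf_gen_spaceE: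
  assumes "h \<in> regf (gen_space P) W" "x \<in> W"
  obtains U f g where "(U, f) \<in> P" "(U, g) \<in> P" "x \<in> U" "g x \<noteq> 0"
    "\<forall>y\<in>W. y \<in> U \<and> g y \<noteq> 0 \<longrightarrow> h y = f y / g y"
proof -
  from assms(1) have "\<forall>x\<in>W. \<exists>U f g. (U, f) \<in> P \<and> (U, g) \<in> P \<and> x \<in> U \<and> g x \<noteq> 0
        \<and> (\<forall>y\<in>W. y \<in> U \<and> g y \<noteq> 0 \<longrightarrow> h y = f y / g y)"
    unfolding regf_gen_space by (rule conjunct2)
  from bspec[OF this assms(2)] show thesis using that by (elim exE conjE)
qed

text \<open>The nonvanishing loci of the generators form a basis, not only a subbasis, of the generated topology,
  because the family is closed under products.\<close>
lemma gen_space_basis: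
  assumes P: "gen_family P" and W: "openin (ztop (gen_space P)) W" and x: "x \<in> W"
  shows "\<exists>U f. (U, f) \<in> P \<and> x \<in> U \<and> f x \<noteq> 0 \<and> {y \<in> U. f y \<noteq> 0} \<subseteq> W"
  using W[unfolded openin_gen_space] x
proof (induction arbitrary: x rule: generate_topology_on.induct)
  case (Int a b)
  then obtain U f V g where *: "(U, f) \<in> P" "x \<in> U" "f x \<noteq> 0" "{y \<in> U. f y \<noteq> 0} \<subseteq> a"
    "(V, g) \<in> P" "x \<in> V" "g x \<noteq> 0" "{y \<in> V. g y \<noteq> 0} \<subseteq> b" by (meson IntD1 IntD2)
  show ?case
    by (rule exI[of _ "U \<inter> V"], rule exI[of _ "\<lambda>x. f x * g x"])
       (use * gen_familyD(2)[OF P] in auto)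
next
  case (UN K)
  then obtain k where "k \<in> K" "x \<in> k" by blast
  from UN.IH[OF this] show ?case using \<open>k \<in> K\<close> by blast
next
  case (Basis s)
  then show ?case by blast
qed simp

lemma gen_space_points:
  assumes P: "gen_family P"
  shows "points (gen_space P) = \<Union>(fst ` P)"
proof (intro subset_antisym subsetI)
  fix x assume "x \<in> points (gen_space P)"
  then show "x \<in> \<Union>(fst ` P)" using gen_space_basis[OF P openin_topspace] by fastforce
next
  fix x assume "x \<in> \<Union>(fst ` P)"
  then obtain U f where "(U, f) \<in> P" "x \<in> U" by auto
  then have "openin (ztop (gen_space P)) {x \<in> U. (to_ac 1 :: 'b alg_closure) \<noteq> 0}"
    by (intro openin_gen_spaceI[where f = "\<lambda>_. to_ac 1"] gen_familyD(3)[OF P])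
  then show "x \<in> points (gen_space P)" using \<open>x \<in> U\<close> openin_subset by fastforce
qed

lemma gen_space_member:
  assumes P: "gen_family P" and f: "(U, f) \<in> P"
  shows "openin (ztop (gen_space P)) U" and "f \<in> regf (gen_space P) U"
proof -
  have 1: "(U, \<lambda>_. to_ac 1) \<in> P" by (rule gen_familyD(3)[OF P f])
  then show U: "openin (ztop (gen_space P)) U" using openin_gen_spaceI[OF 1] by simp
  show "f \<in> regf (gen_space P) U"
    unfolding regf_gen_space
    by (intro conjI U ballI, rule exI[of _ U], rule exI[of _ f], rule exI[of _ "\<lambda>_. to_ac 1"]) (use f 1 in auto)
qed

text \<open>Being locally a quotient of generators is a local condition.\<close>
lemma gen_space_is_sheaf:
  assumes P: "gen_family P" shows "is_sheaf (gen_space P)"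
  unfolding is_sheaf_def
proof (intro allI iffI)
  fix U f assume f: "f \<in> regf (gen_space P) U"
  then have "openin (ztop (gen_space P)) U" by (rule regf_gen_space_open)
  then show "openin (ztop (gen_space P)) U \<and> (\<forall>x\<in>U. \<exists>V g. x \<in> V \<and> openin (ztop (gen_space P)) V
      \<and> g \<in> regf (gen_space P) V \<and> (\<forall>y\<in>U \<inter> V. f y = g y))"
    using f by (intro conjI ballI; (rule exI[of _ U], rule exI[of _ f])?) auto
next
  fix U f assume *: "openin (ztop (gen_space P)) U \<and> (\<forall>x\<in>U. \<exists>V g. x \<in> V \<and> openin (ztop (gen_space P)) V
      \<and> g \<in> regf (gen_space P) V \<and> (\<forall>y\<in>U \<inter> V. f y = g y))"
  show "f \<in> regf (gen_space P) U"
    unfolding regf_gen_space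
  proof (intro conjI ballI)
    show "openin (ztop (gen_space P)) U" using * by blast
    fix x assume x: "x \<in> U"
    then obtain V g where V: "x \<in> V" "openin (ztop (gen_space P)) V" "g \<in> regf (gen_space P) V"
      "\<forall>y\<in>U \<inter> V. f y = g y" using * by blast
    obtain U1 a b where ab: "(U1, a) \<in> P" "(U1, b) \<in> P" "x \<in> U1" "b x \<noteq> 0"
      "\<forall>y\<in>V. y \<in> U1 \<and> b y \<noteq> 0 \<longrightarrow> g y = a y / b y"
      by (rule regf_gen_spaceE[OF V(3,1)])
    obtain U2 e where e: "(U2, e) \<in> P" "x \<in> U2" "e x \<noteq> 0" "{y \<in> U2. e y \<noteq> 0} \<subseteq> V"
      using gen_space_basis[OF P V(2,1)] by blast
    show "\<exists>U' f' g'. (U', f') \<in> P \<and> (U', g') \<in> P \<and> x \<in> U' \<and> g' x \<noteq> 0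
        \<and> (\<forall>y\<in>U. y \<in> U' \<and> g' y \<noteq> 0 \<longrightarrow> f y = f' y / g' y)"
    proof (intro exI conjI ballI impI)
      show "(U1 \<inter> U2, \<lambda>x. a x * e x) \<in> P" "(U1 \<inter> U2, \<lambda>x. b x * e x) \<in> P"
        using gen_familyD(2)[OF P] ab e by blast+
      show "x \<in> U1 \<inter> U2" "b x * e x \<noteq> 0" using ab e by auto
      fix y assume y: "y \<in> U" "y \<in> U1 \<inter> U2 \<and> b y * e y \<noteq> 0"
      then have "y \<in> V" using e(4) by auto
      then show "f y = a y * e y / (b y * e y)" using y ab(5) V(4) by auto
    qed
  qed
qed

text \<open>Sums, products and inverses of local fractions are again local fractions, once the fractions
  are restricted to a common domain.\<close>
lemma gen_space_ring_space:
  assumes P: "gen_family P" shows "ring_space (gen_space P)"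
  unfolding ring_space_def
proof (intro conjI allI impI ballI)
  show "is_sheaf (gen_space P)" by (rule gen_space_is_sheaf[OF P])
next
  fix U c assume U: "openin (ztop (gen_space P)) U"
  show "(\<lambda>_. to_ac c) \<in> regf (gen_space P) U"
  proof (rule sheaf_glue[OF gen_space_is_sheaf[OF P] U])
    fix x assume "x \<in> U"
    then obtain V f where "(V, f) \<in> P" "x \<in> V" using gen_space_basis[OF P U] by blast
    then show "\<exists>V. x \<in> V \<and> (\<lambda>_. to_ac c) \<in> regf (gen_space P) V"
      using gen_space_member(2)[OF P] gen_familyD(3)[OF P] by blast
  qed
next
  fix U h h' assume h: "h \<in> regf (gen_space P) U" and h': "h' \<in> regf (gen_space P) U"
  have U: "openin (ztop (gen_space P)) U" by (rule regf_gen_space_open[OF h])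
  have *: "\<exists>V a b a' b'. (V, a) \<in> P \<and> (V, b) \<in> P \<and> (V, a') \<in> P \<and> (V, b') \<in> P \<and> x \<in> V \<and> b x \<noteq> 0 \<and> b' x \<noteq> 0
     \<and> (\<forall>y\<in>U. y \<in> V \<and> b y \<noteq> 0 \<and> b' y \<noteq> 0 \<longrightarrow> h y = a y / b y \<and> h' y = a' y / b' y)" if x: "x \<in> U" for x
  proof -
    obtain V a b where 1: "(V, a) \<in> P" "(V, b) \<in> P" "x \<in> V" "b x \<noteq> 0"
      "\<forall>y\<in>U. y \<in> V \<and> b y \<noteq> 0 \<longrightarrow> h y = a y / b y"
      by (rule regf_gen_spaceE[OF h x])
    obtain V' a' b' where 2: "(V', a') \<in> P" "(V', b') \<in> P" "x \<in> V'" "b' x \<noteq> 0"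
      "\<forall>y\<in>U. y \<in> V' \<and> b' y \<noteq> 0 \<longrightarrow> h' y = a' y / b' y"
      by (rule regf_gen_spaceE[OF h' x])
    have "(V \<inter> V', f) \<in> P" if "(V, f) \<in> P" for f
      using gen_familyD(2)[OF P that gen_familyD(3)[OF P 2(1), of 1]] by simp
    moreover have "(V \<inter> V', f) \<in> P" if "(V', f) \<in> P" for f
      using gen_familyD(2)[OF P gen_familyD(3)[OF P 1(1), of 1] that] by simp
    ultimately have "(V \<inter> V', a) \<in> P \<and> (V \<inter> V', b) \<in> P \<and> (V \<inter> V', a') \<in> P \<and> (V \<inter> V', b') \<in> P
      \<and> x \<in> V \<inter> V' \<and> b x \<noteq> 0 \<and> b' x \<noteq> 0
      \<and> (\<forall>y\<in>U. y \<in> V \<inter> V' \<and> b y \<noteq> 0 \<and> b' y \<noteq> 0 \<longrightarrow> h y = a y / b y \<and> h' y = a' y / b' y)"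
      using 1 2 by simp
    then show ?thesis by (intro exI)
  qed
  show "(\<lambda>x. h x + h' x) \<in> regf (gen_space P) U"
    unfolding regf_gen_space
  proof (intro conjI U ballI)
    fix x assume "x \<in> U"
    from *[OF this] obtain V a b a' b' where V: "(V, a) \<in> P" "(V, b) \<in> P" "(V, a') \<in> P" "(V, b') \<in> P"
      "x \<in> V" "b x \<noteq> 0" "b' x \<noteq> 0"
      "\<forall>y\<in>U. y \<in> V \<and> b y \<noteq> 0 \<and> b' y \<noteq> 0 \<longrightarrow> h y = a y / b y \<and> h' y = a' y / b' y" by blast
    have "(V \<inter> V, \<lambda>x. a x * b' x + a' x * b x) \<in> P"
      by (intro gen_familyD(1)[OF P] gen_familyD(4)[OF P] V)
    then have num: "(V, \<lambda>x. a x * b' x + a' x * b x) \<in> P" by simp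
    show "\<exists>V f g. (V, f) \<in> P \<and> (V, g) \<in> P \<and> x \<in> V \<and> g x \<noteq> 0
        \<and> (\<forall>y\<in>U. y \<in> V \<and> g y \<noteq> 0 \<longrightarrow> h y + h' y = f y / g y)"
      by (rule exI[of _ V], rule exI[of _ "\<lambda>x. a x * b' x + a' x * b x"], rule exI[of _ "\<lambda>x. b x * b' x"])
         (use V gen_familyD(4)[OF P V(2,4)] num in \<open>simp add: add_frac_eq\<close>)
  qed
  show "(\<lambda>x. h x * h' x) \<in> regf (gen_space P) U"
    unfolding regf_gen_space
  proof (intro conjI U ballI)
    fix x assume "x \<in> U"
    from *[OF this] obtain V a b a' b' where V: "(V, a) \<in> P" "(V, b) \<in> P" "(V, a') \<in> P" "(V, b') \<in> P"
      "x \<in> V" "b x \<noteq> 0" "b' x \<noteq> 0"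
      "\<forall>y\<in>U. y \<in> V \<and> b y \<noteq> 0 \<and> b' y \<noteq> 0 \<longrightarrow> h y = a y / b y \<and> h' y = a' y / b' y" by blast
    show "\<exists>V f g. (V, f) \<in> P \<and> (V, g) \<in> P \<and> x \<in> V \<and> g x \<noteq> 0
        \<and> (\<forall>y\<in>U. y \<in> V \<and> g y \<noteq> 0 \<longrightarrow> h y * h' y = f y / g y)"
      by (rule exI[of _ V], rule exI[of _ "\<lambda>x. a x * a' x"], rule exI[of _ "\<lambda>x. b x * b' x"])
         (use V gen_familyD(4)[OF P V(2,4)] gen_familyD(4)[OF P V(1,3)] in simp)
  qed
next
  fix U h assume h: "h \<in> regf (gen_space P) U"
  have U: "openin (ztop (gen_space P)) U" by (rule regf_gen_space_open[OF h])
  have loc: "\<exists>V a b. (V, a) \<in> P \<and> (V, b) \<in> P \<and> x \<in> V \<and> b x \<noteq> 0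
     \<and> (\<forall>y\<in>U. y \<in> V \<and> b y \<noteq> 0 \<longrightarrow> h y = a y / b y)" if "x \<in> U" for x
    using regf_gen_spaceE[OF h that] by metis
  show "openin (ztop (gen_space P)) {x \<in> U. h x \<noteq> 0}"
  proof (subst openin_subopen, clarify)
    fix x assume x: "x \<in> U" "h x \<noteq> 0"
    obtain V a b where V: "(V, a) \<in> P" "(V, b) \<in> P" "x \<in> V" "b x \<noteq> 0"
      "\<forall>y\<in>U. y \<in> V \<and> b y \<noteq> 0 \<longrightarrow> h y = a y / b y" using loc[OF x(1)] by blast
    have "openin (ztop (gen_space P)) (U \<inter> {y \<in> V. a y * b y \<noteq> 0})"
      by (intro openin_Int U openin_gen_spaceI gen_familyD(4)[OF P] V)
    moreover have "x \<in> U \<inter> {y \<in> V. a y * b y \<noteq> 0}" using V x by auto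
    moreover have "U \<inter> {y \<in> V. a y * b y \<noteq> 0} \<subseteq> {x \<in> U. h x \<noteq> 0}" using V by auto
    ultimately show "\<exists>T. openin (ztop (gen_space P)) T \<and> x \<in> T \<and> T \<subseteq> {x \<in> U. h x \<noteq> 0}" by blast
  qed
  assume nz: "\<forall>x\<in>U. h x \<noteq> 0"
  show "(\<lambda>x. inverse (h x)) \<in> regf (gen_space P) U"
    unfolding regf_gen_space
  proof (intro conjI U ballI)
    fix x assume x: "x \<in> U"
    obtain V a b where V: "(V, a) \<in> P" "(V, b) \<in> P" "x \<in> V" "b x \<noteq> 0"
      "\<forall>y\<in>U. y \<in> V \<and> b y \<noteq> 0 \<longrightarrow> h y = a y / b y" using loc[OF x(1)] by blast
    have ax: "a x \<noteq> 0" using V x nz by auto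
    show "\<exists>V f g. (V, f) \<in> P \<and> (V, g) \<in> P \<and> x \<in> V \<and> g x \<noteq> 0
        \<and> (\<forall>y\<in>U. y \<in> V \<and> g y \<noteq> 0 \<longrightarrow> inverse (h y) = f y / g y)"
      by (rule exI[of _ V], rule exI[of _ "\<lambda>x. b x * b x"], rule exI[of _ "\<lambda>x. a x * b x"])
         (use V ax gen_familyD(4)[OF P V(1,2)] gen_familyD(4)[OF P V(2,2)] in \<open>simp add: inverse_eq_divide\<close>)
  qed
qed

section \<open>Morphisms, transport and locality\<close>

lemma kmorphismD:
  assumes "kmorphism X Y \<phi>"
  shows "x \<in> points X \<Longrightarrow> \<phi> x \<in> points Y"
    and "openin (ztop Y) U \<Longrightarrow> openin (ztop X) (preimg X \<phi> U)"
    and "f \<in> regf Y U \<Longrightarrow> (\<lambda>x. f (\<phi> x)) \<in> regf X (preimg X \<phi> U)"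
  using assms by (auto simp: kmorphism_def continuous_map_def o_def)

lemma kmorphismI:
  assumes "\<And>x. x \<in> points X \<Longrightarrow> \<phi> x \<in> points Y"
    and "\<And>U. openin (ztop Y) U \<Longrightarrow> openin (ztop X) (preimg X \<phi> U)"
    and "\<And>U f. f \<in> regf Y U \<Longrightarrow> (\<lambda>x. f (\<phi> x)) \<in> regf X (preimg X \<phi> U)"
  shows "kmorphism X Y \<phi>"
  using assms by (auto simp: kmorphism_def continuous_map_def o_def)

lemma kmorphism_comp:
  assumes "kmorphism X Y \<phi>" "kmorphism Y Z \<psi>"
  shows "kmorphism X Z (\<lambda>x. \<psi> (\<phi> x))"
proof (rule kmorphismI)
  have eq: "preimg X \<phi> (preimg Y \<psi> U) = preimg X (\<lambda>x. \<psi> (\<phi> x)) U" for U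
    using kmorphismD(1)[OF assms(1)] by auto
  show "openin (ztop X) (preimg X (\<lambda>x. \<psi> (\<phi> x)) U)" if "openin (ztop Z) U" for U
    using kmorphismD(2)[OF assms(1) kmorphismD(2)[OF assms(2) that]] eq by simp
  show "(\<lambda>x. f (\<psi> (\<phi> x))) \<in> regf X (preimg X (\<lambda>x. \<psi> (\<phi> x)) U)" if "f \<in> regf Z U" for f U
    using kmorphismD(3)[OF assms(1) kmorphismD(3)[OF assms(2) that]] eq by simp
qed (blast intro: kmorphismD(1)[OF assms(1)] kmorphismD(1)[OF assms(2)])

lemma kmorphism_cong:
  assumes X: "is_sheaf X" and \<phi>: "kmorphism X Y \<phi>" and eq: "\<And>x. x \<in> points X \<Longrightarrow> \<phi> x = \<psi> x"
  shows "kmorphism X Y \<psi>"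
proof (rule kmorphismI)
  have pre: "preimg X \<phi> U = preimg X \<psi> U" for U using eq by auto
  show "\<psi> x \<in> points Y" if "x \<in> points X" for x using kmorphismD(1)[OF \<phi> that] eq that by simp
  show "openin (ztop X) (preimg X \<psi> U)" if "openin (ztop Y) U" for U
    using kmorphismD(2)[OF \<phi> that] pre by simp
  show "(\<lambda>x. f (\<psi> x)) \<in> regf X (preimg X \<psi> U)" if "f \<in> regf Y U" for f U
    using kmorphismD(3)[OF \<phi> that] eq pre by (auto elim: sheaf_cong[OF X])
qed

text \<open>A map into a generated space is a morphism as soon as the generators pull back to regular functions:
  opens and regular functions of the target are built locally from quotients of generators.\<close>
lemma kmorphism_gen_space:
  assumes X: "ring_space X" and P: "gen_family P"
    and pts: "\<And>x. x \<in> points X \<Longrightarrow> \<phi> x \<in> points (gen_space P)"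
    and reg: "\<And>U f. (U, f) \<in> P \<Longrightarrow> (\<lambda>x. f (\<phi> x)) \<in> regf X (preimg X \<phi> U)"
  shows "kmorphism X (gen_space P) \<phi>"
proof (rule kmorphismI)
  show open': "openin (ztop X) (preimg X \<phi> W)" if W: "openin (ztop (gen_space P)) W" for W
  proof (subst openin_subopen, clarify)
    fix x assume x: "x \<in> points X" "\<phi> x \<in> W"
    obtain U f where U: "(U, f) \<in> P" "\<phi> x \<in> U" "f (\<phi> x) \<noteq> 0" "{y \<in> U. f y \<noteq> 0} \<subseteq> W"
      using gen_space_basis[OF P W x(2)] by blast
    have "openin (ztop X) {y \<in> preimg X \<phi> U. f (\<phi> y) \<noteq> 0}"
      by (intro ring_spaceD(5)[OF X] reg U)
    moreover have "x \<in> {y \<in> preimg X \<phi> U. f (\<phi> y) \<noteq> 0}" using U x by simp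
    moreover have "{y \<in> preimg X \<phi> U. f (\<phi> y) \<noteq> 0} \<subseteq> preimg X \<phi> W" using U by auto
    ultimately show "\<exists>T. openin (ztop X) T \<and> x \<in> T \<and> T \<subseteq> preimg X \<phi> W" by blast
  qed
  fix W h assume h: "h \<in> regf (gen_space P) W"
  have W: "openin (ztop (gen_space P)) W" by (rule regf_gen_space_open[OF h])
  show "(\<lambda>x. h (\<phi> x)) \<in> regf X (preimg X \<phi> W)"
  proof (rule sheaf_glue[OF ring_spaceD(1)[OF X] open'[OF W]], clarify)
    fix x assume x: "x \<in> points X" "\<phi> x \<in> W"
    obtain U f g where U: "(U, f) \<in> P" "(U, g) \<in> P" "\<phi> x \<in> U" "g (\<phi> x) \<noteq> 0"
        "\<forall>y\<in>W. y \<in> U \<and> g y \<noteq> 0 \<longrightarrow> h y = f y / g y"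
      by (rule regf_gen_spaceE[OF h x(2)])
    define N where "N = preimg X \<phi> W \<inter> {y \<in> preimg X \<phi> U. g (\<phi> y) \<noteq> 0}"
    have N: "openin (ztop X) N"
      unfolding N_def by (intro openin_Int open' W ring_spaceD(5)[OF X] reg U)
    have NU: "N \<subseteq> preimg X \<phi> U" by (auto simp: N_def)
    have "(\<lambda>y. f (\<phi> y) / g (\<phi> y)) \<in> regf X N"
      by (rule ring_space_divide[OF X];
          (rule sheaf_restrict[OF ring_spaceD(1)[OF X] reg[OF U(1)] N NU refl]
            | rule sheaf_restrict[OF ring_spaceD(1)[OF X] reg[OF U(2)] N NU refl] | simp add: N_def))
    then have "(\<lambda>y. h (\<phi> y)) \<in> regf X N"
      by (rule sheaf_cong[OF ring_spaceD(1)[OF X]]) (use U(5) in \<open>simp add: N_def\<close>)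
    moreover have "x \<in> N" using x U by (simp add: N_def)
    ultimately show "\<exists>V. x \<in> V \<and> (\<lambda>x. h (\<phi> x)) \<in> regf X V" by blast
  qed
qed (rule pts)

text \<open>A retract of a \<^const>\<open>ring_space\<close> is one: regular functions on \<open>X\<close> are transported to \<open>Y\<close> along \<open>\<psi>\<close>
  and back along \<open>\<phi>\<close>.\<close>
lemma ring_space_transport:
  assumes X: "is_sheaf X" and Y: "ring_space Y" and \<phi>: "kmorphism X Y \<phi>" and \<psi>: "kmorphism Y X \<psi>"
    and inv: "\<And>x. x \<in> points X \<Longrightarrow> \<psi> (\<phi> x) = x"
  shows "ring_space X"
proof -
  have pre: "preimg X \<phi> (preimg Y \<psi> U) = U" if "openin (ztop X) U" for U
    using openin_subset[OF that] kmorphismD(1)[OF \<phi>] inv by auto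
  have pull: "g \<in> regf X U" if h: "h \<in> regf Y (preimg Y \<psi> U)" and U: "openin (ztop X) U"
     and eq: "\<And>x. x \<in> U \<Longrightarrow> h (\<phi> x) = g x" for g h U
    using kmorphismD(3)[OF \<phi> h] pre[OF U] eq by (auto elim: sheaf_cong[OF X])
  have inv': "\<psi> (\<phi> x) = x" if "openin (ztop X) U" "x \<in> U" for x U
    using that inv openin_subset by blast
  note Xo = sheaf_open[OF X]
  show ?thesis
    unfolding ring_space_def
  proof (intro conjI allI impI ballI X)
    show "(\<lambda>_. to_ac c) \<in> regf X U" if "openin (ztop X) U" for c U
      using ring_spaceD(2)[OF Y kmorphismD(2)[OF \<psi> that]] by (rule pull[OF _ that]) simp
    show "(\<lambda>x. f x + g x) \<in> regf X U" "(\<lambda>x. f x * g x) \<in> regf X U"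
      if f: "f \<in> regf X U" and g: "g \<in> regf X U" for f g U
      by (rule pull[OF ring_spaceD(3)[OF Y kmorphismD(3)[OF \<psi> f] kmorphismD(3)[OF \<psi> g]]];
          (rule Xo[OF f] | simp add: inv'[OF Xo[OF f]]))
         (rule pull[OF ring_spaceD(4)[OF Y kmorphismD(3)[OF \<psi> f] kmorphismD(3)[OF \<psi> g]]];
          (rule Xo[OF f] | simp add: inv'[OF Xo[OF f]]))
    fix U f assume f: "f \<in> regf X U"
    have "preimg X \<phi> {y \<in> preimg Y \<psi> U. f (\<psi> y) \<noteq> 0} = {x \<in> U. f x \<noteq> 0}"
      using openin_subset[OF Xo[OF f]] kmorphismD(1)[OF \<phi>] inv by auto
    with kmorphismD(2)[OF \<phi> ring_spaceD(5)[OF Y kmorphismD(3)[OF \<psi> f]]]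
    show "openin (ztop X) {x \<in> U. f x \<noteq> 0}" by simp
    assume "\<forall>x\<in>U. f x \<noteq> 0"
    then show "(\<lambda>x. inverse (f x)) \<in> regf X U"
      by (intro pull[OF ring_spaceD(6)[OF Y kmorphismD(3)[OF \<psi> f]]])
         (auto simp: Xo[OF f] inv'[OF Xo[OF f]])
  qed
qed

lemma openin_open_sub:
  "openin (ztop X) U \<Longrightarrow> openin (ztop (open_sub X U)) W \<longleftrightarrow> openin (ztop X) W \<and> W \<subseteq> U"
  by (simp add: open_sub_def openin_open_subtopology)

lemma regf_open_sub: "f \<in> regf (open_sub X U) W \<longleftrightarrow> W \<subseteq> U \<and> f \<in> regf X W"
  by (simp add: open_sub_def)

lemma points_open_sub: "openin (ztop X) U \<Longrightarrow> points (open_sub X U) = U"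
  using openin_subset[of "ztop X" U] by (auto simp: open_sub_def)

lemma open_sub_is_sheaf:
  assumes X: "is_sheaf X" and U: "openin (ztop X) U"
  shows "is_sheaf (open_sub X U)"
  unfolding is_sheaf_def openin_open_sub[OF U] regf_open_sub
proof (intro allI iffI; (elim conjE)?; (intro conjI ballI)?)
  fix W f assume W: "W \<subseteq> U" "f \<in> regf X W"
  show Wo: "openin (ztop X) W" using sheaf_open[OF X W(2)] .
  show "W \<subseteq> U" by fact
  fix x assume "x \<in> W"
  then show "\<exists>V g. x \<in> V \<and> (openin (ztop X) V \<and> V \<subseteq> U) \<and> (V \<subseteq> U \<and> g \<in> regf X V) \<and> (\<forall>y\<in>W \<inter> V. f y = g y)"
    using W Wo by blast
next
  fix W f assume W: "openin (ztop X) W" "W \<subseteq> U"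
    and loc: "\<forall>x\<in>W. \<exists>V g. x \<in> V \<and> (openin (ztop X) V \<and> V \<subseteq> U) \<and> (V \<subseteq> U \<and> g \<in> regf X V) \<and> (\<forall>y\<in>W \<inter> V. f y = g y)"
  show "W \<subseteq> U" by fact
  show "f \<in> regf X W"
    using loc by (intro sheaf_local[OF X W(1)]) meson
qed

lemma ring_space_local:
  assumes X: "is_sheaf X"
    and cover: "\<And>x. x \<in> points X \<Longrightarrow> \<exists>U. x \<in> U \<and> openin (ztop X) U \<and> ring_space (open_sub X U)"
  shows "ring_space X"
proof -
  note Xo = sheaf_open[OF X]
  have chart: thesis
    if W: "openin (ztop X) W" and x: "x \<in> W"
      and thesis: "\<And>U V. ring_space (open_sub X U) \<Longrightarrow> x \<in> V \<Longrightarrow> V \<subseteq> W \<Longrightarrow> openin (ztop X) U \<Longrightarrow>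
         openin (ztop (open_sub X U)) V \<Longrightarrow> \<forall>f\<in>regf X W. f \<in> regf (open_sub X U) V \<Longrightarrow> thesis"
    for x W thesis
  proof -
    have "x \<in> points X" using openin_subset[OF W] x by blast
    then obtain U where U: "x \<in> U" "openin (ztop X) U" "ring_space (open_sub X U)" using cover by blast
    have V: "openin (ztop X) (W \<inter> U)" using U W by (simp add: openin_Int)
    have "f \<in> regf (open_sub X U) (W \<inter> U)" if "f \<in> regf X W" for f
      using sheaf_restrict[OF X that V Int_lower1 refl] by (simp add: regf_open_sub)
    then show thesis using U x V by (intro thesis[of U "W \<inter> U"]) (simp_all add: openin_open_sub)
  qed
  have sub: "f \<in> regf X V" if "f \<in> regf (open_sub X U) V" for f U V
    using that by (simp add: regf_open_sub)
  show ?thesis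
    unfolding ring_space_def
  proof (intro conjI allI impI ballI X)
    fix W c assume W: "openin (ztop X) W"
    show "(\<lambda>_. to_ac c) \<in> regf X W"
    proof (rule sheaf_glue[OF X W])
      fix x assume "x \<in> W"
      with W obtain U V where V: "ring_space (open_sub X U)" "x \<in> V" "V \<subseteq> W" "openin (ztop X) U"
        "openin (ztop (open_sub X U)) V" "\<forall>f\<in>regf X W. f \<in> regf (open_sub X U) V"
        by (rule chart)
      show "\<exists>V. x \<in> V \<and> (\<lambda>_. to_ac c) \<in> regf X V"
        by (intro exI conjI, rule V(2), rule sub, rule ring_spaceD(2)[OF V(1,5)])
    qed
  next
    fix W f g assume f: "f \<in> regf X W" and g: "g \<in> regf X W"
    show "(\<lambda>x. f x + g x) \<in> regf X W"
    proof (rule sheaf_glue[OF X Xo[OF f]])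
      fix x assume "x \<in> W"
      with Xo[OF f] obtain U V where V: "ring_space (open_sub X U)" "x \<in> V" "V \<subseteq> W" "openin (ztop X) U"
        "openin (ztop (open_sub X U)) V" "\<forall>f\<in>regf X W. f \<in> regf (open_sub X U) V" by (rule chart)
      show "\<exists>V. x \<in> V \<and> (\<lambda>x. f x + g x) \<in> regf X V"
        by (intro exI conjI, rule V(2), rule sub, rule ring_spaceD(3)[OF V(1) bspec[OF V(6) f] bspec[OF V(6) g]])
    qed
    show "(\<lambda>x. f x * g x) \<in> regf X W"
    proof (rule sheaf_glue[OF X Xo[OF f]])
      fix x assume "x \<in> W"
      with Xo[OF f] obtain U V where V: "ring_space (open_sub X U)" "x \<in> V" "V \<subseteq> W" "openin (ztop X) U"
        "openin (ztop (open_sub X U)) V" "\<forall>f\<in>regf X W. f \<in> regf (open_sub X U) V" by (rule chart)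
      show "\<exists>V. x \<in> V \<and> (\<lambda>x. f x * g x) \<in> regf X V"
        by (intro exI conjI, rule V(2), rule sub, rule ring_spaceD(4)[OF V(1) bspec[OF V(6) f] bspec[OF V(6) g]])
    qed
  next
    fix W f assume f: "f \<in> regf X W"
    show "openin (ztop X) {x \<in> W. f x \<noteq> 0}"
    proof (subst openin_subopen, clarify)
      fix x assume x: "x \<in> W" "f x \<noteq> 0"
      obtain U V where V: "ring_space (open_sub X U)" "x \<in> V" "V \<subseteq> W" "openin (ztop X) U"
        "openin (ztop (open_sub X U)) V" "\<forall>f\<in>regf X W. f \<in> regf (open_sub X U) V" using Xo[OF f] x(1) by (rule chart)
      have "openin (ztop X) {x \<in> V. f x \<noteq> 0}"
        using ring_spaceD(5)[OF V(1) bspec[OF V(6) f]] by (simp only: openin_open_sub[OF V(4)])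
      with V x show "\<exists>T. openin (ztop X) T \<and> x \<in> T \<and> T \<subseteq> {x \<in> W. f x \<noteq> 0}" by blast
    qed
    assume nz: "\<forall>x\<in>W. f x \<noteq> 0"
    show "(\<lambda>x. inverse (f x)) \<in> regf X W"
    proof (rule sheaf_glue[OF X Xo[OF f]])
      fix x assume "x \<in> W"
      with Xo[OF f] obtain U V where V: "ring_space (open_sub X U)" "x \<in> V" "V \<subseteq> W" "openin (ztop X) U"
        "openin (ztop (open_sub X U)) V" "\<forall>f\<in>regf X W. f \<in> regf (open_sub X U) V" by (rule chart)
      have "f y \<noteq> 0" if "y \<in> V" for y using nz V(3) that by blast
      then have "(\<lambda>x. inverse (f x)) \<in> regf X V"
        by (intro sub[OF ring_spaceD(6)[OF V(1) bspec[OF V(6) f]]])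
      with V(2) show "\<exists>V. x \<in> V \<and> (\<lambda>x. inverse (f x)) \<in> regf X V" by blast
    qed
  qed
qed

section \<open>Conjugate points\<close>

text \<open>The point \<open>y\<close> is the conjugate \<open>\<tau>(x)\<close>. On a space without coordinates this is expressed by the
  values of the functions defined over \<open>k\<close>, and by \<open>x\<close> and \<open>y\<close> lying in the same open sets over \<open>k\<close>.\<close>
definition conj_related ::
  "('k::field, 'p) kspace \<Rightarrow> ('k alg_closure \<Rightarrow> 'k alg_closure) \<Rightarrow> 'p \<Rightarrow> 'p \<Rightarrow> bool" where
  "conj_related X \<tau> x y \<longleftrightarrow> y \<in> points X \<and>
     (\<forall>U. openin (ztop X) U \<longrightarrow> (y \<in> U \<longleftrightarrow> x \<in> U) \<and> (x \<in> U \<longrightarrow> (\<forall>f\<in>regf X U. f y = \<tau> (f x))))"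

lemma conj_relatedD:
  assumes "conj_related X \<tau> x y"
  shows "y \<in> points X" and "openin (ztop X) U \<Longrightarrow> y \<in> U \<longleftrightarrow> x \<in> U"
    and "is_sheaf X \<Longrightarrow> f \<in> regf X U \<Longrightarrow> x \<in> U \<Longrightarrow> f y = \<tau> (f x)"
    and "x \<in> points X"
  using assms sheaf_open[of X f U] by (auto simp: conj_related_def)

text \<open>The condition under which the definite description \<^const>\<open>pt_act\<close> describes a point.\<close>
definition conj_space :: "('k::field, 'p) kspace \<Rightarrow> bool" where
  "conj_space X \<longleftrightarrow> (\<forall>\<tau>\<in>Aut_ac. \<forall>x\<in>points X. \<exists>!y. conj_related X \<tau> x y)"

lemma pt_act_related:
  "conj_space X \<Longrightarrow> \<tau> \<in> Aut_ac \<Longrightarrow> x \<in> points X \<Longrightarrow> conj_related X \<tau> x (pt_act X \<tau> x)"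
  unfolding pt_act_def conj_related_def[symmetric] conj_space_def by (blast intro: theI')

lemma pt_act_eqI:
  assumes "conj_space X" "\<tau> \<in> Aut_ac" "conj_related X \<tau> x y" shows "pt_act X \<tau> x = y"
proof -
  have x: "x \<in> points X" using conj_relatedD(4)[OF assms(3)] .
  show ?thesis
    using assms x pt_act_related[OF assms(1,2) x] unfolding conj_space_def by blast
qed

text \<open>Morphisms over \<open>k\<close> commute with conjugation, because pulling back functions does.\<close>
lemma conj_related_kmorphism:
  assumes X: "is_sheaf Y" and \<phi>: "kmorphism X Y \<phi>" and r: "conj_related X \<tau> x y"
  shows "conj_related Y \<tau> (\<phi> x) (\<phi> y)"
  unfolding conj_related_def
proof (intro conjI allI impI ballI)
  note x = conj_relatedD(4)[OF r] and y = conj_relatedD(1)[OF r]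
  show "\<phi> y \<in> points Y" by (rule kmorphismD(1)[OF \<phi> y])
  fix U assume U: "openin (ztop Y) U"
  show "\<phi> y \<in> U \<longleftrightarrow> \<phi> x \<in> U"
    using conj_relatedD(2)[OF r kmorphismD(2)[OF \<phi> U]] x y by simp
  fix f assume f: "\<phi> x \<in> U" "f \<in> regf Y U"
  have "\<forall>g\<in>regf X (preimg X \<phi> U). g y = \<tau> (g x)"
    using r kmorphismD(2)[OF \<phi> U] x f(1) unfolding conj_related_def by blast
  from this[rule_format, OF kmorphismD(3)[OF \<phi> f(2)]] show "f (\<phi> y) = \<tau> (f (\<phi> x))" .
qed

lemma conj_related_inv:
  assumes "\<tau> \<in> Aut_ac" "conj_related X \<tau> x y"
  shows "conj_related X (inv_into UNIV \<tau>) y x"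
  unfolding conj_related_def
proof (intro conjI allI impI ballI)
  show "x \<in> points X" by (rule conj_relatedD(4)[OF assms(2)])
  fix U assume U: "openin (ztop X) U"
  show xy: "x \<in> U \<longleftrightarrow> y \<in> U" using conj_relatedD(2)[OF assms(2) U] by blast
  fix f assume "y \<in> U" "f \<in> regf X U"
  then have "f y = \<tau> (f x)" using assms(2) U xy unfolding conj_related_def by blast
  then show "f x = inv_into UNIV \<tau> (f y)" using assms(1) by simp
qed

text \<open>It suffices to compare the values of the generators.\<close>
lemma gen_space_conj_related:
  assumes P: "gen_family P" and \<tau>: "\<tau> \<in> Aut_ac" and pts: "x \<in> points (gen_space P)"
    and rel: "\<And>U f. (U, f) \<in> P \<Longrightarrow> (y \<in> U \<longleftrightarrow> x \<in> U) \<and> (x \<in> U \<longrightarrow> f y = \<tau> (f x))"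
  shows "conj_related (gen_space P) \<tau> x y"
proof -
  have op: "y \<in> W \<longleftrightarrow> x \<in> W" if W: "openin (ztop (gen_space P)) W" for W
  proof
    assume "x \<in> W"
    then obtain U f where "(U, f) \<in> P" "x \<in> U" "f x \<noteq> 0" "{y \<in> U. f y \<noteq> 0} \<subseteq> W"
      using gen_space_basis[OF P W] by blast
    then show "y \<in> W" using rel[of U f] \<tau> by auto
  next
    assume "y \<in> W"
    then obtain U f where "(U, f) \<in> P" "y \<in> U" "f y \<noteq> 0" "{y \<in> U. f y \<noteq> 0} \<subseteq> W"
      using gen_space_basis[OF P W] by blast
    then show "x \<in> W" using rel[of U f] \<tau> by auto
  qed
  show ?thesis
    unfolding conj_related_def
  proof (intro conjI allI impI ballI)
    show "y \<in> points (gen_space P)" using op[OF openin_topspace] pts by blast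
    fix W assume W: "openin (ztop (gen_space P)) W"
    show "y \<in> W \<longleftrightarrow> x \<in> W" by (rule op[OF W])
    fix h assume x: "x \<in> W" and h: "h \<in> regf (gen_space P) W"
    obtain U f g where U: "(U, f) \<in> P" "(U, g) \<in> P" "x \<in> U" "g x \<noteq> 0"
        "\<forall>y\<in>W. y \<in> U \<and> g y \<noteq> 0 \<longrightarrow> h y = f y / g y"
      by (rule regf_gen_spaceE[OF h x])
    have "y \<in> U" "g y \<noteq> 0" "y \<in> W" using rel[OF U(2)] U(3,4) \<tau> op[OF W] x by auto
    then have "h y = f y / g y" "h x = f x / g x" using U x by blast+
    then show "h y = \<tau> (h x)" using rel[OF U(1)] rel[OF U(2)] U(3) by (simp add: Aut_ac_divide[OF \<tau>])
  qed
qed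

section \<open>Conjugate points on varieties\<close>

lemma affine_gen_family: "gen_family {(zero_set n S, f) | f. f \<in> polyfun n}"
  by (auto simp: gen_family_def intro: polyfun.intros)

lemma affine_model_ring_space: "ring_space (affine_model n S)"
  unfolding affine_model_def by (rule gen_space_ring_space[OF affine_gen_family])

lemma affine_model_points: "points (affine_model n S) = zero_set n S"
  unfolding affine_model_def gen_space_points[OF affine_gen_family]
  using polyfun.const by fastforce

lemma polyfun_conj:
  assumes \<tau>: "\<tau> \<in> Aut_ac" and f: "f \<in> polyfun n"
  shows "f (\<lambda>i\<in>{..<n}. \<tau> (x i)) = \<tau> (f x)"
  using f by induction (auto simp: Aut_acD[OF \<tau>])

text \<open>On an affine variety conjugation acts on coordinates, and the coordinate functions show that no
  other point is a conjugate.\<close>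
lemma affine_model_conj_space:
  assumes S: "S \<subseteq> polyfun n"
  shows "conj_space (affine_model n S)"
  unfolding conj_space_def
proof (intro ballI)
  fix \<tau> :: "'a alg_closure \<Rightarrow> 'a alg_closure" and x
  assume \<tau>: "\<tau> \<in> Aut_ac" and x: "x \<in> points (affine_model n S)"
  let ?y = "\<lambda>i\<in>{..<n}. \<tau> (x i)"
  have xZ: "x \<in> zero_set n S" using x by (simp add: affine_model_points)
  have y: "?y \<in> zero_set n S"
  proof -
    have "p ?y = 0" if "p \<in> S" for p
      using polyfun_conj[OF \<tau>, of p n x] S that xZ \<tau> by (auto simp: zero_set_def)
    then show ?thesis by (auto simp: zero_set_def)
  qed
  show "\<exists>!y. conj_related (affine_model n S) \<tau> x y"
  proof (rule ex1I)
    show "conj_related (affine_model n S) \<tau> x ?y"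
      unfolding affine_model_def
    proof (rule gen_space_conj_related[OF affine_gen_family \<tau>])
      show "x \<in> points (gen_space {(zero_set n S, f) | f. f \<in> polyfun n})"
        using x by (simp add: affine_model_def)
    qed (use xZ y polyfun_conj[OF \<tau>] in auto)
    fix z assume z: "conj_related (affine_model n S) \<tau> x z"
    have zZ: "z \<in> zero_set n S" using conj_relatedD(1)[OF z] by (simp add: affine_model_points)
    show "z = ?y"
    proof (rule extensionalityI[of _ "{..<n}"])
      show "z \<in> extensional {..<n}" using zZ by (auto simp: zero_set_def PiE_def)
      fix i assume i: "i \<in> {..<n}"
      have "(\<lambda>x. x i) \<in> regf (affine_model n S) (zero_set n S)"
        unfolding affine_model_def
        by (rule gen_space_member[OF affine_gen_family]) (use i in \<open>auto intro: polyfun.coord\<close>)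
      from conj_relatedD(3)[OF z ring_spaceD(1)[OF affine_model_ring_space] this xZ]
      show "z i = ?y i" using i by simp
    qed simp
  qed
qed

text \<open>For transporting properties from the model, a left inverse of the chart suffices.\<close>
lemma affine_chart:
  assumes "is_affine X"
  obtains n S \<phi> \<psi> where "S \<subseteq> polyfun n" "kmorphism X (affine_model n S) \<phi>"
    "kmorphism (affine_model n S) X \<psi>" "\<And>x. x \<in> points X \<Longrightarrow> \<psi> (\<phi> x) = x"
proof -
  obtain n S \<phi> where S: "S \<subseteq> polyfun n" "kisomorphism X (affine_model n S) \<phi>"
    using assms by (auto simp: is_affine_def)
  then show thesis
    by (intro that[of S n \<phi> "inv_into (points X) \<phi>"])
       (auto simp: kisomorphism_def bij_betw_def inv_into_f_f)
qed

lemma variety_cover: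
  assumes "variety X" "x \<in> points X"
  obtains U where "x \<in> U" "openin (ztop X) U" "is_affine (open_sub X U)"
  using assms unfolding variety_def by blast

lemma variety_is_sheaf: "variety X \<Longrightarrow> is_sheaf X"
  by (simp add: variety_def)

lemma variety_ring_space:
  assumes X: "variety X" shows "ring_space X"
proof (rule ring_space_local[OF variety_is_sheaf[OF X]])
  fix x assume "x \<in> points X"
  then obtain U where U: "x \<in> U" "openin (ztop X) U" "is_affine (open_sub X U)"
    by (rule variety_cover[OF X])
  have "ring_space (open_sub X U)"
    using U(3) by (rule affine_chart)
      (auto intro: ring_space_transport[OF open_sub_is_sheaf[OF variety_is_sheaf[OF X] U(2)] affine_model_ring_space])
  with U show "\<exists>U. x \<in> U \<and> openin (ztop X) U \<and> ring_space (open_sub X U)" by blast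
qed

lemma conj_related_open_sub:
  assumes X: "is_sheaf X" and U: "openin (ztop X) U" and x: "x \<in> U"
  shows "conj_related (open_sub X U) \<tau> x y \<longleftrightarrow> conj_related X \<tau> x y"
proof
  assume r: "conj_related (open_sub X U) \<tau> x y"
  have y: "y \<in> U" using conj_relatedD(1)[OF r] points_open_sub[OF U] by simp
  show "conj_related X \<tau> x y"
    unfolding conj_related_def
  proof (intro conjI allI impI ballI)
    show "y \<in> points X" using y openin_subset[OF U] by blast
    fix W assume W: "openin (ztop X) W"
    have WU: "openin (ztop (open_sub X U)) (W \<inter> U)" using W U by (simp add: openin_open_sub openin_Int)
    show "y \<in> W \<longleftrightarrow> x \<in> W" using conj_relatedD(2)[OF r WU] x y by blast
    fix f assume f: "x \<in> W" "f \<in> regf X W"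
    have "f \<in> regf X (W \<inter> U)" by (rule sheaf_restrict[OF X f(2)]) (use W U in auto)
    then have "f \<in> regf (open_sub X U) (W \<inter> U)" by (simp add: regf_open_sub)
    with r WU x f(1) show "f y = \<tau> (f x)" unfolding conj_related_def by blast
  qed
next
  assume r: "conj_related X \<tau> x y"
  have y: "y \<in> U" using conj_relatedD(2)[OF r U] x by blast
  with r x show "conj_related (open_sub X U) \<tau> x y"
    by (auto simp: conj_related_def openin_open_sub[OF U] regf_open_sub points_open_sub[OF U])
qed

text \<open>Conjugate points lie in the same open sets over \<open>k\<close>, hence in the same affine chart, where they are
  unique.\<close>
lemma variety_conj_space:
  assumes X: "variety X" shows "conj_space X"
  unfolding conj_space_def
proof (intro ballI)
  fix \<tau> :: "'a alg_closure \<Rightarrow> 'a alg_closure" and x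
  assume \<tau>: "\<tau> \<in> Aut_ac" and x: "x \<in> points X"
  note sh = variety_is_sheaf[OF X]
  obtain U where U: "x \<in> U" "openin (ztop X) U" "is_affine (open_sub X U)"
    using x by (rule variety_cover[OF X])
  obtain n S \<phi> \<psi> where S: "S \<subseteq> polyfun n" and \<phi>: "kmorphism (open_sub X U) (affine_model n S) \<phi>"
    and \<psi>: "kmorphism (affine_model n S) (open_sub X U) \<psi>" and inv: "\<And>x. x \<in> U \<Longrightarrow> \<psi> (\<phi> x) = x"
    using U(3) by (rule affine_chart) (auto simp: points_open_sub[OF U(2)])
  note rel = conj_related_open_sub[OF sh U(2,1)]
  have x': "\<phi> x \<in> points (affine_model n S)"
    using kmorphismD(1)[OF \<phi>] U(1) by (simp add: points_open_sub[OF U(2)])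
  have ex1: "\<exists>!y. conj_related (affine_model n S) \<tau> (\<phi> x) y"
    using affine_model_conj_space[OF S] \<tau> x' unfolding conj_space_def by blast
  show "\<exists>!y. conj_related X \<tau> x y"
  proof (rule ex_ex1I)
    obtain y where "conj_related (affine_model n S) \<tau> (\<phi> x) y" using ex1 by blast
    then have "conj_related (open_sub X U) \<tau> (\<psi> (\<phi> x)) (\<psi> y)"
      by (rule conj_related_kmorphism[OF open_sub_is_sheaf[OF sh U(2)] \<psi>])
    then show "\<exists>y. conj_related X \<tau> x y" using inv[OF U(1)] rel by auto
    fix y z assume yz: "conj_related X \<tau> x y" "conj_related X \<tau> x z"
    then have "\<phi> y = \<phi> z"
      using ex1 conj_related_kmorphism[OF ring_spaceD(1)[OF affine_model_ring_space] \<phi>] unfolding rel[symmetric] by blast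
    moreover have "y \<in> U" "z \<in> U" using yz conj_relatedD(2)[OF _ U(2)] U(1) by blast+
    ultimately show "y = z" using inv by metis
  qed
qed

section \<open>Base change to the separable closure\<close>

text \<open>For \<open>C = k\<^sup>s\<close> and \<open>G\<close> the regular functions on an open set these generate the base change to \<open>k\<^sup>s\<close>;
  for \<open>C = k\<close> and \<open>G\<close> the products of functions of one coordinate they generate a product.\<close>
definition lincombs :: "'a::comm_semiring_0 set \<Rightarrow> ('p \<Rightarrow> 'a) set \<Rightarrow> ('p \<Rightarrow> 'a) set" where
  "lincombs C G = {\<lambda>x. \<Sum>i<n. c i * g i x | (n::nat) c g. \<forall>i<n. c i \<in> C \<and> g i \<in> G}"

lemma lincombsI: "(\<And>i. i < n \<Longrightarrow> c i \<in> C \<and> g i \<in> G) \<Longrightarrow> (\<lambda>x. \<Sum>i<(n::nat). c i * g i x) \<in> lincombs C G"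
  unfolding lincombs_def by blast

lemma lincombsE:
  assumes "h \<in> lincombs C G"
  obtains n :: nat and c g where "h = (\<lambda>x. \<Sum>i<n. c i * g i x)" "\<And>i. i < n \<Longrightarrow> c i \<in> C" "\<And>i. i < n \<Longrightarrow> g i \<in> G"
  using assms unfolding lincombs_def by blast

lemma lincombs_zero: "(\<lambda>_. 0) \<in> lincombs C G"
  using lincombsI[of 0] by simp

lemma lincombs_snoc:
  assumes "h \<in> lincombs C G" "c \<in> C" "g \<in> G"
  shows "(\<lambda>x. h x + c * g x) \<in> lincombs C G"
proof -
  obtain n :: nat and c' g' where h: "h = (\<lambda>x. \<Sum>i<n. c' i * g' i x)"
    "\<And>i. i < n \<Longrightarrow> c' i \<in> C" "\<And>i. i < n \<Longrightarrow> g' i \<in> G"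
    using assms(1) by (rule lincombsE) blast
  have "(\<lambda>x. \<Sum>i<Suc n. (c'(n := c)) i * (g'(n := g)) i x) \<in> lincombs C G"
    using h(2,3) assms(2,3) by (intro lincombsI) (auto simp: less_Suc_eq)
  then show ?thesis by (simp add: h(1))
qed

lemma lincombs_induct [consumes 1, case_names zero snoc]:
  assumes "h \<in> lincombs C G" and "P (\<lambda>_. 0)"
    and "\<And>h c g. h \<in> lincombs C G \<Longrightarrow> P h \<Longrightarrow> c \<in> C \<Longrightarrow> g \<in> G \<Longrightarrow> P (\<lambda>x. h x + c * g x)"
  shows "P h"
proof -
  obtain n :: nat and c g where h: "h = (\<lambda>x. \<Sum>i<n. c i * g i x)"
    "\<And>i. i < n \<Longrightarrow> c i \<in> C" "\<And>i. i < n \<Longrightarrow> g i \<in> G"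
    using assms(1) by (rule lincombsE) blast
  have "P (\<lambda>x. \<Sum>i<m. c i * g i x)" if "m \<le> n" for m
    using that
  proof (induction m)
    case (Suc m)
    have "(\<lambda>x. \<Sum>i<m. c i * g i x) \<in> lincombs C G" using h(2,3) Suc.prems by (intro lincombsI) simp
    from assms(3)[OF this _ h(2)[of m] h(3)[of m]] show ?case using Suc by simp
  qed (simp add: assms(2))
  then show ?thesis unfolding h(1) by blast
qed

lemma lincombs_single: "c \<in> C \<Longrightarrow> g \<in> G \<Longrightarrow> (\<lambda>x. c * g x) \<in> lincombs C G"
  using lincombs_snoc[OF lincombs_zero] by force

lemma lincombs_add: "h' \<in> lincombs C G \<Longrightarrow> h \<in> lincombs C G \<Longrightarrow> (\<lambda>x. h x + h' x) \<in> lincombs C G"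
proof (induction rule: lincombs_induct)
  case (snoc h' c g)
  from lincombs_snoc[OF snoc.IH[OF snoc.prems] snoc.hyps(2,3)] show ?case by (simp add: add.assoc)
qed simp

lemma lincombs_mono:
  assumes "h \<in> lincombs C G" "C \<subseteq> C'" "G \<subseteq> G'" shows "h \<in> lincombs C' G'"
  using assms(1)
proof (induction rule: lincombs_induct)
  case zero show ?case by (rule lincombs_zero)
next
  case (snoc h c g) then show ?case using assms(2,3) by (intro lincombs_snoc) auto
qed

lemma lincombs_mult:
  assumes h: "h \<in> lincombs C G" and h': "h' \<in> lincombs C G'"
    and C: "\<And>c d. c \<in> C \<Longrightarrow> d \<in> C \<Longrightarrow> c * d \<in> C"
    and G: "\<And>g g'. g \<in> G \<Longrightarrow> g' \<in> G' \<Longrightarrow> (\<lambda>x. g x * g' x) \<in> G''"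
  shows "(\<lambda>x. h x * h' x) \<in> lincombs C G''"
  using h'
proof (induction rule: lincombs_induct)
  case zero show ?case using lincombs_zero by simp
next
  case (snoc h' d g')
  have "(\<lambda>x. h x * (d * g' x)) \<in> lincombs C G''"
    using h
  proof (induction rule: lincombs_induct)
    case zero show ?case using lincombs_zero by simp
  next
    case (snoc h c g)
    from lincombs_snoc[OF snoc.IH C[OF snoc.hyps(2) \<open>d \<in> C\<close>] G[OF snoc.hyps(3) \<open>g' \<in> G'\<close>]]
    show ?case by (simp add: algebra_simps)
  qed
  from lincombs_add[OF this snoc.IH] show ?case by (simp add: algebra_simps)
qed

lemma lincombs_regf:
  assumes X: "ring_space X" and U: "openin (ztop X) U" and h: "h \<in> lincombs (range to_ac) (regf X U)"
  shows "h \<in> regf X U"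
  using h
proof (induction rule: lincombs_induct)
  case zero show ?case using ring_spaceD(2)[OF X U, of 0] by simp
next
  case (snoc h c g)
  then obtain c' where "c = to_ac c'" by blast
  with snoc show ?case
    using ring_spaceD(3)[OF X snoc.IH ring_spaceD(4)[OF X ring_spaceD(2)[OF X U, of c'] snoc.hyps(3)]] by simp
qed

lemma lincombs_conj:
  assumes \<tau>: "\<tau> \<in> Aut_ac" and h: "h \<in> lincombs (range to_ac) G"
    and G: "\<And>g. g \<in> G \<Longrightarrow> g y = \<tau> (g x)"
  shows "h y = \<tau> (h x)"
  using h by (induction rule: lincombs_induct) (use \<tau> G in \<open>auto simp: Aut_acD[OF \<tau>]\<close>)

definition bc_family :: "('k::field) alg_closure set \<Rightarrow> ('k, 'p) kspace \<Rightarrow> ('p set \<times> ('p \<Rightarrow> 'k alg_closure)) set" where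
  "bc_family L X = {(U, h). openin (ztop X) U \<and> h \<in> lincombs L (regf X U)}"

lemma base_change_eq: "base_change L X = gen_space (bc_family L X)"
proof -
  have "{(U, \<lambda>x. \<Sum>i<n. c i * f i x) | U (n::nat) c f.
        openin (ztop X) U \<and> (\<forall>i<n. c i \<in> L \<and> f i \<in> regf X U)} = bc_family L X"
    unfolding bc_family_def lincombs_def by blast
  then show ?thesis unfolding base_change_def by (rule arg_cong)
qed

lemma bc_gen_family:
  assumes X: "ring_space X" shows "gen_family (bc_family ksep X)"
  unfolding gen_family_def
proof (intro conjI allI impI)
  fix U V f g c
  assume "(U, f) \<in> bc_family ksep X"
  then have f: "openin (ztop X) U" "f \<in> lincombs ksep (regf X U)" by (auto simp: bc_family_def)
  show "(U, \<lambda>_. to_ac c) \<in> bc_family ksep X"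
    using f(1) lincombs_single[OF ksep_closed(1)[of c] ring_space_one[OF X f(1)]] by (simp add: bc_family_def)
  assume "(V, g) \<in> bc_family ksep X"
  then have g: "openin (ztop X) V" "g \<in> lincombs ksep (regf X V)" by (auto simp: bc_family_def)
  have UV: "openin (ztop X) (U \<inter> V)" using f g by (simp add: openin_Int)
  have sub: "regf X U \<subseteq> regf X (U \<inter> V)" "regf X V \<subseteq> regf X (U \<inter> V)"
    using sheaf_restrict[OF ring_spaceD(1)[OF X] _ UV _ refl] by auto
  have f': "f \<in> lincombs ksep (regf X (U \<inter> V))" and g': "g \<in> lincombs ksep (regf X (U \<inter> V))"
    using lincombs_mono[OF f(2) subset_refl sub(1)] lincombs_mono[OF g(2) subset_refl sub(2)] .
  show "(U \<inter> V, \<lambda>x. f x + g x) \<in> bc_family ksep X"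
    using UV lincombs_add[OF g' f'] by (simp add: bc_family_def)
  show "(U \<inter> V, \<lambda>x. f x * g x) \<in> bc_family ksep X"
    using UV lincombs_mult[OF f' g' ksep_closed(3) ring_spaceD(4)[OF X]] by (simp add: bc_family_def)
qed

lemma bc_ring_space: "ring_space X \<Longrightarrow> ring_space (base_change ksep X)"
  unfolding base_change_eq by (intro gen_space_ring_space bc_gen_family)

lemma bc_open:
  assumes "ring_space X" "openin (ztop X) U" shows "openin (ztop (base_change ksep X)) U"
  unfolding base_change_eq
  by (rule gen_space_member(1)[OF bc_gen_family[OF assms(1)], of _ "\<lambda>_. 0"])
     (use assms(2) in \<open>simp add: bc_family_def lincombs_zero\<close>)

lemma bc_points:
  assumes X: "ring_space X" shows "points (base_change ksep X) = points X"
proof -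
  have "\<Union>(fst ` bc_family ksep X) \<subseteq> points X"
    using openin_subset by (fastforce simp: bc_family_def)
  moreover have "points X \<subseteq> points (base_change ksep X)"
    using openin_subset[OF bc_open[OF X openin_topspace]] .
  ultimately show ?thesis unfolding base_change_eq gen_space_points[OF bc_gen_family[OF X]] by blast
qed

lemma bc_regf:
  assumes X: "ring_space X" and f: "f \<in> regf X U" shows "f \<in> regf (base_change ksep X) U"
proof -
  have "(U, f) \<in> bc_family ksep X"
    using lincombs_single[OF ksep_closed(7) f] sheaf_open[OF ring_spaceD(1)[OF X] f] by (simp add: bc_family_def)
  then show ?thesis unfolding base_change_eq by (rule gen_space_member(2)[OF bc_gen_family[OF X]])
qed

lemma lincombs_comp:
  assumes "h \<in> lincombs C G" "\<And>g. g \<in> G \<Longrightarrow> (\<lambda>x. g (\<phi> x)) \<in> G'"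
  shows "(\<lambda>x. h (\<phi> x)) \<in> lincombs C G'"
  using assms(1)
proof (induction rule: lincombs_induct)
  case zero show ?case by (rule lincombs_zero)
next
  case (snoc h c g)
  from lincombs_snoc[OF snoc.IH snoc.hyps(2) assms(2)[OF snoc.hyps(3)]] show ?case .
qed

text \<open>A morphism over \<open>k\<close> remains one over \<open>k\<^sup>s\<close>, since it pulls back combinations of regular functions
  to combinations with the same coefficients.\<close>
lemma bc_kmorphism:
  assumes X: "ring_space X" and Y: "ring_space Y" and \<phi>: "kmorphism X Y \<phi>"
  shows "kmorphism (base_change ksep X) (base_change ksep Y) \<phi>"
  unfolding base_change_eq[of ksep Y]
proof (rule kmorphism_gen_space[OF bc_ring_space[OF X] bc_gen_family[OF Y]])
  show "\<phi> x \<in> points (gen_space (bc_family ksep Y))" if "x \<in> points (base_change ksep X)" for x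
    using kmorphismD(1)[OF \<phi>] that bc_points[OF X] bc_points[OF Y] by (simp add: base_change_eq)
  fix U h assume "(U, h) \<in> bc_family ksep Y"
  then have h: "openin (ztop Y) U" "h \<in> lincombs ksep (regf Y U)" by (auto simp: bc_family_def)
  have "(preimg X \<phi> U, \<lambda>x. h (\<phi> x)) \<in> bc_family ksep X"
    using kmorphismD(2)[OF \<phi> h(1)] lincombs_comp[OF h(2) kmorphismD(3)[OF \<phi>]] by (simp add: bc_family_def)
  from gen_space_member(2)[OF bc_gen_family[OF X] this]
  show "(\<lambda>x. h (\<phi> x)) \<in> regf (base_change ksep X) (preimg (base_change ksep X) \<phi> U)"
    by (simp add: bc_points[OF X]) (simp add: base_change_eq)
qed

section \<open>Galois descent of morphisms\<close>

text \<open>A Galois-stable set that is open over \<open>k\<^sup>s\<close> is open over \<open>k\<close>. Near \<open>x\<close> the set contains the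
  nonvanishing locus of a combination \<open>\<Sum> c i * f i\<close> of functions over \<open>k\<close>. The coefficient vectors
  whose combinations vanish outside \<open>W\<close> form a Galois-stable space, so \<open>c\<close> can be replaced by a vector
  over \<open>k\<close> whose combination still does not vanish at \<open>x\<close>.\<close>
lemma descent_open:
  fixes X :: "('k::field, 'p) kspace"
  assumes X: "ring_space X" "conj_space X" and W: "openin (ztop (base_change ksep X)) W"
    and stable: "\<And>\<tau> x y. \<tau> \<in> Aut_ac \<Longrightarrow> conj_related X \<tau> x y \<Longrightarrow> y \<in> W \<Longrightarrow> x \<in> W"
  shows "openin (ztop X) W"
proof (subst openin_subopen, intro ballI)
  note sh = ring_spaceD(1)[OF X(1)]
  fix x assume x: "x \<in> W"
  obtain U h where U: "(U, h) \<in> bc_family ksep X" "x \<in> U" "h x \<noteq> 0" "{y \<in> U. h y \<noteq> 0} \<subseteq> W"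
    using gen_space_basis[OF bc_gen_family[OF X(1)] W[unfolded base_change_eq] x] by blast
  have Uo: "openin (ztop X) U" and "h \<in> lincombs ksep (regf X U)" using U(1) by (auto simp: bc_family_def)
  then obtain n :: nat and c f where h: "h = (\<lambda>x. \<Sum>i<n. c i * f i x)"
    "\<And>i. i < n \<Longrightarrow> c i \<in> ksep" "\<And>i. i < n \<Longrightarrow> f i \<in> regf X U"
    by (auto elim: lincombsE)
  \<comment> \<open>For \<open>v \<in> M\<close> the nonvanishing locus of \<open>\<Sum> v i * f i\<close> in \<open>U\<close> is contained in \<open>W\<close>.\<close>
  define M where "M = {v. (\<forall>i<n. v i \<in> ksep) \<and> (\<forall>y\<in>U - W. (\<Sum>i<n. v i * f i y) = 0)}"
  have "\<exists>w\<in>M. (\<forall>i\<in>{..<n}. w i \<in> range to_ac) \<and> (\<Sum>i\<in>{..<n}. w i * f i x) \<noteq> 0"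
  proof (rule rational_vector[of "{..<n}" M c "\<lambda>i. f i x"])
    show "c \<in> M" using h(1,2) U(4) by (auto simp: M_def)
    show "(\<Sum>i<n. c i * f i x) \<noteq> 0" using U(3) by (simp add: h(1))
    show "v i \<in> ksep" if "v \<in> M" "i \<in> {..<n}" for v i using that by (simp add: M_def)
    show "(\<lambda>i. v i - d * u i) \<in> M" if "v \<in> M" "u \<in> M" "d \<in> ksep" for v u d
    proof -
      have "(\<Sum>i<n. (v i - d * u i) * f i y) = (\<Sum>i<n. v i * f i y) - d * (\<Sum>i<n. u i * f i y)" for y
        by (simp add: sum_distrib_left sum_subtractf algebra_simps)
      with that show ?thesis by (simp add: M_def ksep_closed)
    qed
    show "(\<lambda>i. d * v i) \<in> M" if "v \<in> M" "d \<in> ksep" for v d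
    proof -
      have "(\<Sum>i<n. d * v i * f i y) = d * (\<Sum>i<n. v i * f i y)" for y
        by (simp add: sum_distrib_left algebra_simps)
      with that show ?thesis by (simp add: M_def ksep_closed)
    qed
    show "(\<lambda>i. \<tau> (v i)) \<in> M" if v: "v \<in> M" and \<tau>: "\<tau> \<in> Aut_ac" for v \<tau>
      unfolding M_def
    proof (intro CollectI conjI allI impI ballI)
      show "\<tau> (v i) \<in> ksep" if "i < n" for i using v that Aut_ac_ksep[OF \<tau>] by (simp add: M_def)
      fix y assume y: "y \<in> U - W"
      then have "y \<in> points X" using openin_subset[OF Uo] by blast
      then obtain z where r: "conj_related X (inv_into UNIV \<tau>) y z"
        using X(2) Aut_ac_inv[OF \<tau>] unfolding conj_space_def by blast
      have r': "conj_related X \<tau> z y"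
        using conj_related_inv[OF Aut_ac_inv[OF \<tau>] r] inv_inv_eq[OF Aut_acD(4)[OF \<tau>]] by simp
      have z: "z \<in> U - W"
        using y conj_relatedD(2)[OF r Uo] stable[OF Aut_ac_inv[OF \<tau>] r] by blast
      have "\<tau> (v i) * f i y = \<tau> (v i * f i z)" if "i < n" for i
        using conj_relatedD(3)[OF r' sh h(3)[OF that]] z by (simp add: Aut_acD(2)[OF \<tau>])
      then have "(\<Sum>i<n. \<tau> (v i) * f i y) = \<tau> (\<Sum>i<n. v i * f i z)" by (simp add: Aut_ac_sum[OF \<tau>])
      also have "\<dots> = 0" using v z \<tau> by (simp add: M_def)
      finally show "(\<Sum>i<n. \<tau> (v i) * f i y) = 0" .
    qed
  qed simp
  then obtain w where w: "w \<in> M" "\<forall>i\<in>{..<n}. w i \<in> range to_ac" "(\<Sum>i<n. w i * f i x) \<noteq> 0" by blast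
  let ?h = "\<lambda>x. \<Sum>i<n. w i * f i x"
  have "?h \<in> regf X U"
    using w(2) h(3) by (intro lincombs_regf[OF X(1) Uo] lincombsI) simp
  then have "openin (ztop X) {y \<in> U. ?h y \<noteq> 0}" by (rule ring_spaceD(5)[OF X(1)])
  moreover have "{y \<in> U. ?h y \<noteq> 0} \<subseteq> W" using w(1) by (auto simp: M_def)
  ultimately show "\<exists>T. openin (ztop X) T \<and> x \<in> T \<and> T \<subseteq> W"
    using U(2) w(3) by (intro exI[of _ "{y \<in> U. ?h y \<noteq> 0}"]) simp
qed

text \<open>An equivariant function that is regular over \<open>k\<^sup>s\<close> is regular over \<open>k\<close>. Locally \<open>h\<close> is a fraction of
  combinations of functions over \<open>k\<close>. The pairs of coefficient vectors \<open>(num, den)\<close> with \<open>h * den = num\<close>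
  form a Galois-stable space because \<open>h\<close> is equivariant, and it contains a pair with entries in \<open>k\<close>
  whose denominator does not vanish at the given point.\<close>
lemma descent_regf:
  fixes X :: "('k::field, 'p) kspace"
  assumes X: "ring_space X" "conj_space X" and h: "h \<in> regf (base_change ksep X) W"
    and stable: "\<And>\<tau> x y. \<tau> \<in> Aut_ac \<Longrightarrow> conj_related X \<tau> x y \<Longrightarrow> y \<in> W \<Longrightarrow> x \<in> W"
    and equiv: "\<And>\<tau> x y. \<tau> \<in> Aut_ac \<Longrightarrow> conj_related X \<tau> x y \<Longrightarrow> x \<in> W \<Longrightarrow> h y = \<tau> (h x)"
  shows "h \<in> regf X W"
proof -
  note sh = ring_spaceD(1)[OF X(1)]
  have W: "openin (ztop X) W"
    using sheaf_open[OF ring_spaceD(1)[OF bc_ring_space[OF X(1)]] h] stable by (rule descent_open[OF X])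
  show ?thesis
  proof (rule sheaf_glue[OF sh W])
    fix x assume x: "x \<in> W"
    obtain U p q where U: "(U, p) \<in> bc_family ksep X" "(U, q) \<in> bc_family ksep X" "x \<in> U" "q x \<noteq> 0"
      and hpq: "\<forall>y\<in>W. y \<in> U \<and> q y \<noteq> 0 \<longrightarrow> h y = p y / q y"
      by (rule regf_gen_spaceE[OF h[unfolded base_change_eq] x])
    have Uo: "openin (ztop X) U" using U(1) by (simp add: bc_family_def)
    \<comment> \<open>Expanding the fraction by \<open>q\<close> makes \<open>h * den = num\<close> hold also where \<open>q\<close> vanishes.\<close>
    note PQ = gen_familyD(4)[OF bc_gen_family[OF X(1)] U(1) U(2)] gen_familyD(4)[OF bc_gen_family[OF X(1)] U(2) U(2)]
    have "(\<lambda>x. p x * q x) \<in> lincombs ksep (regf X U)" using PQ(1) by (simp add: bc_family_def)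
    then obtain n :: nat and c f where f: "(\<lambda>x. p x * q x) = (\<lambda>x. \<Sum>i<n. c i * f i x)"
      "\<And>i. i < n \<Longrightarrow> c i \<in> ksep" "\<And>i. i < n \<Longrightarrow> f i \<in> regf X U" by (rule lincombsE) blast
    have "(\<lambda>x. q x * q x) \<in> lincombs ksep (regf X U)" using PQ(2) by (simp add: bc_family_def)
    then obtain m :: nat and d g where g: "(\<lambda>x. q x * q x) = (\<lambda>x. \<Sum>i<m. d i * g i x)"
      "\<And>i. i < m \<Longrightarrow> d i \<in> ksep" "\<And>i. i < m \<Longrightarrow> g i \<in> regf X U" by (rule lincombsE) blast
    define I where "I = {..<n} <+> {..<m}"
    define num where "num v y = (\<Sum>i<n. v (Inl i) * f i y)" for v :: "nat + nat \<Rightarrow> 'k alg_closure" and y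
    define den where "den v y = (\<Sum>i<m. v (Inr i) * g i y)" for v :: "nat + nat \<Rightarrow> 'k alg_closure" and y
    define M where "M = {v. (\<forall>i\<in>I. v i \<in> ksep) \<and> (\<forall>y\<in>U \<inter> W. h y * den v y = num v y)}"
    \<comment> \<open>The linear form \<open>a\<close> evaluates the denominator at \<open>x\<close>.\<close>
    define a :: "nat + nat \<Rightarrow> 'k alg_closure" where "a = case_sum (\<lambda>_. 0) (\<lambda>i. g i x)"
    have den_a: "(\<Sum>i\<in>I. v i * a i) = den v x" for v
      by (simp add: I_def sum.Plus den_def a_def)
    have lin: "num (\<lambda>i. v i - e * u i) y = num v y - e * num u y" "den (\<lambda>i. v i - e * u i) y = den v y - e * den u y"
        "num (\<lambda>i. e * v i) y = e * num v y" "den (\<lambda>i. e * v i) y = e * den v y" for v u e y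
      by (simp_all add: num_def den_def sum_distrib_left sum_subtractf algebra_simps)
    have "\<exists>w\<in>M. (\<forall>i\<in>I. w i \<in> range to_ac) \<and> (\<Sum>i\<in>I. w i * a i) \<noteq> 0"
    proof (rule rational_vector[of I M "case_sum c d" a])
      show "finite I" by (simp add: I_def)
      show "case_sum c d \<in> M"
        unfolding M_def
      proof (intro CollectI conjI ballI)
        show "case_sum c d i \<in> ksep" if "i \<in> I" for i using that f(2) g(2) by (auto simp: I_def)
        fix y assume y: "y \<in> U \<inter> W"
        have "num (case_sum c d) y = p y * q y" "den (case_sum c d) y = q y * q y"
          using f(1) g(1) by (simp_all add: num_def den_def fun_eq_iff)
        moreover have "h y * (q y * q y) = p y * q y"
        proof (cases "q y = 0")
          case False
          then have "h y = p y / q y" using hpq y by blast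
          with False show ?thesis by simp
        qed simp
        ultimately show "h y * den (case_sum c d) y = num (case_sum c d) y" by simp
      qed
      show "(\<Sum>i\<in>I. case_sum c d i * a i) \<noteq> 0"
        using mult_eq_0_iff[of "q x" "q x"] U(4) fun_cong[OF g(1), of x] by (simp add: den_a den_def del: mult_eq_0_iff)
      show "v i \<in> ksep" if "v \<in> M" "i \<in> I" for v i using that by (simp add: M_def)
      show "(\<lambda>i. v i - e * u i) \<in> M" if "v \<in> M" "u \<in> M" "e \<in> ksep" for v u e
      proof -
        have "h y * (den v y - e * den u y) = num v y - e * num u y" if "y \<in> U \<inter> W" for y
        proof -
          have "h y * den v y = num v y" "h y * den u y = num u y"
            using \<open>v \<in> M\<close> \<open>u \<in> M\<close> that by (auto simp: M_def)
          then show ?thesis by (simp add: right_diff_distrib mult.left_commute)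
        qed
        with that show ?thesis by (simp add: M_def lin ksep_closed)
      qed
      show "(\<lambda>i. e * v i) \<in> M" if "v \<in> M" "e \<in> ksep" for v e
      proof -
        have "h y * (e * den v y) = e * num v y" if "y \<in> U \<inter> W" for y
        proof -
          have "h y * den v y = num v y" using \<open>v \<in> M\<close> that by (auto simp: M_def)
          then show ?thesis by (simp add: mult.left_commute)
        qed
        with that show ?thesis by (simp add: M_def lin ksep_closed)
      qed
      show "(\<lambda>i. \<tau> (v i)) \<in> M" if v: "v \<in> M" and \<tau>: "\<tau> \<in> Aut_ac" for v \<tau>
        unfolding M_def
      proof (intro CollectI conjI ballI)
        show "\<tau> (v i) \<in> ksep" if "i \<in> I" for i using v that Aut_ac_ksep[OF \<tau>] by (simp add: M_def)
        fix y assume y: "y \<in> U \<inter> W"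
        then have "y \<in> points X" using openin_subset[OF Uo] by blast
        then obtain z where r: "conj_related X (inv_into UNIV \<tau>) y z"
          using X(2) Aut_ac_inv[OF \<tau>] unfolding conj_space_def by blast
        have r': "conj_related X \<tau> z y"
          using conj_related_inv[OF Aut_ac_inv[OF \<tau>] r] inv_inv_eq[OF Aut_acD(4)[OF \<tau>]] by simp
        have z: "z \<in> U \<inter> W"
          using y conj_relatedD(2)[OF r Uo] stable[OF \<tau> r'] by blast
        have "\<tau> (v (Inl i)) * f i y = \<tau> (v (Inl i) * f i z)" if "i < n" for i
          using conj_relatedD(3)[OF r' sh f(3)[OF that]] z by (simp add: Aut_acD(2)[OF \<tau>])
        then have 1: "num (\<lambda>i. \<tau> (v i)) y = \<tau> (num v z)" by (simp add: num_def Aut_ac_sum[OF \<tau>])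
        have "\<tau> (v (Inr i)) * g i y = \<tau> (v (Inr i) * g i z)" if "i < m" for i
          using conj_relatedD(3)[OF r' sh g(3)[OF that]] z by (simp add: Aut_acD(2)[OF \<tau>])
        then have 2: "den (\<lambda>i. \<tau> (v i)) y = \<tau> (den v z)" by (simp add: den_def Aut_ac_sum[OF \<tau>])
        have "h y = \<tau> (h z)" using equiv[OF \<tau> r'] z by blast
        then have "h y * den (\<lambda>i. \<tau> (v i)) y = \<tau> (h z * den v z)" by (simp add: 2 Aut_acD(2)[OF \<tau>])
        also have "\<dots> = num (\<lambda>i. \<tau> (v i)) y" using v z by (simp add: M_def 1)
        finally show "h y * den (\<lambda>i. \<tau> (v i)) y = num (\<lambda>i. \<tau> (v i)) y" .
      qed
    qed
    then obtain w where w: "w \<in> M" "\<forall>i\<in>I. w i \<in> range to_ac" "(\<Sum>i\<in>I. w i * a i) \<noteq> 0" by blast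
    have wI: "w (Inl i) \<in> range to_ac" if "i < n" for i
      using bspec[OF w(2)[unfolded I_def] InlI[of i]] that by simp
    have wJ: "w (Inr i) \<in> range to_ac" if "i < m" for i
      using bspec[OF w(2)[unfolded I_def] InrI[of i]] that by simp
    have num: "num w \<in> regf X U" unfolding num_def
      by (rule lincombs_regf[OF X(1) Uo lincombsI[OF conjI[OF wI f(3)]]])
    have den: "den w \<in> regf X U" unfolding den_def
      by (rule lincombs_regf[OF X(1) Uo lincombsI[OF conjI[OF wJ g(3)]]])
    define N where "N = {y \<in> U. den w y \<noteq> 0} \<inter> W"
    have N: "openin (ztop X) N" "N \<subseteq> U"
      unfolding N_def using ring_spaceD(5)[OF X(1) den] W by (auto intro: openin_Int)
    have "(\<lambda>y. num w y / den w y) \<in> regf X N"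
      by (rule ring_space_divide[OF X(1) sheaf_restrict[OF sh num N refl] sheaf_restrict[OF sh den N refl]])
         (simp add: N_def)
    then have "h \<in> regf X N"
    proof (rule sheaf_cong[OF sh])
      fix y assume y: "y \<in> N"
      then have "h y * den w y = num w y" using w(1) by (auto simp: M_def N_def)
      then show "num w y / den w y = h y" using y by (simp add: N_def field_simps)
    qed
    moreover have "x \<in> N" using x U(3) w(3) by (simp add: N_def den_a)
    ultimately show "\<exists>V. x \<in> V \<and> h \<in> regf X V" by blast
  qed
qed

text \<open>A morphism over \<open>k\<^sup>s\<close> that commutes with conjugation of points is defined over \<open>k\<close>: preimages of
  open sets over \<open>k\<close> are Galois-stable, and pullbacks of functions over \<open>k\<close> are equivariant.\<close>
lemma galois_descent:
  assumes X: "ring_space X" "conj_space X" and Y: "ring_space Y"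
    and F: "kmorphism (base_change ksep X) (base_change ksep Y) F"
    and equiv: "\<And>\<tau> x y. \<tau> \<in> Aut_ac \<Longrightarrow> conj_related X \<tau> x y \<Longrightarrow> conj_related Y \<tau> (F x) (F y)"
  shows "kmorphism X Y F"
proof (rule kmorphismI)
  note pre = bc_points[OF X(1)]
  show "F x \<in> points Y" if "x \<in> points X" for x
    using kmorphismD(1)[OF F] that by (simp add: bc_points X Y)
  have stable: "x \<in> preimg X F U" if "openin (ztop Y) U" "\<tau> \<in> Aut_ac" "conj_related X \<tau> x y" "y \<in> preimg X F U" for \<tau> x y U
    using conj_relatedD(2)[OF equiv[OF that(2,3)] that(1)] that(4) conj_relatedD(4)[OF that(3)] by simp
  show "openin (ztop X) (preimg X F U)" if U: "openin (ztop Y) U" for U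
    using kmorphismD(2)[OF F bc_open[OF Y U]] stable[OF U] unfolding pre by (rule descent_open[OF X])
  fix f U assume f: "f \<in> regf Y U"
  have U: "openin (ztop Y) U" by (rule sheaf_open[OF ring_spaceD(1)[OF Y] f])
  show "(\<lambda>x. f (F x)) \<in> regf X (preimg X F U)"
    using kmorphismD(3)[OF F bc_regf[OF Y f]] stable[OF U] unfolding pre
  proof (rule descent_regf[OF X])
    fix \<tau> x y assume \<tau>: "\<tau> \<in> Aut_ac" and r: "conj_related X \<tau> x y" and x: "x \<in> preimg X F U"
    show "f (F y) = \<tau> (f (F x))"
      using conj_relatedD(3)[OF equiv[OF \<tau> r] ring_spaceD(1)[OF Y] f] x by simp
  qed
qed

section \<open>Products of spaces\<close>

definition prod_funs :: "'i set \<Rightarrow> ('i \<Rightarrow> ('k::field, 'p) kspace) \<Rightarrow> ('i \<Rightarrow> 'p set) \<Rightarrow> (('i \<Rightarrow> 'p) \<Rightarrow> 'k alg_closure) set" where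
  "prod_funs A X U = {\<lambda>x. \<Prod>i\<in>A. f i (x i) | f. \<forall>i\<in>A. f i \<in> regf (X i) (U i)}"

lemma prod_funsI: "\<forall>i\<in>A. f i \<in> regf (X i) (U i) \<Longrightarrow> (\<lambda>x. \<Prod>i\<in>A. f i (x i)) \<in> prod_funs A X U"
  unfolding prod_funs_def by blast

definition prod_family :: "'i set \<Rightarrow> ('i \<Rightarrow> ('k::field, 'p) kspace) \<Rightarrow> (('i \<Rightarrow> 'p) set \<times> (('i \<Rightarrow> 'p) \<Rightarrow> 'k alg_closure)) set" where
  "prod_family A X = {(\<Pi>\<^sub>E i\<in>A. U i, h) | U h. (\<forall>i\<in>A. openin (ztop (X i)) (U i))
      \<and> h \<in> lincombs (range to_ac) (prod_funs A X U)}"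

lemma prod_space_eq: "prod_space A X = gen_space (prod_family A X)"
proof -
  have "{(\<Pi>\<^sub>E i\<in>A. U i, \<lambda>x. \<Sum>l<n. to_ac (c l) * (\<Prod>i\<in>A. f l i (x i))) | U (n::nat) c f.
        \<forall>i\<in>A. openin (ztop (X i)) (U i) \<and> (\<forall>l<n. f l i \<in> regf (X i) (U i))} = prod_family A X"
    (is "?L = _")
  proof (intro subset_antisym subsetI)
    fix z assume "z \<in> ?L"
    then obtain U and n :: nat and c f where z: "z = (\<Pi>\<^sub>E i\<in>A. U i, \<lambda>x. \<Sum>l<n. to_ac (c l) * (\<Prod>i\<in>A. f l i (x i)))"
      "\<forall>i\<in>A. openin (ztop (X i)) (U i) \<and> (\<forall>l<n. f l i \<in> regf (X i) (U i))" by blast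
    have "(\<lambda>x. \<Sum>l<n. to_ac (c l) * (\<Prod>i\<in>A. f l i (x i))) \<in> lincombs (range to_ac) (prod_funs A X U)"
      using z(2) by (intro lincombsI) (auto simp: prod_funs_def)
    then show "z \<in> prod_family A X" using z by (auto simp: prod_family_def)
  next
    fix z assume "z \<in> prod_family A X"
    then obtain U h where z: "z = (\<Pi>\<^sub>E i\<in>A. U i, h)" "\<forall>i\<in>A. openin (ztop (X i)) (U i)"
      "h \<in> lincombs (range to_ac) (prod_funs A X U)" by (auto simp: prod_family_def)
    from z(3) obtain n :: nat and c g where h: "h = (\<lambda>x. \<Sum>l<n. c l * g l x)"
      "\<And>l. l < n \<Longrightarrow> c l \<in> range to_ac" "\<And>l. l < n \<Longrightarrow> g l \<in> prod_funs A X U" by (rule lincombsE) blast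
    have "\<forall>l. \<exists>f. l < n \<longrightarrow> g l = (\<lambda>x. \<Prod>i\<in>A. f i (x i)) \<and> (\<forall>i\<in>A. f i \<in> regf (X i) (U i))"
      using h(3) unfolding prod_funs_def by blast
    from choice[OF this] obtain F where
      F: "\<And>l. l < n \<Longrightarrow> g l = (\<lambda>x. \<Prod>i\<in>A. F l i (x i)) \<and> (\<forall>i\<in>A. F l i \<in> regf (X i) (U i))"
      by blast
    have "h = (\<lambda>x. \<Sum>l<n. to_ac (of_ac (c l)) * (\<Prod>i\<in>A. F l i (x i)))"
      unfolding h(1) using F h(2) by (intro ext sum.cong) (auto simp: to_ac_of_ac)
    then have zF: "z = (\<Pi>\<^sub>E i\<in>A. U i, \<lambda>x. \<Sum>l<n. to_ac (of_ac (c l)) * (\<Prod>i\<in>A. F l i (x i)))"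
      using z(1) by simp
    have Fr: "\<forall>i\<in>A. openin (ztop (X i)) (U i) \<and> (\<forall>l<n. F l i \<in> regf (X i) (U i))"
      using z(2) F by blast
    show "z \<in> ?L"
      by (rule CollectI, rule exI[of _ U], rule exI[of _ n], rule exI[of _ "\<lambda>l. of_ac (c l)"],
          rule exI[of _ F]) (rule conjI[OF zF Fr])
  qed
  then show ?thesis unfolding prod_space_def by (rule arg_cong)
qed

lemma prod_gen_family:
  assumes X: "\<forall>i\<in>A. ring_space (X i)"
  shows "gen_family (prod_family A X)"
  unfolding gen_family_def
proof (intro conjI allI impI)
  note X' = bspec[OF X]
  fix S T f g c
  assume "(S, f) \<in> prod_family A X"
  then obtain U where f: "S = (\<Pi>\<^sub>E i\<in>A. U i)" "\<forall>i\<in>A. openin (ztop (X i)) (U i)"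
     "f \<in> lincombs (range to_ac) (prod_funs A X U)" by (auto simp: prod_family_def)
  have "(\<lambda>_. 1) \<in> prod_funs A X U"
    using f(2) ring_space_one[OF X'] by (auto simp: prod_funs_def intro!: exI[of _ "\<lambda>_ _. 1"])
  from lincombs_single[OF _ this, of "to_ac c" "range to_ac"]
  show "(S, \<lambda>_. to_ac c) \<in> prod_family A X" using f(1,2) by (auto simp: prod_family_def)
  assume "(T, g) \<in> prod_family A X"
  then obtain V where g: "T = (\<Pi>\<^sub>E i\<in>A. V i)" "\<forall>i\<in>A. openin (ztop (X i)) (V i)"
     "g \<in> lincombs (range to_ac) (prod_funs A X V)" by (auto simp: prod_family_def)
  let ?W = "\<lambda>i. U i \<inter> V i"
  have ST: "S \<inter> T = (\<Pi>\<^sub>E i\<in>A. ?W i)" using f(1) g(1) by (simp add: PiE_Int)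
  have Wo: "\<forall>i\<in>A. openin (ztop (X i)) (?W i)" using f(2) g(2) by (simp add: openin_Int)
  have sub: "prod_funs A X U \<subseteq> prod_funs A X ?W" "prod_funs A X V \<subseteq> prod_funs A X ?W"
    using sheaf_restrict[OF ring_spaceD(1)[OF X'] _ bspec[OF Wo] _ refl] unfolding prod_funs_def by blast+
  have f': "f \<in> lincombs (range to_ac) (prod_funs A X ?W)" and g': "g \<in> lincombs (range to_ac) (prod_funs A X ?W)"
    using lincombs_mono[OF f(3) subset_refl sub(1)] lincombs_mono[OF g(3) subset_refl sub(2)] .
  show "(S \<inter> T, \<lambda>x. f x + g x) \<in> prod_family A X"
    using ST Wo lincombs_add[OF g' f'] unfolding prod_family_def by blast
  have "(\<lambda>x. f x * g x) \<in> lincombs (range to_ac) (prod_funs A X ?W)"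
  proof (rule lincombs_mult[OF f' g'])
    show "a * b \<in> range to_ac" if "a \<in> range to_ac" "b \<in> range to_ac" for a b :: "'b alg_closure"
    proof -
      from that obtain a' b' where "a = to_ac a'" "b = to_ac b'" by blast
      then have "a * b = to_ac (a' * b')" by simp
      then show ?thesis by blast
    qed
    fix a b assume "a \<in> prod_funs A X ?W" "b \<in> prod_funs A X ?W"
    then obtain a' b' where a': "a = (\<lambda>x. \<Prod>i\<in>A. a' i (x i))" "\<forall>i\<in>A. a' i \<in> regf (X i) (?W i)"
      and b': "b = (\<lambda>x. \<Prod>i\<in>A. b' i (x i))" "\<forall>i\<in>A. b' i \<in> regf (X i) (?W i)"
      unfolding prod_funs_def by blast
    have "(\<lambda>x. a x * b x) = (\<lambda>x. \<Prod>i\<in>A. a' i (x i) * b' i (x i))" by (simp add: a' b' prod.distrib)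
    moreover have "\<forall>i\<in>A. (\<lambda>x. a' i x * b' i x) \<in> regf (X i) (?W i)"
      using ring_spaceD(4)[OF X'] a'(2) b'(2) by blast
    ultimately show "(\<lambda>x. a x * b x) \<in> prod_funs A X ?W"
      unfolding prod_funs_def by (intro CollectI exI[of _ "\<lambda>i x. a' i x * b' i x"]) simp
  qed
  then show "(S \<inter> T, \<lambda>x. f x * g x) \<in> prod_family A X"
    using ST Wo unfolding prod_family_def by blast
qed

lemma prod_ring_space: "\<forall>i\<in>A. ring_space (X i) \<Longrightarrow> ring_space (prod_space A X)"
  unfolding prod_space_eq by (intro gen_space_ring_space prod_gen_family)

lemma prod_points:
  assumes X: "\<forall>i\<in>A. ring_space (X i)"
  shows "points (prod_space A X) = (\<Pi>\<^sub>E i\<in>A. points (X i))"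
  unfolding prod_space_eq gen_space_points[OF prod_gen_family[OF X]]
proof (intro subset_antisym subsetI)
  fix x assume "x \<in> \<Union>(fst ` prod_family A X)"
  then obtain U where U: "x \<in> (\<Pi>\<^sub>E i\<in>A. U i)" "\<forall>i\<in>A. openin (ztop (X i)) (U i)"
    by (auto simp: prod_family_def)
  have "x i \<in> points (X i)" if i: "i \<in> A" for i
    using openin_subset[OF bspec[OF U(2) i]] U(1) i by auto
  then show "x \<in> (\<Pi>\<^sub>E i\<in>A. points (X i))" using U(1) by (simp add: PiE_iff)
next
  fix x assume x: "x \<in> (\<Pi>\<^sub>E i\<in>A. points (X i))"
  have "((\<Pi>\<^sub>E i\<in>A. points (X i)), \<lambda>_. 0) \<in> prod_family A X"
    unfolding prod_family_def using lincombs_zero by blast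
  from imageI[OF this, of fst] have "(\<Pi>\<^sub>E i\<in>A. points (X i)) \<in> fst ` prod_family A X" by simp
  with x show "x \<in> \<Union>(fst ` prod_family A X)" by blast
qed

lemma prod_proj:
  assumes A: "finite A" and X: "\<forall>i\<in>A. ring_space (X i)" and j: "j \<in> A"
  shows "kmorphism (prod_space A X) (X j) (\<lambda>x. x j)"
proof (rule kmorphismI)
  note X' = bspec[OF X]
  note P = prod_gen_family[OF X]
  show "x j \<in> points (X j)" if "x \<in> points (prod_space A X)" for x
    using that j by (auto simp: prod_points[OF X])
  define V where "V U i = (if i = j then U else points (X i))" for U i
  have V: "\<forall>i\<in>A. openin (ztop (X i)) (V U i)" if "openin (ztop (X j)) U" for U
    using that by (auto simp: V_def)
  have pre: "preimg (prod_space A X) (\<lambda>x. x j) U = (\<Pi>\<^sub>E i\<in>A. V U i)" if "openin (ztop (X j)) U" for U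
  proof -
    have "(\<forall>i\<in>A. x i \<in> V U i) \<longleftrightarrow> (\<forall>i\<in>A. x i \<in> points (X i)) \<and> x j \<in> U" for x
    proof
      assume L: "\<forall>i\<in>A. x i \<in> V U i"
      have "x i \<in> points (X i)" if "i \<in> A" for i
        using bspec[OF L that] openin_subset[OF \<open>openin (ztop (X j)) U\<close>] by (cases "i = j") (auto simp: V_def)
      moreover have "x j \<in> U" using bspec[OF L j] by (simp add: V_def)
      ultimately show "(\<forall>i\<in>A. x i \<in> points (X i)) \<and> x j \<in> U" by blast
    qed (simp add: V_def)
    then show ?thesis unfolding set_eq_iff mem_Collect_eq prod_points[OF X] PiE_iff by blast
  qed
  show "openin (ztop (prod_space A X)) (preimg (prod_space A X) (\<lambda>x. x j) U)" if U: "openin (ztop (X j)) U" for U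
  proof -
    have "((\<Pi>\<^sub>E i\<in>A. V U i), \<lambda>_. 0) \<in> prod_family A X"
      unfolding prod_family_def using lincombs_zero V[OF U] by blast
    from gen_space_member(1)[OF P this] show ?thesis unfolding pre[OF U] unfolding prod_space_eq .
  qed
  fix f U assume f: "f \<in> regf (X j) U"
  have U: "openin (ztop (X j)) U" by (rule sheaf_open[OF ring_spaceD(1)[OF X'[OF j]] f])
  \<comment> \<open>A function of the coordinate \<open>j\<close> is a product with all other factors equal to \<open>1\<close>.\<close>
  let ?f = "\<lambda>i. if i = j then f else (\<lambda>_. 1)"
  have fr: "\<forall>i\<in>A. ?f i \<in> regf (X i) (V U i)"
    using f ring_space_one[OF X' openin_topspace] by (auto simp: V_def)
  have feq: "(\<lambda>x. f (x j)) = (\<lambda>x. \<Prod>i\<in>A. ?f i (x i))"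
  proof
    fix x :: "'a \<Rightarrow> 'c"
    have "(\<Prod>i\<in>A. ?f i (x i)) = (\<Prod>i\<in>A. if i = j then f (x j) else 1)" by (intro prod.cong) auto
    then show "f (x j) = (\<Prod>i\<in>A. ?f i (x i))" using A j by simp
  qed
  have "(\<lambda>x. f (x j)) \<in> prod_funs A X (V U)" unfolding feq by (rule prod_funsI[OF fr])
  from lincombs_single[OF rangeI[of to_ac 1] this]
  have "(\<lambda>x. f (x j)) \<in> lincombs (range to_ac) (prod_funs A X (V U))" by simp
  then have "((\<Pi>\<^sub>E i\<in>A. V U i), \<lambda>x. f (x j)) \<in> prod_family A X"
    unfolding prod_family_def using V[OF U] by blast
  from gen_space_member(2)[OF P this]
  show "(\<lambda>x. f (x j)) \<in> regf (prod_space A X) (preimg (prod_space A X) (\<lambda>x. x j) U)"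
    unfolding pre[OF U] unfolding prod_space_eq .
qed

lemma kmorphism_into_prod:
  assumes A: "finite A" and X: "\<forall>i\<in>A. ring_space (X i)" and Z: "ring_space Z"
    and \<phi>: "\<And>i. i \<in> A \<Longrightarrow> kmorphism Z (X i) (\<lambda>z. \<phi> z i)"
    and ext: "\<And>z. z \<in> points Z \<Longrightarrow> \<phi> z \<in> extensional A"
  shows "kmorphism Z (prod_space A X) \<phi>"
  unfolding prod_space_eq
proof (rule kmorphism_gen_space[OF Z prod_gen_family[OF X]])
  note X' = bspec[OF X]
  have pts: "\<phi> z \<in> (\<Pi>\<^sub>E i\<in>A. points (X i))" if "z \<in> points Z" for z
    using kmorphismD(1)[OF \<phi> that] ext[OF that] by (auto simp: PiE_iff)
  then show "\<phi> z \<in> points (gen_space (prod_family A X))" if "z \<in> points Z" for z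
    using that prod_points[OF X] by (simp add: prod_space_eq)
  fix S h assume "(S, h) \<in> prod_family A X"
  then obtain U where U: "S = (\<Pi>\<^sub>E i\<in>A. U i)" "\<forall>i\<in>A. openin (ztop (X i)) (U i)"
    "h \<in> lincombs (range to_ac) (prod_funs A X U)" by (auto simp: prod_family_def)
  have W: "preimg Z \<phi> S = {z \<in> points Z. \<forall>i\<in>A. \<phi> z i \<in> U i}"
    using ext unfolding U(1) set_eq_iff mem_Collect_eq PiE_iff by blast
  have "openin (ztop Z) {z \<in> points Z. \<forall>i\<in>B. \<phi> z i \<in> U i}" if "B \<subseteq> A" for B
    using finite_subset[OF that A] that
  proof (induction B rule: finite_induct)
    case (insert i B)
    have "{z \<in> points Z. \<forall>i\<in>insert i B. \<phi> z i \<in> U i} = {z \<in> points Z. \<forall>i\<in>B. \<phi> z i \<in> U i} \<inter> preimg Z (\<lambda>z. \<phi> z i) (U i)"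
      by auto
    then show ?case using insert kmorphismD(2)[OF \<phi>] U(2) by (auto intro!: openin_Int)
  qed simp
  from this[of A] have Wo: "openin (ztop Z) (preimg Z \<phi> S)" unfolding W by simp
  show "(\<lambda>z. h (\<phi> z)) \<in> regf Z (preimg Z \<phi> S)"
  proof (rule lincombs_regf[OF Z Wo lincombs_comp[OF U(3)]])
    fix g assume "g \<in> prod_funs A X U"
    then obtain f where g: "g = (\<lambda>x. \<Prod>i\<in>A. f i (x i))" "\<forall>i\<in>A. f i \<in> regf (X i) (U i)"
      unfolding prod_funs_def by blast
    have "(\<lambda>z. f i (\<phi> z i)) \<in> regf Z (preimg Z \<phi> S)" if i: "i \<in> A" for i
    proof (rule sheaf_restrict[OF ring_spaceD(1)[OF Z] kmorphismD(3)[OF \<phi>[OF i] bspec[OF g(2) i]] Wo _ refl])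
      show "preimg Z \<phi> S \<subseteq> preimg Z (\<lambda>z. \<phi> z i) (U i)" unfolding W using i by auto
    qed
    then show "(\<lambda>z. g (\<phi> z)) \<in> regf Z (preimg Z \<phi> S)" unfolding g(1) by (rule ring_space_prod[OF Z Wo])
  qed
qed

text \<open>Conjugation on a product is componentwise; the projections show uniqueness.\<close>
lemma prod_conj_space:
  fixes X :: "'i \<Rightarrow> ('k::field, 'p) kspace"
  assumes A: "finite A" and X: "\<forall>i\<in>A. ring_space (X i)" and C: "\<And>i. i \<in> A \<Longrightarrow> conj_space (X i)"
  shows "conj_space (prod_space A X)"
  unfolding conj_space_def
proof (intro ballI)
  note X' = bspec[OF X]
  fix \<tau> :: "'k alg_closure \<Rightarrow> 'k alg_closure" and x
  assume \<tau>: "\<tau> \<in> Aut_ac" and x: "x \<in> points (prod_space A X)"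
  have xi: "x i \<in> points (X i)" if "i \<in> A" for i using x that by (auto simp: prod_points[OF X])
  define y where "y = (\<lambda>i\<in>A. pt_act (X i) \<tau> (x i))"
  have y: "conj_related (X i) \<tau> (x i) (y i)" if "i \<in> A" for i
    using pt_act_related[OF C[OF that] \<tau> xi[OF that]] that by (simp add: y_def)
  show "\<exists>!y. conj_related (prod_space A X) \<tau> x y"
  proof (rule ex1I)
    show "conj_related (prod_space A X) \<tau> x y"
      unfolding prod_space_eq
    proof (rule gen_space_conj_related[OF prod_gen_family[OF X] \<tau> x[unfolded prod_space_eq]])
      fix S h assume "(S, h) \<in> prod_family A X"
      then obtain U where U: "S = (\<Pi>\<^sub>E i\<in>A. U i)" "\<forall>i\<in>A. openin (ztop (X i)) (U i)"
        "h \<in> lincombs (range to_ac) (prod_funs A X U)" by (auto simp: prod_family_def)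
      have ext: "x \<in> extensional A" "y \<in> extensional A"
        using x unfolding prod_points[OF X] PiE_iff y_def by simp_all
      have "y i \<in> U i \<longleftrightarrow> x i \<in> U i" if "i \<in> A" for i
        using conj_relatedD(2)[OF y[OF that]] U(2) that by blast
      then have 1: "y \<in> S \<longleftrightarrow> x \<in> S" using ext unfolding U(1) PiE_iff by blast
      have "h y = \<tau> (h x)" if xS: "x \<in> S"
      proof (rule lincombs_conj[OF \<tau> U(3)])
        fix g assume "g \<in> prod_funs A X U"
        then obtain f where g: "g = (\<lambda>x. \<Prod>i\<in>A. f i (x i))" "\<forall>i\<in>A. f i \<in> regf (X i) (U i)"
          unfolding prod_funs_def by blast
        have "f i (y i) = \<tau> (f i (x i))" if i: "i \<in> A" for i
          using conj_relatedD(3)[OF y[OF i] ring_spaceD(1)[OF X'[OF i]] bspec[OF g(2) i]] xS i by (auto simp: U(1))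
        then show "g y = \<tau> (g x)" by (simp add: g(1) Aut_ac_prod[OF \<tau>])
      qed
      with 1 show "(y \<in> S \<longleftrightarrow> x \<in> S) \<and> (x \<in> S \<longrightarrow> h y = \<tau> (h x))" by blast
    qed
    fix z assume z: "conj_related (prod_space A X) \<tau> x z"
    show "z = y"
    proof (rule extensionalityI[of _ A])
      show "z \<in> extensional A" using conj_relatedD(1)[OF z] unfolding prod_points[OF X] PiE_iff by simp
      show "y \<in> extensional A" by (simp add: y_def)
      fix i assume i: "i \<in> A"
      have "conj_related (X i) \<tau> (x i) (z i)"
        by (rule conj_related_kmorphism[OF ring_spaceD(1)[OF X'[OF i]] prod_proj[OF A X i] z])
      then show "z i = y i" using i pt_act_eqI[OF C[OF i] \<tau>] by (simp add: y_def)
    qed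
  qed
qed

section \<open>Elements of the tensor product with the rationals\<close>

abbreviation tensor_cls :: "('r, 'm) module \<Rightarrow> ('m \<times> rat \<Rightarrow>\<^sub>0 int) \<Rightarrow> ('m \<times> rat \<Rightarrow>\<^sub>0 int) set" where
  "tensor_cls M c \<equiv> tensorQ_rel M #>\<^bsub>tensorQ_free M\<^esub> c"

abbreviation tensor :: "('r, 'm) module \<Rightarrow> 'm \<Rightarrow> rat \<Rightarrow> ('m \<times> rat \<Rightarrow>\<^sub>0 int) set" where
  "tensor M x q \<equiv> tensor_cls M (frag_of (x, q))"

definition tensorQ_gens :: "('r, 'm) module \<Rightarrow> ('m \<times> rat \<Rightarrow>\<^sub>0 int) set" where
  "tensorQ_gens M = {frag_of (x \<oplus>\<^bsub>M\<^esub> y, q) - frag_of (x, q) - frag_of (y, q) | x y q.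
         x \<in> carrier M \<and> y \<in> carrier M}
      \<union> {frag_of (x, p + q) - frag_of (x, p) - frag_of (x, q) | x p q. x \<in> carrier M}"

lemma tensorQ_rel_eq: "tensorQ_rel M = generate (tensorQ_free M) (tensorQ_gens M)"
  by (simp add: tensorQ_rel_def tensorQ_gens_def)

lemma carrier_tensorQ_free: "c \<in> carrier (tensorQ_free M) \<longleftrightarrow> Poly_Mapping.keys c \<subseteq> carrier M \<times> UNIV"
  by (simp add: tensorQ_free_def)

lemma tensorQ_free_comm_group: "comm_group (tensorQ_free M)"
  unfolding tensorQ_free_def by (rule abelian_free_Abelian_group)

context
  fixes M :: "('r, 'm) module"
  assumes M: "abelian_group M"
begin

interpretation M: abelian_group M by (rule M)

interpretation F: comm_group "tensorQ_free M" by (rule tensorQ_free_comm_group)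

lemma tensorQ_gens_carrier: "tensorQ_gens M \<subseteq> carrier (tensorQ_free M)"
proof
  fix c assume "c \<in> tensorQ_gens M"
  then obtain u v w where "c = frag_of u - frag_of v - frag_of w" "{u, v, w} \<subseteq> carrier M \<times> UNIV"
    unfolding tensorQ_gens_def by fastforce
  moreover have "Poly_Mapping.keys (frag_of u - frag_of v - frag_of w) \<subseteq> {u, v, w}"
    using keys_diff[of "frag_of u - frag_of v" "frag_of w"] keys_diff[of "frag_of u" "frag_of v"] by auto
  ultimately show "c \<in> carrier (tensorQ_free M)" by (auto simp: carrier_tensorQ_free)
qed

lemma tensorQ_rel_subgroup: "subgroup (tensorQ_rel M) (tensorQ_free M)"
  unfolding tensorQ_rel_eq by (rule F.generate_is_subgroup[OF tensorQ_gens_carrier])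

lemma tensorQ_rel_normal: "tensorQ_rel M \<lhd> tensorQ_free M"
  using tensorQ_rel_subgroup F.normal_iff_subgroup by blast

lemma tensorQ_comm_group: "comm_group (tensorQ M)"
  unfolding tensorQ_def by (rule F.abelian_FactGroup[OF tensorQ_rel_subgroup])

interpretation T: comm_group "tensorQ M" by (rule tensorQ_comm_group)

lemma tensor_cls_hom: "tensor_cls M \<in> hom (tensorQ_free M) (tensorQ M)"
  unfolding tensorQ_def by (rule normal.r_coset_hom_Mod[OF tensorQ_rel_normal])

lemma carrier_tensorQ: "carrier (tensorQ M) = tensor_cls M ` carrier (tensorQ_free M)"
  unfolding tensorQ_def carrier_FactGroup ..

lemma tensor_cls_closed: "c \<in> carrier (tensorQ_free M) \<Longrightarrow> tensor_cls M c \<in> carrier (tensorQ M)"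
  unfolding carrier_tensorQ by (rule imageI)

lemma frag_of_closed: "x \<in> carrier M \<Longrightarrow> frag_of (x, q) \<in> carrier (tensorQ_free M)"
  by (simp add: carrier_tensorQ_free)

lemma tensor_closed [simp]: "x \<in> carrier M \<Longrightarrow> tensor M x q \<in> carrier (tensorQ M)"
  by (intro tensor_cls_closed frag_of_closed)

lemma tensorQ_free_add: "c \<in> carrier (tensorQ_free M) \<Longrightarrow> d \<in> carrier (tensorQ_free M) \<Longrightarrow> c + d \<in> carrier (tensorQ_free M)"
  using F.m_closed[of c d] by (simp add: tensorQ_free_def)

lemma tensorQ_free_minus: "c \<in> carrier (tensorQ_free M) \<Longrightarrow> - c \<in> carrier (tensorQ_free M)"
  by (simp add: carrier_tensorQ_free)

lemma tensor_cls_add: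
  assumes "c \<in> carrier (tensorQ_free M)" "d \<in> carrier (tensorQ_free M)"
  shows "tensor_cls M (c + d) = tensor_cls M c \<otimes>\<^bsub>tensorQ M\<^esub> tensor_cls M d"
  using hom_mult[OF tensor_cls_hom assms] by (simp add: tensorQ_free_def)

lemma tensor_cls_rel:
  assumes "c \<in> carrier (tensorQ_free M)"
  shows "tensor_cls M c = \<one>\<^bsub>tensorQ M\<^esub> \<longleftrightarrow> c \<in> tensorQ_rel M"
  using F.coset_join1[OF _ assms tensorQ_rel_subgroup] F.coset_join2[OF assms tensorQ_rel_subgroup]
  by (auto simp: tensorQ_def)

lemma tensor_cls_gen:
  assumes "u \<in> carrier M \<times> UNIV" "v \<in> carrier M \<times> UNIV" "w \<in> carrier M \<times> UNIV"
    and "frag_of u - frag_of v - frag_of w \<in> tensorQ_gens M"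
  shows "tensor_cls M (frag_of u) = tensor_cls M (frag_of v) \<otimes>\<^bsub>tensorQ M\<^esub> tensor_cls M (frag_of w)"
proof -
  have c: "frag_of v \<in> carrier (tensorQ_free M)" "frag_of w \<in> carrier (tensorQ_free M)"
    using assms(2,3) by (auto simp: carrier_tensorQ_free)
  let ?g = "frag_of u - frag_of v - frag_of w"
  have g: "?g \<in> tensorQ_rel M" unfolding tensorQ_rel_eq using assms(4) by (rule generate.incl)
  have gc: "?g \<in> carrier (tensorQ_free M)" using tensorQ_gens_carrier assms(4) by blast
  have "tensor_cls M (?g + (frag_of v + frag_of w)) = tensor_cls M ?g \<otimes>\<^bsub>tensorQ M\<^esub> tensor_cls M (frag_of v + frag_of w)"
    by (intro tensor_cls_add tensorQ_free_add gc c)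
  also have "tensor_cls M ?g = \<one>\<^bsub>tensorQ M\<^esub>" using tensor_cls_rel[OF gc] g by simp
  also have "\<one>\<^bsub>tensorQ M\<^esub> \<otimes>\<^bsub>tensorQ M\<^esub> tensor_cls M (frag_of v + frag_of w) = tensor_cls M (frag_of v + frag_of w)"
    by (intro T.l_one tensor_cls_closed tensorQ_free_add c)
  also have "\<dots> = tensor_cls M (frag_of v) \<otimes>\<^bsub>tensorQ M\<^esub> tensor_cls M (frag_of w)"
    by (intro tensor_cls_add c)
  finally show ?thesis by simp
qed

lemma tensor_add_left:
  "x \<in> carrier M \<Longrightarrow> y \<in> carrier M \<Longrightarrow> tensor M (x \<oplus>\<^bsub>M\<^esub> y) q = tensor M x q \<otimes>\<^bsub>tensorQ M\<^esub> tensor M y q"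
  by (rule tensor_cls_gen) (auto simp: tensorQ_gens_def)

lemma tensor_add_right:
  "x \<in> carrier M \<Longrightarrow> tensor M x (p + q) = tensor M x p \<otimes>\<^bsub>tensorQ M\<^esub> tensor M x q"
  by (rule tensor_cls_gen) (auto simp: tensorQ_gens_def)

lemma tensor_zero_left: "tensor M \<zero>\<^bsub>M\<^esub> q = \<one>\<^bsub>tensorQ M\<^esub>"
  using tensor_add_left[of "\<zero>\<^bsub>M\<^esub>" "\<zero>\<^bsub>M\<^esub>" q] T.l_cancel_one'[of "tensor M \<zero>\<^bsub>M\<^esub> q" "tensor M \<zero>\<^bsub>M\<^esub> q"] by simp

lemma tensor_zero_right: "x \<in> carrier M \<Longrightarrow> tensor M x 0 = \<one>\<^bsub>tensorQ M\<^esub>"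
  using tensor_add_right[of x 0 0] T.l_cancel_one'[of "tensor M x 0" "tensor M x 0"] by simp

lemma tensor_hom: "(\<lambda>x. tensor M x q) \<in> hom (add_monoid M) (tensorQ M)"
  by (auto simp: hom_def tensor_add_left)

lemma tensor_nat_right: "x \<in> carrier M \<Longrightarrow> tensor M x (of_nat n * q) = tensor M x q [^]\<^bsub>tensorQ M\<^esub> n"
  by (induction n) (simp_all add: tensor_zero_right tensor_add_right algebra_simps T.m_comm)

lemma tensor_nat_left: "x \<in> carrier M \<Longrightarrow> tensor M ([n] \<cdot>\<^bsub>M\<^esub> x) q = tensor M x q [^]\<^bsub>tensorQ M\<^esub> (n::nat)"
  by (induction n) (simp_all add: tensor_zero_left tensor_add_left)

lemma tensor_minus:
  assumes x: "x \<in> carrier M"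
  shows "tensor M (\<ominus>\<^bsub>M\<^esub> x) q = inv\<^bsub>tensorQ M\<^esub> tensor M x q" "tensor M x (- q) = inv\<^bsub>tensorQ M\<^esub> tensor M x q"
proof -
  show "tensor M (\<ominus>\<^bsub>M\<^esub> x) q = inv\<^bsub>tensorQ M\<^esub> tensor M x q"
    using x tensor_add_left[of "\<ominus>\<^bsub>M\<^esub> x" x q] tensor_zero_left by (intro T.inv_equality[symmetric]) (simp_all add: M.l_neg)
  show "tensor M x (- q) = inv\<^bsub>tensorQ M\<^esub> tensor M x q"
    using x tensor_add_right[of x "- q" q] tensor_zero_right by (intro T.inv_equality[symmetric]) simp_all
qed

lemma tensor_fraction:
  assumes x: "x \<in> carrier M"
  shows "\<exists>m>0. \<exists>y\<in>carrier M. tensor M x q [^]\<^bsub>tensorQ M\<^esub> (m::nat) = tensor M y 1"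
proof -
  obtain a b where ab: "quotient_of q = (a, b)" by (cases "quotient_of q")
  have b: "b > 0" using quotient_of_denom_pos[OF ab] .
  have q: "q = of_int a / of_int b" using quotient_of_div[OF ab] .
  have "tensor M x q [^]\<^bsub>tensorQ M\<^esub> nat b = tensor M x (of_nat (nat b) * q)"
    using x by (simp add: tensor_nat_right)
  also have "of_nat (nat b) * q = of_int a" using b by (simp add: q)
  also have "\<exists>y\<in>carrier M. tensor M x (of_int a) = tensor M y 1"
  proof (cases "a \<ge> 0")
    case True
    then have "tensor M x (of_int a) = tensor M x (of_nat (nat a) * 1)" by simp
    also have "\<dots> = tensor M ([nat a] \<cdot>\<^bsub>M\<^esub> x) 1"
      unfolding tensor_nat_right[OF x] tensor_nat_left[OF x] ..
    finally show ?thesis using x by blast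
  next
    case False
    then have "tensor M x (of_int a) = tensor M x (- (of_nat (nat (- a)) * 1))" by simp
    also have "\<dots> = tensor M (\<ominus>\<^bsub>M\<^esub> ([nat (- a)] \<cdot>\<^bsub>M\<^esub> x)) 1"
      unfolding tensor_minus(2)[OF x] tensor_nat_right[OF x]
      using x by (simp add: tensor_minus(1) tensor_nat_left)
    finally show ?thesis using x by blast
  qed
  finally show ?thesis using b by (intro exI[of _ "nat b"]) simp
qed

text \<open>Every element of \<open>M \<otimes> \<rat>\<close> has a common denominator. As \<^const>\<open>tensorQ\<close> is written
  multiplicatively, multiplication by \<open>m\<close> appears as an \<open>m\<close>-th power.\<close>
lemma tensorQ_fraction:
  assumes X: "X \<in> carrier (tensorQ M)"
  shows "\<exists>m>0. \<exists>x\<in>carrier M. X [^]\<^bsub>tensorQ M\<^esub> (m::nat) = tensor M x 1"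
proof -
  define Q where "Q X \<longleftrightarrow> (\<exists>m>0. \<exists>x\<in>carrier M. X [^]\<^bsub>tensorQ M\<^esub> (m::nat) = tensor M x 1)" for X
  obtain c where c: "Poly_Mapping.keys c \<subseteq> carrier M \<times> UNIV" "X = tensor_cls M c"
    using X unfolding carrier_tensorQ carrier_tensorQ_free[symmetric] by auto
  have "c \<in> carrier (tensorQ_free M) \<and> Q (tensor_cls M c)"
    using c(1)
  proof (induction c rule: frag_induction)
    case zero
    have "0 \<in> carrier (tensorQ_free M)" by (simp add: carrier_tensorQ_free)
    moreover have "tensor_cls M 0 = \<one>\<^bsub>tensorQ M\<^esub>"
      using hom_one[OF tensor_cls_hom F.is_group T.is_group] by (simp add: tensorQ_free_def)
    then have "tensor_cls M 0 [^]\<^bsub>tensorQ M\<^esub> (1::nat) = tensor M \<zero>\<^bsub>M\<^esub> 1" by (simp add: tensor_zero_left)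
    then have "Q (tensor_cls M 0)" unfolding Q_def by (intro exI[of _ "1::nat"] conjI bexI[of _ "\<zero>\<^bsub>M\<^esub>"]) simp_all
    ultimately show ?case by blast
  next
    case (one z)
    then obtain x q where "z = (x, q)" "x \<in> carrier M" by auto
    then show ?case using tensor_fraction[of x q] frag_of_closed[of x q] unfolding Q_def by simp
  next
    case (diff a b)
    then have ab: "a \<in> carrier (tensorQ_free M)" "b \<in> carrier (tensorQ_free M)" by auto
    let ?A = "tensor_cls M a" and ?B = "tensor_cls M b"
    have AB: "?A \<in> carrier (tensorQ M)" "?B \<in> carrier (tensorQ M)" using ab tensor_cls_closed by auto
    have "tensor_cls M (- b) = inv\<^bsub>tensorQ M\<^esub> ?B"
      using group_hom.hom_inv[OF group_hom.intro[OF F.is_group T.is_group group_hom_axioms.intro[OF tensor_cls_hom]] ab(2)] ab(2)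
      by (simp add: tensorQ_free_def)
    then have eq: "tensor_cls M (a - b) = ?A \<otimes>\<^bsub>tensorQ M\<^esub> inv\<^bsub>tensorQ M\<^esub> ?B"
      using tensor_cls_add[OF ab(1) tensorQ_free_minus[OF ab(2)]] by simp
    obtain m :: nat and x where m: "m > 0" "x \<in> carrier M" "?A [^]\<^bsub>tensorQ M\<^esub> m = tensor M x 1"
      using diff(1) unfolding Q_def by blast
    obtain n :: nat and y where n: "n > 0" "y \<in> carrier M" "?B [^]\<^bsub>tensorQ M\<^esub> n = tensor M y 1"
      using diff(2) unfolding Q_def by blast
    have "tensor_cls M (a - b) [^]\<^bsub>tensorQ M\<^esub> (m * n)
        = ?A [^]\<^bsub>tensorQ M\<^esub> (m * n) \<otimes>\<^bsub>tensorQ M\<^esub> inv\<^bsub>tensorQ M\<^esub> (?B [^]\<^bsub>tensorQ M\<^esub> (n * m))"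
      unfolding eq using AB by (simp add: T.pow_mult_distrib T.m_comm T.nat_pow_inv mult.commute)
    also have "\<dots> = tensor M ([n] \<cdot>\<^bsub>M\<^esub> x) 1 \<otimes>\<^bsub>tensorQ M\<^esub> tensor M (\<ominus>\<^bsub>M\<^esub> ([m] \<cdot>\<^bsub>M\<^esub> y)) 1"
      using AB m n by (simp add: T.nat_pow_pow[symmetric] tensor_minus tensor_nat_left)
    also have "\<dots> = tensor M ([n] \<cdot>\<^bsub>M\<^esub> x \<oplus>\<^bsub>M\<^esub> \<ominus>\<^bsub>M\<^esub> ([m] \<cdot>\<^bsub>M\<^esub> y)) 1"
      using m n by (intro tensor_add_left[symmetric]) simp_all
    finally have "Q (tensor_cls M (a - b))" unfolding Q_def using m n by (intro exI[of _ "m * n"]) auto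
    moreover have "a - b \<in> carrier (tensorQ_free M)"
      using tensorQ_free_add[OF ab(1) tensorQ_free_minus[OF ab(2)]] by simp
    ultimately show ?case by blast
  qed
  then show ?thesis using c(2) Q_def by blast
qed

lemma rat_common_denom: "\<exists>D>0. of_nat D * (q::rat) \<in> \<int>"
proof -
  obtain a b where ab: "quotient_of q = (a, b)" by (cases "quotient_of q")
  have b: "b > 0" using quotient_of_denom_pos[OF ab] .
  have "of_nat (nat b) * q = of_int a" using quotient_of_div[OF ab] b by simp
  then show ?thesis using b by (intro exI[of _ "nat b"]) auto
qed

text \<open>The kernel of \<open>M \<rightarrow> M \<otimes> \<rat>\<close> is the torsion of \<open>M\<close>. For each integer \<open>D > 0\<close> consider the additive map
  \<open>h D\<close> on formal sums with \<open>(x, q) \<mapsto> (D q) x\<close> when \<open>D q\<close> is an integer and \<open>(x, q) \<mapsto> 0\<close> otherwise. It does not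
  respect all relations, but every single relation involves finitely many rationals and so is killed
  by \<open>h D\<close> for all multiples \<open>D\<close> of some number. If the class of \<open>(x, 1)\<close> vanishes, this gives \<open>D x = 0\<close>.\<close>
lemma tensor_torsion:
  assumes x: "x \<in> carrier M" and eq: "tensor M x 1 = \<one>\<^bsub>tensorQ M\<^esub>"
  shows "\<exists>D>0. [(D::nat)] \<cdot>\<^bsub>M\<^esub> x = \<zero>\<^bsub>M\<^esub>"
proof -
  have AG: "group (add_monoid M)" by (rule comm_group.axioms(2)[OF M.a_comm_group])
  define f :: "nat \<Rightarrow> 'm \<times> rat \<Rightarrow> 'm" where
    "f D = (\<lambda>(x, q). if of_nat D * q \<in> \<int> then [\<lfloor>of_nat D * q\<rfloor>] \<cdot>\<^bsub>M\<^esub> x else \<zero>\<^bsub>M\<^esub>)" for D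
  have fc: "f D ` (carrier M \<times> UNIV) \<subseteq> carrier (add_monoid M)" for D by (auto simp: f_def)
  have "\<exists>h. h \<in> hom (tensorQ_free M) (add_monoid M) \<and> (\<forall>z\<in>carrier M \<times> UNIV. h (frag_of z) = f D z)" for D
    unfolding tensorQ_free_def using comm_group.free_Abelian_group_universal[OF M.a_comm_group fc[of D]] by metis
  then obtain h where h: "\<And>D. h D \<in> hom (tensorQ_free M) (add_monoid M)"
    "\<And>D z. z \<in> carrier M \<times> UNIV \<Longrightarrow> h D (frag_of z) = f D z" by metis
  interpret h: group_hom "tensorQ_free M" "add_monoid M" "h D" for D
    using h(1) by (intro group_hom.intro group_hom_axioms.intro F.is_group AG)
  have hdiff: "h D (frag_of u - frag_of v - frag_of w) = f D u \<ominus>\<^bsub>M\<^esub> f D v \<ominus>\<^bsub>M\<^esub> f D w"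
    if "u \<in> carrier M \<times> UNIV" "v \<in> carrier M \<times> UNIV" "w \<in> carrier M \<times> UNIV" for D u v w
  proof -
    have c: "frag_of u \<in> carrier (tensorQ_free M)" "- frag_of v \<in> carrier (tensorQ_free M)" "- frag_of w \<in> carrier (tensorQ_free M)"
      using that by (auto simp: carrier_tensorQ_free)
    have neg: "h D (- frag_of z) = \<ominus>\<^bsub>M\<^esub> f D z" if "z \<in> carrier M \<times> UNIV" for z
      using h.hom_inv[of "frag_of z" D] that h(2)[OF that, of D]
      by (simp add: tensorQ_free_def a_inv_def del: h.hom_inv)
    have "h D (frag_of u + - frag_of v + - frag_of w) = h D (frag_of u) \<oplus>\<^bsub>M\<^esub> h D (- frag_of v) \<oplus>\<^bsub>M\<^esub> h D (- frag_of w)"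
      using h.hom_mult[OF tensorQ_free_add[OF c(1,2)] c(3), of D] h.hom_mult[OF c(1,2), of D]
      by (simp add: tensorQ_free_def)
    then show ?thesis using that by (simp add: neg h(2) a_minus_def)
  qed
  have cancel: "(a \<oplus>\<^bsub>M\<^esub> b) \<ominus>\<^bsub>M\<^esub> a \<ominus>\<^bsub>M\<^esub> b = \<zero>\<^bsub>M\<^esub>" if "a \<in> carrier M" "b \<in> carrier M" for a b
    using that by (simp add: a_minus_def M.a_comm[of a b] M.a_assoc M.r_neg)
  have "\<exists>D>0. \<forall>k. h (k * D) c = \<zero>\<^bsub>M\<^esub>" if "c \<in> tensorQ_gens M" for c
  proof -
    from that consider y z q where "c = frag_of (y \<oplus>\<^bsub>M\<^esub> z, q) - frag_of (y, q) - frag_of (z, q)" "y \<in> carrier M" "z \<in> carrier M"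
      | y p q where "c = frag_of (y, p + q) - frag_of (y, p) - frag_of (y, q)" "y \<in> carrier M"
      unfolding tensorQ_gens_def by blast
    then show ?thesis
    proof cases
      case 1
      have "h D c = \<zero>\<^bsub>M\<^esub>" for D
      proof -
        have "f D (y \<oplus>\<^bsub>M\<^esub> z, q) = f D (y, q) \<oplus>\<^bsub>M\<^esub> f D (z, q)"
          using 1 by (simp add: f_def M.add.int_pow_distrib)
        moreover have "f D (y, q) \<in> carrier M" "f D (z, q) \<in> carrier M" using 1 by (auto simp: f_def)
        ultimately show ?thesis
          unfolding 1(1) using 1 by (subst hdiff) (simp_all add: cancel)
      qed
      then show ?thesis by blast
    next
      case 2
      obtain D1 where D1: "D1 > 0" "of_nat D1 * p \<in> \<int>" using rat_common_denom by blast
      obtain D2 where D2: "D2 > 0" "of_nat D2 * q \<in> \<int>" using rat_common_denom by blast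
      have "h (k * (D1 * D2)) c = \<zero>\<^bsub>M\<^esub>" for k
      proof -
        let ?D = "k * (D1 * D2)"
        have "of_nat ?D * p = of_nat (k * D2) * (of_nat D1 * p)" "of_nat ?D * q = of_nat (k * D1) * (of_nat D2 * q)"
          by simp_all
        then have Z: "of_nat ?D * p \<in> \<int>" "of_nat ?D * q \<in> \<int>" using D1(2) D2(2) by (metis Ints_mult Ints_of_nat)+
        then have Z': "of_nat ?D * (p + q) \<in> \<int>" by (simp add: distrib_left)
        obtain a b where ab: "of_nat ?D * p = of_int a" "of_nat ?D * q = of_int b" using Z by (auto elim!: Ints_cases)
        then have "of_nat ?D * (p + q) = of_int (a + b)" by (simp add: distrib_left)
        then have "f ?D (y, p + q) = ([(a + b)] \<cdot>\<^bsub>M\<^esub> y)" "f ?D (y, p) = ([a] \<cdot>\<^bsub>M\<^esub> y)" "f ?D (y, q) = ([b] \<cdot>\<^bsub>M\<^esub> y)"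
          using ab unfolding f_def prod.case by (simp_all only: Ints_of_int if_True floor_of_int)
        then have "f ?D (y, p + q) = f ?D (y, p) \<oplus>\<^bsub>M\<^esub> f ?D (y, q)" using 2 by (simp add: M.add.int_pow_mult)
        moreover have "f ?D (y, p) \<in> carrier M" "f ?D (y, q) \<in> carrier M" using 2 by (auto simp: f_def)
        ultimately show ?thesis
          unfolding 2(1) using 2 by (subst hdiff) (simp_all add: cancel)
      qed
      then show ?thesis using D1(1) D2(1) by (intro exI[of _ "D1 * D2"]) simp
    qed
  qed
  note gens = this
  \<comment> \<open>For a sum of two relations, the product of the two numbers works.\<close>
  have rel: "\<exists>D>0. \<forall>k. h (k * D) c = \<zero>\<^bsub>M\<^esub>" if "c \<in> tensorQ_rel M" for c
    using that unfolding tensorQ_rel_eq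
  proof (induction rule: generate.induct)
    case one
    show ?case using h.hom_one by auto
  next
    case (incl c)
    then show ?case by (rule gens)
  next
    case (inv c)
    have cc: "c \<in> carrier (tensorQ_free M)" using inv tensorQ_gens_carrier by blast
    obtain D where "D > 0" "\<forall>k. h (k * D) c = \<zero>\<^bsub>M\<^esub>" using gens[OF inv] by blast
    then show ?case using h.hom_inv[OF cc] monoid.inv_one[OF group.is_monoid[OF AG]] by (intro exI[of _ D]) simp
  next
    case (eng c d)
    have cd: "c \<in> carrier (tensorQ_free M)" "d \<in> carrier (tensorQ_free M)"
      using eng(1,2) F.generate_in_carrier[OF tensorQ_gens_carrier] by auto
    obtain D where D: "D > 0" "\<And>k. h (k * D) c = \<zero>\<^bsub>M\<^esub>" using eng by blast
    obtain E where E: "E > 0" "\<And>k. h (k * E) d = \<zero>\<^bsub>M\<^esub>" using eng by blast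
    have "h (k * (D * E)) (c \<otimes>\<^bsub>tensorQ_free M\<^esub> d) = \<zero>\<^bsub>M\<^esub>" for k
      using h.hom_mult[OF cd, of "k * (D * E)"] D(2)[of "k * E"] E(2)[of "k * D"] by (simp add: ac_simps)
    then show ?case using D E by (intro exI[of _ "D * E"]) simp
  qed
  have "frag_of (x, 1) \<in> tensorQ_rel M" using eq tensor_cls_rel[OF frag_of_closed[OF x]] by blast
  then obtain D where D: "D > 0" "\<forall>k. h (k * D) (frag_of (x, 1)) = \<zero>\<^bsub>M\<^esub>" using rel by blast
  from D(2)[rule_format, of 1] have "f D (x, 1) = \<zero>\<^bsub>M\<^esub>" using h(2)[of "(x, 1)" D] x by simp
  then have "[int D] \<cdot>\<^bsub>M\<^esub> x = \<zero>\<^bsub>M\<^esub>" by (simp add: f_def)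
  then show ?thesis using D(1) int_pow_int[of "add_monoid M" x D] by (auto simp: add_pow_def)
qed

text \<open>The induced map is given by applying \<open>f\<close> to the formal sums that represent a class, because \<open>f\<close> maps
  relations to relations.\<close>
lemma tensorQ_map_cls:
  assumes f: "f \<in> carrier M \<rightarrow> carrier M" "\<And>x y. x \<in> carrier M \<Longrightarrow> y \<in> carrier M \<Longrightarrow> f (x \<oplus>\<^bsub>M\<^esub> y) = f x \<oplus>\<^bsub>M\<^esub> f y"
    and c: "c \<in> carrier (tensorQ_free M)"
  shows "tensorQ_map M f (tensor_cls M c) = tensor_cls M (frag_extend (\<lambda>(x, q). frag_of (f x, q)) c)"
    and "frag_extend (\<lambda>(x, q). frag_of (f x, q)) c \<in> carrier (tensorQ_free M)"
proof -
  let ?F = "frag_extend (\<lambda>(x, q). frag_of (f x, q))"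
  have Fc: "?F c \<in> carrier (tensorQ_free M)" if "c \<in> carrier (tensorQ_free M)" for c
    using keys_frag_extend[of "\<lambda>(x, q). frag_of (f x, q)" c] that f(1) by (fastforce simp: carrier_tensorQ_free)
  then show "?F c \<in> carrier (tensorQ_free M)" using c .
  have Frel: "?F r \<in> tensorQ_rel M" if "r \<in> tensorQ_rel M" for r
    using that unfolding tensorQ_rel_eq
  proof (induction rule: generate.induct)
    case one
    have "\<one>\<^bsub>tensorQ_free M\<^esub> = 0" by (simp add: tensorQ_free_def)
    then show ?case using generate.one[of "tensorQ_free M"] by simp
  next
    case (incl r)
    then have "?F r \<in> tensorQ_gens M" using f unfolding tensorQ_gens_def
      by (fastforce simp: frag_extend_diff)
    then show ?case by (rule generate.incl)
  next
    case (inv r)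
    then have "?F r \<in> tensorQ_gens M" using f unfolding tensorQ_gens_def
      by (fastforce simp: frag_extend_diff)
    moreover have "r \<in> carrier (tensorQ_free M)" using inv tensorQ_gens_carrier by blast
    ultimately show ?case
      using generate.inv[of "?F r" "tensorQ_gens M" "tensorQ_free M"] Fc[of r]
      by (simp add: tensorQ_free_def frag_extend_minus)
  next
    case (eng a b)
    then show ?case using generate.eng[of "?F a" "tensorQ_free M" "tensorQ_gens M" "?F b"]
      by (simp add: tensorQ_free_def frag_extend_add)
  qed
  have cls: "tensor_cls M u = {r + u | r. r \<in> tensorQ_rel M}" for u
    by (auto simp: r_coset_def tensorQ_free_def)
  have add: "r + s \<in> tensorQ_rel M" if "r \<in> tensorQ_rel M" "s \<in> tensorQ_rel M" for r s
    using subgroup.m_closed[OF tensorQ_rel_subgroup that] by (simp add: tensorQ_free_def)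
  have zero: "0 \<in> tensorQ_rel M"
    using subgroup.one_closed[OF tensorQ_rel_subgroup] by (simp add: tensorQ_free_def)
  show "tensorQ_map M f (tensor_cls M c) = tensor_cls M (?F c)"
  proof (intro subset_antisym subsetI)
    fix z assume "z \<in> tensorQ_map M f (tensor_cls M c)"
    then obtain r s where "r \<in> tensorQ_rel M" "s \<in> tensorQ_rel M" "z = r + ?F (s + c)"
      unfolding tensorQ_map_def cls set_mult_def by (auto simp: tensorQ_free_def)
    then have "z = (r + ?F s) + ?F c" "r + ?F s \<in> tensorQ_rel M"
      using add Frel by (auto simp: frag_extend_add)
    then show "z \<in> tensor_cls M (?F c)" unfolding cls by blast
  next
    fix z assume "z \<in> tensor_cls M (?F c)"
    then obtain r where "r \<in> tensorQ_rel M" "z = r + ?F (0 + c)" unfolding cls by auto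
    then show "z \<in> tensorQ_map M f (tensor_cls M c)"
      using zero unfolding tensorQ_map_def cls set_mult_def by (fastforce simp: tensorQ_free_def)
  qed
qed

lemma tensorQ_map_tensor:
  assumes "f \<in> carrier M \<rightarrow> carrier M" "\<And>x y. x \<in> carrier M \<Longrightarrow> y \<in> carrier M \<Longrightarrow> f (x \<oplus>\<^bsub>M\<^esub> y) = f x \<oplus>\<^bsub>M\<^esub> f y"
    and "x \<in> carrier M"
  shows "tensorQ_map M f (tensor M x q) = tensor M (f x) q"
  using tensorQ_map_cls(1)[OF assms(1,2) frag_of_closed[OF assms(3)]] by simp

lemma tensorQ_map_hom:
  assumes f: "f \<in> carrier M \<rightarrow> carrier M" "\<And>x y. x \<in> carrier M \<Longrightarrow> y \<in> carrier M \<Longrightarrow> f (x \<oplus>\<^bsub>M\<^esub> y) = f x \<oplus>\<^bsub>M\<^esub> f y"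
  shows "tensorQ_map M f \<in> hom (tensorQ M) (tensorQ M)"
proof (rule homI)
  note cls = tensorQ_map_cls[OF f]
  show "tensorQ_map M f X \<in> carrier (tensorQ M)" if "X \<in> carrier (tensorQ M)" for X
    using that cls tensor_cls_closed unfolding carrier_tensorQ by auto
  fix X Y assume "X \<in> carrier (tensorQ M)" "Y \<in> carrier (tensorQ M)"
  then obtain c d where c: "c \<in> carrier (tensorQ_free M)" "X = tensor_cls M c"
    and d: "d \<in> carrier (tensorQ_free M)" "Y = tensor_cls M d" unfolding carrier_tensorQ by blast
  show "tensorQ_map M f (X \<otimes>\<^bsub>tensorQ M\<^esub> Y) = tensorQ_map M f X \<otimes>\<^bsub>tensorQ M\<^esub> tensorQ_map M f Y"
    using c d cls tensorQ_free_add by (simp add: tensor_cls_add[symmetric] frag_extend_add)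
qed

end

section \<open>Linear maps and coordinates on free modules\<close>

lemma linear_mapD:
  assumes "linear_map R M N f"
  shows "x \<in> carrier M \<Longrightarrow> f x \<in> carrier N"
    and "x \<in> carrier M \<Longrightarrow> y \<in> carrier M \<Longrightarrow> f (x \<oplus>\<^bsub>M\<^esub> y) = f x \<oplus>\<^bsub>N\<^esub> f y"
    and "a \<in> carrier R \<Longrightarrow> x \<in> carrier M \<Longrightarrow> f (a \<odot>\<^bsub>M\<^esub> x) = a \<odot>\<^bsub>N\<^esub> f x"
    and "f \<in> carrier M \<rightarrow> carrier N"
  using assms by (auto simp: linear_map_def)

lemma linear_mapI:
  assumes "\<And>x. x \<in> carrier M \<Longrightarrow> f x \<in> carrier N"
    and "\<And>x y. x \<in> carrier M \<Longrightarrow> y \<in> carrier M \<Longrightarrow> f (x \<oplus>\<^bsub>M\<^esub> y) = f x \<oplus>\<^bsub>N\<^esub> f y"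
    and "\<And>a x. a \<in> carrier R \<Longrightarrow> x \<in> carrier M \<Longrightarrow> f (a \<odot>\<^bsub>M\<^esub> x) = a \<odot>\<^bsub>N\<^esub> f x"
  shows "linear_map R M N f"
  using assms by (auto simp: linear_map_def)

lemma linear_map_comp:
  "linear_map R M N f \<Longrightarrow> linear_map R N P g \<Longrightarrow> linear_map R M P (\<lambda>x. g (f x))"
  by (auto simp: linear_map_def Pi_iff)

lemma module_abelian_group: "module R M \<Longrightarrow> abelian_group M"
  by (rule module.axioms(2))

lemma linear_map_hom:
  "linear_map R M N f \<Longrightarrow> f \<in> hom (add_monoid M) (add_monoid N)"
  by (auto simp: hom_def linear_map_def)

lemma linear_map_zero:
  assumes f: "linear_map R M N f" and M: "module R M" and N: "module R N"
  shows "f \<zero>\<^bsub>M\<^esub> = \<zero>\<^bsub>N\<^esub>"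
proof -
  interpret M: module R M by (rule M)
  interpret N: module R N by (rule N)
  show ?thesis
    using hom_one[OF linear_map_hom[OF f]] M.add.is_group N.add.is_group by simp
qed

lemma linear_map_finsum:
  assumes f: "linear_map R M N f" and M: "module R M" and N: "module R N"
    and u: "\<And>i. i \<in> A \<Longrightarrow> u i \<in> carrier M"
  shows "f (finsum M u A) = finsum N (\<lambda>i. f (u i)) A"
proof -
  interpret M: module R M by (rule M)
  interpret N: module R N by (rule N)
  show ?thesis
    using u
  proof (induction A rule: infinite_finite_induct)
    case (insert i A)
    then have "u \<in> A \<rightarrow> carrier M" "(\<lambda>i. f (u i)) \<in> A \<rightarrow> carrier N" using linear_mapD(1)[OF f] by auto
    then show ?case using insert linear_mapD[OF f] by (simp add: M.finsum_insert N.finsum_insert)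
  qed (simp_all add: linear_map_zero[OF f M N])
qed

lemma hom_finsum:
  assumes h: "h \<in> hom (add_monoid M) G" and M: "abelian_group M" and G: "comm_group G"
    and u: "\<And>i. i \<in> A \<Longrightarrow> u i \<in> carrier M"
  shows "h (finsum M u A) = finprod G (\<lambda>i. h (u i)) A"
proof -
  interpret M: abelian_group M by (rule M)
  interpret G: comm_group G by (rule G)
  have h0: "h \<zero>\<^bsub>M\<^esub> = \<one>\<^bsub>G\<^esub>" using hom_one[OF h M.add.is_group G.is_group] by simp
  have hc: "h x \<in> carrier G" if "x \<in> carrier M" for x using hom_in_carrier[OF h] that by simp
  show ?thesis
    using u
  proof (induction A rule: infinite_finite_induct)
    case (insert i A)
    then have "u \<in> A \<rightarrow> carrier M" "(\<lambda>i. h (u i)) \<in> A \<rightarrow> carrier G" using hc by auto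
    then show ?case using insert hom_mult[OF h] hc by (simp add: M.finsum_insert G.finprod_insert)
  qed (simp_all add: h0)
qed

lemma (in module) nat_smult_right:
  "a \<in> carrier R \<Longrightarrow> x \<in> carrier M \<Longrightarrow> a \<odot>\<^bsub>M\<^esub> ([n] \<cdot>\<^bsub>M\<^esub> x) = [(n::nat)] \<cdot>\<^bsub>M\<^esub> (a \<odot>\<^bsub>M\<^esub> x)"
  by (induction n) (simp_all add: smult_r_distr)

lemma linear_map_nat:
  assumes f: "linear_map R M N f" and M: "module R M" and N: "module R N" and x: "x \<in> carrier M"
  shows "f ([(n::nat)] \<cdot>\<^bsub>M\<^esub> x) = [n] \<cdot>\<^bsub>N\<^esub> f x"
proof -
  interpret M: module R M by (rule M)
  interpret N: module R N by (rule N)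
  show ?thesis
    by (induction n) (use x linear_mapD[OF f] in \<open>simp_all add: linear_map_zero[OF f M N]\<close>)
qed

lemma linear_map_nat_multiple:
  assumes f: "linear_map R M N f" and N: "module R N"
  shows "linear_map R M N (\<lambda>x. [(n::nat)] \<cdot>\<^bsub>N\<^esub> f x)"
proof -
  interpret N: module R N by (rule N)
  show ?thesis
    using linear_mapD[OF f]
    by (intro linear_mapI) (simp_all add: N.nat_smult_right N.add.nat_pow_distrib)
qed

abbreviation basis_vec :: "('r, 'a) ring_scheme \<Rightarrow> nat \<Rightarrow> ((nat \<Rightarrow> 'r) \<Rightarrow> 'm) \<Rightarrow> nat \<Rightarrow> 'm" where
  "basis_vec R d j b \<equiv> j (unit_vec R d b)"

abbreviation coord :: "('r, 'a) ring_scheme \<Rightarrow> nat \<Rightarrow> ((nat \<Rightarrow> 'r) \<Rightarrow> 'm) \<Rightarrow> 'm \<Rightarrow> nat \<Rightarrow> 'r" where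
  "coord R d j \<equiv> inv_into (carrier (free_mod R d)) j"

text \<open>Finitely many conditions that are stable under taking multiples can be met by one integer. Finite
  generation of modules and finiteness of the Galois action enter through this lemma.\<close>
lemma common_multiple:
  assumes "finite S" "\<And>s. s \<in> S \<Longrightarrow> \<exists>m>0. P s (m::nat)" "\<And>s m k. s \<in> S \<Longrightarrow> P s m \<Longrightarrow> k > 0 \<Longrightarrow> P s (k * m)"
  shows "\<exists>m>0. \<forall>s\<in>S. P s m"
  using assms
proof (induction S rule: finite_induct)
  case empty show ?case by (intro exI[of _ 1]) simp
next
  case (insert s S)
  then obtain m where m: "m > 0" "\<forall>s\<in>S. P s m" by blast
  obtain k where k: "k > 0" "P s k" using insert.prems(1) by blast
  have "P s (m * k)" using insert.prems(2)[of s k m] k m by simp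
  moreover have "P u (m * k)" if "u \<in> S" for u
    using insert.prems(2)[of u m k] m k that by (simp add: mult.commute)
  ultimately show ?case using m(1) k(1) by (intro exI[of _ "m * k"]) simp
qed

lemma scalar_linear:
  assumes "module R N" "a \<in> carrier R" shows "linear_map R N N (\<lambda>x. a \<odot>\<^bsub>N\<^esub> x)"
proof -
  interpret N: module R N by (rule assms(1))
  show ?thesis
    by (rule linear_mapI)
       (use assms(2) in \<open>simp_all add: N.smult_r_distr N.smult_assoc1[symmetric] N.R.m_comm\<close>)
qed

lemma unit_vec_closed: "ring R \<Longrightarrow> unit_vec R d b \<in> carrier (free_mod R d)"
  by (auto simp: free_mod_def unit_vec_def ring.ring_simprules)

lemma free_mod_closed:
  assumes "ring R"
  shows "v \<in> carrier (free_mod R d) \<Longrightarrow> w \<in> carrier (free_mod R d) \<Longrightarrow> v \<oplus>\<^bsub>free_mod R d\<^esub> w \<in> carrier (free_mod R d)"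
  and "a \<in> carrier R \<Longrightarrow> v \<in> carrier (free_mod R d) \<Longrightarrow> a \<odot>\<^bsub>free_mod R d\<^esub> v \<in> carrier (free_mod R d)"
  using assms by (auto simp: free_mod_def PiE_iff ring.ring_simprules)

context
  fixes R :: "'r ring" and M :: "('r, 'm) module" and d j
  assumes M: "module R M" and j: "basis_iso R M d j"
begin

interpretation M: module R M by (rule M)

lemmas RR = M.R.ring_axioms

lemma basis_linear: "linear_map R (free_mod R d) M j"
  using j by (simp add: basis_iso_def)

lemma basis_inj: "inj_on j (carrier (free_mod R d))"
  and basis_image: "j ` carrier (free_mod R d) = carrier M"
  using j by (auto simp: basis_iso_def bij_betw_def)

lemma basis_vec_closed: "basis_vec R d j b \<in> carrier M"
  using linear_mapD(1)[OF basis_linear unit_vec_closed[OF RR]] .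

lemma coord_closed: "x \<in> carrier M \<Longrightarrow> coord R d j x \<in> carrier (free_mod R d)"
  using inv_into_into[of x j] basis_image by metis

lemma coord_entry: "x \<in> carrier M \<Longrightarrow> b < d \<Longrightarrow> coord R d j x b \<in> carrier R"
  using coord_closed[of x] by (auto simp: free_mod_def)

lemma basis_coord: "x \<in> carrier M \<Longrightarrow> j (coord R d j x) = x"
  using f_inv_into_f[of x j] basis_image by metis

lemma coord_basis: "v \<in> carrier (free_mod R d) \<Longrightarrow> coord R d j (j v) = v"
  by (rule inv_into_f_f[OF basis_inj])

lemma coord_linear: "linear_map R M (free_mod R d) (coord R d j)"
proof (rule linear_mapI[OF coord_closed])
  fix x y assume xy: "x \<in> carrier M" "y \<in> carrier M"
  have "coord R d j (j (coord R d j x \<oplus>\<^bsub>free_mod R d\<^esub> coord R d j y)) = coord R d j x \<oplus>\<^bsub>free_mod R d\<^esub> coord R d j y"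
    by (intro coord_basis free_mod_closed[OF RR] coord_closed xy)
  then show "coord R d j (x \<oplus>\<^bsub>M\<^esub> y) = coord R d j x \<oplus>\<^bsub>free_mod R d\<^esub> coord R d j y"
    using linear_mapD(2)[OF basis_linear coord_closed[OF xy(1)] coord_closed[OF xy(2)]] by (simp add: basis_coord xy)
next
  fix a x assume ax: "a \<in> carrier R" "x \<in> carrier M"
  have "coord R d j (j (a \<odot>\<^bsub>free_mod R d\<^esub> coord R d j x)) = a \<odot>\<^bsub>free_mod R d\<^esub> coord R d j x"
    by (intro coord_basis free_mod_closed[OF RR] coord_closed ax)
  then show "coord R d j (a \<odot>\<^bsub>M\<^esub> x) = a \<odot>\<^bsub>free_mod R d\<^esub> coord R d j x"
    using linear_mapD(3)[OF basis_linear ax(1) coord_closed[OF ax(2)]] by (simp add: basis_coord ax)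
qed

text \<open>The scalar multiples of basis vectors generate the module additively, so that additive
  statements can be checked on them.\<close>
lemma basis_induct [consumes 1, case_names zero add smult]:
  assumes x: "x \<in> carrier M" and zero: "P \<zero>\<^bsub>M\<^esub>"
    and add: "\<And>x y. x \<in> carrier M \<Longrightarrow> y \<in> carrier M \<Longrightarrow> P x \<Longrightarrow> P y \<Longrightarrow> P (x \<oplus>\<^bsub>M\<^esub> y)"
    and smult: "\<And>a b. a \<in> carrier R \<Longrightarrow> b < d \<Longrightarrow> P (a \<odot>\<^bsub>M\<^esub> basis_vec R d j b)"
  shows "P x"
proof -
  define v where "v = coord R d j x"
  have v: "v \<in> carrier (free_mod R d)" unfolding v_def by (rule coord_closed[OF x])
  define w where "w k = (\<lambda>i\<in>{..<d}. if i < k then v i else \<zero>\<^bsub>R\<^esub>)" for k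
  have vR: "v i \<in> carrier R" if "i < d" for i unfolding v_def by (rule coord_entry[OF x that])
  have w: "w k \<in> carrier (free_mod R d)" for k by (simp add: w_def free_mod_def PiE_iff vR)
  have w0: "j (w 0) = \<zero>\<^bsub>M\<^esub>"
  proof -
    have "w 0 \<oplus>\<^bsub>free_mod R d\<^esub> w 0 = w 0" by (simp add: w_def free_mod_def fun_eq_iff)
    then have "j (w 0) \<oplus>\<^bsub>M\<^esub> j (w 0) = j (w 0)" using linear_mapD(2)[OF basis_linear w[of 0] w[of 0]] by simp
    then show ?thesis using linear_mapD(1)[OF basis_linear w[of 0]] M.add.l_cancel_one' by metis
  qed
  have "P (j (w k))" if "k \<le> d" for k
    using that
  proof (induction k)
    case 0 show ?case using zero w0 by simp
  next
    case (Suc k)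
    have "w (Suc k) = w k \<oplus>\<^bsub>free_mod R d\<^esub> (v k \<odot>\<^bsub>free_mod R d\<^esub> unit_vec R d k)"
      unfolding w_def unit_vec_def free_mod_def
      using vR Suc.prems by (simp add: fun_eq_iff less_Suc_eq)
    then have "j (w (Suc k)) = j (w k) \<oplus>\<^bsub>M\<^esub> v k \<odot>\<^bsub>M\<^esub> basis_vec R d j k"
      using Suc.prems w vR free_mod_closed[OF RR] unit_vec_closed[OF RR] linear_mapD(2,3)[OF basis_linear] by simp
    then show ?case
      using Suc w vR by (simp add: add smult linear_mapD(1)[OF basis_linear] basis_vec_closed)
  qed
  moreover have "w d = v"
  proof (rule extensionalityI[of _ "{..<d}"])
    show "v \<in> extensional {..<d}" using v by (simp add: free_mod_def PiE_iff)
  qed (simp_all add: w_def)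
  ultimately show "P x" using basis_coord[OF x] by (metis order_refl v_def)
qed

lemma linear_extension:
  fixes N :: "('r, 'n) module"
  assumes N: "module R N" and y: "\<And>b. b < d \<Longrightarrow> y b \<in> carrier N"
  obtains f where "linear_map R M N f" "\<And>b. b < d \<Longrightarrow> f (basis_vec R d j b) = y b"
proof -
  interpret N: module R N by (rule N)
  define f where "f x = finsum N (\<lambda>b. coord R d j x b \<odot>\<^bsub>N\<^esub> y b) {..<d}" for x
  have trm: "(\<lambda>b. coord R d j x b \<odot>\<^bsub>N\<^esub> y b) \<in> {..<d} \<rightarrow> carrier N" if "x \<in> carrier M" for x
    using y coord_entry[OF that] by auto
  have "linear_map R M N f"
  proof (rule linear_mapI)
    show "f x \<in> carrier N" if "x \<in> carrier M" for x unfolding f_def by (intro N.finsum_closed trm that)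
    fix x z assume xz: "x \<in> carrier M" "z \<in> carrier M"
    have "f (x \<oplus>\<^bsub>M\<^esub> z) = finsum N (\<lambda>b. coord R d j x b \<odot>\<^bsub>N\<^esub> y b \<oplus>\<^bsub>N\<^esub> coord R d j z b \<odot>\<^bsub>N\<^esub> y b) {..<d}"
      unfolding f_def
    proof (rule N.finsum_cong')
      show "(\<lambda>b. coord R d j x b \<odot>\<^bsub>N\<^esub> y b \<oplus>\<^bsub>N\<^esub> coord R d j z b \<odot>\<^bsub>N\<^esub> y b) \<in> {..<d} \<rightarrow> carrier N"
        using y coord_entry xz by auto
      show "coord R d j (x \<oplus>\<^bsub>M\<^esub> z) b \<odot>\<^bsub>N\<^esub> y b = coord R d j x b \<odot>\<^bsub>N\<^esub> y b \<oplus>\<^bsub>N\<^esub> coord R d j z b \<odot>\<^bsub>N\<^esub> y b"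
        if "b \<in> {..<d}" for b
        using that y coord_entry xz linear_mapD(2)[OF coord_linear xz] by (simp add: N.smult_l_distr free_mod_def)
    qed simp
    also have "\<dots> = f x \<oplus>\<^bsub>N\<^esub> f z"
      unfolding f_def by (intro N.finsum_addf trm xz)
    finally show "f (x \<oplus>\<^bsub>M\<^esub> z) = f x \<oplus>\<^bsub>N\<^esub> f z" .
  next
    fix a x assume ax: "a \<in> carrier R" "x \<in> carrier M"
    have "f (a \<odot>\<^bsub>M\<^esub> x) = finsum N (\<lambda>b. a \<odot>\<^bsub>N\<^esub> (coord R d j x b \<odot>\<^bsub>N\<^esub> y b)) {..<d}"
      unfolding f_def
    proof (rule N.finsum_cong')
      show "(\<lambda>b. a \<odot>\<^bsub>N\<^esub> (coord R d j x b \<odot>\<^bsub>N\<^esub> y b)) \<in> {..<d} \<rightarrow> carrier N"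
        using y coord_entry ax by auto
      show "coord R d j (a \<odot>\<^bsub>M\<^esub> x) b \<odot>\<^bsub>N\<^esub> y b = a \<odot>\<^bsub>N\<^esub> (coord R d j x b \<odot>\<^bsub>N\<^esub> y b)"
        if "b \<in> {..<d}" for b
        using that y coord_entry ax linear_mapD(3)[OF coord_linear ax] by (simp add: N.smult_assoc1 free_mod_def)
    qed simp
    also have "\<dots> = a \<odot>\<^bsub>N\<^esub> f x"
      unfolding f_def by (intro N.finsum_smult_ldistr[symmetric] trm ax) simp
    finally show "f (a \<odot>\<^bsub>M\<^esub> x) = a \<odot>\<^bsub>N\<^esub> f x" .
  qed
  moreover have "f (basis_vec R d j b) = y b" if b: "b < d" for b
  proof -
    have "f (basis_vec R d j b) = finsum N (\<lambda>i. if b = i then y i else \<zero>\<^bsub>N\<^esub>) {..<d}"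
      unfolding f_def coord_basis[OF unit_vec_closed[OF RR]]
      by (rule N.finsum_cong') (use y in \<open>auto simp: unit_vec_def\<close>)
    also have "\<dots> = y b" using b y by (intro N.finsum_singleton) auto
    finally show ?thesis .
  qed
  ultimately show thesis by (rule that)
qed

text \<open>Clearing denominators: some multiple of a linear map \<open>\<Phi> : M \<rightarrow> N \<otimes> \<rat>\<close> on a free module comes from a
  linear map \<open>f : M \<rightarrow> N\<close>. The images of the finitely many basis vectors have a common
  denominator, and \<open>f\<close> is defined on the basis by the numerators.\<close>
lemma integral_lift:
  fixes N :: "('r, 'n) module"
  assumes N: "module R N" and \<Phi>: "\<Phi> \<in> hom (add_monoid M) (tensorQ N)"
    and lin: "\<And>a x. a \<in> carrier R \<Longrightarrow> x \<in> carrier M \<Longrightarrow> \<Phi> (a \<odot>\<^bsub>M\<^esub> x) = tensorQ_map N (\<lambda>y. a \<odot>\<^bsub>N\<^esub> y) (\<Phi> x)"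
  shows "\<exists>m>0. \<exists>f. linear_map R M N f \<and> (\<forall>x\<in>carrier M. tensor N (f x) 1 = \<Phi> x [^]\<^bsub>tensorQ N\<^esub> (m::nat))"
proof -
  interpret N: module R N by (rule N)
  note NA = module_abelian_group[OF N]
  interpret T: comm_group "tensorQ N" by (rule tensorQ_comm_group[OF NA])
  have \<Phi>c: "\<Phi> x \<in> carrier (tensorQ N)" if "x \<in> carrier M" for x using hom_in_carrier[OF \<Phi>] that by simp
  have "\<exists>m>0. \<forall>b\<in>{..<d}. \<exists>y\<in>carrier N. \<Phi> (basis_vec R d j b) [^]\<^bsub>tensorQ N\<^esub> (m::nat) = tensor N y 1"
  proof (rule common_multiple)
    show "\<exists>m>0. \<exists>y\<in>carrier N. \<Phi> (basis_vec R d j b) [^]\<^bsub>tensorQ N\<^esub> (m::nat) = tensor N y 1" for b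
      by (rule tensorQ_fraction[OF NA \<Phi>c[OF basis_vec_closed]])
    fix b and m k :: nat assume "\<exists>y\<in>carrier N. \<Phi> (basis_vec R d j b) [^]\<^bsub>tensorQ N\<^esub> m = tensor N y 1"
    then obtain y where y: "y \<in> carrier N" "\<Phi> (basis_vec R d j b) [^]\<^bsub>tensorQ N\<^esub> m = tensor N y 1" by blast
    have "\<Phi> (basis_vec R d j b) [^]\<^bsub>tensorQ N\<^esub> (k * m) = tensor N ([k] \<cdot>\<^bsub>N\<^esub> y) 1"
      using y tensor_nat_left[OF NA y(1)] T.nat_pow_pow[OF \<Phi>c[OF basis_vec_closed], of b m k] by (simp add: mult.commute)
    then show "\<exists>y\<in>carrier N. \<Phi> (basis_vec R d j b) [^]\<^bsub>tensorQ N\<^esub> (k * m) = tensor N y 1" using y(1) by blast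
  qed simp
  then obtain m :: nat where m: "m > 0" "\<forall>b\<in>{..<d}. \<exists>y\<in>carrier N. \<Phi> (basis_vec R d j b) [^]\<^bsub>tensorQ N\<^esub> m = tensor N y 1"
    by blast
  then have "\<forall>b\<in>{..<d}. \<exists>y. y \<in> carrier N \<and> \<Phi> (basis_vec R d j b) [^]\<^bsub>tensorQ N\<^esub> m = tensor N y 1"
    by blast
  from bchoice[OF this] obtain y where y: "\<And>b. b < d \<Longrightarrow> y b \<in> carrier N"
    "\<And>b. b < d \<Longrightarrow> \<Phi> (basis_vec R d j b) [^]\<^bsub>tensorQ N\<^esub> m = tensor N (y b) 1"
    by blast
  obtain f where f: "linear_map R M N f" "\<And>b. b < d \<Longrightarrow> f (basis_vec R d j b) = y b"
    by (rule linear_extension[OF N y(1)]) blast+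
  have "tensor N (f x) 1 = \<Phi> x [^]\<^bsub>tensorQ N\<^esub> m" if "x \<in> carrier M" for x
    using that
  proof (induction rule: basis_induct)
    case zero
    have "\<Phi> \<zero>\<^bsub>M\<^esub> = \<one>\<^bsub>tensorQ N\<^esub>" using hom_one[OF \<Phi> M.add.is_group T.is_group] by simp
    then show ?case by (simp add: linear_map_zero[OF f(1) M N] tensor_zero_left[OF NA])
  next
    case (add x z)
    have "\<Phi> (x \<oplus>\<^bsub>M\<^esub> z) = \<Phi> x \<otimes>\<^bsub>tensorQ N\<^esub> \<Phi> z" using hom_mult[OF \<Phi>] add by simp
    then show ?case
      using add linear_mapD[OF f(1)] \<Phi>c by (simp add: tensor_add_left[OF NA] T.pow_mult_distrib T.m_comm)
  next
    case (smult a b)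
    let ?e = "basis_vec R d j b"
    note sc = scalar_linear[OF N smult(1)]
    have "tensor N (f (a \<odot>\<^bsub>M\<^esub> ?e)) 1 = tensor N (a \<odot>\<^bsub>N\<^esub> y b) 1"
      using smult f basis_vec_closed by (simp add: linear_mapD(3)[OF f(1)])
    also have "\<dots> = tensorQ_map N (\<lambda>y. a \<odot>\<^bsub>N\<^esub> y) (tensor N (y b) 1)"
      using smult y(1) by (intro tensorQ_map_tensor[OF NA linear_mapD(4)[OF sc] linear_mapD(2)[OF sc], symmetric])
    also have "\<dots> = tensorQ_map N (\<lambda>y. a \<odot>\<^bsub>N\<^esub> y) (\<Phi> ?e [^]\<^bsub>tensorQ N\<^esub> m)"
      using smult y(2) by simp
    also have "\<dots> = tensorQ_map N (\<lambda>y. a \<odot>\<^bsub>N\<^esub> y) (\<Phi> ?e) [^]\<^bsub>tensorQ N\<^esub> m"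
      by (intro group_hom.hom_nat_pow group_hom.intro group_hom_axioms.intro T.is_group
           tensorQ_map_hom[OF NA linear_mapD(4)[OF sc] linear_mapD(2)[OF sc]] \<Phi>c basis_vec_closed)
    also have "\<dots> = \<Phi> (a \<odot>\<^bsub>M\<^esub> ?e) [^]\<^bsub>tensorQ N\<^esub> m"
      using lin[OF smult(1) basis_vec_closed] by simp
    finally show ?case .
  qed
  then show ?thesis using m(1) f(1) by blast
qed

text \<open>Two linear maps that agree after tensoring with \<open>\<rat>\<close> agree up to multiplication by one integer: on
  each of the finitely many basis vectors they differ by a torsion element.\<close>
lemma linear_torsion:
  fixes N :: "('r, 'n) module"
  assumes N: "module R N" and u: "linear_map R M N u" and v: "linear_map R M N v"
    and eq: "\<And>x. x \<in> carrier M \<Longrightarrow> tensor N (u x) 1 = tensor N (v x) 1"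
  shows "\<exists>D>0. \<forall>x\<in>carrier M. [(D::nat)] \<cdot>\<^bsub>N\<^esub> u x = [D] \<cdot>\<^bsub>N\<^esub> v x"
proof -
  interpret N: module R N by (rule N)
  note NA = module_abelian_group[OF N]
  interpret T: comm_group "tensorQ N" by (rule tensorQ_comm_group[OF NA])
  have "\<exists>D>0. \<forall>b\<in>{..<d}. [(D::nat)] \<cdot>\<^bsub>N\<^esub> u (basis_vec R d j b) = [D] \<cdot>\<^bsub>N\<^esub> v (basis_vec R d j b)"
  proof (rule common_multiple)
    fix b
    let ?e = "basis_vec R d j b"
    have uv: "u ?e \<in> carrier N" "v ?e \<in> carrier N" using linear_mapD(1)[OF u] linear_mapD(1)[OF v] basis_vec_closed by auto
    have "tensor N (u ?e \<oplus>\<^bsub>N\<^esub> \<ominus>\<^bsub>N\<^esub> v ?e) 1 = \<one>\<^bsub>tensorQ N\<^esub>"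
      using uv eq[OF basis_vec_closed[of b]] tensor_closed[OF NA uv(2)]
      by (simp add: tensor_add_left[OF NA] tensor_minus(1)[OF NA])
    then obtain D :: nat where D: "D > 0" "[D] \<cdot>\<^bsub>N\<^esub> (u ?e \<oplus>\<^bsub>N\<^esub> \<ominus>\<^bsub>N\<^esub> v ?e) = \<zero>\<^bsub>N\<^esub>"
      using tensor_torsion[OF NA, of "u ?e \<oplus>\<^bsub>N\<^esub> \<ominus>\<^bsub>N\<^esub> v ?e"] uv by auto
    have "[D] \<cdot>\<^bsub>N\<^esub> u ?e = [D] \<cdot>\<^bsub>N\<^esub> ((u ?e \<oplus>\<^bsub>N\<^esub> \<ominus>\<^bsub>N\<^esub> v ?e) \<oplus>\<^bsub>N\<^esub> v ?e)"
      using uv by (simp add: N.a_assoc N.l_neg)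
    also have "\<dots> = [D] \<cdot>\<^bsub>N\<^esub> v ?e" using uv D(2) by (subst N.add.nat_pow_distrib) simp_all
    finally show "\<exists>D>0. [(D::nat)] \<cdot>\<^bsub>N\<^esub> u ?e = [D] \<cdot>\<^bsub>N\<^esub> v ?e" using D(1) by blast
    fix D k :: nat assume "[D] \<cdot>\<^bsub>N\<^esub> u ?e = [D] \<cdot>\<^bsub>N\<^esub> v ?e"
    then show "[(k * D)] \<cdot>\<^bsub>N\<^esub> u ?e = [(k * D)] \<cdot>\<^bsub>N\<^esub> v ?e"
      using N.add.nat_pow_pow[OF uv(1), of k D] N.add.nat_pow_pow[OF uv(2), of k D] by (simp add: mult.commute)
  qed simp
  then obtain D :: nat where D: "D > 0" "\<And>b. b < d \<Longrightarrow> [D] \<cdot>\<^bsub>N\<^esub> u (basis_vec R d j b) = [D] \<cdot>\<^bsub>N\<^esub> v (basis_vec R d j b)"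
    by auto
  note Du = linear_map_nat_multiple[OF u N, of D] and Dv = linear_map_nat_multiple[OF v N, of D]
  have "[D] \<cdot>\<^bsub>N\<^esub> u x = [D] \<cdot>\<^bsub>N\<^esub> v x" if "x \<in> carrier M" for x
    using that
  proof (induction rule: basis_induct)
    case zero show ?case by (simp add: linear_map_zero[OF u M N] linear_map_zero[OF v M N])
  next
    case (add x y) then show ?case using linear_mapD(2)[OF Du] linear_mapD(2)[OF Dv] by simp
  next
    case (smult a b)
    then show ?case using linear_mapD(3)[OF Du smult(1) basis_vec_closed] linear_mapD(3)[OF Dv smult(1) basis_vec_closed] D(2) by simp
  qed
  then show ?thesis using D(1) by blast
qed

end

section \<open>Integral maps from an isomorphism over the rationals\<close>

lemma linear_map_id: "linear_map R M M (\<lambda>x. x)"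
  by (simp add: linear_map_def)

lemma finite_image_factor:
  assumes "finite (g ` S)" "\<And>x y. x \<in> S \<Longrightarrow> y \<in> S \<Longrightarrow> g x = g y \<Longrightarrow> f x = f y"
  shows "finite (f ` S)"
proof -
  have "f ` S \<subseteq> (\<lambda>r. f (SOME x. x \<in> S \<and> g x = r)) ` g ` S"
  proof
    fix z assume "z \<in> f ` S"
    then obtain x where x: "x \<in> S" "z = f x" by blast
    have "(SOME y. y \<in> S \<and> g y = g x) \<in> S \<and> g (SOME y. y \<in> S \<and> g y = g x) = g x"
      by (rule someI[of _ x]) (use x in simp)
    then have "f (SOME y. y \<in> S \<and> g y = g x) = z" using assms(2)[OF _ x(1)] x(2) by blast
    then show "z \<in> (\<lambda>r. f (SOME x. x \<in> S \<and> g x = r)) ` g ` S" using x(1) by blast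
  qed
  then show ?thesis by (rule finite_subset[OF _ finite_imageI[OF assms(1)]])
qed

text \<open>A vector space basis of \<open>F\<close> is finite, each of its elements has finitely many conjugates, and an
  automorphism is determined on \<open>F\<close> by its values on the basis.\<close>
lemma finite_Gal_restriction:
  fixes F :: "('k::field) alg_closure set"
  assumes F: "finite_galois_subext F"
  shows "finite ((\<lambda>\<gamma>. restrict \<gamma> F) ` carrier Gal)"
proof -
  interpret V: vector_space "\<lambda>(c::'k) x. to_ac c * x"
    by unfold_locales (simp_all add: algebra_simps)
  obtain B where B: "finite B" "F \<subseteq> V.span B" and Fs: "F \<subseteq> ksep"
    using F by (auto simp: finite_galois_subext_def)
  obtain C where C: "C \<subseteq> F" "V.independent C" "F \<subseteq> V.span C"
    by (rule V.basis_exists[of F]) blast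
  have "finite C" using V.independent_span_bound[OF B(1) C(2)] C(1) B(2) by blast
  have root: "finite ((\<lambda>\<gamma>. \<gamma> b) ` carrier Gal)" if b: "b \<in> C" for b
  proof -
    obtain p :: "'k poly" where p: "p \<noteq> 0" "poly (map_poly to_ac p) b = 0"
      by (rule alg_closure_algebraic)
    have "(\<lambda>\<gamma>. \<gamma> b) ` carrier Gal \<subseteq> {y. poly (map_poly to_ac p) y = 0}"
    proof clarify
      fix \<gamma> :: "'k alg_closure \<Rightarrow> 'k alg_closure" assume \<gamma>: "\<gamma> \<in> carrier Gal"
      have "gal_ext \<gamma> b = \<gamma> b" using gal_ext_Aut(2)[OF \<gamma>] b C(1) Fs by blast
      then show "poly (map_poly to_ac p) (\<gamma> b) = 0"
        using Aut_ac_poly[OF gal_ext_Aut(1)[OF \<gamma>], of p b] p(2) gal_ext_Aut(1)[OF \<gamma>] by simp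
    qed
    moreover have "finite {y. poly (map_poly to_ac p) y = 0}" using p(1) by (intro poly_roots_finite) simp
    ultimately show ?thesis by (rule finite_subset)
  qed
  have "(\<lambda>\<gamma>. restrict \<gamma> C) ` carrier Gal \<subseteq> (\<Pi>\<^sub>E b\<in>C. (\<lambda>\<gamma>. \<gamma> b) ` carrier Gal)" by auto
  then have fin: "finite ((\<lambda>\<gamma>. restrict \<gamma> C) ` carrier Gal)"
    by (rule finite_subset) (intro finite_PiE \<open>finite C\<close> root)
  then show ?thesis
  proof (rule finite_image_factor)
    fix \<gamma> \<delta> :: "'k alg_closure \<Rightarrow> 'k alg_closure"
    assume \<gamma>: "\<gamma> \<in> carrier Gal" and \<delta>: "\<delta> \<in> carrier Gal" and eq: "restrict \<gamma> C = restrict \<delta> C"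
    note a = gal_ext_Aut(1)[OF \<gamma>] gal_ext_Aut(1)[OF \<delta>]
    have span: "gal_ext \<gamma> x = gal_ext \<delta> x" if "x \<in> V.span C" for x
      using that
    proof (rule V.span_induct)
      show "V.subspace {x. gal_ext \<gamma> x = gal_ext \<delta> x}"
        by (rule V.subspaceI) (use a in \<open>simp_all add: Aut_acD[OF a(1)] Aut_acD[OF a(2)]\<close>)
      fix x assume x: "x \<in> C"
      then have "\<gamma> x = \<delta> x" using fun_cong[OF eq, of x] by simp
      moreover have "x \<in> ksep" using x C(1) Fs by blast
      ultimately show "gal_ext \<gamma> x = gal_ext \<delta> x" using gal_ext_Aut(2)[OF \<gamma>] gal_ext_Aut(2)[OF \<delta>] by metis
    qed
    have "\<gamma> x = \<delta> x" if "x \<in> F" for x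
    proof -
      have "x \<in> V.span C" "x \<in> ksep" using that C(3) Fs by blast+
      then show ?thesis
        using span[of x] gal_ext_Aut(2)[OF \<gamma>, of x] gal_ext_Aut(2)[OF \<delta>, of x] by simp
    qed
    then show "restrict \<gamma> F = restrict \<delta> F" by (intro restrict_ext)
  qed
qed

lemma FModD:
  assumes "FMod R M"
  shows "module R (mdl M)" and "\<exists>d j. basis_iso R (mdl M) d j"
    and "\<gamma> \<in> carrier Gal \<Longrightarrow> linear_map R (mdl M) (mdl M) (\<lambda>x. gact M x \<gamma>)"
  using assms by (auto simp: FMod_def)

text \<open>Continuity of the action: it factors through the restriction to a finite extension.\<close>
lemma FMod_finite_actions:
  fixes M :: "('k::field, 'r, 'm) galmod"
  assumes M: "FMod R M"
  shows "finite ((\<lambda>\<gamma>. \<lambda>x\<in>carrier (mdl M). gact M x \<gamma>) ` carrier Gal)"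
proof -
  obtain F where F: "finite_galois_subext F"
    and dep: "\<forall>\<gamma>\<in>carrier Gal. \<forall>\<delta>\<in>carrier Gal. (\<forall>x\<in>F. \<gamma> x = \<delta> x)
                \<longrightarrow> (\<forall>x\<in>carrier (mdl M). gact M x \<gamma> = gact M x \<delta>)"
    using M unfolding FMod_def by blast
  show ?thesis
  proof (rule finite_image_factor[OF finite_Gal_restriction[OF F]])
    fix \<gamma> \<delta> :: "'k alg_closure \<Rightarrow> 'k alg_closure"
    assume *: "\<gamma> \<in> carrier Gal" "\<delta> \<in> carrier Gal" "restrict \<gamma> F = restrict \<delta> F"
    have "\<gamma> x = \<delta> x" if "x \<in> F" for x using fun_cong[OF *(3), of x] that by simp
    then have "\<forall>x\<in>carrier (mdl M). gact M x \<gamma> = gact M x \<delta>" using dep *(1,2) by blast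
    then show "(\<lambda>x\<in>carrier (mdl M). gact M x \<gamma>) = (\<lambda>x\<in>carrier (mdl M). gact M x \<delta>)"
      by (intro restrict_ext) (rule bspec)
  qed
qed

lemma nat_mult_assoc:
  assumes "module R N" "z \<in> carrier N"
  shows "[((k::nat) * m)] \<cdot>\<^bsub>N\<^esub> z = [k] \<cdot>\<^bsub>N\<^esub> ([m] \<cdot>\<^bsub>N\<^esub> z)"
proof -
  interpret N: module R N by (rule assms(1))
  show ?thesis using N.add.nat_pow_pow[OF assms(2), of k m] by (simp add: mult.commute)
qed

lemma nat_mult_closed:
  assumes "module R N" "z \<in> carrier N" shows "[(k::nat)] \<cdot>\<^bsub>N\<^esub> z \<in> carrier N"
proof -
  interpret N: module R N by (rule assms(1))
  show ?thesis using assms(2) by simp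
qed

lemma integral_lift_family:
  fixes R :: "'r ring" and M :: "'i \<Rightarrow> ('r, 'm) module" and N :: "'i \<Rightarrow> ('r, 'n) module"
  assumes A: "finite A"
    and M: "\<And>i. i \<in> A \<Longrightarrow> module R (M i)" "\<And>i. i \<in> A \<Longrightarrow> \<exists>d j. basis_iso R (M i) d j"
    and N: "\<And>i. i \<in> A \<Longrightarrow> module R (N i)"
    and \<Phi>: "\<And>i. i \<in> A \<Longrightarrow> \<Phi> i \<in> hom (add_monoid (M i)) (tensorQ (N i))"
    and lin: "\<And>i a x. i \<in> A \<Longrightarrow> a \<in> carrier R \<Longrightarrow> x \<in> carrier (M i) \<Longrightarrow>
                \<Phi> i (a \<odot>\<^bsub>M i\<^esub> x) = tensorQ_map (N i) (\<lambda>y. a \<odot>\<^bsub>N i\<^esub> y) (\<Phi> i x)"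
  obtains m :: nat and f where "m > 0" "\<And>i. i \<in> A \<Longrightarrow> linear_map R (M i) (N i) (f i)"
    "\<And>i x. i \<in> A \<Longrightarrow> x \<in> carrier (M i) \<Longrightarrow> tensor (N i) (f i x) 1 = \<Phi> i x [^]\<^bsub>tensorQ (N i)\<^esub> m"
proof -
  define P where "P i m \<longleftrightarrow> (\<exists>f. linear_map R (M i) (N i) f
      \<and> (\<forall>x\<in>carrier (M i). tensor (N i) (f x) 1 = \<Phi> i x [^]\<^bsub>tensorQ (N i)\<^esub> (m::nat)))" for i m
  have "\<exists>m>0. \<forall>i\<in>A. P i m"
  proof (rule common_multiple[OF A])
    fix i assume i: "i \<in> A"
    obtain d j where j: "basis_iso R (M i) d j" using M(2)[OF i] by blast
    show "\<exists>m>0. P i m" unfolding P_def by (rule integral_lift[OF M(1)[OF i] j N[OF i] \<Phi>[OF i]]) (rule lin[OF i])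
  next
    fix i and m k :: nat assume i: "i \<in> A" and "P i m"
    then obtain f where f: "linear_map R (M i) (N i) f"
      "\<forall>x\<in>carrier (M i). tensor (N i) (f x) 1 = \<Phi> i x [^]\<^bsub>tensorQ (N i)\<^esub> m" unfolding P_def by blast
    note NA = module_abelian_group[OF N[OF i]]
    interpret T: comm_group "tensorQ (N i)" by (rule tensorQ_comm_group[OF NA])
    have "tensor (N i) ([k] \<cdot>\<^bsub>N i\<^esub> f x) 1 = \<Phi> i x [^]\<^bsub>tensorQ (N i)\<^esub> (k * m)" if x: "x \<in> carrier (M i)" for x
      using tensor_nat_left[OF NA linear_mapD(1)[OF f(1) x], of k 1] bspec[OF f(2) x]
        T.nat_pow_pow[of "\<Phi> i x" m k] hom_in_carrier[OF \<Phi>[OF i], of x] x by (simp add: mult.commute)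
    then show "P i (k * m)" unfolding P_def using linear_map_nat_multiple[OF f(1) N[OF i]] by blast
  qed
  then obtain m where m: "m > 0" "\<forall>i\<in>A. P i m" by blast
  from bchoice[OF m(2)[unfolded P_def]] obtain f where
    "\<forall>i\<in>A. linear_map R (M i) (N i) (f i) \<and> (\<forall>x\<in>carrier (M i). tensor (N i) (f i x) 1 = \<Phi> i x [^]\<^bsub>tensorQ (N i)\<^esub> m)"
    by blast
  then show thesis using that[of m f] m(1) by blast
qed

text \<open>The isomorphism \<open>\<theta>\<close> and its inverse, restricted to \<open>I\<close> and to the \<open>J k\<close>, lift up to a common
  denominator to \<open>f\<close> and \<open>g\<close>. The compositions and the equivariance of \<open>f\<close> are correct after tensoring
  with \<open>\<rat>\<close>, hence correct up to torsion. The torsion is killed by a single integer, since there are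
  finitely many index pairs and finitely many different actions of Galois elements.\<close>
theorem integral_quasi_inverse:
  fixes R :: "'r ring" and I :: "('k::field, 'r, 'm) galmod" and J :: "'i \<Rightarrow> ('k, 'r, 'n) galmod"
  assumes I: "FMod R I" and J: "\<And>i. i \<in> A \<Longrightarrow> FMod R (J i)" and A: "finite A"
    and iso: "tensorQ_iso_sum R I A J"
  obtains n :: nat and f g where "n > 0"
    "\<And>i. i \<in> A \<Longrightarrow> linear_map R (mdl I) (mdl (J i)) (f i)"
    "\<And>i. i \<in> A \<Longrightarrow> linear_map R (mdl (J i)) (mdl I) (g i)"
    "\<And>i \<gamma> x. i \<in> A \<Longrightarrow> \<gamma> \<in> carrier Gal \<Longrightarrow> x \<in> carrier (mdl I) \<Longrightarrow> f i (gact I x \<gamma>) = gact (J i) (f i x) \<gamma>"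
    "\<And>i k y. i \<in> A \<Longrightarrow> k \<in> A \<Longrightarrow> y \<in> carrier (mdl (J k)) \<Longrightarrow>
        f i (g k y) = (if i = k then [n] \<cdot>\<^bsub>mdl (J i)\<^esub> y else \<zero>\<^bsub>mdl (J i)\<^esub>)"
    "\<And>x. x \<in> carrier (mdl I) \<Longrightarrow> finsum (mdl I) (\<lambda>i. g i (f i x)) A = [n] \<cdot>\<^bsub>mdl I\<^esub> x"
proof -
  let ?I = "mdl I" and ?J = "\<lambda>i. mdl (J i)"
  let ?TI = "tensorQ ?I" and ?T = "\<lambda>i. tensorQ (?J i)"
  note MI = FModD(1)[OF I] and MJ = FModD(1)[OF J]
  note AI = module_abelian_group[OF MI] and AJ = module_abelian_group[OF MJ]
  interpret I: module R ?I by (rule MI)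
  interpret TI: comm_group ?TI by (rule tensorQ_comm_group[OF AI])
  have TJ: "comm_group (?T i)" if "i \<in> A" for i by (rule tensorQ_comm_group[OF AJ[OF that]])
  have GJ: "group (?T i)" if "i \<in> A" for i using TJ[OF that] by (rule comm_group.axioms(2))
  obtain \<theta> where \<theta>: "\<theta> \<in> iso ?TI (product_group A ?T)"
    and \<theta>_lin: "\<And>a X. a \<in> carrier R \<Longrightarrow> X \<in> carrier ?TI \<Longrightarrow>
           \<theta> (tensorQ_map ?I (\<lambda>x. a \<odot>\<^bsub>?I\<^esub> x) X) = (\<lambda>i\<in>A. tensorQ_map (?J i) (\<lambda>x. a \<odot>\<^bsub>?J i\<^esub> x) (\<theta> X i))"
    and \<theta>_gal: "\<And>\<gamma> X. \<gamma> \<in> carrier Gal \<Longrightarrow> X \<in> carrier ?TI \<Longrightarrow>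
           \<theta> (tensorQ_map ?I (\<lambda>x. gact I x \<gamma>) X) = (\<lambda>i\<in>A. tensorQ_map (?J i) (\<lambda>x. gact (J i) x \<gamma>) (\<theta> X i))"
    using iso unfolding tensorQ_iso_sum_def by blast
  have \<theta>_hom: "\<theta> \<in> hom ?TI (product_group A ?T)" and \<theta>_bij: "bij_betw \<theta> (carrier ?TI) (\<Pi>\<^sub>E i\<in>A. carrier (?T i))"
    using \<theta> by (auto simp: iso_def)
  have \<theta>c: "\<theta> X \<in> (\<Pi>\<^sub>E i\<in>A. carrier (?T i))" if "X \<in> carrier ?TI" for X
    using hom_in_carrier[OF \<theta>_hom that] by simp
  have \<theta>_comp: "(\<lambda>X. \<theta> X i) \<in> hom ?TI (?T i)" if i: "i \<in> A" for i
  proof (rule homI)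
    show "\<theta> X i \<in> carrier (?T i)" if "X \<in> carrier ?TI" for X using \<theta>c[OF that] i by auto
    show "\<theta> (X \<otimes>\<^bsub>?TI\<^esub> Y) i = \<theta> X i \<otimes>\<^bsub>?T i\<^esub> \<theta> Y i" if "X \<in> carrier ?TI" "Y \<in> carrier ?TI" for X Y
      using hom_mult[OF \<theta>_hom that] i by simp
  qed
  have \<theta>_eqI: "X = Y" if "X \<in> carrier ?TI" "Y \<in> carrier ?TI" "\<And>i. i \<in> A \<Longrightarrow> \<theta> X i = \<theta> Y i" for X Y
  proof -
    have "\<theta> X = \<theta> Y" by (rule PiE_ext[OF \<theta>c[OF that(1)] \<theta>c[OF that(2)] that(3)])
    then show ?thesis using \<theta>_bij that(1,2) by (auto simp: bij_betw_def dest: inj_onD)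
  qed

  define \<Phi> where "\<Phi> i x = \<theta> (tensor ?I x 1) i" for i x
  have \<Phi>_hom: "\<Phi> i \<in> hom (add_monoid ?I) (?T i)" if i: "i \<in> A" for i
    using hom_compose[OF tensor_hom[OF AI, of 1] \<theta>_comp[OF i]] by (simp add: o_def \<Phi>_def[abs_def])
  have \<Phi>c: "\<Phi> i x \<in> carrier (?T i)" if "i \<in> A" "x \<in> carrier ?I" for i x
    using hom_in_carrier[OF \<Phi>_hom[OF that(1)]] that(2) by simp
  have \<Phi>_lin: "\<Phi> i (a \<odot>\<^bsub>?I\<^esub> x) = tensorQ_map (?J i) (\<lambda>y. a \<odot>\<^bsub>?J i\<^esub> y) (\<Phi> i x)"
    if "i \<in> A" "a \<in> carrier R" "x \<in> carrier ?I" for i a x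
    using \<theta>_lin[OF that(2) tensor_closed[OF AI that(3), of 1]] that
      tensorQ_map_tensor[OF AI linear_mapD(4)[OF scalar_linear[OF MI that(2)]] linear_mapD(2)[OF scalar_linear[OF MI that(2)]] that(3), of 1]
    by (simp add: \<Phi>_def)
  have \<Phi>_gal: "\<Phi> i (gact I x \<gamma>) = tensorQ_map (?J i) (\<lambda>y. gact (J i) y \<gamma>) (\<Phi> i x)"
    if "i \<in> A" "\<gamma> \<in> carrier Gal" "x \<in> carrier ?I" for i \<gamma> x
    using \<theta>_gal[OF that(2) tensor_closed[OF AI that(3), of 1]] that
      tensorQ_map_tensor[OF AI linear_mapD(4)[OF FModD(3)[OF I that(2)]] linear_mapD(2)[OF FModD(3)[OF I that(2)]] that(3), of 1]
    by (simp add: \<Phi>_def)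

  \<comment> \<open>The \<open>k\<close>-th component of the inverse of \<open>\<theta>\<close>: \<open>\<Psi> k y\<close> is the element mapped to \<open>y \<otimes> 1\<close> in the component \<open>k\<close>.\<close>
  define single where "single k t = (\<lambda>i\<in>A. if i = k then t else \<one>\<^bsub>?T i\<^esub>)" for k t
  define \<Psi> where "\<Psi> k y = inv_into (carrier ?TI) \<theta> (single k (tensor (?J k) y 1))" for k y
  have single: "single k (tensor (?J k) y 1) \<in> \<theta> ` carrier ?TI" if "k \<in> A" "y \<in> carrier (?J k)" for k y
    using \<theta>_bij that tensor_closed[OF AJ[OF that(1)] that(2)] GJ
    by (auto simp: bij_betw_def single_def group.is_monoid monoid.one_closed)
  have \<Psi>c: "\<Psi> k y \<in> carrier ?TI" if "k \<in> A" "y \<in> carrier (?J k)" for k y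
    unfolding \<Psi>_def by (rule inv_into_into[OF single[OF that]])
  have \<theta>\<Psi>: "\<theta> (\<Psi> k y) i = (if i = k then tensor (?J k) y 1 else \<one>\<^bsub>?T i\<^esub>)"
    if "k \<in> A" "y \<in> carrier (?J k)" "i \<in> A" for k y i
    unfolding \<Psi>_def f_inv_into_f[OF single[OF that(1,2)]] using that(3) by (simp add: single_def)
  have one_mult: "\<one>\<^bsub>?T i\<^esub> \<otimes>\<^bsub>?T i\<^esub> \<one>\<^bsub>?T i\<^esub> = \<one>\<^bsub>?T i\<^esub>" if "i \<in> A" for i
    using GJ[OF that] by (simp add: group.is_monoid monoid.l_one monoid.one_closed)
  have \<Psi>_hom: "\<Psi> k \<in> hom (add_monoid (?J k)) ?TI" if k: "k \<in> A" for k
  proof (rule homI)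
    show "\<Psi> k y \<in> carrier ?TI" if "y \<in> carrier (add_monoid (?J k))" for y using \<Psi>c[OF k] that by simp
    fix y z assume "y \<in> carrier (add_monoid (?J k))" "z \<in> carrier (add_monoid (?J k))"
    then have yz: "y \<in> carrier (?J k)" "z \<in> carrier (?J k)" by simp_all
    interpret Jk: module R "?J k" by (rule MJ[OF k])
    have "\<Psi> k (y \<oplus>\<^bsub>?J k\<^esub> z) = \<Psi> k y \<otimes>\<^bsub>?TI\<^esub> \<Psi> k z"
    proof (rule \<theta>_eqI)
      fix i assume i: "i \<in> A"
      show "\<theta> (\<Psi> k (y \<oplus>\<^bsub>?J k\<^esub> z)) i = \<theta> (\<Psi> k y \<otimes>\<^bsub>?TI\<^esub> \<Psi> k z) i"
        using hom_mult[OF \<theta>_comp[OF i] \<Psi>c[OF k yz(1)] \<Psi>c[OF k yz(2)]] yz k i one_mult[OF i]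
        by (simp add: \<theta>\<Psi> tensor_add_left[OF AJ])
    qed (use \<Psi>c[OF k] yz in auto)
    then show "\<Psi> k (y \<otimes>\<^bsub>add_monoid (?J k)\<^esub> z) = \<Psi> k y \<otimes>\<^bsub>?TI\<^esub> \<Psi> k z" by simp
  qed
  have \<Psi>_lin: "\<Psi> k (a \<odot>\<^bsub>?J k\<^esub> y) = tensorQ_map ?I (\<lambda>x. a \<odot>\<^bsub>?I\<^esub> x) (\<Psi> k y)"
    if k: "k \<in> A" and a: "a \<in> carrier R" and y: "y \<in> carrier (?J k)" for k a y
  proof (rule \<theta>_eqI)
    have ay: "a \<odot>\<^bsub>?J k\<^esub> y \<in> carrier (?J k)" by (rule linear_mapD(1)[OF scalar_linear[OF MJ[OF k] a] y])
    then show "\<Psi> k (a \<odot>\<^bsub>?J k\<^esub> y) \<in> carrier ?TI" by (rule \<Psi>c[OF k])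
    note scI = scalar_linear[OF MI a]
    show "tensorQ_map ?I (\<lambda>x. a \<odot>\<^bsub>?I\<^esub> x) (\<Psi> k y) \<in> carrier ?TI"
      by (rule hom_in_carrier[OF tensorQ_map_hom[OF AI linear_mapD(4)[OF scI] linear_mapD(2)[OF scI]] \<Psi>c[OF k y]])
    fix i assume i: "i \<in> A"
    note sc = scalar_linear[OF MJ[OF i] a]
    have "\<theta> (tensorQ_map ?I (\<lambda>x. a \<odot>\<^bsub>?I\<^esub> x) (\<Psi> k y)) i = tensorQ_map (?J i) (\<lambda>x. a \<odot>\<^bsub>?J i\<^esub> x) (\<theta> (\<Psi> k y) i)"
      using \<theta>_lin[OF a \<Psi>c[OF k y]] i by simp
    also have "\<dots> = (if i = k then tensor (?J k) (a \<odot>\<^bsub>?J k\<^esub> y) 1 else \<one>\<^bsub>?T i\<^esub>)"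
    proof (cases "i = k")
      case True
      then show ?thesis
        using \<theta>\<Psi>[OF k y i] tensorQ_map_tensor[OF AJ[OF i] linear_mapD(4)[OF sc] linear_mapD(2)[OF sc], of y 1] y by simp
    next
      case False
      then show ?thesis
        using \<theta>\<Psi>[OF k y i] hom_one[OF tensorQ_map_hom[OF AJ[OF i] linear_mapD(4)[OF sc] linear_mapD(2)[OF sc]] GJ[OF i] GJ[OF i]] by simp
    qed
    also have "\<dots> = \<theta> (\<Psi> k (a \<odot>\<^bsub>?J k\<^esub> y)) i" using \<theta>\<Psi>[OF k ay i] by simp
    finally show "\<theta> (\<Psi> k (a \<odot>\<^bsub>?J k\<^esub> y)) i = \<theta> (tensorQ_map ?I (\<lambda>x. a \<odot>\<^bsub>?I\<^esub> x) (\<Psi> k y)) i" ..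
  qed

  obtain m1 :: nat and f where m1: "m1 > 0" and f: "\<And>i. i \<in> A \<Longrightarrow> linear_map R ?I (?J i) (f i)"
    and \<iota>f: "\<And>i x. i \<in> A \<Longrightarrow> x \<in> carrier ?I \<Longrightarrow> tensor (?J i) (f i x) 1 = \<Phi> i x [^]\<^bsub>?T i\<^esub> m1"
    by (rule integral_lift_family[of A R "\<lambda>_. ?I" ?J \<Phi>])
       (use A MI FModD(2)[OF I] MJ \<Phi>_hom \<Phi>_lin in auto)
  obtain m2 :: nat and g where m2: "m2 > 0" and g: "\<And>i. i \<in> A \<Longrightarrow> linear_map R (?J i) ?I (g i)"
    and \<iota>g: "\<And>i x. i \<in> A \<Longrightarrow> x \<in> carrier (?J i) \<Longrightarrow> tensor ?I (g i x) 1 = \<Psi> i x [^]\<^bsub>?TI\<^esub> m2"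
    by (rule integral_lift_family[of A R ?J "\<lambda>_. ?I" \<Psi>])
       (use A MI FModD(2)[OF J] MJ \<Psi>_hom \<Psi>_lin in auto)
  define m where "m = m1 * m2"
  have m: "m > 0" using m1 m2 by (simp add: m_def)
  have fc: "f i x \<in> carrier (?J i)" if "i \<in> A" "x \<in> carrier ?I" for i x by (rule linear_mapD(1)[OF f[OF that(1)] that(2)])
  have gc: "g i x \<in> carrier ?I" if "i \<in> A" "x \<in> carrier (?J i)" for i x by (rule linear_mapD(1)[OF g[OF that(1)] that(2)])
  have \<Phi>g: "\<Phi> i (g k y) = (if i = k then tensor (?J k) y 1 [^]\<^bsub>?T k\<^esub> m2 else \<one>\<^bsub>?T i\<^esub>)"
    if i: "i \<in> A" and k: "k \<in> A" and y: "y \<in> carrier (?J k)" for i k y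
  proof -
    interpret hi: group_hom ?TI "?T i" "\<lambda>X. \<theta> X i"
      by (intro group_hom.intro group_hom_axioms.intro TI.is_group GJ i \<theta>_comp)
    have "\<Phi> i (g k y) = (\<theta> (\<Psi> k y) i) [^]\<^bsub>?T i\<^esub> m2"
      unfolding \<Phi>_def \<iota>g[OF k y] by (rule hi.hom_nat_pow[OF \<Psi>c[OF k y]])
    then show ?thesis using \<theta>\<Psi>[OF k y i] by (simp add: hi.H.nat_pow_one)
  qed
  have pow_m: "(tensor (?J i) y 1 [^]\<^bsub>?T i\<^esub> m2) [^]\<^bsub>?T i\<^esub> m1 = tensor (?J i) ([m] \<cdot>\<^bsub>?J i\<^esub> y) 1"
    if "i \<in> A" "y \<in> carrier (?J i)" for i y
  proof -
    interpret Ti: comm_group "?T i" by (rule TJ[OF that(1)])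
    show ?thesis
      using tensor_closed[OF AJ[OF that(1)] that(2)]
      by (simp add: tensor_nat_left[OF AJ[OF that(1)] that(2)] Ti.nat_pow_pow m_def mult.commute)
  qed
  have fg: "\<exists>D>0. \<forall>y\<in>carrier (?J k). [(D::nat)] \<cdot>\<^bsub>?J i\<^esub> f i (g k y)
      = [D] \<cdot>\<^bsub>?J i\<^esub> (if i = k then [m] \<cdot>\<^bsub>?J i\<^esub> y else \<zero>\<^bsub>?J i\<^esub>)" if i: "i \<in> A" and k: "k \<in> A" for i k
  proof -
    interpret Ji: module R "?J i" by (rule MJ[OF i])
    interpret Ti: comm_group "?T i" by (rule TJ[OF i])
    obtain d j where j: "basis_iso R (?J k) d j" using FModD(2)[OF J[OF k]] by blast
    show ?thesis
    proof (rule linear_torsion[OF MJ[OF k] j MJ[OF i] linear_map_comp[OF g[OF k] f[OF i]]])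
      show "linear_map R (?J k) (?J i) (\<lambda>y. if i = k then [m] \<cdot>\<^bsub>?J i\<^esub> y else \<zero>\<^bsub>?J i\<^esub>)"
      proof (cases "i = k")
        case True
        have "linear_map R (?J i) (?J i) (\<lambda>x. x)" by (rule linear_map_id)
        from linear_map_nat_multiple[OF this MJ[OF i], of m] show ?thesis using True by simp
      qed (auto intro!: linear_mapI simp: Ji.smult_r_null)
      fix y assume y: "y \<in> carrier (?J k)"
      show "tensor (?J i) (f i (g k y)) 1 = tensor (?J i) (if i = k then [m] \<cdot>\<^bsub>?J i\<^esub> y else \<zero>\<^bsub>?J i\<^esub>) 1"
        unfolding \<iota>f[OF i gc[OF k y]] \<Phi>g[OF i k y] using pow_m[OF k y]
        by (auto simp: tensor_zero_left[OF AJ[OF i]] Ti.nat_pow_one)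
    qed
  qed
  have gf: "\<exists>D>0. \<forall>x\<in>carrier ?I. [(D::nat)] \<cdot>\<^bsub>?I\<^esub> (finsum ?I (\<lambda>i. g i (f i x)) A) = [D] \<cdot>\<^bsub>?I\<^esub> ([m] \<cdot>\<^bsub>?I\<^esub> x)"
  proof -
    obtain d j where j: "basis_iso R ?I d j" using FModD(2)[OF I] by blast
    have trm: "(\<lambda>i. g i (f i x)) \<in> A \<rightarrow> carrier ?I" if "x \<in> carrier ?I" for x using fc gc that by auto
    show ?thesis
    proof (rule linear_torsion[OF MI j MI])
      show "linear_map R ?I ?I (\<lambda>x. finsum ?I (\<lambda>i. g i (f i x)) A)"
      proof (rule linear_mapI)
        show "finsum ?I (\<lambda>i. g i (f i x)) A \<in> carrier ?I" if "x \<in> carrier ?I" for x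
          by (rule I.finsum_closed[OF trm[OF that]])
        fix x y assume xy: "x \<in> carrier ?I" "y \<in> carrier ?I"
        have "finsum ?I (\<lambda>i. g i (f i (x \<oplus>\<^bsub>?I\<^esub> y))) A = finsum ?I (\<lambda>i. g i (f i x) \<oplus>\<^bsub>?I\<^esub> g i (f i y)) A"
          using xy fc gc linear_mapD(2)[OF linear_map_comp[OF f g]] by (intro I.finsum_cong') auto
        also have "\<dots> = finsum ?I (\<lambda>i. g i (f i x)) A \<oplus>\<^bsub>?I\<^esub> finsum ?I (\<lambda>i. g i (f i y)) A"
          by (rule I.finsum_addf[OF trm[OF xy(1)] trm[OF xy(2)]])
        finally show "finsum ?I (\<lambda>i. g i (f i (x \<oplus>\<^bsub>?I\<^esub> y))) A = finsum ?I (\<lambda>i. g i (f i x)) A \<oplus>\<^bsub>?I\<^esub> finsum ?I (\<lambda>i. g i (f i y)) A" .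
      next
        fix a x assume ax: "a \<in> carrier R" "x \<in> carrier ?I"
        have "finsum ?I (\<lambda>i. g i (f i (a \<odot>\<^bsub>?I\<^esub> x))) A = finsum ?I (\<lambda>i. a \<odot>\<^bsub>?I\<^esub> g i (f i x)) A"
          using ax fc gc linear_mapD(3)[OF linear_map_comp[OF f g]] by (intro I.finsum_cong') auto
        also have "\<dots> = a \<odot>\<^bsub>?I\<^esub> finsum ?I (\<lambda>i. g i (f i x)) A"
          by (rule I.finsum_smult_ldistr[OF A ax(1) trm[OF ax(2)], symmetric])
        finally show "finsum ?I (\<lambda>i. g i (f i (a \<odot>\<^bsub>?I\<^esub> x))) A = a \<odot>\<^bsub>?I\<^esub> finsum ?I (\<lambda>i. g i (f i x)) A" .
      qed
      have "linear_map R ?I ?I (\<lambda>x. x)" by (rule linear_map_id)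
      from linear_map_nat_multiple[OF this MI, of m] show "linear_map R ?I ?I (\<lambda>x. [m] \<cdot>\<^bsub>?I\<^esub> x)" .
      fix x assume x: "x \<in> carrier ?I"
      show "tensor ?I (finsum ?I (\<lambda>i. g i (f i x)) A) 1 = tensor ?I ([m] \<cdot>\<^bsub>?I\<^esub> x) 1"
      proof (rule \<theta>_eqI)
        fix k assume k: "k \<in> A"
        interpret Tk: comm_group "?T k" by (rule TJ[OF k])
        have "\<Phi> k (finsum ?I (\<lambda>i. g i (f i x)) A) = finprod (?T k) (\<lambda>i. \<Phi> k (g i (f i x))) A"
          by (rule hom_finsum[OF \<Phi>_hom[OF k] AI TJ[OF k]]) (use fc gc x in auto)
        also have "\<dots> = finprod (?T k) (\<lambda>i. if k = i then tensor (?J i) (f i x) 1 [^]\<^bsub>?T i\<^esub> m2 else \<one>\<^bsub>?T k\<^esub>) A"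
          using k x fc tensor_closed[OF AJ] by (intro Tk.finprod_cong') (auto simp: \<Phi>g)
        also have "\<dots> = finprod (?T k) (\<lambda>i. if k = i then tensor (?J k) (f k x) 1 [^]\<^bsub>?T k\<^esub> m2 else \<one>\<^bsub>?T k\<^esub>) A"
          using k x fc tensor_closed[OF AJ] by (intro Tk.finprod_cong') auto
        also have "\<dots> = tensor (?J k) (f k x) 1 [^]\<^bsub>?T k\<^esub> m2"
          using k x fc A tensor_closed[OF AJ] by (intro Tk.finprod_singleton) auto
        also have "\<dots> = \<Phi> k x [^]\<^bsub>?T k\<^esub> m"
          using \<Phi>c[OF k x] by (simp add: \<iota>f[OF k x] Tk.nat_pow_pow m_def)
        also have "\<dots> = \<Phi> k ([m] \<cdot>\<^bsub>?I\<^esub> x)"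
          using group_hom.hom_nat_pow[OF group_hom.intro[OF I.add.is_group Tk.is_group group_hom_axioms.intro[OF \<Phi>_hom[OF k]]], of x m] x
          by (simp add: add_pow_def)
        finally show "\<theta> (tensor ?I (finsum ?I (\<lambda>i. g i (f i x)) A) 1) k = \<theta> (tensor ?I ([m] \<cdot>\<^bsub>?I\<^esub> x) 1) k"
          by (simp add: \<Phi>_def)
      qed (use tensor_closed[OF AI] I.finsum_closed[OF trm[OF x]] x in auto)
    qed
  qed
  define act where "act i \<gamma> = ((\<lambda>x\<in>carrier ?I. gact I x \<gamma>), (\<lambda>x\<in>carrier (?J i). gact (J i) x \<gamma>))" for i \<gamma>
  have eqv: "\<exists>D>0. \<forall>\<gamma>\<in>carrier Gal. \<forall>x\<in>carrier ?I. [(D::nat)] \<cdot>\<^bsub>?J i\<^esub> f i (gact I x \<gamma>) = [D] \<cdot>\<^bsub>?J i\<^esub> gact (J i) (f i x) \<gamma>"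
    if i: "i \<in> A" for i
  proof -
    interpret Ji: module R "?J i" by (rule MJ[OF i])
    interpret Ti: comm_group "?T i" by (rule TJ[OF i])
    define P where "P p D \<longleftrightarrow> (\<forall>\<gamma>\<in>carrier Gal. act i \<gamma> = p \<longrightarrow>
       (\<forall>x\<in>carrier ?I. [(D::nat)] \<cdot>\<^bsub>?J i\<^esub> f i (gact I x \<gamma>) = [D] \<cdot>\<^bsub>?J i\<^esub> gact (J i) (f i x) \<gamma>))" for p D
    have "act i ` carrier Gal \<subseteq> ((\<lambda>\<gamma>. \<lambda>x\<in>carrier ?I. gact I x \<gamma>) ` carrier Gal) \<times> ((\<lambda>\<gamma>. \<lambda>x\<in>carrier (?J i). gact (J i) x \<gamma>) ` carrier Gal)"
      unfolding act_def by blast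
    then have fin: "finite (act i ` carrier Gal)"
      by (rule finite_subset) (intro finite_cartesian_product FMod_finite_actions[OF I] FMod_finite_actions[OF J[OF i]])
    have "\<exists>D>0. \<forall>p\<in>act i ` carrier Gal. P p D"
    proof (rule common_multiple[OF fin])
      fix p assume "p \<in> act i ` carrier Gal"
      then obtain \<gamma> where \<gamma>: "\<gamma> \<in> carrier Gal" "p = act i \<gamma>" by blast
      note LI = FModD(3)[OF I \<gamma>(1)] and LJ = FModD(3)[OF J[OF i] \<gamma>(1)]
      obtain d j where j: "basis_iso R ?I d j" using FModD(2)[OF I] by blast
      have "\<exists>D>0. \<forall>x\<in>carrier ?I. [(D::nat)] \<cdot>\<^bsub>?J i\<^esub> f i (gact I x \<gamma>) = [D] \<cdot>\<^bsub>?J i\<^esub> gact (J i) (f i x) \<gamma>"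
      proof (rule linear_torsion[OF MI j MJ[OF i] linear_map_comp[OF LI f[OF i]] linear_map_comp[OF f[OF i] LJ]])
        fix x assume x: "x \<in> carrier ?I"
        note mhom = tensorQ_map_hom[OF AJ[OF i] linear_mapD(4)[OF LJ] linear_mapD(2)[OF LJ]]
        have "tensor (?J i) (f i (gact I x \<gamma>)) 1 = (tensorQ_map (?J i) (\<lambda>y. gact (J i) y \<gamma>) (\<Phi> i x)) [^]\<^bsub>?T i\<^esub> m1"
          using \<iota>f[OF i linear_mapD(1)[OF LI x]] \<Phi>_gal[OF i \<gamma>(1) x] by simp
        also have "\<dots> = tensorQ_map (?J i) (\<lambda>y. gact (J i) y \<gamma>) (\<Phi> i x [^]\<^bsub>?T i\<^esub> m1)"
          by (intro group_hom.hom_nat_pow[symmetric] group_hom.intro group_hom_axioms.intro Ti.is_group mhom \<Phi>c i x)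
        also have "\<dots> = tensorQ_map (?J i) (\<lambda>y. gact (J i) y \<gamma>) (tensor (?J i) (f i x) 1)"
          by (simp add: \<iota>f[OF i x])
        also have "\<dots> = tensor (?J i) (gact (J i) (f i x) \<gamma>) 1"
          by (rule tensorQ_map_tensor[OF AJ[OF i] linear_mapD(4)[OF LJ] linear_mapD(2)[OF LJ] fc[OF i x]])
        finally show "tensor (?J i) (f i (gact I x \<gamma>)) 1 = tensor (?J i) (gact (J i) (f i x) \<gamma>) 1" .
      qed
      then obtain D :: nat where D: "D > 0"
        "\<forall>x\<in>carrier ?I. [D] \<cdot>\<^bsub>?J i\<^esub> f i (gact I x \<gamma>) = [D] \<cdot>\<^bsub>?J i\<^esub> gact (J i) (f i x) \<gamma>" by blast
      have "P p D" unfolding P_def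
      proof (intro ballI impI)
        fix \<delta> x assume \<delta>: "\<delta> \<in> carrier Gal" "act i \<delta> = p" and x: "x \<in> carrier ?I"
        have e: "(\<lambda>x\<in>carrier ?I. gact I x \<delta>) = (\<lambda>x\<in>carrier ?I. gact I x \<gamma>)"
          "(\<lambda>x\<in>carrier (?J i). gact (J i) x \<delta>) = (\<lambda>x\<in>carrier (?J i). gact (J i) x \<gamma>)"
          using \<delta>(2) \<gamma>(2) by (simp_all add: act_def)
        have "gact I x \<delta> = gact I x \<gamma>" "gact (J i) (f i x) \<delta> = gact (J i) (f i x) \<gamma>"
          using fun_cong[OF e(1), of x] fun_cong[OF e(2), of "f i x"] x fc[OF i x] by simp_all
        then show "[D] \<cdot>\<^bsub>?J i\<^esub> f i (gact I x \<delta>) = [D] \<cdot>\<^bsub>?J i\<^esub> gact (J i) (f i x) \<delta>" using D(2) x by simp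
      qed
      then show "\<exists>D>0. P p D" using D(1) by blast
    next
      fix p and D k :: nat assume "P p D"
      then show "P p (k * D)" unfolding P_def
        using nat_mult_assoc[OF MJ[OF i]] fc[OF i] linear_mapD(1)[OF FModD(3)[OF I]] linear_mapD(1)[OF FModD(3)[OF J[OF i]]] by simp
    qed
    then show ?thesis unfolding P_def by blast
  qed

  have "\<exists>D>0. \<forall>p\<in>A \<times> A. \<forall>y\<in>carrier (?J (snd p)). [(D::nat)] \<cdot>\<^bsub>?J (fst p)\<^esub> f (fst p) (g (snd p) y)
      = [D] \<cdot>\<^bsub>?J (fst p)\<^esub> (if fst p = snd p then [m] \<cdot>\<^bsub>?J (fst p)\<^esub> y else \<zero>\<^bsub>?J (fst p)\<^esub>)"
  proof (rule common_multiple)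
    fix p D and k :: nat assume p: "p \<in> A \<times> A" and D: "\<forall>y\<in>carrier (?J (snd p)). [(D::nat)] \<cdot>\<^bsub>?J (fst p)\<^esub> f (fst p) (g (snd p) y)
      = [D] \<cdot>\<^bsub>?J (fst p)\<^esub> (if fst p = snd p then [m] \<cdot>\<^bsub>?J (fst p)\<^esub> y else \<zero>\<^bsub>?J (fst p)\<^esub>)"
    have p': "fst p \<in> A" "snd p \<in> A" using p by auto
    show "\<forall>y\<in>carrier (?J (snd p)). [(k * D)] \<cdot>\<^bsub>?J (fst p)\<^esub> f (fst p) (g (snd p) y)
      = [(k * D)] \<cdot>\<^bsub>?J (fst p)\<^esub> (if fst p = snd p then [m] \<cdot>\<^bsub>?J (fst p)\<^esub> y else \<zero>\<^bsub>?J (fst p)\<^esub>)"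
    proof
      fix y assume y: "y \<in> carrier (?J (snd p))"
      have c: "f (fst p) (g (snd p) y) \<in> carrier (?J (fst p))" using fc gc p' y by blast
      have z: "\<zero>\<^bsub>?J (fst p)\<^esub> \<in> carrier (?J (fst p))" using AJ[OF p'(1)] by (simp add: abelian_group_def abelian_monoid.zero_closed)
      have e: "(if fst p = snd p then [m] \<cdot>\<^bsub>?J (fst p)\<^esub> y else \<zero>\<^bsub>?J (fst p)\<^esub>) \<in> carrier (?J (fst p))"
        using nat_mult_closed[OF MJ[OF p'(2)] y] z by auto
      show "[(k * D)] \<cdot>\<^bsub>?J (fst p)\<^esub> f (fst p) (g (snd p) y)
        = [(k * D)] \<cdot>\<^bsub>?J (fst p)\<^esub> (if fst p = snd p then [m] \<cdot>\<^bsub>?J (fst p)\<^esub> y else \<zero>\<^bsub>?J (fst p)\<^esub>)"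
        unfolding nat_mult_assoc[OF MJ[OF p'(1)] c] nat_mult_assoc[OF MJ[OF p'(1)] e] bspec[OF D y] ..
    qed
  next
    show "finite (A \<times> A)" using A by simp
  next
    fix p assume "p \<in> A \<times> A"
    then have "fst p \<in> A" "snd p \<in> A" by auto
    then show "\<exists>D>0. \<forall>y\<in>carrier (?J (snd p)). [(D::nat)] \<cdot>\<^bsub>?J (fst p)\<^esub> f (fst p) (g (snd p) y)
      = [D] \<cdot>\<^bsub>?J (fst p)\<^esub> (if fst p = snd p then [m] \<cdot>\<^bsub>?J (fst p)\<^esub> y else \<zero>\<^bsub>?J (fst p)\<^esub>)"
      by (rule fg)
  qed
  then obtain D1 :: nat where D1_pos: "D1 > 0"
    and D1_eq: "\<forall>p\<in>A \<times> A. \<forall>y\<in>carrier (?J (snd p)). [D1] \<cdot>\<^bsub>?J (fst p)\<^esub> f (fst p) (g (snd p) y)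
      = [D1] \<cdot>\<^bsub>?J (fst p)\<^esub> (if fst p = snd p then [m] \<cdot>\<^bsub>?J (fst p)\<^esub> y else \<zero>\<^bsub>?J (fst p)\<^esub>)"
    by (elim exE conjE)
  have D1: "[D1] \<cdot>\<^bsub>?J i\<^esub> f i (g k y) = [D1] \<cdot>\<^bsub>?J i\<^esub> (if i = k then [m] \<cdot>\<^bsub>?J i\<^esub> y else \<zero>\<^bsub>?J i\<^esub>)"
    if "i \<in> A" "k \<in> A" "y \<in> carrier (?J k)" for i k y
    using bspec[OF D1_eq, of "(i, k)"] that by simp
  obtain D2 :: nat where D2: "D2 > 0" "\<And>x. x \<in> carrier ?I \<Longrightarrow>
     [D2] \<cdot>\<^bsub>?I\<^esub> (finsum ?I (\<lambda>i. g i (f i x)) A) = [D2] \<cdot>\<^bsub>?I\<^esub> ([m] \<cdot>\<^bsub>?I\<^esub> x)"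
    using gf by blast
  have "\<exists>D>0. \<forall>i\<in>A. \<forall>\<gamma>\<in>carrier Gal. \<forall>x\<in>carrier ?I. [(D::nat)] \<cdot>\<^bsub>?J i\<^esub> f i (gact I x \<gamma>) = [D] \<cdot>\<^bsub>?J i\<^esub> gact (J i) (f i x) \<gamma>"
  proof (rule common_multiple[OF A eqv])
    fix i D and k :: nat assume i: "i \<in> A" and D: "\<forall>\<gamma>\<in>carrier Gal. \<forall>x\<in>carrier ?I. [(D::nat)] \<cdot>\<^bsub>?J i\<^esub> f i (gact I x \<gamma>) = [D] \<cdot>\<^bsub>?J i\<^esub> gact (J i) (f i x) \<gamma>"
    then show "\<forall>\<gamma>\<in>carrier Gal. \<forall>x\<in>carrier ?I. [(k * D)] \<cdot>\<^bsub>?J i\<^esub> f i (gact I x \<gamma>) = [(k * D)] \<cdot>\<^bsub>?J i\<^esub> gact (J i) (f i x) \<gamma>"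
      using nat_mult_assoc[OF MJ[OF i]] fc[OF i] linear_mapD(1)[OF FModD(3)[OF I]] linear_mapD(1)[OF FModD(3)[OF J[OF i]]] by simp
  qed
  then obtain D3 :: nat where D3: "D3 > 0" "\<And>i \<gamma> x. i \<in> A \<Longrightarrow> \<gamma> \<in> carrier Gal \<Longrightarrow> x \<in> carrier ?I \<Longrightarrow>
     [D3] \<cdot>\<^bsub>?J i\<^esub> f i (gact I x \<gamma>) = [D3] \<cdot>\<^bsub>?J i\<^esub> gact (J i) (f i x) \<gamma>" by blast
  \<comment> \<open>Each of the three identities survives multiplication by \<open>D\<close>; only \<open>f\<close> is rescaled, so \<open>m\<close> becomes \<open>D * m\<close>.\<close>
  define D where "D = D1 * D2 * D3"
  have Dk: "D = (D2 * D3) * D1" "D = (D1 * D3) * D2" "D = (D1 * D2) * D3" by (simp_all add: D_def)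
  define f' where "f' i x = [D] \<cdot>\<^bsub>?J i\<^esub> f i x" for i x
  have f': "linear_map R ?I (?J i) (f' i)" if "i \<in> A" for i
    unfolding f'_def by (rule linear_map_nat_multiple[OF f[OF that] MJ[OF that]])
  show thesis
  proof (rule that[of "D * m" f' g])
    show "D * m > 0" using m D1_pos D2 D3 by (simp add: D_def)
    show "linear_map R ?I (?J i) (f' i)" "linear_map R (?J i) ?I (g i)" if "i \<in> A" for i using f' g that by auto
    show "f' i (gact I x \<gamma>) = gact (J i) (f' i x) \<gamma>" if i: "i \<in> A" and \<gamma>: "\<gamma> \<in> carrier Gal" and x: "x \<in> carrier ?I" for i \<gamma> x
    proof -
      note LI = FModD(3)[OF I \<gamma>] and LJ = FModD(3)[OF J[OF i] \<gamma>]
      have "f' i (gact I x \<gamma>) = [D] \<cdot>\<^bsub>?J i\<^esub> gact (J i) (f i x) \<gamma>"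
        unfolding f'_def Dk(3) nat_mult_assoc[OF MJ[OF i] fc[OF i linear_mapD(1)[OF LI x]]]
           nat_mult_assoc[OF MJ[OF i] linear_mapD(1)[OF LJ fc[OF i x]]] D3(2)[OF i \<gamma> x] ..
      then show ?thesis unfolding f'_def linear_map_nat[OF LJ MJ[OF i] MJ[OF i] fc[OF i x]] .
    qed
    show "f' i (g k y) = (if i = k then [(D * m)] \<cdot>\<^bsub>?J i\<^esub> y else \<zero>\<^bsub>?J i\<^esub>)" if i: "i \<in> A" and k: "k \<in> A" and y: "y \<in> carrier (?J k)" for i k y
    proof -
      interpret Ji: module R "?J i" by (rule MJ[OF i])
      have e: "(if i = k then [m] \<cdot>\<^bsub>?J i\<^esub> y else \<zero>\<^bsub>?J i\<^esub>) \<in> carrier (?J i)"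
        using nat_mult_closed[OF MJ[OF k] y, of m] by auto
      have "f' i (g k y) = [D] \<cdot>\<^bsub>?J i\<^esub> (if i = k then [m] \<cdot>\<^bsub>?J i\<^esub> y else \<zero>\<^bsub>?J i\<^esub>)"
        unfolding f'_def Dk(1) nat_mult_assoc[OF MJ[OF i] fc[OF i gc[OF k y]]] nat_mult_assoc[OF MJ[OF i] e] D1[OF i k y] ..
      then show ?thesis using nat_mult_assoc[OF MJ[OF k] y, of D m] by (cases "i = k") simp_all
    qed
    show "finsum ?I (\<lambda>i. g i (f' i x)) A = [(D * m)] \<cdot>\<^bsub>?I\<^esub> x" if x: "x \<in> carrier ?I" for x
    proof -
      have trm: "(\<lambda>i. g i (f i x)) \<in> A \<rightarrow> carrier ?I" using fc gc x by auto
      have idl: "linear_map R ?I ?I (\<lambda>x. [D] \<cdot>\<^bsub>?I\<^esub> x)"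
        by (rule linear_map_nat_multiple[OF linear_map_id MI])
      have "finsum ?I (\<lambda>i. g i (f' i x)) A = finsum ?I (\<lambda>i. [D] \<cdot>\<^bsub>?I\<^esub> g i (f i x)) A"
        using fc gc x by (intro I.finsum_cong') (auto simp: f'_def linear_map_nat[OF g MJ MI])
      also have "\<dots> = [D] \<cdot>\<^bsub>?I\<^esub> finsum ?I (\<lambda>i. g i (f i x)) A"
        using trm by (intro linear_map_finsum[OF idl MI MI, symmetric]) auto
      also have "\<dots> = [D] \<cdot>\<^bsub>?I\<^esub> ([m] \<cdot>\<^bsub>?I\<^esub> x)"
        unfolding Dk(2) nat_mult_assoc[OF MI I.finsum_closed[OF trm]] nat_mult_assoc[OF MI nat_mult_closed[OF MI x]] D2(2)[OF x] ..
      finally show ?thesis using nat_mult_assoc[OF MI x, of D m] by simp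
    qed
  qed
qed

section \<open>Products of commutative groups\<close>

lemma (in comm_monoid) finprod_swap:
  assumes "finite A" "\<And>i b. i \<in> A \<Longrightarrow> b \<in> B \<Longrightarrow> h i b \<in> carrier G"
  shows "finprod G (\<lambda>i. finprod G (\<lambda>b. h i b) B) A = finprod G (\<lambda>b. finprod G (\<lambda>i. h i b) A) B"
  using assms
proof (induction A rule: finite_induct)
  case empty
  have "finprod G (\<lambda>b. \<one>) B = \<one>" by (rule finprod_one_eqI) simp
  then show ?case by simp
next
  case (insert i A)
  have c: "(\<lambda>b. finprod G (\<lambda>i. h i b) A) \<in> B \<rightarrow> carrier G" "h i \<in> B \<rightarrow> carrier G"
    using insert.prems by (auto intro!: finprod_closed)
  have "finprod G (\<lambda>i. finprod G (\<lambda>b. h i b) B) (insert i A) = finprod G (h i) B \<otimes> finprod G (\<lambda>i. finprod G (\<lambda>b. h i b) B) A"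
    using insert by (intro finprod_insert) (auto intro!: finprod_closed)
  also have "finprod G (\<lambda>i. finprod G (\<lambda>b. h i b) B) A = finprod G (\<lambda>b. finprod G (\<lambda>i. h i b) A) B"
    using insert by simp
  also have "finprod G (h i) B \<otimes> \<dots> = finprod G (\<lambda>b. h i b \<otimes> finprod G (\<lambda>i. h i b) A) B"
    using c by (intro finprod_multf[symmetric]) auto
  also have "\<dots> = finprod G (\<lambda>b. finprod G (\<lambda>i. h i b) (insert i A)) B"
  proof (rule finprod_cong')
    show "(\<lambda>b. finprod G (\<lambda>i. h i b) (insert i A)) \<in> B \<rightarrow> carrier G"
      using insert.prems by (auto intro!: finprod_closed)
    show "h i b \<otimes> finprod G (\<lambda>i. h i b) A = finprod G (\<lambda>i. h i b) (insert i A)" if "b \<in> B" for b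
      using insert that by (intro finprod_insert[symmetric]) auto
  qed simp
  finally show ?case .
qed

lemma hom_finprod:
  assumes h: "h \<in> hom G H" and G: "comm_group G" and H: "comm_group H"
    and u: "\<And>i. i \<in> A \<Longrightarrow> u i \<in> carrier G"
  shows "h (finprod G u A) = finprod H (\<lambda>i. h (u i)) A"
proof -
  interpret G: comm_group G by (rule G)
  interpret H: comm_group H by (rule H)
  have h0: "h \<one>\<^bsub>G\<^esub> = \<one>\<^bsub>H\<^esub>" by (rule hom_one[OF h G.is_group H.is_group])
  show ?thesis
    using u
  proof (induction A rule: infinite_finite_induct)
    case (insert i A)
    have "u \<in> A \<rightarrow> carrier G" "(\<lambda>i. h (u i)) \<in> A \<rightarrow> carrier H" using insert.prems hom_in_carrier[OF h] by auto
    then show ?case using insert hom_mult[OF h] hom_in_carrier[OF h] by simp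
  qed (simp_all add: h0)
qed

lemma product_comm_group:
  assumes "\<And>i. i \<in> A \<Longrightarrow> comm_group (H i)" shows "comm_group (product_group A H)"
proof (rule group.group_comm_groupI)
  show "group (product_group A H)"
    by (rule product_group) (rule comm_group.axioms(2)[OF assms])
  fix x y assume xy: "x \<in> carrier (product_group A H)" "y \<in> carrier (product_group A H)"
  have "x i \<otimes>\<^bsub>H i\<^esub> y i = y i \<otimes>\<^bsub>H i\<^esub> x i" if i: "i \<in> A" for i
    using xy i by (intro comm_monoid.m_comm[OF comm_group.axioms(1)[OF assms[OF i]]]) auto
  then show "x \<otimes>\<^bsub>product_group A H\<^esub> y = y \<otimes>\<^bsub>product_group A H\<^esub> x"
    by (simp cong: restrict_cong)
qed

lemma product_group_proj: "i \<in> A \<Longrightarrow> (\<lambda>x. x i) \<in> hom (product_group A H) (H i)"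
  by (auto simp: hom_def)

lemma product_group_homI:
  assumes "\<And>i. i \<in> A \<Longrightarrow> (\<lambda>x. f x i) \<in> hom G (H i)" "\<And>x. x \<in> carrier G \<Longrightarrow> f x \<in> extensional A"
    and "group G"
  shows "f \<in> hom G (product_group A H)"
proof (rule homI)
  show "f x \<in> carrier (product_group A H)" if "x \<in> carrier G" for x
    using hom_in_carrier[OF assms(1) that] assms(2)[OF that] by (simp add: PiE_iff)
  fix x y assume xy: "x \<in> carrier G" "y \<in> carrier G"
  then have "x \<otimes>\<^bsub>G\<^esub> y \<in> carrier G" using assms(3) by (simp add: group.is_monoid monoid.m_closed)
  then have "f (x \<otimes>\<^bsub>G\<^esub> y) \<in> extensional A" by (rule assms(2))
  then show "f (x \<otimes>\<^bsub>G\<^esub> y) = f x \<otimes>\<^bsub>product_group A H\<^esub> f y"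
    by (intro extensionalityI[of _ A]) (simp_all add: hom_mult[OF assms(1) xy])
qed

context
  fixes R :: "'r ring" and M :: "('r, 'm) module" and d j
  assumes M: "module R M" and j: "basis_iso R M d j"
begin

interpretation M: module R M by (rule M)

lemma coord_add: "x \<in> carrier M \<Longrightarrow> y \<in> carrier M \<Longrightarrow> i < d \<Longrightarrow>
    coord R d j (x \<oplus>\<^bsub>M\<^esub> y) i = coord R d j x i \<oplus>\<^bsub>R\<^esub> coord R d j y i"
  using fun_cong[OF linear_mapD(2)[OF coord_linear[OF M j], of x y], of i] by (simp add: free_mod_def)

lemma coord_smult: "a \<in> carrier R \<Longrightarrow> x \<in> carrier M \<Longrightarrow> i < d \<Longrightarrow>
    coord R d j (a \<odot>\<^bsub>M\<^esub> x) i = a \<otimes>\<^bsub>R\<^esub> coord R d j x i"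
  using fun_cong[OF linear_mapD(3)[OF coord_linear[OF M j], of a x], of i] by (simp add: free_mod_def)

lemma coord_basis_vec: "i < d \<Longrightarrow> coord R d j (basis_vec R d j b) i = (if i = b then \<one>\<^bsub>R\<^esub> else \<zero>\<^bsub>R\<^esub>)"
  using fun_cong[OF coord_basis[OF M j unit_vec_closed[OF M.R.ring_axioms], of b], of i] by (simp add: unit_vec_def)

lemma coord_zero: "i < d \<Longrightarrow> coord R d j \<zero>\<^bsub>M\<^esub> i = \<zero>\<^bsub>R\<^esub>"
  using coord_smult[of "\<zero>\<^bsub>R\<^esub>" "\<zero>\<^bsub>M\<^esub>" i] coord_entry[OF M j M.zero_closed, of i] by simp

end

text \<open>A linear functional is determined by its values on the basis. Applied to a coordinate of a composite
  map, this is the formula for the entries of a matrix product.\<close>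
lemma linear_functional_expand:
  fixes R :: "'r ring" and N :: "('r, 'n) module"
  assumes N: "module R N" and j: "basis_iso R N e j"
    and \<phi>: "\<And>y. y \<in> carrier N \<Longrightarrow> \<phi> y \<in> carrier R"
      "\<And>y z. y \<in> carrier N \<Longrightarrow> z \<in> carrier N \<Longrightarrow> \<phi> (y \<oplus>\<^bsub>N\<^esub> z) = \<phi> y \<oplus>\<^bsub>R\<^esub> \<phi> z"
      "\<And>a y. a \<in> carrier R \<Longrightarrow> y \<in> carrier N \<Longrightarrow> \<phi> (a \<odot>\<^bsub>N\<^esub> y) = a \<otimes>\<^bsub>R\<^esub> \<phi> y"
    and y: "y \<in> carrier N"
  shows "\<phi> y = finsum R (\<lambda>i. coord R e j y i \<otimes>\<^bsub>R\<^esub> \<phi> (basis_vec R e j i)) {..<e}"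
proof -
  interpret N: module R N by (rule N)
  have \<phi>e: "\<phi> (basis_vec R e j i) \<in> carrier R" for i by (rule \<phi>(1)[OF basis_vec_closed[OF N j]])
  have trm: "(\<lambda>i. coord R e j y i \<otimes>\<^bsub>R\<^esub> \<phi> (basis_vec R e j i)) \<in> {..<e} \<rightarrow> carrier R" if "y \<in> carrier N" for y
    using coord_entry[OF N j that] \<phi>e by auto
  show ?thesis
    using y
  proof (induction rule: basis_induct[OF N j, consumes 1, case_names zero add smult])
    case zero
    have "\<phi> \<zero>\<^bsub>N\<^esub> \<oplus>\<^bsub>R\<^esub> \<phi> \<zero>\<^bsub>N\<^esub> = \<phi> \<zero>\<^bsub>N\<^esub>" using \<phi>(2)[of "\<zero>\<^bsub>N\<^esub>" "\<zero>\<^bsub>N\<^esub>"] by simp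
    then have \<phi>0: "\<phi> \<zero>\<^bsub>N\<^esub> = \<zero>\<^bsub>R\<^esub>" using \<phi>(1)[of "\<zero>\<^bsub>N\<^esub>"] N.R.add.l_cancel_one' by simp
    have "finsum R (\<lambda>i. coord R e j \<zero>\<^bsub>N\<^esub> i \<otimes>\<^bsub>R\<^esub> \<phi> (basis_vec R e j i)) {..<e} = \<zero>\<^bsub>R\<^esub>"
      using \<phi>e by (intro N.R.add.finprod_one_eqI) (simp add: coord_zero[OF N j])
    with \<phi>0 show ?case by simp
  next
    case (add x y)
    have "finsum R (\<lambda>i. coord R e j (x \<oplus>\<^bsub>N\<^esub> y) i \<otimes>\<^bsub>R\<^esub> \<phi> (basis_vec R e j i)) {..<e}
       = finsum R (\<lambda>i. coord R e j x i \<otimes>\<^bsub>R\<^esub> \<phi> (basis_vec R e j i) \<oplus>\<^bsub>R\<^esub> coord R e j y i \<otimes>\<^bsub>R\<^esub> \<phi> (basis_vec R e j i)) {..<e}"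
    proof (rule N.R.finsum_cong')
      show "(\<lambda>i. coord R e j x i \<otimes>\<^bsub>R\<^esub> \<phi> (basis_vec R e j i) \<oplus>\<^bsub>R\<^esub> coord R e j y i \<otimes>\<^bsub>R\<^esub> \<phi> (basis_vec R e j i)) \<in> {..<e} \<rightarrow> carrier R"
        using coord_entry[OF N j add(1)] coord_entry[OF N j add(2)] \<phi>e by auto
      show "coord R e j (x \<oplus>\<^bsub>N\<^esub> y) i \<otimes>\<^bsub>R\<^esub> \<phi> (basis_vec R e j i)
        = coord R e j x i \<otimes>\<^bsub>R\<^esub> \<phi> (basis_vec R e j i) \<oplus>\<^bsub>R\<^esub> coord R e j y i \<otimes>\<^bsub>R\<^esub> \<phi> (basis_vec R e j i)"
        if "i \<in> {..<e}" for i
        using that coord_entry[OF N j add(1)] coord_entry[OF N j add(2)] \<phi>e[of i]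
        by (simp add: coord_add[OF N j add(1,2)] N.R.l_distr)
    qed simp
    also have "\<dots> = \<phi> x \<oplus>\<^bsub>R\<^esub> \<phi> y"
      unfolding add(3) add(4) by (intro N.R.finsum_addf trm add(1,2))
    finally show ?case using \<phi>(2)[OF add(1,2)] by simp
  next
    case (smult a b)
    have "finsum R (\<lambda>i. coord R e j (a \<odot>\<^bsub>N\<^esub> basis_vec R e j b) i \<otimes>\<^bsub>R\<^esub> \<phi> (basis_vec R e j i)) {..<e}
      = finsum R (\<lambda>i. if b = i then a \<otimes>\<^bsub>R\<^esub> \<phi> (basis_vec R e j i) else \<zero>\<^bsub>R\<^esub>) {..<e}"
    proof (rule N.R.finsum_cong')
      show "(\<lambda>i. if b = i then a \<otimes>\<^bsub>R\<^esub> \<phi> (basis_vec R e j i) else \<zero>\<^bsub>R\<^esub>) \<in> {..<e} \<rightarrow> carrier R"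
        using \<phi>e smult by auto
      show "coord R e j (a \<odot>\<^bsub>N\<^esub> basis_vec R e j b) i \<otimes>\<^bsub>R\<^esub> \<phi> (basis_vec R e j i)
         = (if b = i then a \<otimes>\<^bsub>R\<^esub> \<phi> (basis_vec R e j i) else \<zero>\<^bsub>R\<^esub>)" if "i \<in> {..<e}" for i
        using that smult(1) \<phi>e[of i]
        by (simp add: coord_smult[OF N j smult(1) basis_vec_closed[OF N j]] coord_basis_vec[OF N j])
    qed simp
    also have "\<dots> = a \<otimes>\<^bsub>R\<^esub> \<phi> (basis_vec R e j b)"
      using smult \<phi>e by (intro N.R.finsum_singleton) auto
    finally show ?case using \<phi>(3)[OF smult(1) basis_vec_closed[OF N j]] by simp
  qed
qed

section \<open>Matrices acting on powers of a group\<close>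

text \<open>The matrix of \<open>f\<close> in the bases \<open>j\<close> and \<open>j'\<close>, acting as a map \<open>V\<^sup>d \<rightarrow> V\<^sup>e\<close>. The group law of \<open>V\<close> is
  written multiplicatively.\<close>
definition mod_act ::
  "'r ring \<Rightarrow> ('k::field, 'r, 'p) cag \<Rightarrow> nat \<Rightarrow> ((nat \<Rightarrow> 'r) \<Rightarrow> 'm) \<Rightarrow> nat \<Rightarrow> ((nat \<Rightarrow> 'r) \<Rightarrow> 'n)
    \<Rightarrow> ('m \<Rightarrow> 'n) \<Rightarrow> (nat \<Rightarrow> 'p) \<Rightarrow> nat \<Rightarrow> 'p" where
  "mod_act R V d j e j' f v =
     (\<lambda>a\<in>{..<e}. finprod (grp V) (\<lambda>b. ract V (coord R e j' (f (basis_vec R d j b)) a) (v b)) {..<d})"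

text \<open>The cocycle of a twist is the matrix of the action of \<open>\<gamma>\<^sup>-\<^sup>1\<close>.\<close>
lemma matrix_act_twist:
  "matrix_act R V d (twist_cocycle R M d j \<gamma>) v = mod_act R V d j d j (\<lambda>x. gact M x (inv\<^bsub>Gal\<^esub> \<gamma>)) v"
  by (simp add: matrix_act_def mod_act_def twist_cocycle_def)

lemma CAGD:
  assumes "CAG R V"
  shows "comm_group (grp V)" and "variety (vrt V)" and "carrier (grp V) = points (vrt V)"
    and "kmorphism (prod_space {..<2::nat} (\<lambda>_. vrt V)) (vrt V) (\<lambda>x. x 0 \<otimes>\<^bsub>grp V\<^esub> x 1)"
    and "kmorphism (prod_space ({}::nat set) (\<lambda>_. vrt V)) (vrt V) (\<lambda>_. \<one>\<^bsub>grp V\<^esub>)"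
    and "ract V \<in> ring_hom R (End_ring (grp V) (vrt V))"
  using assms by (auto simp: CAG_def comm_alg_group_def)

context
  fixes R :: "'r ring" and V :: "('k::field, 'r, 'p) cag"
  assumes R: "cring R" and V: "CAG R V"
begin

interpretation R: cring R by (rule R)

interpretation G: comm_group "grp V" by (rule CAGD(1)[OF V])

lemma ract_End: "a \<in> carrier R \<Longrightarrow> ract V a \<in> carrier (End_ring (grp V) (vrt V))"
  using ring_hom_closed[OF CAGD(6)[OF V]] .

lemma ract_hom: "a \<in> carrier R \<Longrightarrow> ract V a \<in> hom (grp V) (grp V)"
  using ract_End by (simp add: End_ring_def)

lemma ract_kmorphism: "a \<in> carrier R \<Longrightarrow> kmorphism (vrt V) (vrt V) (ract V a)"
  using ract_End by (simp add: End_ring_def)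

lemma ract_closed [simp]: "a \<in> carrier R \<Longrightarrow> x \<in> carrier (grp V) \<Longrightarrow> ract V a x \<in> carrier (grp V)"
  using hom_in_carrier[OF ract_hom] .

lemma ract_add:
  "a \<in> carrier R \<Longrightarrow> b \<in> carrier R \<Longrightarrow> x \<in> carrier (grp V) \<Longrightarrow> ract V (a \<oplus>\<^bsub>R\<^esub> b) x = ract V a x \<otimes>\<^bsub>grp V\<^esub> ract V b x"
  using ring_hom_add[OF CAGD(6)[OF V], of a b] by (simp add: End_ring_def)

lemma ract_mult:
  "a \<in> carrier R \<Longrightarrow> b \<in> carrier R \<Longrightarrow> x \<in> carrier (grp V) \<Longrightarrow> ract V (a \<otimes>\<^bsub>R\<^esub> b) x = ract V a (ract V b x)"
  using ring_hom_mult[OF CAGD(6)[OF V], of a b] by (simp add: End_ring_def compose_def)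

lemma ract_one: "x \<in> carrier (grp V) \<Longrightarrow> ract V \<one>\<^bsub>R\<^esub> x = x"
  using ring_hom_one[OF CAGD(6)[OF V]] by (simp add: End_ring_def)

lemma ract_zero: "x \<in> carrier (grp V) \<Longrightarrow> ract V \<zero>\<^bsub>R\<^esub> x = \<one>\<^bsub>grp V\<^esub>"
  using ract_add[of "\<zero>\<^bsub>R\<^esub>" "\<zero>\<^bsub>R\<^esub>" x] G.l_cancel_one'[of "ract V \<zero>\<^bsub>R\<^esub> x" "ract V \<zero>\<^bsub>R\<^esub> x"] by simp

lemma ract_finsum:
  assumes "x \<in> carrier (grp V)" "\<And>i. i \<in> A \<Longrightarrow> u i \<in> carrier R"
  shows "ract V (finsum R u A) x = finprod (grp V) (\<lambda>i. ract V (u i) x) A"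
proof (rule hom_finsum[OF _ R.abelian_group_axioms G.comm_group_axioms assms(2)])
  show "(\<lambda>a. ract V a x) \<in> hom (add_monoid R) (grp V)"
    using assms(1) by (auto simp: hom_def ract_add)
qed

lemma ract_finprod:
  assumes "a \<in> carrier R" "\<And>i. i \<in> A \<Longrightarrow> u i \<in> carrier (grp V)"
  shows "ract V a (finprod (grp V) u A) = finprod (grp V) (\<lambda>i. ract V a (u i)) A"
  by (rule hom_finprod[OF ract_hom[OF assms(1)] G.comm_group_axioms G.comm_group_axioms assms(2)])

lemma ract_nat: "x \<in> carrier (grp V) \<Longrightarrow> ract V ([(n::nat)] \<cdot>\<^bsub>R\<^esub> \<one>\<^bsub>R\<^esub>) x = x [^]\<^bsub>grp V\<^esub> n"
  by (induction n) (simp_all add: ract_zero ract_add ract_one)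

abbreviation pow :: "nat \<Rightarrow> (nat \<Rightarrow> 'p) monoid" where
  "pow d \<equiv> product_group {..<d} (\<lambda>_. grp V)"

lemma pow_comm_group: "comm_group (pow d)"
  by (rule product_comm_group) (rule G.comm_group_axioms)

lemma entry_closed:
  assumes N: "module R N" "basis_iso R N e j'" and M: "module R M" "basis_iso R M d j"
    and f: "linear_map R M N f" and a: "a < e"
  shows "coord R e j' (f (basis_vec R d j b)) a \<in> carrier R"
  by (rule coord_entry[OF N linear_mapD(1)[OF f basis_vec_closed[OF M]] a])

lemma mod_act_closed:
  assumes N: "module R N" "basis_iso R N e j'" and M: "module R M" "basis_iso R M d j"
    and f: "linear_map R M N f" and v: "v \<in> carrier (pow d)"
  shows "mod_act R V d j e j' f v \<in> carrier (pow e)"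
  unfolding carrier_product_group
proof (rule PiE_I)
  have vc: "v b \<in> carrier (grp V)" if "b < d" for b using v that by auto
  show "mod_act R V d j e j' f v a \<in> carrier (grp V)" if "a \<in> {..<e}" for a
    using that entry_closed[OF N M f] vc by (auto simp: mod_act_def intro!: G.finprod_closed)
qed (simp add: mod_act_def)

lemma mod_act_hom:
  assumes N: "module R N" "basis_iso R N e j'" and M: "module R M" "basis_iso R M d j"
    and f: "linear_map R M N f"
  shows "mod_act R V d j e j' f \<in> hom (pow d) (pow e)"
proof (rule homI)
  show "mod_act R V d j e j' f v \<in> carrier (pow e)" if "v \<in> carrier (pow d)" for v
    by (rule mod_act_closed[OF N M f that])
  fix v w assume vw: "v \<in> carrier (pow d)" "w \<in> carrier (pow d)"
  have c: "v b \<in> carrier (grp V)" "w b \<in> carrier (grp V)" if "b < d" for b using vw that by auto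
  have "mod_act R V d j e j' f (v \<otimes>\<^bsub>pow d\<^esub> w) a = mod_act R V d j e j' f v a \<otimes>\<^bsub>grp V\<^esub> mod_act R V d j e j' f w a"
    if a: "a < e" for a
  proof -
    note ec = entry_closed[OF N M f a]
    let ?C = "\<lambda>b. coord R e j' (f (basis_vec R d j b)) a"
    have "mod_act R V d j e j' f (v \<otimes>\<^bsub>pow d\<^esub> w) a = finprod (grp V) (\<lambda>b. ract V (?C b) ((v \<otimes>\<^bsub>pow d\<^esub> w) b)) {..<d}"
      using a by (simp add: mod_act_def del: mult_product_group)
    also have "\<dots> = finprod (grp V) (\<lambda>b. ract V (?C b) (v b) \<otimes>\<^bsub>grp V\<^esub> ract V (?C b) (w b)) {..<d}"
    proof (rule G.finprod_cong')
      show "(\<lambda>b. ract V (?C b) (v b) \<otimes>\<^bsub>grp V\<^esub> ract V (?C b) (w b)) \<in> {..<d} \<rightarrow> carrier (grp V)"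
        using c ec by auto
      show "ract V (?C b) ((v \<otimes>\<^bsub>pow d\<^esub> w) b) = ract V (?C b) (v b) \<otimes>\<^bsub>grp V\<^esub> ract V (?C b) (w b)"
        if "b \<in> {..<d}" for b
        using that hom_mult[OF ract_hom[OF ec] c(1) c(2), of b b] by simp
    qed simp
    also have "\<dots> = mod_act R V d j e j' f v a \<otimes>\<^bsub>grp V\<^esub> mod_act R V d j e j' f w a"
      using a c ec by (subst G.finprod_multf) (auto simp: mod_act_def)
    finally show ?thesis .
  qed
  then show "mod_act R V d j e j' f (v \<otimes>\<^bsub>pow d\<^esub> w) = mod_act R V d j e j' f v \<otimes>\<^bsub>pow e\<^esub> mod_act R V d j e j' f w"
    by (intro extensionalityI[of _ "{..<e}"]) (simp_all add: mod_act_def[of R V d j e j' f "v \<otimes>\<^bsub>pow d\<^esub> w"] del: mult_product_group, simp_all)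
qed

text \<open>The action of a product of matrices; the sum over the intermediate index is interchanged with the sum
  that defines the action.\<close>
lemma mod_act_comp:
  assumes M: "module R M" "basis_iso R M d j" and N: "module R N" "basis_iso R N e j'"
    and P: "module R P" "basis_iso R P c j''"
    and f: "linear_map R M N f" and g: "linear_map R N P g" and v: "v \<in> carrier (pow d)"
  shows "mod_act R V e j' c j'' g (mod_act R V d j e j' f v) = mod_act R V d j c j'' (\<lambda>x. g (f x)) v"
proof (rule extensionalityI[of _ "{..<c}"])
  fix a assume a: "a \<in> {..<c}"
  define E where "E i = coord R c j'' (g (basis_vec R e j' i)) a" for i
  define D where "D b i = coord R e j' (f (basis_vec R d j b)) i" for b i
  have E: "E i \<in> carrier R" for i unfolding E_def using a by (intro entry_closed[OF P N g]) simp
  have D: "D b i \<in> carrier R" if "i < e" for b i unfolding D_def by (rule entry_closed[OF N M f that])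
  have vc: "v b \<in> carrier (grp V)" if "b < d" for b using v that by auto
  have exp: "coord R c j'' (g y) a = finsum R (\<lambda>i. coord R e j' y i \<otimes>\<^bsub>R\<^esub> E i) {..<e}" if y: "y \<in> carrier N" for y
    unfolding E_def
  proof (rule linear_functional_expand[OF N _ _ _ y, where \<phi> = "\<lambda>y. coord R c j'' (g y) a"])
    note L = linear_map_comp[OF g coord_linear[OF P]]
    show "coord R c j'' (g y) a \<in> carrier R" if "y \<in> carrier N" for y
      using coord_entry[OF P linear_mapD(1)[OF g that]] a by simp
    show "coord R c j'' (g (y \<oplus>\<^bsub>N\<^esub> z)) a = coord R c j'' (g y) a \<oplus>\<^bsub>R\<^esub> coord R c j'' (g z) a"
      if "y \<in> carrier N" "z \<in> carrier N" for y z
      using linear_mapD(2)[OF L that] a by (simp add: free_mod_def)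
    show "coord R c j'' (g (s \<odot>\<^bsub>N\<^esub> y)) a = s \<otimes>\<^bsub>R\<^esub> coord R c j'' (g y) a"
      if "s \<in> carrier R" "y \<in> carrier N" for s y
      using linear_mapD(3)[OF L that] a by (simp add: free_mod_def)
  qed
  have "mod_act R V e j' c j'' g (mod_act R V d j e j' f v) a
      = finprod (grp V) (\<lambda>i. ract V (E i) (finprod (grp V) (\<lambda>b. ract V (D b i) (v b)) {..<d})) {..<e}"
    using a E D vc by (auto simp: mod_act_def E_def[symmetric] D_def[symmetric] intro!: G.finprod_cong')
  also have "\<dots> = finprod (grp V) (\<lambda>i. finprod (grp V) (\<lambda>b. ract V (D b i \<otimes>\<^bsub>R\<^esub> E i) (v b)) {..<d}) {..<e}"
  proof (rule G.finprod_cong')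
    show "(\<lambda>i. finprod (grp V) (\<lambda>b. ract V (D b i \<otimes>\<^bsub>R\<^esub> E i) (v b)) {..<d}) \<in> {..<e} \<rightarrow> carrier (grp V)"
      using E D vc by (auto intro!: G.finprod_closed)
    fix i assume i: "i \<in> {..<e}"
    have "ract V (E i) (finprod (grp V) (\<lambda>b. ract V (D b i) (v b)) {..<d}) = finprod (grp V) (\<lambda>b. ract V (E i) (ract V (D b i) (v b))) {..<d}"
      using i E D vc by (intro ract_finprod) auto
    also have "\<dots> = finprod (grp V) (\<lambda>b. ract V (D b i \<otimes>\<^bsub>R\<^esub> E i) (v b)) {..<d}"
    proof (rule G.finprod_cong')
      show "(\<lambda>b. ract V (D b i \<otimes>\<^bsub>R\<^esub> E i) (v b)) \<in> {..<d} \<rightarrow> carrier (grp V)" using i E D vc by auto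
      show "ract V (E i) (ract V (D b i) (v b)) = ract V (D b i \<otimes>\<^bsub>R\<^esub> E i) (v b)" if "b \<in> {..<d}" for b
        using i E D vc that ract_mult[of "E i" "D b i" "v b"] R.m_comm[of "D b i" "E i"] by simp
    qed simp
    finally show "ract V (E i) (finprod (grp V) (\<lambda>b. ract V (D b i) (v b)) {..<d}) = finprod (grp V) (\<lambda>b. ract V (D b i \<otimes>\<^bsub>R\<^esub> E i) (v b)) {..<d}" .
  qed simp
  also have "\<dots> = finprod (grp V) (\<lambda>b. finprod (grp V) (\<lambda>i. ract V (D b i \<otimes>\<^bsub>R\<^esub> E i) (v b)) {..<e}) {..<d}"
    using E D vc by (intro G.finprod_swap) auto
  also have "\<dots> = finprod (grp V) (\<lambda>b. ract V (coord R c j'' (g (f (basis_vec R d j b))) a) (v b)) {..<d}"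
  proof (rule G.finprod_cong')
    have fe: "f (basis_vec R d j b) \<in> carrier N" for b by (rule linear_mapD(1)[OF f basis_vec_closed[OF M]])
    show "(\<lambda>b. ract V (coord R c j'' (g (f (basis_vec R d j b))) a) (v b)) \<in> {..<d} \<rightarrow> carrier (grp V)"
      using coord_entry[OF P linear_mapD(1)[OF g fe]] a vc by auto
    fix b assume b: "b \<in> {..<d}"
    show "finprod (grp V) (\<lambda>i. ract V (D b i \<otimes>\<^bsub>R\<^esub> E i) (v b)) {..<e} = ract V (coord R c j'' (g (f (basis_vec R d j b))) a) (v b)"
      unfolding exp[OF fe] D_def[symmetric] using b E D vc by (intro ract_finsum[symmetric]) auto
  qed simp
  also have "\<dots> = mod_act R V d j c j'' (\<lambda>x. g (f x)) v a" using a by (simp add: mod_act_def)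
  finally show "mod_act R V e j' c j'' g (mod_act R V d j e j' f v) a = mod_act R V d j c j'' (\<lambda>x. g (f x)) v a" .
qed (simp_all add: mod_act_def)

lemma mod_act_cong:
  assumes "\<And>x. x \<in> carrier M \<Longrightarrow> f x = g x" "module R M" "basis_iso R M d j"
  shows "mod_act R V d j e j' f v = mod_act R V d j e j' g v"
  using assms(1)[OF basis_vec_closed[OF assms(2,3)]] by (simp add: mod_act_def)

lemma mod_act_nat:
  assumes M: "module R M" "basis_iso R M d j" and v: "v \<in> carrier (pow d)"
  shows "mod_act R V d j d j (\<lambda>x. [(n::nat)] \<cdot>\<^bsub>M\<^esub> x) v = v [^]\<^bsub>pow d\<^esub> n"
proof -
  interpret M: module R M by (rule M(1))
  let ?n = "[n] \<cdot>\<^bsub>R\<^esub> \<one>\<^bsub>R\<^esub>"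
  have n: "[n] \<cdot>\<^bsub>M\<^esub> x = ?n \<odot>\<^bsub>M\<^esub> x" if "x \<in> carrier M" for x
    by (induction n) (use that in \<open>simp_all add: M.smult_l_distr\<close>)
  have nR: "?n \<in> carrier R" by simp
  have vc: "v b \<in> carrier (grp V)" if "b < d" for b using v that by auto
  have pw: "v [^]\<^bsub>pow d\<^esub> n = (\<lambda>a\<in>{..<d}. v a [^]\<^bsub>grp V\<^esub> n)"
    by (induction n) (auto intro!: restrict_ext)
  have "mod_act R V d j d j (\<lambda>x. [n] \<cdot>\<^bsub>M\<^esub> x) v a = v a [^]\<^bsub>grp V\<^esub> n" if a: "a < d" for a
  proof -
    have entry: "coord R d j ([n] \<cdot>\<^bsub>M\<^esub> basis_vec R d j b) a = (if a = b then ?n else \<zero>\<^bsub>R\<^esub>)" for b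
      unfolding n[OF basis_vec_closed[OF M]]
      using a by (simp add: coord_smult[OF M nR basis_vec_closed[OF M]] coord_basis_vec[OF M])
    have "mod_act R V d j d j (\<lambda>x. [n] \<cdot>\<^bsub>M\<^esub> x) v a = finprod (grp V) (\<lambda>b. if a = b then ract V ?n (v b) else \<one>\<^bsub>grp V\<^esub>) {..<d}"
      unfolding mod_act_def using a vc nR by (simp add: entry, intro G.finprod_cong') (auto simp: ract_zero)
    also have "\<dots> = ract V ?n (v a)" using a vc nR by (intro G.finprod_singleton) auto
    finally show ?thesis using vc[OF a] by (simp add: ract_nat)
  qed
  note pointwise = this
  show ?thesis
    unfolding pw
  proof (rule extensionalityI[of _ "{..<d}"])
    show "mod_act R V d j d j (\<lambda>x. [n] \<cdot>\<^bsub>M\<^esub> x) v \<in> extensional {..<d}" by (simp add: mod_act_def)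
  next
    fix a assume "a \<in> {..<d}"
    then show "mod_act R V d j d j (\<lambda>x. [n] \<cdot>\<^bsub>M\<^esub> x) v a = (\<lambda>a\<in>{..<d}. v a [^]\<^bsub>grp V\<^esub> n) a"
      using pointwise by simp
  qed simp
qed

lemma mod_act_zero:
  assumes M: "module R M" "basis_iso R M d j" and N: "module R N" "basis_iso R N e j'" and v: "v \<in> carrier (pow d)"
  shows "mod_act R V d j e j' (\<lambda>_. \<zero>\<^bsub>N\<^esub>) v = \<one>\<^bsub>pow e\<^esub>"
proof -
  interpret N: module R N by (rule N(1))
  note z = coord_zero[OF N]
  have vc: "v b \<in> carrier (grp V)" if "b < d" for b using v that by auto
  have "finprod (grp V) (\<lambda>b. ract V (coord R e j' \<zero>\<^bsub>N\<^esub> a) (v b)) {..<d} = \<one>\<^bsub>grp V\<^esub>" if a: "a < e" for a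
    using vc by (intro G.finprod_one_eqI) (simp add: z[OF a] ract_zero)
  then show ?thesis by (auto simp: mod_act_def intro!: restrict_ext)
qed

lemma mod_act_add:
  assumes M: "module R M" "basis_iso R M d j" and N: "module R N" "basis_iso R N e j'"
    and f: "linear_map R M N f" and g: "linear_map R M N g" and v: "v \<in> carrier (pow d)"
  shows "mod_act R V d j e j' (\<lambda>x. f x \<oplus>\<^bsub>N\<^esub> g x) v = mod_act R V d j e j' f v \<otimes>\<^bsub>pow e\<^esub> mod_act R V d j e j' g v"
proof -
  have vc: "v b \<in> carrier (grp V)" if "b < d" for b using v that by auto
  have "finprod (grp V) (\<lambda>b. ract V (coord R e j' (f (basis_vec R d j b) \<oplus>\<^bsub>N\<^esub> g (basis_vec R d j b)) a) (v b)) {..<d}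
     = finprod (grp V) (\<lambda>b. ract V (coord R e j' (f (basis_vec R d j b)) a) (v b)) {..<d}
       \<otimes>\<^bsub>grp V\<^esub> finprod (grp V) (\<lambda>b. ract V (coord R e j' (g (basis_vec R d j b)) a) (v b)) {..<d}" if a: "a < e" for a
  proof -
    note ef = entry_closed[OF N M f a] and eg = entry_closed[OF N M g a]
    have fe: "f (basis_vec R d j b) \<in> carrier N" "g (basis_vec R d j b) \<in> carrier N" for b
      using linear_mapD(1)[OF f basis_vec_closed[OF M]] linear_mapD(1)[OF g basis_vec_closed[OF M]] by auto
    have c: "coord R e j' (f (basis_vec R d j b) \<oplus>\<^bsub>N\<^esub> g (basis_vec R d j b)) a
        = coord R e j' (f (basis_vec R d j b)) a \<oplus>\<^bsub>R\<^esub> coord R e j' (g (basis_vec R d j b)) a" for b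
      by (rule coord_add[OF N fe a])
    have "finprod (grp V) (\<lambda>b. ract V (coord R e j' (f (basis_vec R d j b) \<oplus>\<^bsub>N\<^esub> g (basis_vec R d j b)) a) (v b)) {..<d}
      = finprod (grp V) (\<lambda>b. ract V (coord R e j' (f (basis_vec R d j b)) a) (v b)
          \<otimes>\<^bsub>grp V\<^esub> ract V (coord R e j' (g (basis_vec R d j b)) a) (v b)) {..<d}"
      unfolding c using vc ef eg by (intro G.finprod_cong') (auto simp: ract_add)
    then show ?thesis using vc ef eg by (subst (asm) G.finprod_multf) auto
  qed
  then show ?thesis by (auto simp: mod_act_def intro!: restrict_ext)
qed

text \<open>Used for maps \<open>h i = g i \<circ> f i\<close> at a point \<open>v\<close> that all of the \<open>f i\<close> annihilate.\<close>
lemma mod_act_finsum_one: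
  assumes M: "module R M" "basis_iso R M d j" and N: "module R N" "basis_iso R N e j'" and A: "finite A"
    and h: "\<And>i. i \<in> A \<Longrightarrow> linear_map R M N (h i)" and v: "v \<in> carrier (pow d)"
    and one: "\<And>i. i \<in> A \<Longrightarrow> mod_act R V d j e j' (h i) v = \<one>\<^bsub>pow e\<^esub>"
  shows "mod_act R V d j e j' (\<lambda>x. finsum N (\<lambda>i. h i x) A) v = \<one>\<^bsub>pow e\<^esub>"
proof -
  interpret N: module R N by (rule N(1))
  interpret M: module R M by (rule M(1))
  interpret P: comm_group "pow e" by (rule pow_comm_group)
  from A h one have "linear_map R M N (\<lambda>x. finsum N (\<lambda>i. h i x) A) \<and> mod_act R V d j e j' (\<lambda>x. finsum N (\<lambda>i. h i x) A) v = \<one>\<^bsub>pow e\<^esub>"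
  proof (induction A rule: finite_induct)
    case empty
    have "linear_map R M N (\<lambda>_. \<zero>\<^bsub>N\<^esub>)" by (rule linear_mapI) simp_all
    then show ?case using mod_act_zero[OF M N v] by simp
  next
    case (insert i A)
    let ?S = "\<lambda>x. finsum N (\<lambda>i. h i x) A"
    have S: "linear_map R M N ?S" and S1: "mod_act R V d j e j' ?S v = \<one>\<^bsub>pow e\<^esub>" using insert by auto
    have hi: "linear_map R M N (h i)" using insert by simp
    have eq: "finsum N (\<lambda>i. h i x) (insert i A) = h i x \<oplus>\<^bsub>N\<^esub> ?S x" if x: "x \<in> carrier M" for x
      using insert.hyps linear_mapD(1)[OF insert.prems(1) x] by (intro N.finsum_insert) auto
    have L: "linear_map R M N (\<lambda>x. h i x \<oplus>\<^bsub>N\<^esub> ?S x)"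
      using linear_mapD[OF hi] linear_mapD[OF S]
      by (intro linear_mapI) (simp_all add: N.smult_r_distr N.a_ac)
    have "linear_map R M N (\<lambda>x. finsum N (\<lambda>i. h i x) (insert i A))"
      using linear_mapD[OF L] by (intro linear_mapI) (simp_all add: eq)
    moreover have "mod_act R V d j e j' (\<lambda>x. finsum N (\<lambda>i. h i x) (insert i A)) v = \<one>\<^bsub>pow e\<^esub>"
    proof -
      have "mod_act R V d j e j' (\<lambda>x. finsum N (\<lambda>i. h i x) (insert i A)) v = mod_act R V d j e j' (\<lambda>x. h i x \<oplus>\<^bsub>N\<^esub> ?S x) v"
        by (rule mod_act_cong[OF _ M]) (rule eq)
      also have "\<dots> = mod_act R V d j e j' (h i) v \<otimes>\<^bsub>pow e\<^esub> mod_act R V d j e j' ?S v"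
        by (rule mod_act_add[OF M N hi S v])
      also have "\<dots> = \<one>\<^bsub>pow e\<^esub>"
        unfolding S1 insert.prems(2)[OF insertI1] by (rule P.r_one[OF P.one_closed])
      finally show ?thesis .
    qed
    ultimately show ?case by blast
  qed
  then show ?thesis by blast
qed

text \<open>The ring is commutative, so matrices over it commute with scalars.\<close>
lemma mod_act_ract:
  assumes N: "module R N" "basis_iso R N e j'" and M: "module R M" "basis_iso R M d j"
    and f: "linear_map R M N f" and v: "v \<in> carrier (pow d)" and s: "s \<in> carrier R"
  shows "mod_act R V d j e j' f (\<lambda>b\<in>{..<d}. ract V s (v b)) = (\<lambda>a\<in>{..<e}. ract V s (mod_act R V d j e j' f v a))"
proof -
  have vc: "v b \<in> carrier (grp V)" if "b < d" for b using v that by auto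
  have "finprod (grp V) (\<lambda>b. ract V (coord R e j' (f (basis_vec R d j b)) a) ((\<lambda>b\<in>{..<d}. ract V s (v b)) b)) {..<d}
      = ract V s (finprod (grp V) (\<lambda>b. ract V (coord R e j' (f (basis_vec R d j b)) a) (v b)) {..<d})" if a: "a < e" for a
  proof -
    note ef = entry_closed[OF N M f a]
    have "finprod (grp V) (\<lambda>b. ract V (coord R e j' (f (basis_vec R d j b)) a) ((\<lambda>b\<in>{..<d}. ract V s (v b)) b)) {..<d}
       = finprod (grp V) (\<lambda>b. ract V s (ract V (coord R e j' (f (basis_vec R d j b)) a) (v b))) {..<d}"
    proof (rule G.finprod_cong')
      show "(\<lambda>b. ract V s (ract V (coord R e j' (f (basis_vec R d j b)) a) (v b))) \<in> {..<d} \<rightarrow> carrier (grp V)"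
        using vc ef s by auto
      show "ract V (coord R e j' (f (basis_vec R d j b)) a) ((\<lambda>b\<in>{..<d}. ract V s (v b)) b) = ract V s (ract V (coord R e j' (f (basis_vec R d j b)) a) (v b))"
        if "b \<in> {..<d}" for b
        using that vc[of b] ef[of b] s ract_mult[OF s ef[of b], of "v b"] ract_mult[OF ef[of b] s, of "v b"] R.m_comm[OF s ef[of b]] by simp
    qed simp
    also have "\<dots> = ract V s (finprod (grp V) (\<lambda>b. ract V (coord R e j' (f (basis_vec R d j b)) a) (v b)) {..<d})"
      using vc ef s by (intro ract_finprod[symmetric]) auto
    finally show ?thesis .
  qed
  then show ?thesis by (auto simp: mod_act_def intro!: restrict_ext)
qed

section \<open>Matrices act by morphisms\<close>

lemma V_ring_space: "ring_space (vrt V)" and V_conj_space: "conj_space (vrt V)"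
  using variety_ring_space variety_conj_space CAGD(2)[OF V] by auto

text \<open>By induction, since the group law is a morphism.\<close>
lemma finprod_kmorphism:
  assumes Z: "ring_space Z" and B: "finite B" and \<alpha>: "\<And>b. b \<in> B \<Longrightarrow> kmorphism Z (vrt V) (\<alpha> b)"
  shows "kmorphism Z (vrt V) (\<lambda>z. finprod (grp V) (\<lambda>b. \<alpha> b z) B)"
  using B \<alpha>
proof (induction B rule: finite_induct)
  case empty
  have "kmorphism Z (prod_space ({}::nat set) (\<lambda>_. vrt V)) (\<lambda>_ _. undefined)"
    by (rule kmorphism_into_prod[OF _ _ Z]) auto
  from kmorphism_comp[OF this CAGD(5)[OF V]] show ?case by simp
next
  case (insert b B)
  let ?rest = "\<lambda>z. finprod (grp V) (\<lambda>b. \<alpha> b z) B"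
  let ?pair = "\<lambda>z. \<lambda>i\<in>{..<2::nat}. if i = 0 then \<alpha> b z else ?rest z"
  have rest: "kmorphism Z (vrt V) ?rest" using insert by blast
  have ab: "kmorphism Z (vrt V) (\<alpha> b)" using insert.prems by simp
  have "kmorphism Z (prod_space {..<2::nat} (\<lambda>_. vrt V)) ?pair"
  proof (rule kmorphism_into_prod[OF _ _ Z])
    fix i :: nat assume i: "i \<in> {..<2}"
    show "kmorphism Z (vrt V) (\<lambda>z. ?pair z i)" using i rest ab by (cases "i = 0") simp_all
  qed (auto simp: V_ring_space)
  from kmorphism_comp[OF this CAGD(4)[OF V]]
  have "kmorphism Z (vrt V) (\<lambda>z. \<alpha> b z \<otimes>\<^bsub>grp V\<^esub> ?rest z)" by simp
  then show ?case
  proof (rule kmorphism_cong[OF ring_spaceD(1)[OF Z]])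
    fix z assume z: "z \<in> points Z"
    have "\<alpha> c z \<in> carrier (grp V)" if "c \<in> insert b B" for c
      using kmorphismD(1)[OF insert.prems[OF that] z] CAGD(3)[OF V] by simp
    then show "\<alpha> b z \<otimes>\<^bsub>grp V\<^esub> ?rest z = finprod (grp V) (\<lambda>b. \<alpha> b z) (insert b B)"
      using insert.hyps by (intro G.finprod_insert[symmetric]) auto
  qed
qed

abbreviation vpow :: "nat \<Rightarrow> ('k, nat \<Rightarrow> 'p) kspace" where
  "vpow d \<equiv> prod_space {..<d} (\<lambda>_. vrt V)"

lemma vpow_ring_space: "ring_space (vpow d)" and vpow_conj_space: "conj_space (vpow d)"
  by (rule prod_ring_space, simp add: V_ring_space)
     (rule prod_conj_space, simp_all add: V_ring_space V_conj_space)

lemma vpow_points: "points (vpow d) = carrier (pow d)"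
  using prod_points[of "{..<d}" "\<lambda>_. vrt V"] by (simp add: V_ring_space CAGD(3)[OF V])

lemma mod_act_kmorphism:
  assumes N: "module R N" "basis_iso R N e j'" and M: "module R M" "basis_iso R M d j"
    and f: "linear_map R M N f"
  shows "kmorphism (vpow d) (vpow e) (mod_act R V d j e j' f)"
proof (rule kmorphism_into_prod[OF _ _ vpow_ring_space])
  fix a assume a: "a \<in> {..<e}"
  have "kmorphism (vpow d) (vrt V) (\<lambda>v. finprod (grp V) (\<lambda>b. ract V (coord R e j' (f (basis_vec R d j b)) a) (v b)) {..<d})"
  proof (rule finprod_kmorphism[OF vpow_ring_space])
    fix b assume b: "b \<in> {..<d}"
    have "kmorphism (vpow d) (vrt V) (\<lambda>v. v b)" by (rule prod_proj) (use b in \<open>simp_all add: V_ring_space\<close>)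
    moreover have "kmorphism (vrt V) (vrt V) (ract V (coord R e j' (f (basis_vec R d j b)) a))"
      using a by (intro ract_kmorphism entry_closed[OF N M f]) simp
    ultimately show "kmorphism (vpow d) (vrt V) (\<lambda>v. ract V (coord R e j' (f (basis_vec R d j b)) a) (v b))"
      by (rule kmorphism_comp)
  qed simp
  then show "kmorphism (vpow d) (vrt V) (\<lambda>v. mod_act R V d j e j' f v a)" using a by (simp add: mod_act_def)
qed (simp_all add: V_ring_space mod_act_def)

end

section \<open>Morphisms between twists\<close>

lemma ksep_twist_kmorphism:
  assumes R: "cring R" and V: "CAG R V" and W: "CAG R W" and iso: "CAG_iso_ksep R (CAG_power V d) W \<phi>"
  shows "kmorphism (base_change ksep (vpow V d)) (base_change ksep (vrt W)) \<phi>"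
    and "kmorphism (base_change ksep (vrt W)) (base_change ksep (vpow V d)) (inv_into (carrier (pow V d)) \<phi>)"
  using iso bc_points[OF vpow_ring_space[OF R V], of d] vpow_points[OF R V, of d]
  by (simp_all add: CAG_iso_ksep_def kisomorphism_def CAG_sum_def)

text \<open>The Galois action on the points of a twist. The defining condition
  \<open>c(\<gamma>) = \<phi>\<^sup>-\<^sup>1 \<circ> \<phi>\<^sup>\<gamma>\<close> is evaluated at \<open>v = \<tau>(w)\<close>: there \<open>\<phi>\<^sup>\<gamma>(v) = \<tau>(\<phi>(\<tau>\<^sup>-\<^sup>1(v))) = \<tau>(\<phi>(w))\<close>,
  so the conjugate of \<open>\<phi>(w)\<close> is \<open>\<phi>(c(\<gamma>) v)\<close>.\<close>
lemma twist_conj_related: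
  fixes V :: "('k::field, 'r, 'v) cag" and W :: "('k, 'r, 'q) cag" and M :: "('k, 'r, 'm) galmod"
  assumes R: "cring R" and V: "CAG R V" and tw: "is_twist_via R M V d j W \<phi>" and \<tau>: "\<tau> \<in> Aut_ac"
    and r: "conj_related (vpow V d) \<tau> w v"
  shows "conj_related (vrt W) \<tau> (\<phi> w)
           (\<phi> (mod_act R V d j d j (\<lambda>x. gact M x (inv\<^bsub>Gal\<^esub> (restrict \<tau> ksep))) v))"
proof -
  let ?\<gamma> = "restrict \<tau> ksep" and ?P = "carrier (pow V d)"
  have W: "CAG R W" and bij: "bij_betw \<phi> ?P (carrier (grp W))"
    and coc: "\<And>\<gamma> v. \<gamma> \<in> carrier Gal \<Longrightarrow> v \<in> ?P \<Longrightarrow> matrix_act R V d (twist_cocycle R M d j \<gamma>) v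
            = inv_into ?P \<phi> (conj_map (vpow V d) (vrt W) \<gamma> \<phi> v)"
    using tw by (auto simp: is_twist_via_def CAG_iso_ksep_def iso_def CAG_sum_def)
  note \<gamma> = restrict_Aut_ac[OF \<tau>]
  have v: "v \<in> ?P" and w: "w \<in> ?P"
    using conj_relatedD(1,4)[OF r] vpow_points[OF R V] by auto
  have "pt_act (vpow V d) (inv_into UNIV \<tau>) v = w"
    by (rule pt_act_eqI[OF vpow_conj_space[OF R V] Aut_ac_inv[OF \<tau>] conj_related_inv[OF \<tau> r]])
  then have cm: "conj_map (vpow V d) (vrt W) ?\<gamma> \<phi> v = pt_act (vrt W) \<tau> (\<phi> w)"
    using inv_Gal(2)[OF \<gamma>(1)] by (simp add: conj_map_def \<gamma>(2))
  have \<phi>w: "\<phi> w \<in> points (vrt W)" using bij w CAGD(3)[OF W] by (auto simp: bij_betw_def)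
  have rel: "conj_related (vrt W) \<tau> (\<phi> w) (pt_act (vrt W) \<tau> (\<phi> w))"
    by (rule pt_act_related[OF V_conj_space[OF R W] \<tau> \<phi>w])
  have "pt_act (vrt W) \<tau> (\<phi> w) \<in> \<phi> ` ?P"
    using conj_relatedD(1)[OF rel] bij CAGD(3)[OF W] by (simp add: bij_betw_def)
  then have "\<phi> (inv_into ?P \<phi> (pt_act (vrt W) \<tau> (\<phi> w))) = pt_act (vrt W) \<tau> (\<phi> w)"
    by (rule f_inv_into_f)
  then have "\<phi> (mod_act R V d j d j (\<lambda>x. gact M x (inv\<^bsub>Gal\<^esub> ?\<gamma>)) v) = pt_act (vrt W) \<tau> (\<phi> w)"
    using coc[OF \<gamma>(1) v] by (simp add: cm matrix_act_twist)
  with rel show ?thesis by simp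
qed

text \<open>Functoriality of twisting. The matrix of \<open>f\<close> is defined over \<open>k\<close> and \<open>\<phi>\<close>, \<open>\<psi>\<close> over \<open>k\<^sup>s\<close>, so the
  composite is a morphism over \<open>k\<^sup>s\<close>. It commutes with conjugation, because \<open>f\<close> commutes with the
  cocycles, which are the Galois actions on \<open>M\<close> and \<open>N\<close>; therefore it descends to \<open>k\<close>.\<close>
lemma twist_morphism:
  fixes V :: "('k::field, 'r, 'v) cag" and M :: "('k, 'r, 'm) galmod" and N :: "('k, 'r, 'n) galmod"
    and W :: "('k, 'r, 'p) cag" and W' :: "('k, 'r, 'q) cag"
  assumes R: "cring R" and V: "CAG R V" and M: "FMod R M" and N: "FMod R N"
    and tw: "is_twist_via R M V d j W \<phi>" and tw': "is_twist_via R N V e j' W' \<psi>"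
    and f: "linear_map R (mdl M) (mdl N) f"
    and eqv: "\<And>\<gamma> x. \<gamma> \<in> carrier Gal \<Longrightarrow> x \<in> carrier (mdl M) \<Longrightarrow> f (gact M x \<gamma>) = gact N (f x) \<gamma>"
  shows "kmorphism (vrt W) (vrt W') (\<lambda>x. \<psi> (mod_act R V d j e j' f (inv_into (carrier (pow V d)) \<phi> x)))"
    and "(\<lambda>x. \<psi> (mod_act R V d j e j' f (inv_into (carrier (pow V d)) \<phi> x))) \<in> hom (grp W) (grp W')"
    and "a \<in> carrier R \<Longrightarrow> x \<in> carrier (grp W) \<Longrightarrow>
      \<psi> (mod_act R V d j e j' f (inv_into (carrier (pow V d)) \<phi> (ract W a x)))
        = ract W' a (\<psi> (mod_act R V d j e j' f (inv_into (carrier (pow V d)) \<phi> x)))"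
proof -
  let ?P = "carrier (pow V d)" and ?A = "mod_act R V d j e j' f"
  let ?F = "\<lambda>x. \<psi> (?A (inv_into ?P \<phi> x))"
  have jM: "basis_iso R (mdl M) d j" and W: "CAG R W" and iso: "CAG_iso_ksep R (CAG_power V d) W \<phi>"
    using tw by (auto simp: is_twist_via_def)
  have jN: "basis_iso R (mdl N) e j'" and W': "CAG R W'" and iso': "CAG_iso_ksep R (CAG_power V e) W' \<psi>"
    using tw' by (auto simp: is_twist_via_def)
  note Mb = FModD(1)[OF M] jM and Nb = FModD(1)[OF N] jN
  have \<phi>: "\<phi> \<in> iso (pow V d) (grp W)" and \<psi>: "\<psi> \<in> iso (pow V e) (grp W')"
    using iso iso' by (auto simp: CAG_iso_ksep_def CAG_sum_def)
  note PG = comm_group.axioms(2)[OF pow_comm_group[OF R V]]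
  have inj: "inj_on \<phi> ?P" and im: "\<phi> ` ?P = carrier (grp W)" using \<phi> by (auto simp: iso_def bij_betw_def)
  have inv_im: "inv_into ?P \<phi> x \<in> ?P" "\<phi> (inv_into ?P \<phi> x) = x" if "x \<in> carrier (grp W)" for x
    using that im inv_into_into[of x \<phi> ?P] f_inv_into_f[of x \<phi> ?P] by auto
  note Ahom = mod_act_hom[OF R V Nb Mb f] and Ak = mod_act_kmorphism[OF R V Nb Mb f]
  note vr = vpow_ring_space[OF R V]
  show "?F \<in> hom (grp W) (grp W')"
  proof -
    have "inv_into ?P \<phi> \<in> hom (grp W) (pow V d)"
      using group.iso_set_sym[OF PG \<phi>] by (simp add: iso_def)
    from hom_compose[OF hom_compose[OF this Ahom], of \<psi> "grp W'"] show ?thesis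
      using \<psi> by (simp add: iso_def o_def)
  qed
  show "kmorphism (vrt W) (vrt W') ?F"
  proof (rule galois_descent[OF V_ring_space[OF R W] V_conj_space[OF R W] V_ring_space[OF R W']])
    show "kmorphism (base_change ksep (vrt W)) (base_change ksep (vrt W')) ?F"
      by (rule kmorphism_comp[OF kmorphism_comp[OF ksep_twist_kmorphism(2)[OF R V W iso] bc_kmorphism[OF vr vr Ak]]
            ksep_twist_kmorphism(1)[OF R V W' iso']])
    fix \<tau> x y assume \<tau>: "\<tau> \<in> Aut_ac" and r: "conj_related (vrt W) \<tau> x y"
    let ?\<gamma> = "inv\<^bsub>Gal\<^esub> (restrict \<tau> ksep)"
    have \<gamma>: "?\<gamma> \<in> carrier Gal" by (rule inv_Gal(1)[OF restrict_Aut_ac(1)[OF \<tau>]])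
    have x: "x \<in> carrier (grp W)" using conj_relatedD(4)[OF r] CAGD(3)[OF W] by simp
    define w where "w = inv_into ?P \<phi> x"
    have w: "w \<in> ?P" "\<phi> w = x" using inv_im[OF x] by (simp_all add: w_def)
    then have "w \<in> points (vpow V d)" using vpow_points[OF R V] by simp
    then obtain v where v: "conj_related (vpow V d) \<tau> w v"
      using pt_act_related[OF vpow_conj_space[OF R V] \<tau>] by blast
    then have vP: "v \<in> ?P" unfolding vpow_points[OF R V, symmetric] by (rule conj_relatedD(1))
    let ?c = "mod_act R V d j d j (\<lambda>x. gact M x ?\<gamma>)" and ?c' = "mod_act R V e j' e j' (\<lambda>x. gact N x ?\<gamma>)"
    have cP: "?c v \<in> ?P" by (rule mod_act_closed[OF R V Mb Mb FModD(3)[OF M \<gamma>] vP])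
    have "conj_related (vrt W) \<tau> x (\<phi> (?c v))"
      using twist_conj_related[OF R V tw \<tau> v] w(2) by simp
    then have "y = \<phi> (?c v)"
      using r pt_act_eqI[OF V_conj_space[OF R W] \<tau>] by metis
    then have inv_y: "inv_into ?P \<phi> y = ?c v" using inv_into_f_f[OF inj cP] by simp
    \<comment> \<open>Conjugation turns \<open>\<phi> w\<close> into \<open>\<phi> (?c v)\<close> and \<open>\<psi> (?A w)\<close> into \<open>\<psi> (?c' (?A v))\<close>.\<close>
    have "?A (?c v) = mod_act R V d j e j' (\<lambda>x. f (gact M x ?\<gamma>)) v"
      by (rule mod_act_comp[OF R V Mb Mb Nb FModD(3)[OF M \<gamma>] f vP])
    also have "\<dots> = mod_act R V d j e j' (\<lambda>x. gact N (f x) ?\<gamma>) v"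
      by (rule mod_act_cong[OF R V _ Mb]) (rule eqv[OF \<gamma>])
    also have "\<dots> = ?c' (?A v)"
      by (rule mod_act_comp[OF R V Mb Nb Nb f FModD(3)[OF N \<gamma>] vP, symmetric])
    finally have comm: "?A (?c v) = ?c' (?A v)" .
    have "conj_related (vpow V e) \<tau> (?A w) (?A v)"
      by (rule conj_related_kmorphism[OF ring_spaceD(1)[OF vr] Ak v])
    from twist_conj_related[OF R V tw' \<tau> this]
    show "conj_related (vrt W') \<tau> (?F x) (?F y)" unfolding inv_y comm w_def[symmetric] .
  qed
  show "?F (ract W a x) = ract W' a (?F x)" if a: "a \<in> carrier R" and x: "x \<in> carrier (grp W)"
  proof -
    let ?w = "inv_into ?P \<phi> x"
    note w = inv_im[OF x]
    have aw: "(\<lambda>b\<in>{..<d}. ract V a (?w b)) \<in> ?P"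
      using w(1) ract_closed[OF R V a] by auto
    have "\<phi> (\<lambda>b\<in>{..<d}. ract V a (?w b)) = ract W a (\<phi> ?w)"
      using iso a w(1) by (auto simp: CAG_iso_ksep_def equivariant_def CAG_sum_def cong: restrict_cong)
    then have "inv_into ?P \<phi> (ract W a x) = (\<lambda>b\<in>{..<d}. ract V a (?w b))"
      using w(2) inv_into_f_f[OF inj aw] by simp
    then have "?F (ract W a x) = \<psi> (\<lambda>b\<in>{..<e}. ract V a (?A ?w b))"
      by (simp only: mod_act_ract[OF R V Nb Mb f w(1) a])
    also have "\<dots> = ract W' a (\<psi> (?A ?w))"
      using iso' a mod_act_closed[OF R V Nb Mb f w(1)]
      by (auto simp: CAG_iso_ksep_def equivariant_def CAG_sum_def cong: restrict_cong)
    finally show ?thesis .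
  qed
qed

section \<open>The isogeny\<close>

theorem corollary2p5:
  fixes R :: "'r ring"
    and V :: "('k::field, 'r, 'v) cag"
    and I :: "('k, 'r, 'i) galmod"
    and J :: "nat \<Rightarrow> ('k, 'r, 'j) galmod"
    and t :: nat
    and IV :: "('k, 'r, 'p) cag"
    and JV :: "nat \<Rightarrow> ('k, 'r, 'q) cag"
  assumes "cring R"
    and "CAG R V"
    and "FMod R I"
    and "\<And>i. i \<in> {1..t} \<Longrightarrow> FMod R (J i)"
    and "tensorQ_iso_sum R I {1..t} J"
    and "is_twist R I V IV"
    and "\<And>i. i \<in> {1..t} \<Longrightarrow> is_twist R (J i) V (JV i)"
  shows "k_isogenous R IV (CAG_sum {1..t} JV)"
proof -
  note R = assms(1) and V = assms(2) and I = assms(3) and J = assms(4)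
  let ?T = "{1..t}"
  obtain d j \<phi> where tw: "is_twist_via R I V d j IV \<phi>" using assms(6) by (auto simp: is_twist_def)
  have "\<exists>e j' \<psi>. is_twist_via R (J i) V e j' (JV i) \<psi>" if "i \<in> ?T" for i
    using assms(7)[OF that] by (auto simp: is_twist_def)
  then obtain e j' \<psi> where tw': "\<And>i. i \<in> ?T \<Longrightarrow> is_twist_via R (J i) V (e i) (j' i) (JV i) (\<psi> i)"
    by metis
  obtain n :: nat and f g where n: "n > 0"
    and f: "\<And>i. i \<in> ?T \<Longrightarrow> linear_map R (mdl I) (mdl (J i)) (f i)"
    and g: "\<And>i. i \<in> ?T \<Longrightarrow> linear_map R (mdl (J i)) (mdl I) (g i)"
    and eqv: "\<And>i \<gamma> x. i \<in> ?T \<Longrightarrow> \<gamma> \<in> carrier Gal \<Longrightarrow> x \<in> carrier (mdl I) \<Longrightarrow>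
           f i (gact I x \<gamma>) = gact (J i) (f i x) \<gamma>"
    and fg: "\<And>i k y. i \<in> ?T \<Longrightarrow> k \<in> ?T \<Longrightarrow> y \<in> carrier (mdl (J k)) \<Longrightarrow>
        f i (g k y) = (if i = k then [n] \<cdot>\<^bsub>mdl (J i)\<^esub> y else \<zero>\<^bsub>mdl (J i)\<^esub>)"
    and gf: "\<And>x. x \<in> carrier (mdl I) \<Longrightarrow> finsum (mdl I) (\<lambda>i. g i (f i x)) ?T = [n] \<cdot>\<^bsub>mdl I\<^esub> x"
  proof (rule integral_quasi_inverse[OF I J finite_atLeastAtMost assms(5)], goal_cases)
    case (2 n f g)
    show ?case by (rule 2(1)[of n f g]) (rule 2; assumption)+
  qed
  have jI: "basis_iso R (mdl I) d j" and IV: "CAG R IV" and \<phi>: "\<phi> \<in> iso (pow V d) (grp IV)"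
    using tw by (auto simp: is_twist_via_def CAG_iso_ksep_def CAG_sum_def)
  have jJ: "basis_iso R (mdl (J i)) (e i) (j' i)" and JV: "CAG R (JV i)" and \<psi>: "\<psi> i \<in> iso (pow V (e i)) (grp (JV i))"
    if "i \<in> ?T" for i
    using tw'[OF that] by (auto simp: is_twist_via_def CAG_iso_ksep_def CAG_sum_def)
  note Ib = FModD(1)[OF I] jI
  have Jb: "module R (mdl (J i))" "basis_iso R (mdl (J i)) (e i) (j' i)" if "i \<in> ?T" for i
    using FModD(1)[OF J[OF that]] jJ[OF that] .
  let ?A = "\<lambda>i. mod_act R V d j (e i) (j' i) (f i)"
  let ?B = "\<lambda>i. mod_act R V (e i) (j' i) d j (g i)"
  let ?P = "carrier (pow V d)"
  define F where "F x = (\<lambda>i\<in>?T. \<psi> i (?A i (inv_into ?P \<phi> x)))" for x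
  let ?S = "product_group ?T (\<lambda>i. grp (JV i))"
  interpret IG: comm_group "grp IV" by (rule CAGD(1)[OF IV])
  interpret S: comm_group ?S by (rule product_comm_group[OF CAGD(1)[OF JV]])
  interpret Pd: comm_group "pow V d" by (rule pow_comm_group[OF R V])
  have JG: "comm_group (grp (JV i))" if "i \<in> ?T" for i by (rule CAGD(1)[OF JV[OF that]])
  have mor_k: "kmorphism (vrt IV) (vrt (JV i)) (\<lambda>x. \<psi> i (?A i (inv_into ?P \<phi> x)))"
    and mor_hom: "(\<lambda>x. \<psi> i (?A i (inv_into ?P \<phi> x))) \<in> hom (grp IV) (grp (JV i))" if i: "i \<in> ?T" for i
    by (rule twist_morphism(1,2)[OF R V I J[OF i] tw tw'[OF i] f[OF i] eqv[OF i]]; assumption)+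
  have mor_ract: "\<psi> i (?A i (inv_into ?P \<phi> (ract IV a x))) = ract (JV i) a (\<psi> i (?A i (inv_into ?P \<phi> x)))"
    if i: "i \<in> ?T" and a: "a \<in> carrier R" and x: "x \<in> carrier (grp IV)" for i a x
    by (rule twist_morphism(3)[OF R V I J[OF i] tw tw'[OF i] f[OF i] eqv[OF i] a x])
  have F_hom: "F \<in> hom (grp IV) ?S"
    by (rule product_group_homI) (use mor_hom in \<open>simp_all add: F_def\<close>)
  interpret F: group_hom "grp IV" ?S F
    by (intro group_hom.intro group_hom_axioms.intro F_hom IG.is_group S.is_group)
  have "kmorphism (vrt IV) (prod_space ?T (\<lambda>i. vrt (JV i))) F"
  proof (rule kmorphism_into_prod[OF _ _ V_ring_space[OF R IV]])
    show "\<forall>i\<in>?T. ring_space (vrt (JV i))" using V_ring_space[OF R JV] by blast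
    show "kmorphism (vrt IV) (vrt (JV i)) (\<lambda>z. F z i)" if "i \<in> ?T" for i
      using mor_k[OF that] that by (simp add: F_def)
  qed (simp_all add: F_def)
  moreover have "equivariant R IV (CAG_sum ?T JV) F"
    unfolding equivariant_def
  proof (intro ballI)
    fix a x assume a: "a \<in> carrier R" and x: "x \<in> carrier (grp IV)"
    have "F x \<in> (\<Pi>\<^sub>E i\<in>?T. carrier (grp (JV i)))" using F.hom_closed[OF x] by simp
    moreover have "F (ract IV a x) = (\<lambda>i\<in>?T. ract (JV i) a (F x i))"
      unfolding F_def using mor_ract[OF _ a x] by (intro restrict_ext) simp
    ultimately show "F (ract IV a x) = ract (CAG_sum ?T JV) a (F x)" by (simp add: CAG_sum_def)
  qed
  ultimately have CH: "CAG_hom R IV (CAG_sum ?T JV) F"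
    using F_hom by (simp add: CAG_hom_def CAG_sum_def)

  have \<psi>_inj: "inj_on (\<psi> i) (carrier (pow V (e i)))" and \<psi>_im: "\<psi> i ` carrier (pow V (e i)) = carrier (grp (JV i))"
    and \<psi>_hom: "\<psi> i \<in> hom (pow V (e i)) (grp (JV i))" if "i \<in> ?T" for i
    using \<psi>[OF that] by (auto simp: iso_def bij_betw_def)
  have \<phi>_im: "\<phi> ` ?P = carrier (grp IV)" and \<phi>_inj: "inj_on \<phi> ?P" and \<phi>_hom: "\<phi> \<in> hom (pow V d) (grp IV)"
    using \<phi> by (auto simp: iso_def bij_betw_def)
  have Pe: "comm_group (pow V (e i))" for i by (rule pow_comm_group[OF R V])

  \<comment> \<open>If \<open>v\<close> corresponds to \<open>x\<close>, then \<open>n v\<close> is the sum of the \<open>g i (f i v)\<close>, which are trivial.\<close>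
  have ker: "x [^]\<^bsub>grp IV\<^esub> n = \<one>\<^bsub>grp IV\<^esub>" if x: "x \<in> kernel (grp IV) ?S F" for x
  proof -
    have xc: "x \<in> carrier (grp IV)" and Fx: "F x = \<one>\<^bsub>?S\<^esub>" using x by (auto simp: kernel_def)
    define v where "v = inv_into ?P \<phi> x"
    have v: "v \<in> ?P" "\<phi> v = x"
      using xc \<phi>_im inv_into_into[of x \<phi> ?P] f_inv_into_f[of x \<phi> ?P] by (auto simp: v_def)
    have Av: "?A i v = \<one>\<^bsub>pow V (e i)\<^esub>" if i: "i \<in> ?T" for i
    proof -
      have "\<psi> i (?A i v) = \<one>\<^bsub>grp (JV i)\<^esub>" using fun_cong[OF Fx, of i] i by (simp add: F_def v_def)
      also have "\<dots> = \<psi> i \<one>\<^bsub>pow V (e i)\<^esub>"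
        using hom_one[OF \<psi>_hom[OF i] comm_group.axioms(2)[OF Pe] comm_group.axioms(2)[OF JG[OF i]]] by simp
      finally show ?thesis
        using inj_onD[OF \<psi>_inj[OF i] _ mod_act_closed[OF R V Jb[OF i] Ib f[OF i] v(1)]]
          monoid.one_closed[OF group.is_monoid[OF comm_group.axioms(2)[OF Pe]]] by blast
    qed
    have "mod_act R V d j d j (\<lambda>x. g i (f i x)) v = \<one>\<^bsub>pow V d\<^esub>" if i: "i \<in> ?T" for i
    proof -
      have "mod_act R V d j d j (\<lambda>x. g i (f i x)) v = ?B i (?A i v)"
        by (rule mod_act_comp[OF R V Ib Jb[OF i] Ib f[OF i] g[OF i] v(1), symmetric])
      also have "\<dots> = \<one>\<^bsub>pow V d\<^esub>" unfolding Av[OF i]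
        by (rule hom_one[OF mod_act_hom[OF R V Ib Jb[OF i] g[OF i]] comm_group.axioms(2)[OF Pe] Pd.is_group])
      finally show ?thesis .
    qed
    then have "mod_act R V d j d j (\<lambda>x. finsum (mdl I) (\<lambda>i. g i (f i x)) ?T) v = \<one>\<^bsub>pow V d\<^esub>"
      by (intro mod_act_finsum_one[OF R V Ib Ib _ _ v(1)] linear_map_comp[OF f g]) simp_all
    moreover have "mod_act R V d j d j (\<lambda>x. finsum (mdl I) (\<lambda>i. g i (f i x)) ?T) v = mod_act R V d j d j (\<lambda>x. [n] \<cdot>\<^bsub>mdl I\<^esub> x) v"
      by (rule mod_act_cong[OF R V _ Ib]) (rule gf)
    ultimately have "v [^]\<^bsub>pow V d\<^esub> n = \<one>\<^bsub>pow V d\<^esub>" using mod_act_nat[OF R V Ib v(1)] by simp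
    moreover have "\<phi> (v [^]\<^bsub>pow V d\<^esub> n) = x [^]\<^bsub>grp IV\<^esub> n"
      using group_hom.hom_nat_pow[OF group_hom.intro[OF Pd.is_group IG.is_group group_hom_axioms.intro[OF \<phi>_hom]] v(1)] v(2) by simp
    ultimately show ?thesis using hom_one[OF \<phi>_hom Pd.is_group IG.is_group] by simp
  qed

  \<comment> \<open>The preimage of \<open>n z\<close> is the sum \<open>u\<close> of the images under \<open>g k\<close> of the components of \<open>z\<close>.\<close>
  have coker: "z [^]\<^bsub>?S\<^esub> n \<in> F ` carrier (grp IV)" if z: "z \<in> carrier ?S" for z
  proof -
    have zi: "z i \<in> carrier (grp (JV i))" if "i \<in> ?T" for i using z that by auto
    define w where "w i = inv_into (carrier (pow V (e i))) (\<psi> i) (z i)" for i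
    have w: "w i \<in> carrier (pow V (e i))" "\<psi> i (w i) = z i" if i: "i \<in> ?T" for i
      using zi[OF i] \<psi>_im[OF i] inv_into_into[of "z i" "\<psi> i" "carrier (pow V (e i))"]
        f_inv_into_f[of "z i" "\<psi> i" "carrier (pow V (e i))"] by (auto simp: w_def)
    have Bw: "?B k (w k) \<in> ?P" if k: "k \<in> ?T" for k by (rule mod_act_closed[OF R V Ib Jb[OF k] g[OF k] w(1)[OF k]])
    define u where "u = finprod (pow V d) (\<lambda>k. ?B k (w k)) ?T"
    have u: "u \<in> ?P" unfolding u_def using Bw by (intro Pd.finprod_closed) auto
    have Au: "?A i u = w i [^]\<^bsub>pow V (e i)\<^esub> n" if i: "i \<in> ?T" for i
    proof -
      interpret Pi: comm_group "pow V (e i)" by (rule Pe)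
      have "?A i u = finprod (pow V (e i)) (\<lambda>k. ?A i (?B k (w k))) ?T"
        unfolding u_def by (rule hom_finprod[OF mod_act_hom[OF R V Jb[OF i] Ib f[OF i]] Pd.comm_group_axioms Pi.comm_group_axioms Bw])
      also have "\<dots> = finprod (pow V (e i)) (\<lambda>k. if i = k then w i [^]\<^bsub>pow V (e i)\<^esub> n else \<one>\<^bsub>pow V (e i)\<^esub>) ?T"
      proof (rule Pi.finprod_cong')
        show "(\<lambda>k. if i = k then w i [^]\<^bsub>pow V (e i)\<^esub> n else \<one>\<^bsub>pow V (e i)\<^esub>) \<in> ?T \<rightarrow> carrier (pow V (e i))"
          using Pi.nat_pow_closed[OF w(1)[OF i], of n] Pi.one_closed
          by (intro Pi_I, split if_split, blast)
        fix k assume k: "k \<in> ?T"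
        have "?A i (?B k (w k)) = mod_act R V (e k) (j' k) (e i) (j' i) (\<lambda>y. f i (g k y)) (w k)"
          by (rule mod_act_comp[OF R V Jb[OF k] Ib Jb[OF i] g[OF k] f[OF i] w(1)[OF k]])
        also have "\<dots> = mod_act R V (e k) (j' k) (e i) (j' i) (\<lambda>y. if i = k then [n] \<cdot>\<^bsub>mdl (J i)\<^esub> y else \<zero>\<^bsub>mdl (J i)\<^esub>) (w k)"
          by (rule mod_act_cong[OF R V _ Jb[OF k]]) (rule fg[OF i k])
        also have "\<dots> = (if i = k then w i [^]\<^bsub>pow V (e i)\<^esub> n else \<one>\<^bsub>pow V (e i)\<^esub>)"
        proof (cases "i = k")
          case True
          then show ?thesis using mod_act_nat[OF R V Jb[OF k] w(1)[OF k], of n] by simp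
        next
          case False
          then show ?thesis using mod_act_zero[OF R V Jb[OF k] Jb[OF i] w(1)[OF k]] by simp
        qed
        finally show "?A i (?B k (w k)) = (if i = k then w i [^]\<^bsub>pow V (e i)\<^esub> n else \<one>\<^bsub>pow V (e i)\<^esub>)" .
      qed simp
      also have "\<dots> = w i [^]\<^bsub>pow V (e i)\<^esub> n"
        using i Pi.nat_pow_closed[OF w(1)[OF i]] by (intro Pi.finprod_singleton) auto
      finally show ?thesis .
    qed
    have \<phi>u: "\<phi> u \<in> carrier (grp IV)" using u \<phi>_im by blast
    have "F (\<phi> u) = z [^]\<^bsub>?S\<^esub> n"
    proof (rule extensionalityI[of _ ?T])
      show "F (\<phi> u) \<in> extensional ?T" by (simp add: F_def)
      show "z [^]\<^bsub>?S\<^esub> n \<in> extensional ?T" using S.nat_pow_closed[OF z, of n] by (simp add: PiE_iff)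
      fix i assume i: "i \<in> ?T"
      have "F (\<phi> u) i = \<psi> i (w i [^]\<^bsub>pow V (e i)\<^esub> n)" using i inv_into_f_f[OF \<phi>_inj u] Au[OF i] by (simp add: F_def)
      also have "\<dots> = z i [^]\<^bsub>grp (JV i)\<^esub> n"
        using group_hom.hom_nat_pow[OF group_hom.intro[OF comm_group.axioms(2)[OF Pe] comm_group.axioms(2)[OF JG[OF i]]
           group_hom_axioms.intro[OF \<psi>_hom[OF i]]] w(1)[OF i]] w(2)[OF i] by simp
      also have "\<dots> = (z [^]\<^bsub>?S\<^esub> n) i"
        using group_hom.hom_nat_pow[OF group_hom.intro[OF S.is_group comm_group.axioms(2)[OF JG[OF i]]
           group_hom_axioms.intro[OF product_group_proj[OF i]]] z] by simp
      finally show "F (\<phi> u) i = (z [^]\<^bsub>?S\<^esub> n) i" .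
    qed
    then show ?thesis using \<phi>u by force
  qed

  let ?H = "F ` carrier (grp IV)"
  have sub: "subgroup ?H ?S" by (rule F.img_is_subgroup)
  then have norm: "?H \<lhd> ?S" using S.normal_iff_subgroup by blast
  have "y [^]\<^bsub>?S Mod ?H\<^esub> n = \<one>\<^bsub>?S Mod ?H\<^esub>" if y: "y \<in> carrier (?S Mod ?H)" for y
  proof -
    obtain z where z: "z \<in> carrier ?S" "y = ?H #>\<^bsub>?S\<^esub> z" using y unfolding carrier_FactGroup by blast
    interpret q: group_hom ?S "?S Mod ?H" "\<lambda>a. ?H #>\<^bsub>?S\<^esub> a"
      by (intro group_hom.intro group_hom_axioms.intro S.is_group normal.factorgroup_is_group[OF norm] normal.r_coset_hom_Mod[OF norm])
    have "y [^]\<^bsub>?S Mod ?H\<^esub> n = ?H #>\<^bsub>?S\<^esub> (z [^]\<^bsub>?S\<^esub> n)" using q.hom_nat_pow[OF z(1)] z(2) by simp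
    also have "\<dots> = ?H" by (rule S.coset_join2[OF S.nat_pow_closed[OF z(1)] sub coker[OF z(1)]])
    finally show ?thesis by simp
  qed
  then have "k_isogeny R IV (CAG_sum ?T JV) F"
    unfolding k_isogeny_def using CH n ker
    by (intro conjI exI[of _ n]) (auto simp: CAG_sum_def Let_def)
  then show ?thesis unfolding k_isogenous_def by blast
qed

end
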